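(* Let $X$ be a real separable Hilbert space over a physical domain $D\subset\mathbb{R}^d$ ($d\in\{1,2,3\}$), let $\mathcal{A}$ be a Laplacian-like operator on $X$ (see context), let $\alpha>d/2$, and let $\mathcal{C}_0=\mathcal{A}^{-\alpha}$ be the Gaussian prior covariance operator. Let $\mathcal{C}_1=(H_{\text{misfit}}+\mathcal{C}_0^{-1})^{-1}$ be the Gaussian posterior covariance operator, where $H_{\text{misfit}}$ is the Hessian misfit (see context), with eigenpairs $(\lambda_j^1,\psi_j^1)_{j\ge1}$ ($\lambda_j^1$ non-increasing, $(\psi_j^1)_{j\ge1}$ orthonormal in $X$), let $m_1$ be the MAP point, and let $$m^1(\boldsymbol\xi)=m_1+\sum_{j\ge1}\sqrt{\lambda_j^1}\,\psi_j^1\,\xi_j,\qquad \boldsymbol\xi=(\xi_j)_{j\ge1}\in\Xi=\mathbb{R}^\infty,$$ where $\Xi$ carries the product $\mu$ of standard univariate Gaussian measures. Suppose that a functional $Q:X\to\mathbb{R}$ satisfies, with a constant $C<\infty$, $$\int_\Xi\left|D_m^kQ(m^1(\boldsymbol\xi))(\psi_{j_1}^1,\dots,\psi_{j_k}^1)\right|^2d\mu(\boldsymbol\xi)<C\,k!\qquad\text{for all }k=0,1,2,\dots\text{ and all }j_1,\dots,j_k\in\mathbb{N},$$ where $D_m^kQ(m^1(\boldsymbol\xi))(\psi_{j_1}^1,\dots,\psi_{j_k}^1)$ is the $k$-th derivative of $Q$ with respect to $m$, acting in the directions $\psi_{j_1}^1,\dots,\psi_{j_k}^1$ and evaluated at $m^1(\boldsymbol\xi)$.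 Then for every $s<\frac{\alpha}{d}-1$ there exist $0<q<1$, a positive sequence $\boldsymbol\tau=(\tau_j)_{j\ge1}$ with $(\tau_j^{-1})_{j\ge1}\in\ell^q(\mathbb{N})$, and a constant $C'$ independent of $N$ such that, for every $N\ge1$, there is an admissible index set $\Lambda_N\subset\mathcal{F}$ whose $N$ indices $\boldsymbol\nu$ correspond to the smallest values of $b_{\boldsymbol\nu}$ (defined in the context from $\boldsymbol\tau$ and $q$), for which the sparse quadrature error is bounded by $$\left|\mathbb{E}^\mu(Q)-\mathcal{Q}_{\Lambda_N}(Q)\right|\le C'(N+1)^{-s},$$ where $\mathbb{E}^\mu(Q)=\int_\Xi Q(m^1(\boldsymbol\xi))\,d\mu(\boldsymbol\xi)$ and $\mathcal{Q}_{\Lambda_N}(Q)$ is the sparse quadrature applied to the function $\boldsymbol\xi\mapsto Q(m^1(\boldsymbol\xi))$.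
   Context: Laplacian-like operator: $\mathcal{A}$ is positive definite, self-adjoint, and invertible, with eigenpairs $\{(\lambda_j,\psi_j)\}_{j\ge1}$, where the eigenfunctions $(\psi_j)_{j\ge1}$ form an orthonormal basis of $X$, and the eigenvalues $\lambda_j$ grow asymptotically as $j^{2/d}$, so that $(\lambda_j^{-1})_{j\ge1}\in\ell^q$ for all $q>d/2$. The power $\mathcal{A}^{-\alpha}$ is defined spectrally. Bayesian setting: the data are $y=\mathcal{G}(m)+\eta$ with $\mathcal{G}:X\to Y$ the parameter-to-observable map, $Y$ a separable Banach space (typically $\mathbb{R}^K$), and $\eta\sim\mathcal{N}(0,\Gamma_{\text{noise}})$; the prior is $\mathcal{N}(m_0,\mathcal{C}_0)$. The negative log-likelihood is $\Phi(m)=\frac12\|y-\mathcal{G}(m)\|^2_{\Gamma_{\text{noise}}}$ with $\|v\|^2_{\Gamma_{\text{noise}}}=v^T\Gamma_{\text{noise}}^{-1}v$. The MAP point $m_1$ is the minimizer of $\Phi(m)+\frac12\|\mathcal{C}_0^{-1/2}(m-m_0)\|_X^2$ over the Cameron–Martin space of the prior. The Hessian misfit is $H_{\text{misfit}}=D_m^2\Phi(m)|_{m=m_1}$ (which, for a linear map $\mathcal{G}(m)=Gm$, or under linearization with $G=\mathcal{G}'(m_1)$, is $G^*\Gamma_{\text{noise}}^{-1}G$). The operator $\mathcal{C}_1$ is taken to be self-adjoint, positive definite, compact and of trace class. Multi-indices: $\mathcal{F}$ is the set of $\boldsymbol\nu=(\nu_1,\nu_2,\dots)$ of non-negative integers with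 finitely many nonzero entries. A set $\Lambda\subset\mathcal{F}$ is admissible if $\boldsymbol\nu\in\Lambda$ implies $\boldsymbol\mu\in\Lambda$ for every $\boldsymbol\mu\in\mathcal{F}$ with $\mu_j\le\nu_j$ for all $j$. Weights: given $0<q<1$ and a positive sequence $\boldsymbol\tau$ with $(\tau_j^{-1})\in\ell^q(\mathbb{N})$, let $r$ be the smallest integer with $r>14/q$ and $$b_{\boldsymbol\nu}=\sum_{\boldsymbol\mu\in\mathcal{F},\,|\boldsymbol\mu|_\infty\le r}\binom{\boldsymbol\nu}{\boldsymbol\mu}\boldsymbol\tau^{2\boldsymbol\mu},\qquad \binom{\boldsymbol\nu}{\boldsymbol\mu}=\prod_{j\ge1}\binom{\nu_j}{\mu_j},\quad \boldsymbol\tau^{2\boldsymbol\mu}=\prod_{j\ge1}\tau_j^{2\mu_j},\quad |\boldsymbol\mu|_\infty=\max_j\mu_j,$$ with $\binom{n}{k}=0$ for $k>n$. Sparse quadrature (Gauss–Hermite): for $n=0,1,2,\dots$ let $\mathcal{Q}_n$ be the univariate Gauss–Hermite quadrature for the standard Gaussian density $\frac{1}{\sqrt{2\pi}}e^{-\xi^2/2}$ with $n+1$ points (exact for polynomials of degree $2n+1$), and $\mathcal{Q}_{-1}=0$. Let $\triangle_n=\mathcal{Q}_n-\mathcal{Q}_{n-1}$, and for $\boldsymbol\nu\in\mathcal{F}$ let $\triangle_{\boldsymbol\nu}=\bigotimes_{j\ge1}\triangle_{\nu_j}$, where $\triangle_{\nu_j}$ acts on the variable $\xi_j$. For an admissible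 set $\Lambda$, $\mathcal{Q}_\Lambda(g)=\sum_{\boldsymbol\nu\in\Lambda}\triangle_{\boldsymbol\nu}(g)$. *)

theory Defs
  imports "HOL-Probability.Probability" "HOL-Computational_Algebra.Polynomial"
    "HOL-Library.Landau_Symbols"
begin

text \<open>
  All sequences are indexed from 0, so index \<open>j\<close> here is index \<open>j + 1\<close> in the usual
  enumeration \<open>j \<ge> 1\<close> of eigenpairs and of the coordinates of \<open>\<Xi> = \<real>\<^sup>\<infinity>\<close>.
\<close>

section \<open>Operators on a Hilbert space\<close>

definition orthonormal_basis :: "(nat \<Rightarrow> 'a::real_inner) \<Rightarrow> bool" where
  "orthonormal_basis e \<longleftrightarrow>
     (\<forall>i j. e i \<bullet> e j = (if i = j then 1 else 0)) \<and> closure (span (range e)) = UNIV"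

text \<open>
  An unbounded operator is a function together with its domain \<open>domT\<close>; its values outside
  \<open>domT\<close> are irrelevant. The last conjunct says that the domain of the adjoint is \<open>domT\<close>.
\<close>

definition self_adjoint_on :: "'a::real_inner set \<Rightarrow> ('a \<Rightarrow> 'a) \<Rightarrow> bool" where
  "self_adjoint_on domT T \<longleftrightarrow>
     subspace domT \<and> closure domT = UNIV \<and>
     (\<forall>x\<in>domT. \<forall>y\<in>domT. T (x + y) = T x + T y) \<and>
     (\<forall>c. \<forall>x\<in>domT. T (c *\<^sub>R x) = c *\<^sub>R T x) \<and>
     (\<forall>x\<in>domT. \<forall>y\<in>domT. T x \<bullet> y = x \<bullet> T y) \<and>
     {y. \<exists>z. \<forall>x\<in>domT. T x \<bullet> y = x \<bullet> z} = domT"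

definition positive_definite_on :: "'a::real_inner set \<Rightarrow> ('a \<Rightarrow> 'a) \<Rightarrow> bool" where
  "positive_definite_on domT T \<longleftrightarrow> (\<forall>x\<in>domT. x \<noteq> 0 \<longrightarrow> 0 < T x \<bullet> x)"

definition laplacian_like ::
  "nat \<Rightarrow> 'a::real_inner set \<Rightarrow> ('a \<Rightarrow> 'a) \<Rightarrow> (nat \<Rightarrow> real) \<Rightarrow> (nat \<Rightarrow> 'a) \<Rightarrow> bool" where
  "laplacian_like d domT A lam \<psi> \<longleftrightarrow>
     self_adjoint_on domT A \<and> positive_definite_on domT A \<and> bij_betw A domT UNIV \<and>
     orthonormal_basis \<psi> \<and> (\<forall>j. \<psi> j \<in> domT \<and> A (\<psi> j) = lam j *\<^sub>R \<psi> j) \<and>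
     lam \<in> \<Theta>(\<lambda>j. real (Suc j) powr (2 / real d))"

text \<open>
  The power \<open>A\<^sup>p\<close> of the operator with eigenpairs \<open>(lam\<^sub>j, \<psi>\<^sub>j)\<close>. It is used below
  for negative \<open>p\<close> only, where the series converges everywhere.
\<close>

definition spectral_power :: "(nat \<Rightarrow> real) \<Rightarrow> (nat \<Rightarrow> 'a::real_inner) \<Rightarrow> real \<Rightarrow> 'a \<Rightarrow> 'a" where
  "spectral_power lam \<psi> p x = (\<Sum>j. (lam j powr p * (x \<bullet> \<psi> j)) *\<^sub>R \<psi> j)"

definition compact_operator :: "('a::real_normed_vector \<Rightarrow> 'a) \<Rightarrow> bool" where
  "compact_operator T \<longleftrightarrow> bounded_linear T \<and> compact (closure (T ` cball 0 1))"

text \<open>Trace class for positive operators, for which \<open>\<bar>T\<bar> = T\<close>.\<close>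

definition positive_trace_class :: "('a::real_inner \<Rightarrow> 'a) \<Rightarrow> bool" where
  "positive_trace_class T \<longleftrightarrow>
     (\<forall>e. orthonormal_basis e \<longrightarrow> summable (\<lambda>j. T (e j) \<bullet> e j))"

section \<open>Derivatives\<close>

definition bounded_multilinear_form :: "nat \<Rightarrow> ('a::real_normed_vector list \<Rightarrow> real) \<Rightarrow> bool" where
  "bounded_multilinear_form k M \<longleftrightarrow>
     (\<forall>vs i. length vs = k \<longrightarrow> i < k \<longrightarrow> linear (\<lambda>x. M (vs[i := x]))) \<and>
     (\<exists>K. \<forall>vs. length vs = k \<longrightarrow> \<bar>M vs\<bar> \<le> K * (\<Prod>v\<leftarrow>vs. norm v))"

text \<open>
  \<open>f\<close> is infinitely Frechet differentiable and \<open>D m [v\<^sub>1, \<dots>, v\<^sub>k]\<close> is its \<open>k\<close>-th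
  derivative at \<open>m\<close> in the directions \<open>v\<^sub>1, \<dots>, v\<^sub>k\<close>: for every \<open>k\<close> the map
  \<open>m \<mapsto> D\<^sup>k f(m)\<close> into the bounded \<open>k\<close>-linear forms is Frechet differentiable with respect to
  the operator norm, with derivative \<open>h \<mapsto> D\<^sup>k\<^sup>+\<^sup>1 f(m)(h, \<dots>)\<close>.
\<close>

definition frechet_derivatives ::
  "('a::real_normed_vector \<Rightarrow> real) \<Rightarrow> ('a \<Rightarrow> 'a list \<Rightarrow> real) \<Rightarrow> bool" where
  "frechet_derivatives f D \<longleftrightarrow>
     (\<forall>m. D m [] = f m) \<and>
     (\<forall>k m. bounded_multilinear_form k (D m) \<and>
        (\<forall>\<epsilon>>0. \<exists>\<delta>>0. \<forall>h vs. norm h < \<delta> \<longrightarrow> length vs = k \<longrightarrow>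
           \<bar>D (m + h) vs - D m vs - D m (h # vs)\<bar> \<le> \<epsilon> * norm h * (\<Prod>v\<leftarrow>vs. norm v)))"

text \<open>The second Frechet derivative of \<open>f\<close> at \<open>m\<close> is the bilinear form \<open>(h, k) \<mapsto> \<langle>H h, k\<rangle>\<close>.\<close>

definition is_hessian :: "('a::real_inner \<Rightarrow> real) \<Rightarrow> 'a \<Rightarrow> ('a \<Rightarrow> 'a) \<Rightarrow> bool" where
  "is_hessian f m H \<longleftrightarrow>
     bounded_linear H \<and>
     (\<exists>Df. (\<forall>\<^sub>F x in nhds m. (f has_derivative blinfun_apply (Df x)) (at x)) \<and>
           (Df has_derivative (\<lambda>h. blinfun_inner_right (H h))) (at m))"

section \<open>Bayesian setting\<close>

definition normal_variable :: "'b measure \<Rightarrow> ('b \<Rightarrow> real) \<Rightarrow> real \<Rightarrow> real \<Rightarrow> bool" where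
  "normal_variable M Z a v \<longleftrightarrow>
     (if v = 0 then (AE x in M. Z x = a)
      else 0 < v \<and> distributed M lborel Z (\<lambda>t. ennreal (normal_density a (sqrt v) t)))"

text \<open>\<open>\<N>(m, C)\<close> on a Hilbert space.\<close>

definition gaussian_hilbert :: "'a::real_inner measure \<Rightarrow> 'a \<Rightarrow> ('a \<Rightarrow> 'a) \<Rightarrow> bool" where
  "gaussian_hilbert M m C \<longleftrightarrow>
     prob_space M \<and> sets M = sets borel \<and>
     (\<forall>u. normal_variable M (\<lambda>x. x \<bullet> u) (m \<bullet> u) (C u \<bullet> u))"

text \<open>
  \<open>\<N>(0, \<Gamma>)\<close> on a Banach space \<open>Y\<close>; the covariance is an operator from the dual of \<open>Y\<close>
  to \<open>Y\<close>. For \<open>Y = \<real>\<^sup>K\<close> the dual is \<open>\<real>\<^sup>K\<close> and \<open>\<Gamma>\<close> is the covariance matrix.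
\<close>

definition gaussian_banach ::
  "'y::real_normed_vector measure \<Rightarrow> (('y \<Rightarrow>\<^sub>L real) \<Rightarrow> 'y) \<Rightarrow> bool" where
  "gaussian_banach M \<Gamma> \<longleftrightarrow>
     prob_space M \<and> sets M = sets borel \<and> bounded_linear \<Gamma> \<and>
     (\<forall>\<phi> \<theta>. blinfun_apply \<phi> (\<Gamma> \<theta>) = blinfun_apply \<theta> (\<Gamma> \<phi>)) \<and>
     (\<forall>\<phi>. normal_variable M (blinfun_apply \<phi>) 0 (blinfun_apply \<phi> (\<Gamma> \<phi>)))"

text \<open>The squared norm \<open>v\<^sup>T \<Gamma>\<^sup>-\<^sup>1 v\<close>, meaningful for injective \<open>\<Gamma>\<close> and \<open>v\<close> in its range.\<close>

definition noise_norm_sq :: "(('y::real_normed_vector \<Rightarrow>\<^sub>L real) \<Rightarrow> 'y) \<Rightarrow> 'y \<Rightarrow> real" where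
  "noise_norm_sq \<Gamma> v = blinfun_apply (inv \<Gamma> v) v"

definition neg_log_likelihood ::
  "(('y::real_normed_vector \<Rightarrow>\<^sub>L real) \<Rightarrow> 'y) \<Rightarrow> ('a \<Rightarrow> 'y) \<Rightarrow> 'y \<Rightarrow> 'a \<Rightarrow> real" where
  "neg_log_likelihood \<Gamma> \<G> y m = noise_norm_sq \<Gamma> (y - \<G> m) / 2"

text \<open>
  \<open>R\<close> is the square root of the prior covariance. Its range is the Cameron-Martin space of the
  centred prior, and the minimisation runs over the set where the regularisation term is finite.
\<close>

definition is_MAP_point ::
  "('a::real_inner \<Rightarrow> real) \<Rightarrow> ('a \<Rightarrow> 'a) \<Rightarrow> 'a \<Rightarrow> 'a \<Rightarrow> bool" where
  "is_MAP_point \<Phi> R m0 m1 \<longleftrightarrow>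
     is_arg_min (\<lambda>m. \<Phi> m + (norm (inv R (m - m0)))\<^sup>2 / 2) (\<lambda>m. m - m0 \<in> range R) m1"

text \<open>\<open>C1 = (H + C0\<^sup>-\<^sup>1)\<^sup>-\<^sup>1\<close>, where \<open>H + C0\<^sup>-\<^sup>1\<close> has domain \<open>range C0\<close>.\<close>

definition is_posterior_covariance ::
  "('a::real_inner \<Rightarrow> 'a) \<Rightarrow> ('a \<Rightarrow> 'a) \<Rightarrow> ('a \<Rightarrow> 'a) \<Rightarrow> bool" where
  "is_posterior_covariance C0 H C1 \<longleftrightarrow>
     bij_betw (\<lambda>x. H x + inv C0 x) (range C0) UNIV \<and>
     C1 = inv_into (range C0) (\<lambda>x. H x + inv C0 x)"

definition std_gaussian :: "real measure" where
  "std_gaussian = density lborel (\<lambda>x. ennreal (std_normal_density x))"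

definition product_gaussian :: "(nat \<Rightarrow> real) measure" where
  "product_gaussian = PiM UNIV (\<lambda>_. std_gaussian)"

definition kl_expansion ::
  "'a::real_inner \<Rightarrow> (nat \<Rightarrow> real) \<Rightarrow> (nat \<Rightarrow> 'a) \<Rightarrow> (nat \<Rightarrow> real) \<Rightarrow> 'a" where
  "kl_expansion m1 lam1 \<psi>1 \<xi> = m1 + (\<Sum>j. (sqrt (lam1 j) * \<xi> j) *\<^sub>R \<psi>1 j)"

section \<open>Multi-indices and weights\<close>

definition multi_indices :: "(nat \<Rightarrow> nat) set" where
  "multi_indices = {\<nu>. finite {j. \<nu> j \<noteq> 0}}"

definition admissible :: "(nat \<Rightarrow> nat) set \<Rightarrow> bool" where
  "admissible \<Lambda> \<longleftrightarrow> (\<forall>\<nu>\<in>\<Lambda>. \<forall>\<mu>\<in>multi_indices. (\<forall>j. \<mu> j \<le> \<nu> j) \<longrightarrow> \<mu> \<in> \<Lambda>)"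

definition multi_binomial :: "(nat \<Rightarrow> nat) \<Rightarrow> (nat \<Rightarrow> nat) \<Rightarrow> nat" where
  "multi_binomial \<nu> \<mu> = (\<Prod>j | \<nu> j \<noteq> 0 \<or> \<mu> j \<noteq> 0. \<nu> j choose \<mu> j)"

definition multi_power :: "(nat \<Rightarrow> real) \<Rightarrow> (nat \<Rightarrow> nat) \<Rightarrow> real" where
  "multi_power x \<mu> = (\<Prod>j | \<mu> j \<noteq> 0. x j ^ \<mu> j)"

definition weight_order :: "real \<Rightarrow> nat" where
  "weight_order q = (LEAST r::nat. real r > 14 / q)"

text \<open>Only the finitely many \<open>\<mu> \<le> \<nu>\<close> contribute to the sum.\<close>

definition quad_weight :: "real \<Rightarrow> (nat \<Rightarrow> real) \<Rightarrow> (nat \<Rightarrow> nat) \<Rightarrow> real" where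
  "quad_weight q \<tau> \<nu> =
     (\<Sum>\<^sub>\<infinity>\<mu>\<in>{\<mu> \<in> multi_indices. \<forall>j. \<mu> j \<le> weight_order q}.
        real (multi_binomial \<nu> \<mu>) * multi_power (\<lambda>j. (\<tau> j)\<^sup>2) \<mu>)"

section \<open>Sparse Gauss-Hermite quadrature\<close>

text \<open>The Hermite polynomials orthogonal for the density \<open>exp (- x\<^sup>2 / 2) / sqrt (2 * pi)\<close>.\<close>

fun hermite_poly :: "nat \<Rightarrow> real poly" where
  "hermite_poly 0 = 1"
| "hermite_poly (Suc 0) = [:0, 1:]"
| "hermite_poly (Suc (Suc n)) =
     [:0, 1:] * hermite_poly (Suc n) - smult (real (Suc n)) (hermite_poly n)"

definition gh_nodes :: "nat \<Rightarrow> real set" where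
  "gh_nodes n = {x. poly (hermite_poly (Suc n)) x = 0}"

text \<open>The weight of a node is the Gaussian integral of its Lagrange basis polynomial.\<close>

definition gh_weight :: "nat \<Rightarrow> real \<Rightarrow> real" where
  "gh_weight n x = (\<integral>t. (\<Prod>z\<in>gh_nodes n - {x}. (t - z) / (x - z)) \<partial>std_gaussian)"

definition gh_quad :: "nat \<Rightarrow> (real \<Rightarrow> real) \<Rightarrow> real" where
  "gh_quad n g = (\<Sum>x\<in>gh_nodes n. gh_weight n x * g x)"

definition gh_diff :: "nat \<Rightarrow> (real \<Rightarrow> real) \<Rightarrow> real" where
  "gh_diff n g = gh_quad n g - (if n = 0 then 0 else gh_quad (n - 1) g)"

definition gh_diff_var ::
  "nat \<Rightarrow> nat \<Rightarrow> ((nat \<Rightarrow> real) \<Rightarrow> real) \<Rightarrow> (nat \<Rightarrow> real) \<Rightarrow> real" where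
  "gh_diff_var n j g = (\<lambda>\<xi>. gh_diff n (\<lambda>t. g (\<xi>(j := t))))"

text \<open>
  The tensor product over all variables. In a variable \<open>\<xi>\<^sub>j\<close> with \<open>\<nu> j = 0\<close> the factor is
  \<open>gh_quad 0\<close>, the one-point rule with node 0 and weight 1, i.e. evaluation at \<open>\<xi>\<^sub>j = 0\<close>.
\<close>

definition tensor_diff :: "(nat \<Rightarrow> nat) \<Rightarrow> ((nat \<Rightarrow> real) \<Rightarrow> real) \<Rightarrow> real" where
  "tensor_diff \<nu> g =
     fold (\<lambda>j. gh_diff_var (\<nu> j) j) (sorted_list_of_set {j. \<nu> j \<noteq> 0}) g (\<lambda>_. 0)"

definition sparse_quad :: "(nat \<Rightarrow> nat) set \<Rightarrow> ((nat \<Rightarrow> real) \<Rightarrow> real) \<Rightarrow> real" where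
  "sparse_quad \<Lambda> g = (\<Sum>\<nu>\<in>\<Lambda>. tensor_diff \<nu> g)"

end

theory Submission
  imports Defs "HOL-Complex_Analysis.Cauchy_Integral_Formula" "HOL-Real_Asymp.Real_Asymp"
begin

text \<open>
  Comparing Rayleigh quotients of \<open>C1\<^sup>-\<^sup>1 = H + C0\<^sup>-\<^sup>1\<close> and \<open>C0\<^sup>-\<^sup>1\<close> on a vector that lies in the span of the
  first \<open>n + 1\<close> posterior eigenvectors and is orthogonal to the first \<open>n\<close> prior ones gives
  \<open>\<lambda>\<^sup>1\<^sub>n \<le> K (n + 1) powr (- a)\<close> with \<open>a = 2 \<alpha> / d > 1\<close>, as \<open>H\<close> is bounded. Integration by parts in
  single variables turns the derivative bounds into bounds for the Hermite coefficients \<open>f\<^sub>\<mu>\<close> of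
  \<open>\<xi> \<mapsto> Q (m\<^sup>1(\<xi>))\<close>, for every \<open>\<kappa> \<le> \<mu>\<close>:
  \<open>f\<^sub>\<mu>\<^sup>2 \<le> C |\<kappa>|! (\<lambda>\<^sup>1) ^ \<kappa> (\<mu> - \<kappa>)! / \<mu>!\<close>.
  The quadrature of a product of Hermite functions vanishes if some index is odd, since Gauss-Hermite
  rules are symmetric, and otherwise it is bounded by a product of polynomials in the indices. Summing
  over even indices only, one gains a factor \<open>\<lambda>\<^sup>1\<^sub>j\<close> instead of \<open>sqrt \<lambda>\<^sup>1\<^sub>j\<close> per new variable, so that the
  error series converges with a power of the weight \<open>b\<^sub>\<mu>\<close> to spare; with \<open>q = 1/2\<close> and
  \<open>\<tau>\<^sub>j = (j + 1) powr \<beta>\<close>, \<open>\<beta> > 2\<close>, this gives every rate \<open>s < \<alpha> / d - 1/2\<close>. The Hermite series must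
  also represent the functional at the quadrature points, which form a null set: this follows by
  averaging over shrinking product bumps around such a point.
\<close>

subsection \<open>Orthonormal bases\<close>

text \<open>Why even indices gain a full eigenvalue: for \<mu> = 2k the square root of (2|k|)! /
  (2k)! is at most 2^|k| |k|! / k!, so the error is dominated by a multinomial series whose
  variables are proportional to \<open>lam1 j\<close> times the growth of the weight, and only the
  sum of these variables has to be finite. Where the exponents come from: for q = 1/2 the weights to
  the power -1/4 are summable, so a rate s has to be paid for with b^(s/4) in the error series. This
  multiplies \<open>lam1 j\<close> by the power s of \<tau> j, and the product has order (j +
  1)^(\<beta> s - a). Its summability asks for \<beta> s < a - 1, while summability of \<tau> j to
  the power -1/2 asks for \<beta> > 2. The obstacle at the quadrature points: the hypothesis
  controls mean squares only. A bump can be narrow in finitely many variables at most, since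
  otherwise its mass would be 0. The other variables get growing radii t j for which the sum of
  \<open>lam1 j\<close> (t j)^2 stays finite; the supports then shrink in X although they do not
  shrink in the sequence space.\<close>

lemma orthonormal_basis_inner:
  assumes "orthonormal_basis e"
  shows "e i \<bullet> e j = (if i = j then 1 else 0)"
  using assms by (auto simp: orthonormal_basis_def)

lemma orthonormal_basis_norm:
  assumes "orthonormal_basis e"
  shows "norm (e i) = 1"
  using orthonormal_basis_inner[OF assms, of i i] by (simp add: norm_eq_sqrt_inner)

lemma norm_sum_orthonormal:
  fixes e :: "nat \<Rightarrow> 'a::real_inner"
  assumes "orthonormal_basis e" "finite I"
  shows "(norm (\<Sum>i\<in>I. a i *\<^sub>R e i))\<^sup>2 = (\<Sum>i\<in>I. (a i)\<^sup>2)"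
proof -
  have "(norm (\<Sum>i\<in>I. a i *\<^sub>R e i))\<^sup>2 = (\<Sum>i\<in>I. \<Sum>j\<in>I. a i * a j * (e i \<bullet> e j))"
    unfolding power2_norm_eq_inner
    by (simp add: inner_sum_left inner_sum_right mult.assoc sum_distrib_left mult.left_commute inner_commute)
  also have "\<dots> = (\<Sum>i\<in>I. \<Sum>j\<in>I. if i = j then (a i)\<^sup>2 else 0)"
    by (intro sum.cong refl) (auto simp: orthonormal_basis_inner[OF assms(1)] power2_eq_square)
  also have "\<dots> = (\<Sum>i\<in>I. (a i)\<^sup>2)"
    using assms(2) by (simp add: sum.delta)
  finally show ?thesis .
qed

lemma summable_orthonormal:
  fixes e :: "nat \<Rightarrow> 'a::{real_inner, banach}"
  assumes e: "orthonormal_basis e" and a: "summable (\<lambda>i. (a i)\<^sup>2)"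
  shows "summable (\<lambda>i. a i *\<^sub>R e i)"
  unfolding summable_Cauchy
proof (intro allI impI)
  fix \<epsilon> :: real assume "\<epsilon> > 0"
  then have "\<epsilon>\<^sup>2 > 0" by simp
  with a obtain N where N: "\<And>m n. m \<ge> N \<Longrightarrow> norm (\<Sum>i\<in>{m..<n}. (a i)\<^sup>2) < \<epsilon>\<^sup>2"
    unfolding summable_Cauchy by meson
  show "\<exists>N. \<forall>m\<ge>N. \<forall>n. norm (\<Sum>i\<in>{m..<n}. a i *\<^sub>R e i) < \<epsilon>"
  proof (intro exI[of _ N] allI impI)
    fix m n assume "m \<ge> N"
    have "(norm (\<Sum>i\<in>{m..<n}. a i *\<^sub>R e i))\<^sup>2 < \<epsilon>\<^sup>2"
      unfolding norm_sum_orthonormal[OF e finite_atLeastLessThan]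
      using N[OF \<open>m \<ge> N\<close>, of n] by (simp add: sum_nonneg)
    then show "norm (\<Sum>i\<in>{m..<n}. a i *\<^sub>R e i) < \<epsilon>"
      using \<open>\<epsilon> > 0\<close> by (rule power_less_imp_less_base[OF _ less_imp_le])
  qed
qed

lemma inner_orthonormal_series:
  fixes e :: "nat \<Rightarrow> 'a::{real_inner, banach}"
  assumes e: "orthonormal_basis e" and a: "summable (\<lambda>i. a i *\<^sub>R e i)"
  shows "(\<Sum>i. a i *\<^sub>R e i) \<bullet> e k = a k"
proof -
  have "(\<Sum>i. a i *\<^sub>R e i) \<bullet> e k = (\<Sum>i. (a i *\<^sub>R e i) \<bullet> e k)"
    by (rule bounded_linear.suminf[OF bounded_linear_inner_left a])
  also have "\<dots> = (\<Sum>i. if i = k then a i else 0)"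
    by (simp add: orthonormal_basis_inner[OF e] if_distrib cong: if_cong)
  also have "\<dots> = a k"
    using sums_single[of k "\<lambda>i. a i"] by (simp add: sums_iff)
  finally show ?thesis .
qed

lemma Bessel_inequality:
  fixes e :: "nat \<Rightarrow> 'a::real_inner"
  assumes e: "orthonormal_basis e"
  shows "(\<Sum>i<n. (x \<bullet> e i)\<^sup>2) \<le> (norm x)\<^sup>2"
proof -
  let ?s = "\<Sum>i<n. (x \<bullet> e i) *\<^sub>R e i"
  have 1: "x \<bullet> ?s = (\<Sum>i<n. (x \<bullet> e i)\<^sup>2)"
    by (simp add: inner_sum_right power2_eq_square)
  have 2: "?s \<bullet> ?s = (\<Sum>i<n. (x \<bullet> e i)\<^sup>2)"
    using norm_sum_orthonormal[OF e, of "{..<n}" "\<lambda>i. x \<bullet> e i"] by (simp add: power2_norm_eq_inner)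
  have "0 \<le> (x - ?s) \<bullet> (x - ?s)" by simp
  also have "\<dots> = x \<bullet> x - 2 * (x \<bullet> ?s) + ?s \<bullet> ?s"
    by (simp add: inner_diff_left inner_diff_right inner_commute)
  finally show ?thesis using 1 2 by (simp add: power2_norm_eq_inner)
qed

lemma summable_coeff_sq:
  fixes e :: "nat \<Rightarrow> 'a::real_inner"
  assumes e: "orthonormal_basis e"
  shows "summable (\<lambda>i. (x \<bullet> e i)\<^sup>2)"
  by (rule summableI_nonneg_bounded[of _ "(norm x)\<^sup>2"]) (use Bessel_inequality[OF e] in auto)

lemma orthonormal_basis_eq_zero:
  fixes e :: "nat \<Rightarrow> 'a::real_inner"
  assumes e: "orthonormal_basis e" and x: "\<And>i. x \<bullet> e i = 0"
  shows "x = 0"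
proof -
  have "closed {y. x \<bullet> y = 0}"
    by (rule closed_Collect_eq) (intro continuous_intros)+
  moreover have "span (range e) \<subseteq> {y. x \<bullet> y = 0}"
    by (rule span_minimal) (use x in \<open>auto simp: subspace_def inner_add_right\<close>)
  ultimately have "closure (span (range e)) \<subseteq> {y. x \<bullet> y = 0}"
    by (rule closure_minimal[rotated])
  then have "x \<in> {y. x \<bullet> y = 0}"
    using e unfolding orthonormal_basis_def by blast
  then have "x \<bullet> x = 0" by simp
  then show ?thesis by simp
qed

lemma orthonormal_expansion:
  fixes e :: "nat \<Rightarrow> 'a::{real_inner, banach}"
  assumes e: "orthonormal_basis e"
  shows "(\<lambda>i. (x \<bullet> e i) *\<^sub>R e i) sums x"
proof -
  have s: "summable (\<lambda>i. (x \<bullet> e i) *\<^sub>R e i)"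
    by (rule summable_orthonormal[OF e summable_coeff_sq[OF e]])
  have "x - (\<Sum>i. (x \<bullet> e i) *\<^sub>R e i) = 0"
    by (rule orthonormal_basis_eq_zero[OF e])
      (simp add: inner_diff_left inner_orthonormal_series[OF e s])
  then show ?thesis using s by (simp add: sums_iff)
qed

lemma Parseval_inner:
  fixes e :: "nat \<Rightarrow> 'a::{real_inner, banach}"
  assumes e: "orthonormal_basis e"
  shows "(\<lambda>i. (x \<bullet> e i) * (y \<bullet> e i)) sums (x \<bullet> y)"
  using bounded_linear.sums[OF bounded_linear_inner_left[of y] orthonormal_expansion[OF e, of x]]
  by (simp add: inner_commute mult.commute)

subsection \<open>Eigenvalues of the prior and the posterior covariance\<close>

text \<open>Dimension count: the projection \<open>F\<close> onto the span of the first n vectors of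
  \<open>e\<close> cannot be injective on the span of n + 1 independent vectors, and a nonzero
  vector of its kernel is what is wanted.\<close>

lemma orthogonal_vector_in_span:
  fixes e1 e :: "nat \<Rightarrow> 'a::real_inner"
  assumes e1: "orthonormal_basis e1" and e: "orthonormal_basis e"
  obtains a where "(\<Sum>i\<le>n. a i *\<^sub>R e1 i) \<noteq> 0" "\<And>k. k < n \<Longrightarrow> (\<Sum>i\<le>n. a i *\<^sub>R e1 i) \<bullet> e k = 0"
proof -
  let ?V = "e1 ` {..n}"
  define F where "F x = (\<Sum>k<n. (x \<bullet> e k) *\<^sub>R e k)" for x
  have lin: "linear F"
    unfolding F_def by (rule linearI) (simp_all add: inner_add_left scaleR_add_left sum.distrib scaleR_sum_right)
  have inj: "inj e1"
  proof (rule injI)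
    fix i j assume "e1 i = e1 j"
    then show "i = j" using orthonormal_basis_inner[OF e1, of i i] orthonormal_basis_inner[OF e1, of i j]
      by (auto split: if_splits)
  qed
  have "pairwise orthogonal ?V"
    unfolding pairwise_def orthogonal_def using orthonormal_basis_inner[OF e1] inj
    by (auto dest: injD)
  moreover have "0 \<notin> ?V" using orthonormal_basis_norm[OF e1] by (metis imageE norm_zero zero_neq_one)
  ultimately have ind: "independent ?V" by (rule pairwise_orthogonal_independent)
  have card: "card ?V = Suc n" using inj by (simp add: card_image inj_on_def inj_def)
  have "\<not> inj_on F (span ?V)"
  proof
    assume i: "inj_on F (span ?V)"
    have "independent (F ` ?V)"
      by (rule real_vector.linear_independent_injective_image[OF lin ind i])
    moreover have "F ` ?V \<subseteq> span (e ` {..<n})"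
      unfolding F_def by (intro image_subsetI span_sum span_scale span_base) auto
    ultimately have "card (F ` ?V) \<le> card (e ` {..<n})"
      by (intro conjunct2[OF real_vector.independent_span_bound]) auto
    also have "\<dots> \<le> n" using card_image_le[of "{..<n}" e] by simp
    finally have "card (F ` ?V) \<le> n" .
    moreover have "card (F ` ?V) = card ?V"
      by (rule card_image) (use i in \<open>meson inj_on_subset span_superset\<close>)
    ultimately show False using card by simp
  qed
  then obtain x y where xy: "x \<in> span ?V" "y \<in> span ?V" "F x = F y" "x \<noteq> y"
    unfolding inj_on_def by blast
  define v where "v = x - y"
  have v: "v \<in> span ?V" "v \<noteq> 0" "F v = 0"
    using xy lin by (auto simp: v_def span_diff linear_diff)
  obtain b where b: "v = (\<Sum>w\<in>?V. b w *\<^sub>R w)"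
    using v(1) span_finite[of ?V] by auto
  have v': "v = (\<Sum>i\<le>n. b (e1 i) *\<^sub>R e1 i)"
    unfolding b using inj by (subst sum.reindex) (auto simp: inj_on_def inj_def)
  have "v \<bullet> e k = 0" if "k < n" for k
  proof -
    have "F v \<bullet> e k = (\<Sum>i<n. (v \<bullet> e i) * (if i = k then 1 else 0))"
      unfolding F_def by (simp add: inner_sum_left orthonormal_basis_inner[OF e])
    also have "\<dots> = v \<bullet> e k" using that by (simp add: if_distrib sum.delta cong: if_cong)
    finally show ?thesis using v by simp
  qed
  with v v' that[of "\<lambda>i. b (e1 i)"] show ?thesis by metis
qed

lemma laplacian_like_pos:
  assumes "laplacian_like d domA A lam \<psi>"
  shows "lam j > 0"
proof -
  have p: "positive_definite_on domA A" and o: "orthonormal_basis \<psi>"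
    and j: "\<psi> j \<in> domA" "A (\<psi> j) = lam j *\<^sub>R \<psi> j"
    using assms by (auto simp: laplacian_like_def)
  have "\<psi> j \<noteq> 0" using orthonormal_basis_norm[OF o, of j] by auto
  then have "0 < A (\<psi> j) \<bullet> \<psi> j" using p j by (auto simp: positive_definite_on_def)
  then show ?thesis using j orthonormal_basis_inner[OF o, of j j] by simp
qed

lemma laplacian_like_lower:
  assumes L: "laplacian_like d domA A lam \<psi>"
  obtains c N where "c > 0" "\<And>j. j \<ge> N \<Longrightarrow> lam j \<ge> c * real (Suc j) powr (2 / real d)"
proof -
  have "lam \<in> \<Omega>(\<lambda>j. real (Suc j) powr (2 / real d))"
    using L by (auto simp: laplacian_like_def bigtheta_def)
  then obtain c where c: "c > 0"
    and "\<forall>\<^sub>F j in sequentially. norm (lam j) \<ge> c * norm (real (Suc j) powr (2 / real d))"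
    by (elim landau_omega.bigE)
  then obtain N where "\<And>j. j \<ge> N \<Longrightarrow> norm (lam j) \<ge> c * norm (real (Suc j) powr (2 / real d))"
    by (auto simp: eventually_at_top_linorder)
  with that[OF c, of N] laplacian_like_pos[OF L] show ?thesis
    by (metis abs_of_nonneg abs_of_pos powr_ge_zero real_norm_def)
qed

text \<open>The eigenvalues \<open>lam\<close> carry no order, so the finitely many indices before
  the asymptotic regime are covered by a maximum.\<close>

lemma bounded_neg_power:
  assumes L: "laplacian_like d domA A lam \<psi>" and \<alpha>: "\<alpha> \<ge> 0"
  obtains B where "\<And>j. lam j powr (-\<alpha>) \<le> B"
proof -
  obtain c N where c: "c > 0" "\<And>j. j \<ge> N \<Longrightarrow> lam j \<ge> c * real (Suc j) powr (2 / real d)"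
    using laplacian_like_lower[OF L] by metis
  have 1: "lam j powr (-\<alpha>) \<le> c powr (-\<alpha>)" if "j \<ge> N" for j
  proof (rule powr_mono2')
    have "1 \<le> real (Suc j) powr (2 / real d)" by (rule ge_one_powr_ge_zero) auto
    then have "c * 1 \<le> c * real (Suc j) powr (2 / real d)" using c(1) by (intro mult_left_mono) auto
    then show "c \<le> lam j" using c(2)[OF that] by simp
  qed (use c \<alpha> in auto)
  have "lam j powr (-\<alpha>) \<le> Max ((\<lambda>j. lam j powr (-\<alpha>)) ` {..N}) + c powr (-\<alpha>)" for j
  proof (cases "j \<le> N")
    case True
    then have "lam j powr (-\<alpha>) \<le> Max ((\<lambda>j. lam j powr (-\<alpha>)) ` {..N})" by (intro Max_ge) auto
    then show ?thesis by (simp add: add_increasing2)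
  next
    case False
    have "0 \<le> lam 0 powr (-\<alpha>)" by simp
    also have "lam 0 powr (-\<alpha>) \<le> Max ((\<lambda>j. lam j powr (-\<alpha>)) ` {..N})" by (intro Max_ge) auto
    finally show ?thesis using 1[of j] False by simp
  qed
  then show ?thesis using that by blast
qed

lemma inner_spectral_power:
  fixes \<psi> :: "nat \<Rightarrow> 'a::{real_inner, banach}"
  assumes L: "laplacian_like d domA A lam \<psi>" and \<alpha>: "\<alpha> \<ge> 0"
  shows "spectral_power lam \<psi> (-\<alpha>) x \<bullet> \<psi> k = lam k powr (-\<alpha>) * (x \<bullet> \<psi> k)"
proof -
  have o: "orthonormal_basis \<psi>" using L by (auto simp: laplacian_like_def)
  obtain B where B: "\<And>j. lam j powr (-\<alpha>) \<le> B" using bounded_neg_power[OF L \<alpha>] by blast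
  have "summable (\<lambda>j. (lam j powr (-\<alpha>) * (x \<bullet> \<psi> j))\<^sup>2)"
  proof (rule summable_comparison_test')
    show "summable (\<lambda>j. B\<^sup>2 * (x \<bullet> \<psi> j)\<^sup>2)"
      by (intro summable_mult summable_coeff_sq[OF o])
    show "norm ((lam j powr (-\<alpha>) * (x \<bullet> \<psi> j))\<^sup>2) \<le> B\<^sup>2 * (x \<bullet> \<psi> j)\<^sup>2" if "j \<ge> 0" for j
      using B[of j] by (simp add: power_mult_distrib mult_right_mono power_mono)
  qed
  from summable_orthonormal[OF o this] show ?thesis
    unfolding spectral_power_def by (rule inner_orthonormal_series[OF o])
qed

text \<open>Half of the min-max principle. On a suitable vector v the quadratic form of the inverse
  of \<open>C1\<close> is at most |v|^2 / \<open>lam1 n\<close>, because v lies in the leading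
  eigenspaces, while that of the inverse of \<open>C0\<close> is at least c^\<alpha> (n + 1)^a
  |v|^2. The Hessian \<open>H\<close> may be indefinite, so the comparison loses an additive
  constant B, which is absorbed for large n.\<close>

theorem posterior_eigenvalues_decay:
  fixes \<psi> \<psi>1 :: "nat \<Rightarrow> 'a::{real_inner, banach}"
  assumes d: "d > 0" and L: "laplacian_like d domA A lam \<psi>" and \<alpha>: "\<alpha> > 0"
    and C0: "C0 = spectral_power lam \<psi> (- \<alpha>)"
    and H: "bounded_linear H"
    and C1: "is_posterior_covariance C0 H C1" "self_adjoint_on UNIV C1" "positive_definite_on UNIV C1"
    and e1: "orthonormal_basis \<psi>1" "\<And>j. C1 (\<psi>1 j) = lam1 j *\<^sub>R \<psi>1 j" "decseq lam1"
  shows "\<And>j. lam1 j > 0"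
    and "\<exists>K>0. \<forall>j. lam1 j \<le> K * real (Suc j) powr (- (2 * \<alpha> / real d))"
proof -
  have o: "orthonormal_basis \<psi>" using L by (auto simp: laplacian_like_def)
  show pos: "lam1 j > 0" for j
  proof -
    have "\<psi>1 j \<noteq> 0" using orthonormal_basis_norm[OF e1(1), of j] by auto
    then have "0 < C1 (\<psi>1 j) \<bullet> \<psi>1 j" using C1(3) by (auto simp: positive_definite_on_def)
    then show ?thesis using e1(2) orthonormal_basis_inner[OF e1(1), of j j] by simp
  qed
  note C0i = inner_spectral_power[OF L less_imp_le[OF \<alpha>], folded C0]
  have lp: "lam j > 0" for j by (rule laplacian_like_pos[OF L])
  have injC0: "inj C0"
  proof (rule injI)
    fix x y assume "C0 x = C0 y"
    have "x - y = 0"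
    proof (rule orthonormal_basis_eq_zero[OF o])
      fix i
      have "lam i powr (-\<alpha>) * (x \<bullet> \<psi> i) = lam i powr (-\<alpha>) * (y \<bullet> \<psi> i)"
        by (simp only: C0i[symmetric] \<open>C0 x = C0 y\<close>)
      then have "x \<bullet> \<psi> i = y \<bullet> \<psi> i" using less_imp_neq[OF lp[of i], symmetric] by (metis mult_cancel_left powr_eq_0_iff)
      then show "(x - y) \<bullet> \<psi> i = 0" by (simp add: inner_diff_left)
    qed
    then show "x = y" by simp
  qed
  obtain B where B: "B > 0" "\<And>x. norm (H x) \<le> norm x * B"
    using bounded_linear.pos_bounded[OF H] by blast
  have add: "C1 (x + y) = C1 x + C1 y" and scale: "C1 (c *\<^sub>R x) = c *\<^sub>R C1 x" for x y c
    using C1(2) by (auto simp: self_adjoint_on_def)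
  interpret C1: linear C1 by (rule linearI) (use add scale in auto)
  obtain c N where c: "c > 0" "\<And>j. j \<ge> N \<Longrightarrow> lam j \<ge> c * real (Suc j) powr (2 / real d)"
    using laplacian_like_lower[OF L] by metis
  let ?a = "2 * \<alpha> / real d"
  have key: "1 / lam1 n \<ge> c powr \<alpha> * real (Suc n) powr ?a - B" if "n \<ge> N" for n
  proof -
    obtain b where b: "(\<Sum>i\<le>n. b i *\<^sub>R \<psi>1 i) \<noteq> 0"
      "\<And>k. k < n \<Longrightarrow> (\<Sum>i\<le>n. b i *\<^sub>R \<psi>1 i) \<bullet> \<psi> k = 0"
      using orthogonal_vector_in_span[OF e1(1) o, of n] by blast
    define v where "v = (\<Sum>i\<le>n. b i *\<^sub>R \<psi>1 i)"
    \<comment> \<open>Dividing the coefficients by the eigenvalues gives the preimage of v under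
      \<open>C1\<close> explicitly.\<close>
    define u where "u = (\<Sum>i\<le>n. (b i / lam1 i) *\<^sub>R \<psi>1 i)"
    have vu: "v = C1 u"
      unfolding v_def u_def C1.sum using pos by (simp add: scale e1(2) less_imp_neq[symmetric])
    have bij: "bij_betw (\<lambda>x. H x + inv C0 x) (range C0) UNIV"
      and C1eq: "C1 = inv_into (range C0) (\<lambda>x. H x + inv C0 x)"
      using C1(1) by (auto simp: is_posterior_covariance_def)
    have img: "(\<lambda>x. H x + inv C0 x) ` range C0 = UNIV" using bij by (simp add: bij_betw_def)
    have "v \<in> range C0" unfolding vu C1eq by (rule inv_into_into) (simp add: img)
    then obtain w where w: "v = C0 w" by blast
    have "H v + inv C0 v = u" unfolding vu C1eq
      by (rule f_inv_into_f[of u "\<lambda>x. H x + inv C0 x" "range C0"]) (simp add: img)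
    \<comment> \<open>Since v lies in \<open>range C0\<close>, the inverse of \<open>C1\<close>
      applied to v splits into the bounded part H v and the preimage w of v under
      \<open>C0\<close>.\<close>
    then have u: "u = H v + w" using inv_f_f[OF injC0, of w] by (simp add: w)
    have "u \<bullet> v = (\<Sum>i\<le>n. \<Sum>j\<le>n. (b i / lam1 i) * b j * (\<psi>1 i \<bullet> \<psi>1 j))"
      unfolding u_def v_def
      by (simp add: inner_sum_left inner_sum_right sum_distrib_left sum_divide_distrib mult_ac inner_commute)
    also have "\<dots> = (\<Sum>i\<le>n. \<Sum>j\<le>n. if j = i then (b i)\<^sup>2 / lam1 i else 0)"
      by (intro sum.cong refl) (auto simp: orthonormal_basis_inner[OF e1(1)] power2_eq_square)
    also have "\<dots> = (\<Sum>i\<le>n. (b i)\<^sup>2 / lam1 i)" by (simp add: sum.delta)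
    also have "\<dots> \<le> (\<Sum>i\<le>n. (b i)\<^sup>2 / lam1 n)"
      using e1(3) pos by (intro sum_mono divide_left_mono mult_pos_pos) (auto simp: decseq_def)
    also have "\<dots> = (norm v)\<^sup>2 / lam1 n"
      unfolding v_def norm_sum_orthonormal[OF e1(1) finite_atMost] by (simp add: sum_divide_distrib)
    finally have up: "u \<bullet> v \<le> (norm v)\<^sup>2 / lam1 n" .
    let ?m = "c powr \<alpha> * real (Suc n) powr ?a"
    \<comment> \<open>Compared coefficientwise in the prior basis: for i < n the coefficient of v is
      0, and for i \<ge> n the lower bound for \<open>lam i\<close> applies.\<close>
    have wv: "?m * (v \<bullet> v) \<le> w \<bullet> v"
    proof (rule sums_le)
      show "(\<lambda>i. ?m * ((v \<bullet> \<psi> i) * (v \<bullet> \<psi> i))) sums (?m * (v \<bullet> v))"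
        by (intro sums_mult Parseval_inner[OF o])
      show "(\<lambda>i. (w \<bullet> \<psi> i) * (v \<bullet> \<psi> i)) sums (w \<bullet> v)" by (rule Parseval_inner[OF o])
      fix i
      show "?m * ((v \<bullet> \<psi> i) * (v \<bullet> \<psi> i)) \<le> (w \<bullet> \<psi> i) * (v \<bullet> \<psi> i)"
      proof (cases "i < n")
        case True
        then show ?thesis using b(2) by (simp add: v_def)
      next
        case False
        have wi: "w \<bullet> \<psi> i = lam i powr \<alpha> * (v \<bullet> \<psi> i)"
          unfolding w C0i using lp[of i] by (simp add: powr_minus field_simps)
        have "?m = (c * real (Suc n) powr (2 / real d)) powr \<alpha>"
          using c(1) by (simp add: powr_mult powr_powr)
        also have "\<dots> \<le> lam i powr \<alpha>"
        proof (rule powr_mono2)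
          have "c * real (Suc n) powr (2 / real d) \<le> c * real (Suc i) powr (2 / real d)"
            using c(1) False by (intro mult_left_mono powr_mono2) auto
          also have "\<dots> \<le> lam i" using c(2)[of i] False \<open>n \<ge> N\<close> by simp
          finally show "c * real (Suc n) powr (2 / real d) \<le> lam i" .
        qed (use \<alpha> c in auto)
        finally have "?m * ((v \<bullet> \<psi> i) * (v \<bullet> \<psi> i)) \<le> lam i powr \<alpha> * ((v \<bullet> \<psi> i) * (v \<bullet> \<psi> i))"
          by (rule mult_right_mono) simp
        then show ?thesis by (simp add: wi mult.assoc)
      qed
    qed
    have "\<bar>H v \<bullet> v\<bar> \<le> norm (H v) * norm v" by (rule Cauchy_Schwarz_ineq2)
    also have "\<dots> \<le> norm v * B * norm v" by (intro mult_right_mono B) auto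
    finally have "H v \<bullet> v \<ge> - (B * (norm v)\<^sup>2)" by (simp add: power2_eq_square mult_ac)
    then have "(?m - B) * (norm v)\<^sup>2 \<le> (norm v)\<^sup>2 / lam1 n"
      using up wv unfolding u by (simp add: inner_add_left power2_norm_eq_inner[symmetric] algebra_simps)
    moreover have "(norm v)\<^sup>2 > 0" using b(1) by (simp add: v_def)
    ultimately show ?thesis
      by (metis (no_types, opaque_lifting) divide_inverse inverse_eq_divide mult.commute mult_le_cancel_right_pos)
  qed
  have apos: "?a > 0" using d \<alpha> by simp
  have "filterlim (\<lambda>n. real (Suc n) powr ?a) at_top sequentially"
    using apos by real_asymp
  then have "eventually (\<lambda>n. real (Suc n) powr ?a \<ge> 2 * B / c powr \<alpha>) sequentially"
    by (simp add: filterlim_at_top)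
  \<comment> \<open>From this index on B is at most half of the leading term, so the other half
    survives.\<close>
  then obtain N' where N': "\<And>n. n \<ge> N' \<Longrightarrow> real (Suc n) powr ?a \<ge> 2 * B / c powr \<alpha>"
    by (auto simp: eventually_at_top_linorder)
  define M where "M = max N N'"
  have cp: "c powr \<alpha> > 0" using c(1) by simp
  have big: "lam1 n \<le> (2 / c powr \<alpha>) * real (Suc n) powr (- ?a)" if "n \<ge> M" for n
  proof -
    have "n \<ge> N" "n \<ge> N'" using that by (auto simp: M_def)
    let ?t = "c powr \<alpha> * real (Suc n) powr ?a"
    have tpos: "?t > 0" using cp by simp
    have "?t \<ge> 2 * B" using N'[OF \<open>n \<ge> N'\<close>] cp by (simp add: field_simps)
    then have "1 / lam1 n \<ge> ?t / 2" using key[OF \<open>n \<ge> N\<close>] by linarith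
    then have "lam1 n \<le> 2 / ?t" using pos[of n] tpos by (simp add: field_simps)
    then show ?thesis by (simp add: powr_minus field_simps)
  qed
  \<comment> \<open>The second summand covers the indices below M, where \<open>lam1 j\<close> is at
    most \<open>lam1 0\<close>.\<close>
  define K where "K = 2 / c powr \<alpha> + lam1 0 * real (Suc M) powr ?a"
  have K1: "lam1 0 * real (Suc M) powr ?a \<ge> 0" using pos[of 0] by simp
  show "\<exists>K>0. \<forall>j. lam1 j \<le> K * real (Suc j) powr (- ?a)"
  proof (intro exI[of _ K] conjI allI)
    show "K > 0" using cp K1 by (auto simp: K_def intro!: add_pos_nonneg)
    fix j
    show "lam1 j \<le> K * real (Suc j) powr (- ?a)"
    proof (cases "j \<ge> M")
      case True
      have "(2 / c powr \<alpha>) * real (Suc j) powr (- ?a) \<le> K * real (Suc j) powr (- ?a)"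
        using K1 by (intro mult_right_mono) (auto simp: K_def)
      then show ?thesis using big[OF True] by linarith
    next
      case False
      have "real (Suc j) powr ?a \<le> real (Suc M) powr ?a" using False apos by (intro powr_mono2) auto
      then have "lam1 0 * real (Suc j) powr ?a \<le> lam1 0 * real (Suc M) powr ?a"
        using pos[of 0] by (intro mult_left_mono) auto
      also have "\<dots> \<le> K" using cp by (simp add: K_def)
      finally have "lam1 0 \<le> K * real (Suc j) powr (- ?a)" by (simp add: powr_minus field_simps)
      moreover have "lam1 j \<le> lam1 0" using e1(3) by (simp add: decseq_def)
      ultimately show ?thesis by linarith
    qed
  qed
qed

subsection \<open>The standard Gaussian measure and Hermite polynomials\<close>

lemma prob_space_std_gaussian: "prob_space std_gaussian"
  unfolding std_gaussian_def by (rule prob_space_normal_density) simp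

lemma sets_std_gaussian [simp, measurable_cong]: "sets std_gaussian = sets borel"
  by (simp add: std_gaussian_def)

lemma space_std_gaussian [simp]: "space std_gaussian = UNIV"
  by (simp add: std_gaussian_def)

interpretation std: prob_space std_gaussian by (rule prob_space_std_gaussian)

lemma integrable_std_gaussian_iff:
  fixes g :: "real \<Rightarrow> real"
  assumes "g \<in> borel_measurable borel"
  shows "integrable std_gaussian g \<longleftrightarrow> integrable lborel (\<lambda>x. std_normal_density x * g x)"
  unfolding std_gaussian_def using assms
  by (subst integrable_real_density) (auto simp: normal_density_nonneg)

lemma integral_std_gaussian:
  fixes g :: "real \<Rightarrow> real"
  assumes "g \<in> borel_measurable borel"
  shows "(\<integral>x. g x \<partial>std_gaussian) = (\<integral>x. std_normal_density x * g x \<partial>lborel)"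
  unfolding std_gaussian_def using assms
  by (subst integral_real_density) (auto simp: normal_density_nonneg)

lemma std_gaussian_moment_even:
  "integral\<^sup>L std_gaussian (\<lambda>x. x ^ (2 * k)) = fact (2 * k) / (2 ^ k * fact k)"
  by (subst integral_std_gaussian) (auto simp: integral_std_normal_moment_even)

lemma integrable_power_std_gaussian: "integrable std_gaussian (\<lambda>x. x ^ k)"
  by (subst integrable_std_gaussian_iff) (auto simp: integrable_std_normal_moment)

lemma borel_measurable_poly [measurable]: "(\<lambda>x::real. poly p x) \<in> borel_measurable borel"
  by (intro borel_measurable_continuous_onI continuous_intros)

lemma integrable_poly_std_gaussian: "integrable std_gaussian (\<lambda>x. poly p x)"
  unfolding poly_altdef
  by (intro Bochner_Integration.integrable_sum Bochner_Integration.integrable_mult_right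
      integrable_power_std_gaussian)

text \<open>Multiplication by exp (x^2 / 4) turns the standard normal density into sqrt 2 times the
  density of variance 2. This is the growth allowed to the normalised Hermite functions, hence the
  natural majorant in all later estimates.\<close>

lemma has_bochner_integral_exp_square_quarter:
  "has_bochner_integral std_gaussian (\<lambda>x. exp (x\<^sup>2 / 4)) (sqrt 2)"
proof -
  have eq: "std_normal_density x * exp (x\<^sup>2 / 4) = sqrt 2 * normal_density 0 (sqrt 2) x" for x
    by (simp add: normal_density_def std_normal_density_def real_sqrt_mult exp_add[symmetric] field_simps)
  have i: "integrable lborel (\<lambda>x. sqrt 2 * normal_density 0 (sqrt 2) x)"
    by (intro Bochner_Integration.integrable_mult_right integrable_normal_density) auto
  have "(\<integral>x. normal_density 0 (sqrt 2) x \<partial>lborel) = 1"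
    by (rule integral_normal_density) auto
  then show ?thesis
    unfolding has_bochner_integral_iff using i
    by (subst integrable_std_gaussian_iff, simp, subst integral_std_gaussian, simp) (simp add: eq)
qed

lemma integrable_exp_square_quarter: "integrable std_gaussian (\<lambda>x. exp (x\<^sup>2 / 4))"
  and integral_exp_square_quarter: "integral\<^sup>L std_gaussian (\<lambda>x. exp (x\<^sup>2 / 4)) = sqrt 2"
  using has_bochner_integral_exp_square_quarter by (auto simp: has_bochner_integral_iff)

lemma std_gaussian_reflect:
  fixes g :: "real \<Rightarrow> real"
  assumes [measurable]: "g \<in> borel_measurable borel"
  shows "(\<integral>x. g (- x) \<partial>std_gaussian) = (\<integral>x. g x \<partial>std_gaussian)"
  using lborel_integral_real_affine[of "-1" "\<lambda>x. std_normal_density x * g x" 0]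
  by (simp add: integral_std_gaussian std_normal_density_def)

section \<open>Gaussian integration by parts\<close>

lemma integral_derivative_eq_0:
  fixes F :: "real \<Rightarrow> real"
  assumes der: "\<And>x. (F has_real_derivative F' x) (at x)"
    and cont: "continuous_on UNIV F'"
    and F: "integrable lborel F" and F': "integrable lborel F'"
  shows "(\<integral>x. F' x \<partial>lborel) = 0"
proof (rule ccontr)
  let ?L = "\<integral>x. F' x \<partial>lborel" and ?G = "\<lambda>y. F y - F (- y)"
  \<comment> \<open>The integral of F' over [-y, y] tends to \<open>?L\<close> and equals
    \<open>?G y\<close>. If \<open>?L\<close> were nonzero, the integrable function
    \<open>?G\<close> would stay away from 0 on a half line, which is absurd. Integrability thus
    takes the place of decay at infinity.\<close>
  assume L: "?L \<noteq> 0"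
  have G: "integrable lborel ?G"
    using lborel_integrable_real_affine[OF F, of "-1" 0] F by simp
  have eq: "(\<integral>x. indicator {- y..y} x *\<^sub>R F' x \<partial>lborel) = ?G y" if "y \<ge> 0" for y
    using integral_FTC_atLeastAtMost[of "- y" y F F'] that der cont
    by (auto simp: has_real_derivative_iff_has_vector_derivative
        intro: has_vector_derivative_at_within continuous_on_subset)
  have "((\<lambda>y. \<integral>x. indicator {- y..y} x *\<^sub>R F' x \<partial>lborel) \<longlongrightarrow> ?L) at_top"
  proof (rule integral_dominated_convergence_at_top)
    show "integrable lborel (\<lambda>x. norm (F' x))" using F' by simp
    show "\<forall>\<^sub>F y in at_top. AE x in lborel. norm (indicator {- y..y} x *\<^sub>R F' x) \<le> norm (F' x)"
      by (auto split: split_indicator)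
    show "AE x in lborel. ((\<lambda>y. indicator {- y..y} x *\<^sub>R F' x) \<longlongrightarrow> F' x) at_top"
    proof (intro AE_I2 tendsto_eventually)
      fix x :: real
      show "\<forall>\<^sub>F y in at_top. indicator {- y..y} x *\<^sub>R F' x = F' x"
        using eventually_ge_at_top[of "\<bar>x\<bar>"] by eventually_elim (auto simp: abs_le_iff)
    qed
  qed (use F' in auto)
  moreover have "\<forall>\<^sub>F y in at_top. (\<integral>x. indicator {- y..y} x *\<^sub>R F' x \<partial>lborel) = ?G y"
    using eventually_ge_at_top[of 0] by eventually_elim (rule eq)
  ultimately have "(?G \<longlongrightarrow> ?L) at_top" by (rule Lim_transform_eventually)
  then have "\<forall>\<^sub>F y in at_top. dist (?G y) ?L < \<bar>?L\<bar> / 2" using L by (intro tendstoD) auto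
  then obtain A where A: "\<And>y. y \<ge> A \<Longrightarrow> dist (?G y) ?L < \<bar>?L\<bar> / 2"
    by (auto simp: eventually_at_top_linorder)
  have big: "\<bar>?G y\<bar> \<ge> \<bar>?L\<bar> / 2" if "y \<ge> A" for y
    using A[OF that] unfolding dist_real_def by arith
  have "real n * (\<bar>?L\<bar> / 2) \<le> (\<integral>y. \<bar>?G y\<bar> \<partial>lborel)" for n
  proof -
    have "real n * (\<bar>?L\<bar> / 2) = (\<integral>y. indicator {A..A + real n} y * (\<bar>?L\<bar> / 2) \<partial>lborel)"
      by simp
    also have "\<dots> \<le> (\<integral>y. \<bar>?G y\<bar> \<partial>lborel)"
      by (rule integral_mono) (use G big in \<open>auto split: split_indicator\<close>)
    finally show ?thesis .
  qed
  moreover obtain n where "real n > (\<integral>y. \<bar>?G y\<bar> \<partial>lborel) / (\<bar>?L\<bar> / 2)"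
    using reals_Archimedean2 by blast
  ultimately show False using L by (simp add: field_simps) (meson not_le)
qed

lemma std_normal_density_has_derivative:
  "(std_normal_density has_real_derivative - x * std_normal_density x) (at x)"
  unfolding std_normal_density_def
  by (rule derivative_eq_intros refl | simp add: field_simps)+

text \<open>The operator sending p to x p - p' is the adjoint of differentiation for the Gaussian
  weight, and it raises Hermite polynomials by one degree. The boundary terms vanish because the
  density times g p and its derivative are integrable.\<close>

lemma gaussian_integration_by_parts:
  fixes g g' :: "real \<Rightarrow> real" and p :: "real poly"
  assumes der: "\<And>x. (g has_real_derivative g' x) (at x)" and cont: "continuous_on UNIV g'"
    and g: "\<And>q. integrable std_gaussian (\<lambda>x. g x * poly q x)"
    and g': "integrable std_gaussian (\<lambda>x. g' x * poly p x)"
  shows "(\<integral>x. g x * poly ([:0, 1:] * p - pderiv p) x \<partial>std_gaussian) = (\<integral>x. g' x * poly p x \<partial>std_gaussian)"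
proof -
  let ?\<phi> = std_normal_density
  have cg: "continuous_on UNIV g" using der by (meson DERIV_isCont continuous_at_imp_continuous_on)
  have m: "g \<in> borel_measurable borel" "g' \<in> borel_measurable borel"
    using cg cont by (auto intro: borel_measurable_continuous_onI)
  note [measurable] = m
  let ?F = "\<lambda>x. ?\<phi> x * (g x * poly p x)"
  let ?F' = "\<lambda>x. ?\<phi> x * (g' x * poly p x) - ?\<phi> x * (g x * poly ([:0, 1:] * p - pderiv p) x)"
  have iF: "integrable lborel (\<lambda>x. ?\<phi> x * (g x * poly q x))" for q
    using g[of q] by (subst (asm) integrable_std_gaussian_iff) auto
  have iG: "integrable lborel (\<lambda>x. ?\<phi> x * (g' x * poly p x))"
    using g' by (subst (asm) integrable_std_gaussian_iff) auto
  have cphi: "continuous_on UNIV ?\<phi>"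
    using std_normal_density_has_derivative by (meson DERIV_isCont continuous_at_imp_continuous_on)
  have "(\<integral>x. ?F' x \<partial>lborel) = 0"
  proof (rule integral_derivative_eq_0)
    show "(?F has_real_derivative ?F' x) (at x)" for x
      by (rule derivative_eq_intros der std_normal_density_has_derivative poly_DERIV refl)+
        (simp add: algebra_simps)
    show "continuous_on UNIV ?F'"
      by (intro continuous_intros cphi cont cg)
    show "integrable lborel ?F" by (rule iF)
    show "integrable lborel ?F'" by (intro Bochner_Integration.integrable_diff iF iG)
  qed
  then have "(\<integral>x. ?\<phi> x * (g' x * poly p x) \<partial>lborel) =
      (\<integral>x. ?\<phi> x * (g x * poly ([:0, 1:] * p - pderiv p) x) \<partial>lborel)"
    by (subst (asm) Bochner_Integration.integral_diff[OF iG iF]) simp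
  then show ?thesis
    by (subst (1 2) integral_std_gaussian) (auto intro: borel_measurable_times)
qed

section \<open>Hermite polynomials and their orthogonality\<close>

lemma pderiv_hermite_poly: "pderiv (hermite_poly (Suc n)) = smult (real (Suc n)) (hermite_poly n)"
proof (induction n rule: less_induct)
  case (less n)
  show ?case
  proof (cases n)
    case 0
    then show ?thesis by (simp add: pderiv_pCons)
  next
    case (Suc m)
    show ?thesis
    proof (cases m)
      case 0
      with Suc show ?thesis by (simp add: pderiv_pCons pderiv_mult pderiv_smult one_pCons)
    next
      case (Suc k)
      have 1: "pderiv (hermite_poly (Suc m)) = smult (real (Suc m)) (hermite_poly m)"
        using less[of m] \<open>n = Suc m\<close> by simp
      have 2: "pderiv (hermite_poly m) = smult (real m) (hermite_poly k)"
        using less[of k] \<open>n = Suc m\<close> Suc by simp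
      have "pderiv (hermite_poly (Suc n)) = hermite_poly (Suc m)
          + [:0, 1:] * smult (real (Suc m)) (hermite_poly m) - smult (real (Suc m)) (smult (real m) (hermite_poly k))"
        unfolding \<open>n = Suc m\<close> hermite_poly.simps(3) pderiv_diff pderiv_mult pderiv_smult 1 2
        by (simp add: pderiv_pCons)
      also have "\<dots> = hermite_poly (Suc m) + smult (real (Suc m)) ([:0, 1:] * hermite_poly m - smult (real m) (hermite_poly k))"
        by (simp add: smult_diff_right mult_smult_right)
      also have "[:0, 1:] * hermite_poly m - smult (real m) (hermite_poly k) = hermite_poly (Suc m)"
        using Suc by simp
      finally have "pderiv (hermite_poly (Suc n)) = smult 1 (hermite_poly n) + smult (real n) (hermite_poly n)"
        using \<open>n = Suc m\<close> by simp
      then show ?thesis unfolding smult_add_left[symmetric] by (simp add: add.commute)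
    qed
  qed
qed

lemma hermite_poly_Suc: "hermite_poly (Suc n) = [:0, 1:] * hermite_poly n - pderiv (hermite_poly n)"
proof (cases n)
  case (Suc m)
  show ?thesis unfolding Suc pderiv_hermite_poly hermite_poly.simps(3) ..
qed simp

declare hermite_poly.simps(2,3) [simp del]

lemma hermite_poly_monic: "degree (hermite_poly n) = n \<and> lead_coeff (hermite_poly n) = 1"
proof (induction n)
  case (Suc n)
  let ?p = "hermite_poly n"
  have p0: "?p \<noteq> 0" using Suc by auto
  have d: "degree ([:0, 1:] * ?p) = Suc n"
    using Suc p0 by (simp add: degree_mult_eq)
  have le: "degree (pderiv ?p) < Suc n" using Suc by (simp add: degree_pderiv)
  have "degree (hermite_poly (Suc n)) = Suc n"
    unfolding hermite_poly_Suc using le d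
    by (metis degree_add_eq_left degree_minus diff_conv_add_uminus)
  moreover have "coeff (hermite_poly (Suc n)) (Suc n) = 1"
    using Suc coeff_eq_0[OF le] by (auto simp: hermite_poly_Suc simp del: coeff_pderiv)
  ultimately show ?case by simp
qed simp

lemma degree_hermite_poly [simp]: "degree (hermite_poly n) = n"
  and lead_coeff_hermite_poly: "lead_coeff (hermite_poly n) = 1"
  and hermite_poly_nonzero [simp]: "hermite_poly n \<noteq> 0"
  using hermite_poly_monic[of n] by auto

lemma poly_hermite_poly_minus: "poly (hermite_poly n) (- x) = (- 1) ^ n * poly (hermite_poly n) x"
  by (induction n rule: hermite_poly.induct)
    (simp_all add: hermite_poly.simps(2,3) algebra_simps)

lemma integral_mult_hermite_poly_Suc:
  "(\<integral>x. poly g x * poly (hermite_poly (Suc n)) x \<partial>std_gaussian) =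
   (\<integral>x. poly (pderiv g) x * poly (hermite_poly n) x \<partial>std_gaussian)"
  unfolding hermite_poly_Suc
  by (rule gaussian_integration_by_parts)
    (auto intro: poly_DERIV continuous_intros simp: poly_mult[symmetric] integrable_poly_std_gaussian
      simp del: poly_mult)

lemma integral_mult_hermite_poly_eq_0:
  "degree g < n \<Longrightarrow> (\<integral>x. poly g x * poly (hermite_poly n) x \<partial>std_gaussian) = 0"
proof (induction n arbitrary: g)
  case (Suc n)
  show ?case
  proof (cases "degree g = 0")
    case True
    then have "pderiv g = 0" by (simp add: pderiv_eq_0_iff)
    then show ?thesis by (simp add: integral_mult_hermite_poly_Suc)
  next
    case False
    then have "degree (pderiv g) < n" using Suc.prems by (simp add: degree_pderiv)
    then show ?thesis by (simp add: integral_mult_hermite_poly_Suc Suc.IH)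
  qed
qed simp

lemma hermite_poly_orthogonal:
  "(\<integral>x. poly (hermite_poly m) x * poly (hermite_poly n) x \<partial>std_gaussian) = (if m = n then fact n else 0)"
proof (induction n arbitrary: m)
  case 0
  show ?case
  proof (cases m)
    case 0
    then show ?thesis using std.prob_space by simp
  next
    case (Suc k)
    then show ?thesis using integral_mult_hermite_poly_eq_0[of 1 m] by (simp add: mult.commute)
  qed
next
  case (Suc n)
  show ?case
  proof (cases m)
    case 0
    then show ?thesis using integral_mult_hermite_poly_eq_0[of 1 "Suc n"] by simp
  next
    case (Suc k)
    then show ?thesis using Suc.IH[of k]
      by (simp add: integral_mult_hermite_poly_Suc pderiv_hermite_poly mult.assoc)
  qed
qed

definition hermite_fun :: "nat \<Rightarrow> real \<Rightarrow> real" where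
  "hermite_fun n x = poly (hermite_poly n) x / sqrt (fact n)"

lemma hermite_fun_0 [simp]: "hermite_fun 0 = (\<lambda>x. 1)"
  by (auto simp: hermite_fun_def)

lemma hermite_fun_eq_poly: "hermite_fun n x = poly (smult (1 / sqrt (fact n)) (hermite_poly n)) x"
  by (simp add: hermite_fun_def)

lemma borel_measurable_hermite_fun [measurable]: "hermite_fun n \<in> borel_measurable borel"
  unfolding hermite_fun_eq_poly[abs_def] by measurable

lemma integrable_hermite_fun_mult: "integrable std_gaussian (\<lambda>x. hermite_fun m x * hermite_fun n x)"
  unfolding hermite_fun_eq_poly poly_mult[symmetric] by (rule integrable_poly_std_gaussian)

lemma hermite_fun_orthonormal:
  "(\<integral>x. hermite_fun m x * hermite_fun n x \<partial>std_gaussian) = (if m = n then 1 else 0)"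
proof -
  have "(\<integral>x. hermite_fun m x * hermite_fun n x \<partial>std_gaussian) =
     (\<integral>x. poly (hermite_poly m) x * poly (hermite_poly n) x / (sqrt (fact m) * sqrt (fact n)) \<partial>std_gaussian)"
    by (simp add: hermite_fun_def)
  also have "\<dots> = (if m = n then fact n else 0) / (sqrt (fact m) * sqrt (fact n))"
    by (simp only: integral_divide_zero hermite_poly_orthogonal)
  finally show ?thesis by simp
qed

lemma hermite_fun_minus: "hermite_fun n (- x) = (- 1) ^ n * hermite_fun n x"
  by (simp add: hermite_fun_def poly_hermite_poly_minus)

section \<open>Pointwise growth of the Hermite functions\<close>

lemma poly_map_poly_of_real:
  "poly (map_poly complex_of_real p) (of_real x) = of_real (poly p x)"
  by (induction p) (simp_all add: map_poly_pCons)

lemma map_poly_of_real_hermite_Suc: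
  "map_poly complex_of_real (hermite_poly (Suc n)) =
   [:0, 1:] * map_poly of_real (hermite_poly n) - pderiv (map_poly of_real (hermite_poly n))"
  by (rule poly_eqI)
    (simp add: hermite_poly_Suc coeff_map_poly coeff_pderiv coeff_pCons split: nat.split)

text \<open>exp (x t - t^2 / 2) is the exponential generating function of the Hermite polynomials:
  at t = 0 the formula gives He_n(x). The induction needs it at every t, where the argument is
  shifted to x - t.\<close>

lemma hermite_generating_function:
  fixes x :: real
  defines "F \<equiv> \<lambda>t::complex. exp (of_real x * t - t\<^sup>2 / 2)"
  shows "(deriv ^^ n) F = (\<lambda>t. poly (map_poly of_real (hermite_poly n)) (of_real x - t) * F t)"
proof (induction n)
  case (Suc n)
  let ?p = "map_poly complex_of_real (hermite_poly n)"
  have "deriv (\<lambda>t. poly ?p (of_real x - t) * F t) t =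
      poly (map_poly of_real (hermite_poly (Suc n))) (of_real x - t) * F t" for t
  proof (rule DERIV_imp_deriv)
    have 1: "((\<lambda>t. poly ?p (of_real x - t)) has_field_derivative poly (pderiv ?p) (of_real x - t) * (- 1)) (at t)"
      by (rule DERIV_chain2[OF poly_DERIV]) (auto intro!: derivative_eq_intros)
    have 2: "(F has_field_derivative (of_real x - t) * F t) (at t)"
      unfolding F_def by (rule derivative_eq_intros refl | simp)+
    show "((\<lambda>t. poly ?p (of_real x - t) * F t) has_field_derivative
        poly (map_poly of_real (hermite_poly (Suc n))) (of_real x - t) * F t) (at t)"
      by (rule DERIV_cong[OF DERIV_mult[OF 1 2]])
        (simp add: map_poly_of_real_hermite_Suc algebra_simps)
  qed
  then show ?case using Suc by simp
qed (simp add: F_def)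

text \<open>Cauchy's inequality for the generating function on the circle of radius r. There x Re t
  \<le> x^2 / 4 + (Re t)^2, which produces the exponent x^2 / 4 whatever r is.\<close>

lemma hermite_poly_bound:
  assumes "r > 0"
  shows "\<bar>poly (hermite_poly n) x\<bar> \<le> fact n * exp (x\<^sup>2 / 4 + r\<^sup>2 / 2) / r ^ n"
proof -
  define F where "F = (\<lambda>t::complex. exp (of_real x * t - t\<^sup>2 / 2))"
  have "norm ((deriv ^^ n) F 0) \<le> fact n * exp (x\<^sup>2 / 4 + r\<^sup>2 / 2) / r ^ n"
  proof (rule Cauchy_inequality)
    show "F holomorphic_on ball 0 r" "continuous_on (cball 0 r) F"
      unfolding F_def by (intro holomorphic_intros continuous_intros | simp)+
    fix t :: complex assume "norm (0 - t) = r"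
    then have r: "r\<^sup>2 = (Re t)\<^sup>2 + (Im t)\<^sup>2" using cmod_power2[of t] by simp
    have "0 \<le> (x / 2 - Re t)\<^sup>2" by simp
    then have "Re (of_real x * t - t\<^sup>2 / 2) \<le> x\<^sup>2 / 4 + r\<^sup>2 / 2"
      unfolding r by (simp add: power2_eq_square field_simps)
    then show "norm (F t) \<le> exp (x\<^sup>2 / 4 + r\<^sup>2 / 2)"
      by (simp add: F_def norm_exp_eq_Re)
  qed (use assms in simp)
  moreover have "(deriv ^^ n) F 0 = of_real (poly (hermite_poly n) x)"
    unfolding F_def by (simp add: hermite_generating_function poly_map_poly_of_real)
  ultimately show ?thesis by simp
qed

text \<open>An upper Stirling bound; its induction step is e \<le> (1 + 1/m)^(m + 1).\<close>

lemma fact_exp_le: "m \<ge> 1 \<Longrightarrow> fact m * exp (real m) \<le> exp 1 * real m * real m ^ m"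
proof (induction m rule: nat_induct_at_least)
  case (Suc m)
  have "exp (1 / (real m + 1)) \<le> (real m + 1) / real m"
  proof -
    have "1 + (- (1 / (real m + 1))) \<le> exp (- (1 / (real m + 1)))" by (rule exp_ge_add_one_self)
    then have "real m / (real m + 1) \<le> inverse (exp (1 / (real m + 1)))"
      by (simp add: exp_minus field_simps)
    then show ?thesis using Suc by (simp add: field_simps)
  qed
  then have "exp (1 / (real m + 1)) ^ (m + 1) \<le> ((real m + 1) / real m) ^ (m + 1)"
    by (rule power_mono) simp
  moreover have "exp (1 / (real m + 1)) ^ (m + 1) = exp 1"
    by (subst exp_of_nat_mult[symmetric]) (simp add: field_simps)
  ultimately have e: "exp 1 * real m ^ (m + 1) \<le> (real m + 1) ^ (m + 1)"
    using Suc by (simp add: power_divide field_simps)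
  have "fact (Suc m) * exp (real (Suc m)) = (real m + 1) * exp 1 * (fact m * exp (real m))"
    by (simp add: exp_add algebra_simps)
  also have "\<dots> \<le> (real m + 1) * exp 1 * (exp 1 * real m * real m ^ m)"
    using Suc by (intro mult_left_mono) auto
  also have "\<dots> = (real m + 1) * exp 1 * (exp 1 * real m ^ (m + 1))" by simp
  also have "\<dots> \<le> (real m + 1) * exp 1 * (real m + 1) ^ (m + 1)"
    by (intro mult_left_mono e) auto
  finally show ?case by (simp add: add.commute mult_ac)
qed simp

text \<open>The radius sqrt m balances exp (r^2 / 2) against r^m in the Cauchy bound, and Stirling
  then leaves only a factor polynomial in m. Such factors are harmless later, because the
  coefficients decay to any polynomial order in each single variable.\<close>

lemma hermite_fun_bound: "\<bar>hermite_fun m x\<bar> \<le> 2 * (real m + 1) * exp (x\<^sup>2 / 4)"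
proof (cases "m = 0")
  case True
  have "1 \<le> exp (x\<^sup>2 / 4)" by simp
  then have "1 \<le> 2 * exp (x\<^sup>2 / 4)" by linarith
  then show ?thesis using True by simp
next
  case False
  let ?r = "sqrt (real m)"
  have b: "\<bar>poly (hermite_poly m) x\<bar> \<le> fact m * exp (x\<^sup>2 / 4 + real m / 2) / ?r ^ m"
    using hermite_poly_bound[of ?r m x] False by simp
  have "(hermite_fun m x)\<^sup>2 = \<bar>poly (hermite_poly m) x\<bar>\<^sup>2 / fact m"
    by (simp add: hermite_fun_def power_divide)
  also have "\<dots> \<le> (fact m * exp (x\<^sup>2 / 4 + real m / 2) / ?r ^ m)\<^sup>2 / fact m"
    by (intro divide_right_mono power_mono b) auto
  also have "\<dots> = fact m * (exp (x\<^sup>2 / 4 + real m / 2))\<^sup>2 / (?r ^ m)\<^sup>2"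
    by (simp add: power_divide power_mult_distrib power2_eq_square)
  also have "(?r ^ m)\<^sup>2 = real m ^ m" by (simp add: power2_eq_square flip: power_mult_distrib)
  also have "(exp (x\<^sup>2 / 4 + real m / 2))\<^sup>2 = exp (real m) * (exp (x\<^sup>2 / 4))\<^sup>2"
    by (simp add: exp_add[symmetric] power2_eq_square)
  also have "fact m * (exp (real m) * (exp (x\<^sup>2 / 4))\<^sup>2) / real m ^ m
      = (fact m * exp (real m)) / real m ^ m * (exp (x\<^sup>2 / 4))\<^sup>2" by simp
  also have "\<dots> \<le> (exp 1 * real m * real m ^ m) / real m ^ m * (exp (x\<^sup>2 / 4))\<^sup>2"
    using False by (intro mult_right_mono divide_right_mono fact_exp_le) auto
  also have "\<dots> = exp 1 * real m * (exp (x\<^sup>2 / 4))\<^sup>2" using False by simp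
  also have "\<dots> \<le> (2 * (real m + 1))\<^sup>2 * (exp (x\<^sup>2 / 4))\<^sup>2"
  proof (rule mult_right_mono)
    have "exp 1 * real m \<le> 3 * real m" using exp_le by (intro mult_right_mono) auto
    also have "\<dots> \<le> (2 * (real m + 1))\<^sup>2" by (simp add: power2_eq_square algebra_simps)
    finally show "exp 1 * real m \<le> (2 * (real m + 1))\<^sup>2" .
  qed simp
  finally have "\<bar>hermite_fun m x\<bar>\<^sup>2 \<le> (2 * (real m + 1) * exp (x\<^sup>2 / 4))\<^sup>2"
    by (simp add: power_mult_distrib)
  then show ?thesis by (rule power2_le_imp_le) simp
qed

subsection \<open>Gauss-Hermite quadrature\<close>

text \<open>Separates the roots of odd multiplicity, collected in S, from a square and a rootless
  factor: S is where p changes sign.\<close>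

lemma real_poly_decomposition:
  fixes p :: "real poly"
  assumes "p \<noteq> 0"
  shows "\<exists>S r u. finite S \<and> p = (\<Prod>a\<in>S. [:- a, 1:]) * r\<^sup>2 * u \<and> (\<forall>x. poly u x \<noteq> 0)"
  using assms
proof (induction "degree p" arbitrary: p rule: less_induct)
  case (less p)
  show ?case
  proof (cases "\<exists>a. poly p a = 0")
    case False
    then show ?thesis by (intro exI[of _ "{}"] exI[of _ 1] exI[of _ p]) auto
  next
    case True
    then obtain a where "poly p a = 0" by blast
    then obtain q where q: "p = [:- a, 1:] * q" by (auto simp: poly_eq_0_iff_dvd)
    then have "q \<noteq> 0" using less.prems by auto
    then have "degree q < degree p" unfolding q by (subst degree_mult_eq) auto
    from less.hyps[OF this \<open>q \<noteq> 0\<close>] obtain S r u where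
      S: "finite S" "q = (\<Prod>a\<in>S. [:- a, 1:]) * r\<^sup>2 * u" "\<And>x. poly u x \<noteq> 0" by blast
    show ?thesis
    proof (cases "a \<in> S")
      case True
      then have e: "(\<Prod>a\<in>S. [:- a, 1:]) = [:- a, 1:] * (\<Prod>a\<in>S - {a}. [:- a, 1:])"
        using S(1) by (rule prod.remove[rotated])
      have "p = (\<Prod>a\<in>S - {a}. [:- a, 1:]) * ([:- a, 1:] * r)\<^sup>2 * u"
        unfolding q S(2) e by (simp only: power2_eq_square mult_ac)
      then show ?thesis using S by (intro exI[of _ "S - {a}"] exI[of _ "[:- a, 1:] * r"] exI[of _ u]) auto
    next
      case False
      have "p = (\<Prod>a\<in>insert a S. [:- a, 1:]) * r\<^sup>2 * u"
        unfolding q S(2) using False S(1) by (simp only: prod.insert mult_ac) simp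
      then show ?thesis using S by (intro exI[of _ "insert a S"] exI[of _ r] exI[of _ u]) auto
    qed
  qed
qed

lemma integral_poly_nonneg_eq_0:
  assumes nn: "\<And>x. poly p x \<ge> 0" and z: "(\<integral>x. poly p x \<partial>std_gaussian) = 0"
  shows "p = 0"
proof (rule ccontr)
  assume "p \<noteq> 0"
  have "AE x in std_gaussian. poly p x = 0"
    using z nn by (subst (asm) integral_nonneg_eq_0_iff_AE) (auto intro: integrable_poly_std_gaussian)
  moreover have "AE x in lborel. std_normal_density x > 0" by (simp add: normal_density_pos)
  ultimately have "AE x in lborel. poly p x = 0"
    unfolding std_gaussian_def by (subst (asm) AE_density) (auto simp: normal_density_pos)
  then have "AE x in lborel. x \<in> {x. poly p x = 0}" by simp
  moreover have "AE x in lborel. x \<notin> {x. poly p x = 0}"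
    by (rule AE_not_in) (use poly_roots_finite[OF \<open>p \<noteq> 0\<close>] in \<open>auto intro: finite_imp_null_set_lborel\<close>)
  ultimately have "AE x in (lborel :: real measure). False" by eventually_elim auto
  then show False using emeasure_lborel_UNIV by (simp add: AE_iff_measurable[of UNIV])
qed

lemma poly_no_root_const_sign:
  fixes u :: "real poly"
  assumes "\<And>x. poly u x \<noteq> 0"
  obtains s :: real where "s \<noteq> 0" "\<And>x. s * poly u x > 0"
proof -
  have "poly u x * poly u 0 > 0" for x
  proof (rule ccontr)
    assume "\<not> poly u x * poly u 0 > 0"
    then have l: "poly u x * poly u 0 < 0" using assms by (simp add: not_less le_less)
    then consider "x < 0" | "x > 0" by (cases "x = 0") (auto simp: not_less[symmetric] mult_less_0_iff linorder_neq_iff)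
    then show False
    proof cases
      case 1
      then show ?thesis using poly_IVT[of x 0 u] l assms by auto
    next
      case 2
      then show ?thesis using poly_IVT[of 0 x u] l assms by (auto simp: mult.commute)
    qed
  qed
  then show ?thesis using that[of "poly u 0"] assms by (auto simp: mult.commute)
qed

lemma finite_gh_nodes [simp]: "finite (gh_nodes n)"
  unfolding gh_nodes_def by (rule poly_roots_finite) simp

text \<open>If \<open>He\<^sub>n\<close> changed sign at fewer than \<open>n\<close> points, multiplying it by the polynomial with these
  sign changes would contradict orthogonality.\<close>

lemma card_gh_nodes: "card (gh_nodes n) = Suc n"
proof -
  let ?p = "hermite_poly (Suc n)"
  obtain S r u where S: "finite S" "?p = (\<Prod>a\<in>S. [:- a, 1:]) * r\<^sup>2 * u" "\<And>x. poly u x \<noteq> 0"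
    using real_poly_decomposition[OF hermite_poly_nonzero[of "Suc n"]] by blast
  define q :: "real poly" where "q = (\<Prod>a\<in>S. [:- a, 1:])"
  have dq: "degree q = card S" unfolding q_def by (subst degree_prod_eq_sum_degree) auto
  obtain s where s: "s \<noteq> 0" "\<And>x. s * poly u x > 0" using poly_no_root_const_sign[OF S(3)] by blast
  have "card S \<ge> Suc n"
  proof (rule ccontr)
    assume "\<not> card S \<ge> Suc n"
    then have "degree (smult s q) < Suc n" using dq by (simp add: s)
    from integral_mult_hermite_poly_eq_0[OF this]
    have "(\<integral>x. poly (smult s q * ?p) x \<partial>std_gaussian) = 0" by (simp only: poly_mult)
    moreover have "poly (smult s q * ?p) x \<ge> 0" for x
    proof -
      have "poly (smult s q * ?p) x = (poly q x * poly r x)\<^sup>2 * (s * poly u x)"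
        unfolding S(2) q_def[symmetric] by (simp add: power2_eq_square mult_ac)
      then show ?thesis using less_imp_le[OF s(2)[of x]] by (simp only: mult_nonneg_nonneg zero_le_power2)
    qed
    ultimately have "smult s q * ?p = 0" by (intro integral_poly_nonneg_eq_0)
    then have "q = 0" using s(1) hermite_poly_nonzero[of "Suc n"] by simp
    moreover have "q \<noteq> 0" unfolding q_def using S(1) by simp
    ultimately show False by simp
  qed
  moreover have "S \<subseteq> gh_nodes n"
  proof
    fix a assume "a \<in> S"
    then have "poly q a = 0" unfolding q_def poly_prod using S(1) by (auto intro!: prod_zero)
    then show "a \<in> gh_nodes n" unfolding gh_nodes_def by (simp only: S(2) q_def[symmetric]) simp
  qed
  ultimately have "Suc n \<le> card (gh_nodes n)"
    using card_mono[OF finite_gh_nodes, of S n] by linarith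
  moreover have "card (gh_nodes n) \<le> Suc n"
    using card_poly_roots_bound[of ?p] by (simp add: gh_nodes_def)
  ultimately show ?thesis by simp
qed

definition lagrange_basis :: "nat \<Rightarrow> real \<Rightarrow> real poly" where
  "lagrange_basis n x = (\<Prod>z\<in>gh_nodes n - {x}. smult (1 / (x - z)) [:- z, 1:])"

lemma poly_lagrange_basis: "poly (lagrange_basis n x) t = (\<Prod>z\<in>gh_nodes n - {x}. (t - z) / (x - z))"
  by (simp add: lagrange_basis_def poly_prod diff_divide_distrib)

lemma degree_lagrange_basis: "x \<in> gh_nodes n \<Longrightarrow> degree (lagrange_basis n x) \<le> n"
proof -
  assume x: "x \<in> gh_nodes n"
  have "degree (lagrange_basis n x) \<le> (\<Sum>z\<in>gh_nodes n - {x}. 1)"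
    unfolding lagrange_basis_def
    by (rule order.trans[OF degree_prod_sum_le]) (auto intro!: sum_mono order.trans[OF degree_smult_le])
  then show ?thesis using x by (simp add: card_gh_nodes)
qed

lemma lagrange_basis_node:
  "x \<in> gh_nodes n \<Longrightarrow> y \<in> gh_nodes n \<Longrightarrow> poly (lagrange_basis n x) y = (if x = y then 1 else 0)"
proof (cases "x = y")
  case True
  then show ?thesis unfolding poly_lagrange_basis by (auto intro!: prod.neutral)
next
  case False
  assume "y \<in> gh_nodes n"
  then have "(\<Prod>z\<in>gh_nodes n - {x}. (y - z) / (x - z)) = 0"
    using False by (intro prod_zero bexI[of _ y]) auto
  then show ?thesis using False by (simp add: poly_lagrange_basis)
qed

lemma gh_weight_eq: "gh_weight n x = (\<integral>t. poly (lagrange_basis n x) t \<partial>std_gaussian)"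
  by (simp add: gh_weight_def poly_lagrange_basis)

lemma gh_quad_exact_low:
  assumes "degree g \<le> n"
  shows "gh_quad n (poly g) = (\<integral>t. poly g t \<partial>std_gaussian)"
proof -
  have "g = (\<Sum>x\<in>gh_nodes n. smult (poly g x) (lagrange_basis n x))"
  proof (rule poly_eqI_degree[where A = "gh_nodes n"])
    fix y assume y: "y \<in> gh_nodes n"
    have "poly (\<Sum>x\<in>gh_nodes n. smult (poly g x) (lagrange_basis n x)) y
        = (\<Sum>x\<in>gh_nodes n. if x = y then poly g x else 0)"
      unfolding poly_sum by (intro sum.cong refl) (simp add: lagrange_basis_node y)
    also have "\<dots> = poly g y" using y by simp
    finally show "poly g y = poly (\<Sum>x\<in>gh_nodes n. smult (poly g x) (lagrange_basis n x)) y" ..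
  next
    have "degree (\<Sum>x\<in>gh_nodes n. smult (poly g x) (lagrange_basis n x)) \<le> n"
      by (intro degree_sum_le) (auto intro: degree_lagrange_basis)
    then show "degree (\<Sum>x\<in>gh_nodes n. smult (poly g x) (lagrange_basis n x)) < card (gh_nodes n)"
      by (simp add: card_gh_nodes)
  qed (use assms in \<open>simp add: card_gh_nodes\<close>)
  then have eq: "poly g t = poly (\<Sum>x\<in>gh_nodes n. smult (poly g x) (lagrange_basis n x)) t" for t
    by (rule arg_cong)
  have "(\<integral>t. poly g t \<partial>std_gaussian)
      = (\<integral>t. (\<Sum>x\<in>gh_nodes n. poly g x * poly (lagrange_basis n x) t) \<partial>std_gaussian)"
    by (rule Bochner_Integration.integral_cong[OF refl]) (rule trans[OF eq], simp only: poly_sum poly_smult)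
  also have "\<dots> = (\<Sum>x\<in>gh_nodes n. poly g x * gh_weight n x)"
    by (subst Bochner_Integration.integral_sum)
      (auto simp: gh_weight_eq integrable_poly_std_gaussian)
  finally show ?thesis by (simp add: gh_quad_def mult.commute)
qed

text \<open>Gauss's argument: division by He_(n+1) leaves a quotient of degree at most n, which is
  orthogonal to He_(n+1), and the nodes are the roots of He_(n+1). So neither the integral nor the
  rule sees the quotient.\<close>

lemma gh_quad_exact:
  assumes "degree g \<le> 2 * n + 1"
  shows "gh_quad n (poly g) = (\<integral>t. poly g t \<partial>std_gaussian)"
proof -
  let ?p = "hermite_poly (Suc n)"
  define q r where "q = g div ?p" and "r = g mod ?p"
  have g: "g = q * ?p + r" by (simp add: q_def r_def)
  have dr: "degree r \<le> n" using degree_mod_less[of ?p g] by (auto simp: r_def)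
  have "degree q < Suc n"
  proof (cases "q = 0")
    case False
    have "degree (q * ?p) = degree q + Suc n" using False by (simp add: degree_mult_eq)
    moreover from this have "degree (q * ?p + r) = degree (q * ?p)"
      using dr by (intro degree_add_eq_left) simp
    ultimately show ?thesis using assms g by simp
  qed simp
  then have "(\<integral>t. poly q t * poly ?p t \<partial>std_gaussian) = 0" by (rule integral_mult_hermite_poly_eq_0)
  then have "(\<integral>t. poly g t \<partial>std_gaussian) = (\<integral>t. poly r t \<partial>std_gaussian)"
    using Bochner_Integration.integral_add[OF integrable_poly_std_gaussian[of "q * ?p"] integrable_poly_std_gaussian[of r]]
    unfolding g by simp
  moreover have "poly g x = poly r x" if "x \<in> gh_nodes n" for x
    using that unfolding g by (simp add: gh_nodes_def)
  ultimately show ?thesis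
    using gh_quad_exact_low[OF dr] by (simp add: gh_quad_def)
qed

text \<open>The rule is exact for the square of the Lagrange polynomial, whose degree is at most 2n,
  so the weight is the integral of a square.\<close>

lemma gh_weight_nonneg:
  assumes x: "x \<in> gh_nodes n"
  shows "gh_weight n x \<ge> 0"
proof -
  have "degree ((lagrange_basis n x)\<^sup>2) \<le> 2 * n + 1"
    using degree_power_le[of "lagrange_basis n x" 2] degree_lagrange_basis[OF x] by simp
  from gh_quad_exact[OF this]
  have "(\<integral>t. (poly (lagrange_basis n x) t)\<^sup>2 \<partial>std_gaussian)
      = (\<Sum>y\<in>gh_nodes n. gh_weight n y * (poly (lagrange_basis n x) y)\<^sup>2)"
    by (simp add: gh_quad_def)
  also have "\<dots> = (\<Sum>y\<in>gh_nodes n. if y = x then gh_weight n y else 0)"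
    by (intro sum.cong refl) (simp add: lagrange_basis_node x)
  also have "\<dots> = gh_weight n x" using x by simp
  finally show ?thesis using Bochner_Integration.integral_nonneg[of std_gaussian "\<lambda>t. (poly (lagrange_basis n x) t)\<^sup>2"] by simp
qed

lemma gh_nodes_minus: "- x \<in> gh_nodes n \<longleftrightarrow> x \<in> gh_nodes n"
  by (simp add: gh_nodes_def poly_hermite_poly_minus)

lemma uminus_gh_nodes: "uminus ` gh_nodes n = gh_nodes n"
proof (intro equalityI subsetI)
  fix x assume "x \<in> gh_nodes n"
  then have "- x \<in> gh_nodes n" by (simp add: gh_nodes_minus)
  then show "x \<in> uminus ` gh_nodes n" by (intro image_eqI[of _ _ "- x"]) auto
qed (auto simp: gh_nodes_minus)

lemma poly_lagrange_basis_minus: "poly (lagrange_basis n (- x)) (- t) = poly (lagrange_basis n x) t"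
proof -
  have "poly (lagrange_basis n (- x)) (- t) = (\<Prod>z\<in>uminus ` (gh_nodes n - {x}). (- t - z) / (- x - z))"
    unfolding poly_lagrange_basis
  proof (intro prod.cong refl)
    show "gh_nodes n - {- x} = uminus ` (gh_nodes n - {x})"
    proof (intro equalityI subsetI)
      fix z assume "z \<in> gh_nodes n - {- x}"
      then have "- z \<in> gh_nodes n - {x}" by (auto simp: gh_nodes_minus)
      then show "z \<in> uminus ` (gh_nodes n - {x})" by (intro image_eqI[of _ _ "- z"]) auto
    qed (auto simp: gh_nodes_minus)
  qed
  also have "\<dots> = (\<Prod>z\<in>gh_nodes n - {x}. (- t + z) / (- x + z))"
    by (subst prod.reindex) (auto simp: inj_on_def)
  also have "\<dots> = poly (lagrange_basis n x) t"
    unfolding poly_lagrange_basis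
  proof (intro prod.cong refl)
    fix z
    have "(- t + z) / (- x + z) = (- (t - z)) / (- (x - z))" by simp
    also have "\<dots> = (t - z) / (x - z)" by (rule minus_divide_divide)
    finally show "(- t + z) / (- x + z) = (t - z) / (x - z)" .
  qed
  finally show ?thesis .
qed

lemma gh_weight_minus: "gh_weight n (- x) = gh_weight n x"
proof -
  have "gh_weight n (- x) = (\<integral>t. poly (lagrange_basis n (- x)) (- t) \<partial>std_gaussian)"
    unfolding gh_weight_eq by (rule std_gaussian_reflect[symmetric]) measurable
  then show ?thesis by (simp add: poly_lagrange_basis_minus gh_weight_eq)
qed

lemma gh_quad_odd:
  assumes "\<And>x. g (- x) = - g x"
  shows "gh_quad n g = 0"
proof -
  have "gh_quad n g = (\<Sum>x\<in>uminus ` gh_nodes n. gh_weight n x * g x)"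
    by (simp add: gh_quad_def uminus_gh_nodes)
  also have "\<dots> = (\<Sum>x\<in>gh_nodes n. gh_weight n (- x) * g (- x))"
    by (subst sum.reindex) (auto simp: inj_on_def)
  also have "\<dots> = - gh_quad n g"
    by (simp add: gh_weight_minus assms gh_quad_def sum_negf)
  finally show ?thesis by simp
qed

section \<open>Bounds for the rules that are uniform in the number of nodes\<close>

lemma power_eq_quotient_nonneg:
  fixes ys :: "real list"
  assumes "\<And>y. y \<in> set ys \<Longrightarrow> y \<ge> 0"
  shows "\<exists>q p. monom 1 k = q * (\<Prod>y\<leftarrow>ys. [:- y, 1:]) + p \<and> (\<forall>i. coeff q i \<ge> 0) \<and>
    (p = 0 \<or> degree p < length ys)"
  using assms
proof (induction ys)
  case Nil
  show ?case by (intro exI[of _ "monom 1 k"] exI[of _ 0]) simp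
next
  case (Cons a ys)
  then obtain q p where IH: "monom 1 k = q * (\<Prod>y\<leftarrow>ys. [:- y, 1:]) + p"
    "\<And>i. coeff q i \<ge> 0" "p = 0 \<or> degree p < length ys" by auto
  have a: "a \<ge> 0" using Cons by simp
  let ?W = "\<Prod>y\<leftarrow>ys. [:- y, 1:]"
  let ?s = "synthetic_div q a"
  have q: "q = [:- a, 1:] * ?s + [:poly q a:]"
    using synthetic_div_correct'[of a q] by simp
  \<comment> \<open>The coefficients of the quotient by x - a are the intermediate values of
    Horner's scheme at a, and a \<ge> 0. After all divisions they are the complete homogeneous
    symmetric polynomials of the points.\<close>
  have "coeff ?s i \<ge> 0" for i
    using IH(2)
  proof (induction q arbitrary: i)
    case (pCons c q)
    then have c: "\<And>i. coeff q i \<ge> 0" by (metis coeff_pCons_Suc)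
    then have "poly q a \<ge> 0" unfolding poly_altdef using a by (auto intro!: sum_nonneg)
    then show ?case using pCons.IH[OF c] by (simp add: coeff_pCons split: nat.split)
  qed simp
  moreover have "monom 1 k = ?s * (\<Prod>y\<leftarrow>a # ys. [:- y, 1:]) + (smult (poly q a) ?W + p)"
    using IH(1) by (subst (asm) q) (simp add: algebra_simps)
  moreover have "degree (smult (poly q a) ?W + p) \<le> length ys"
  proof (rule degree_add_le)
    have "degree ?W \<le> length ys"
    proof (induction ys)
      case (Cons y ys)
      have "degree ([:- y, 1:] * (\<Prod>y\<leftarrow>ys. [:- y, 1:])) \<le> 1 + length ys"
        by (rule order.trans[OF degree_mult_le]) (use Cons in auto)
      then show ?case by (simp only: list.map prod_list.Cons list.size)
    qed simp
    then show "degree (smult (poly q a) ?W) \<le> length ys"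
      by (rule order.trans[OF degree_smult_le])
    show "degree p \<le> length ys" using IH(3) by auto
  qed
  ultimately show ?case
    by (intro exI[of _ ?s] exI[of _ "smult (poly q a) ?W + p"]) auto
qed

lemma hermite_poly_factor: "hermite_poly (Suc n) = (\<Prod>x\<in>gh_nodes n. [:- x, 1:])"
proof (rule poly_eqI_degree_lead_coeff[where n = "Suc n" and A = "gh_nodes n"])
  have d: "degree (\<Prod>x\<in>gh_nodes n. [:- x, 1:]) = Suc n"
    by (subst degree_prod_eq_sum_degree) (auto simp: card_gh_nodes)
  then show "degree (\<Prod>x\<in>gh_nodes n. [:- x, 1:]) \<le> Suc n" by simp
  have "lead_coeff (\<Prod>x\<in>gh_nodes n. [:- x, 1:]) = 1" by (simp add: lead_coeff_prod)
  then show "coeff (hermite_poly (Suc n)) (Suc n) = coeff (\<Prod>x\<in>gh_nodes n. [:- x, 1:]) (Suc n)"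
    using lead_coeff_hermite_poly[of "Suc n"] d by simp
  show "poly (hermite_poly (Suc n)) z = poly (\<Prod>x\<in>gh_nodes n. [:- x, 1:]) z" if "z \<in> gh_nodes n" for z
    using that proof -
    have "poly (\<Prod>x\<in>gh_nodes n. [:- x, 1:]) z = 0"
      unfolding poly_prod using that by (intro prod_zero) auto
    then show ?thesis using that by (simp add: gh_nodes_def)
  qed
qed (simp_all add: card_gh_nodes)

text \<open>Division of \<open>x\<^sup>2\<^sup>k\<close> by \<open>He\<^sub>n\<^sub>+\<^sub>1(x)\<^sup>2 = \<Prod> (x\<^sup>2 - x\<^sub>i\<^sup>2)\<close>, carried out in the variable \<open>x\<^sup>2\<close>, has a
  quotient with nonnegative coefficients, so the quadrature error has a sign.\<close>

lemma gh_quad_even_power_le: "gh_quad n (\<lambda>x. x ^ (2 * k)) \<le> fact (2 * k) / (2 ^ k * fact k)"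
proof -
  let ?X = "[:0, 0, 1:] :: real poly"
  obtain xs where xs: "set xs = gh_nodes n" "distinct xs"
    using finite_distinct_list[OF finite_gh_nodes] by blast
  have len: "length xs = Suc n" using distinct_card[OF xs(2)] xs(1) by (simp add: card_gh_nodes)
  define ys where "ys = map (\<lambda>x. x\<^sup>2) xs"
  obtain q p where qp: "monom 1 k = q * (\<Prod>y\<leftarrow>ys. [:- y, 1:]) + p"
    "\<And>i. coeff q i \<ge> 0" "p = 0 \<or> degree p < length ys"
    proof -
    have "\<And>y. y \<in> set ys \<Longrightarrow> y \<ge> 0" by (auto simp: ys_def)
    from power_eq_quotient_nonneg[of ys, OF this, of k] show ?thesis using that by blast
  qed
  \<comment> \<open>The nodes are symmetric about 0, so the factors x - z and the factors x + z have
    the same product.\<close>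
  have W: "poly (\<Prod>y\<leftarrow>ys. [:- y, 1:]) (x\<^sup>2) = (poly (hermite_poly (Suc n)) x)\<^sup>2" for x
  proof -
    have 1: "poly (hermite_poly (Suc n)) t = (\<Prod>z\<in>gh_nodes n. (t - z))" for t
      by (simp add: hermite_poly_factor poly_prod)
    have "poly (\<Prod>y\<leftarrow>ys. [:- y, 1:]) (x\<^sup>2) = (\<Prod>z\<leftarrow>xs. (x\<^sup>2 - z\<^sup>2))"
      unfolding ys_def by (induction xs) (auto simp: algebra_simps)
    also have "\<dots> = (\<Prod>z\<in>gh_nodes n. (x - z) * (x + z))"
      using prod.distinct_set_conv_list[OF xs(2), of "\<lambda>z. x\<^sup>2 - z\<^sup>2"]
      by (simp add: xs(1) power2_eq_square square_diff_square_factored mult.commute)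
    also have "\<dots> = poly (hermite_poly (Suc n)) x * (\<Prod>z\<in>gh_nodes n. (x + z))"
      by (simp add: prod.distrib 1)
    also have "(\<Prod>z\<in>gh_nodes n. (x + z)) = (\<Prod>z\<in>uminus ` gh_nodes n. (x + z))"
      by (simp add: uminus_gh_nodes)
    also have "\<dots> = poly (hermite_poly (Suc n)) x"
      by (subst prod.reindex) (auto simp: inj_on_def 1)
    finally show ?thesis by (simp add: power2_eq_square)
  qed
  have e: "x ^ (2 * k) = poly (pcompose q ?X * (hermite_poly (Suc n))\<^sup>2) x + poly (pcompose p ?X) x" for x
  proof -
    have "x ^ (2 * k) = poly (monom 1 k) (x\<^sup>2)" by (simp add: poly_monom power_mult)
    also have "\<dots> = poly q (x\<^sup>2) * (poly (hermite_poly (Suc n)) x)\<^sup>2 + poly p (x\<^sup>2)"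
      unfolding qp(1) by (simp add: W)
    finally show ?thesis by (simp add: poly_pcompose power2_eq_square)
  qed
  have dp: "degree (pcompose p ?X) \<le> 2 * n + 1"
  proof -
    have "degree (pcompose p ?X) \<le> degree p * 2"
      using degree_pcompose_le[of p ?X] by simp
    then show ?thesis using qp(3) by (auto simp: ys_def len)
  qed
  have "gh_quad n (\<lambda>x. x ^ (2 * k)) = gh_quad n (poly (pcompose p ?X))"
    unfolding gh_quad_def e by (intro sum.cong refl) (simp add: gh_nodes_def)
  also have "\<dots> = (\<integral>x. poly (pcompose p ?X) x \<partial>std_gaussian)"
    by (rule gh_quad_exact[OF dp])
  also have "\<dots> \<le> (\<integral>x. x ^ (2 * k) \<partial>std_gaussian)"
  proof (rule integral_mono)
    fix x
    have "poly q (x\<^sup>2) \<ge> 0" unfolding poly_altdef using qp(2) by (auto intro!: sum_nonneg)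
    then show "poly (pcompose p ?X) x \<le> x ^ (2 * k)"
      unfolding e by (simp add: poly_pcompose power2_eq_square)
  qed (auto intro: integrable_poly_std_gaussian integrable_power_std_gaussian)
  finally show ?thesis by (simp add: std_gaussian_moment_even)
qed

text \<open>The power series has nonnegative terms and the rule underestimates every even moment, so
  the k-th term is at most (2k choose k) / 8^k \<le> 2^(-k), independently of n.\<close>

lemma gh_quad_exp_square_quarter_le: "gh_quad n (\<lambda>x. exp (x\<^sup>2 / 4)) \<le> 2"
proof -
  have 1: "(\<lambda>k. \<Sum>x\<in>gh_nodes n. gh_weight n x * ((x\<^sup>2 / 4) ^ k /\<^sub>R fact k)) sums gh_quad n (\<lambda>x. exp (x\<^sup>2 / 4))"
    unfolding gh_quad_def by (intro sums_sum sums_mult exp_converges)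
  have 2: "(\<lambda>k. (1 / 2 :: real) ^ k) sums 2" using geometric_sums[of "1 / 2 :: real"] by simp
  have 3: "(\<Sum>x\<in>gh_nodes n. gh_weight n x * ((x\<^sup>2 / 4) ^ k /\<^sub>R fact k)) \<le> (1 / 2) ^ k" for k
  proof -
    have "(\<Sum>x\<in>gh_nodes n. gh_weight n x * ((x\<^sup>2 / 4) ^ k /\<^sub>R fact k))
        = gh_quad n (\<lambda>x. x ^ (2 * k)) / (4 ^ k * fact k)"
      unfolding gh_quad_def sum_divide_distrib
    proof (intro sum.cong refl)
      fix x :: real
      have "x ^ (2 * k) = (x\<^sup>2) ^ k" by (rule power_mult)
      moreover have "w * (inverse f * (y / c)) = w * y / (c * f)" for w f y c :: real
        by (simp add: inverse_eq_divide mult.commute[of f c])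
      ultimately show "gh_weight n x * ((x\<^sup>2 / 4) ^ k /\<^sub>R fact k) = gh_weight n x * x ^ (2 * k) / (4 ^ k * fact k)"
        by (simp only: power_divide real_scaleR_def)
    qed
    also have "\<dots> \<le> fact (2 * k) / (2 ^ k * fact k) / (4 ^ k * fact k)"
      by (intro divide_right_mono gh_quad_even_power_le) auto
    also have "\<dots> = real (2 * k choose k) / 8 ^ k"
    proof -
      have "real (2 * k choose k) = fact (2 * k) / (fact k * fact k)"
        using binomial_fact[of k "2 * k", where 'a = real] by simp
      moreover have "(8::real) ^ k = 2 ^ k * 4 ^ k" by (simp flip: power_mult_distrib)
      ultimately show ?thesis by simp
    qed
    also have "\<dots> \<le> 2 ^ (2 * k) / 8 ^ k"
    proof (rule divide_right_mono)
      have "real (2 * k choose k) \<le> real (2 ^ (2 * k))"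
        using binomial_le_pow2[of "2 * k" k] by (simp only: of_nat_le_iff)
      then show "real (2 * k choose k) \<le> 2 ^ (2 * k)" by simp
    qed simp
    also have "\<dots> = (1 / 2) ^ k"
      by (simp add: power_mult power_divide[symmetric])
    finally show ?thesis .
  qed
  show ?thesis by (rule sums_le[OF 3 1 2])
qed

text \<open>Nonnegative weights allow the pointwise majorant of the Hermite function to be inserted
  under the sum.\<close>

lemma gh_quad_hermite_bound: "\<bar>gh_quad n (hermite_fun m)\<bar> \<le> 4 * (real m + 1)"
proof -
  have "\<bar>gh_quad n (hermite_fun m)\<bar> \<le> (\<Sum>x\<in>gh_nodes n. gh_weight n x * (2 * (real m + 1) * exp (x\<^sup>2 / 4)))"
    unfolding gh_quad_def
  proof (intro order.trans[OF sum_abs] sum_mono)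
    fix x assume "x \<in> gh_nodes n"
    then show "\<bar>gh_weight n x * hermite_fun m x\<bar> \<le> gh_weight n x * (2 * (real m + 1) * exp (x\<^sup>2 / 4))"
      unfolding abs_mult abs_of_nonneg[OF gh_weight_nonneg[OF \<open>x \<in> gh_nodes n\<close>]]
      by (intro mult_left_mono hermite_fun_bound gh_weight_nonneg)
  qed
  also have "\<dots> = 2 * (real m + 1) * gh_quad n (\<lambda>x. exp (x\<^sup>2 / 4))"
    by (simp add: gh_quad_def sum_distrib_left mult_ac)
  also have "\<dots> \<le> 2 * (real m + 1) * 2"
    by (intro mult_left_mono gh_quad_exp_square_quarter_le) auto
  finally show ?thesis by simp
qed

lemma gh_quad_hermite_exact:
  assumes "m \<le> 2 * n + 1"
  shows "gh_quad n (hermite_fun m) = (if m = 0 then 1 else 0)"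
proof -
  let ?p = "smult (1 / sqrt (fact m)) (hermite_poly m)"
  have eq: "hermite_fun m = poly ?p" by (auto simp: hermite_fun_eq_poly)
  have "gh_quad n (hermite_fun m) = (\<integral>x. hermite_fun m x \<partial>std_gaussian)"
    unfolding eq by (rule gh_quad_exact) (use assms in \<open>auto intro: order.trans[OF degree_smult_le]\<close>)
  then show ?thesis using hermite_fun_orthonormal[of m 0] by simp
qed

lemma gh_diff_0: "gh_diff 0 g = g 0"
proof -
  have "hermite_poly 1 = [:0, 1:]" by (simp add: hermite_poly.simps(2))
  then have n: "gh_nodes 0 = {0}" by (simp add: gh_nodes_def)
  then have "gh_weight 0 0 = 1" using std.prob_space by (simp add: gh_weight_def)
  then show ?thesis by (simp add: gh_diff_def gh_quad_def n)
qed

lemma gh_diff_hermite_odd: "odd m \<Longrightarrow> gh_diff n (hermite_fun m) = 0"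
  by (simp add: gh_diff_def gh_quad_odd hermite_fun_minus)

lemma gh_diff_hermite_eq_0:
  assumes "n > m"
  shows "gh_diff n (hermite_fun m) = 0"
proof -
  have "m \<le> 2 * n + 1" "m \<le> 2 * (n - 1) + 1" using assms by auto
  then show ?thesis using assms by (simp add: gh_diff_def gh_quad_hermite_exact)
qed

lemma sum_gh_diff: "(\<Sum>n\<le>k. gh_diff n g) = gh_quad k g"
  by (induction k) (simp_all add: gh_diff_def)

text \<open>Differences of level above m annihilate \<open>hermite_fun m\<close>, so this is the sum
  over all levels. Its value 1 at m = 0 makes products over all variables meaningful, and its value
  0 at odd m restricts them to even indices.\<close>

definition gh_diff_bound :: "nat \<Rightarrow> real" where
  "gh_diff_bound m = (\<Sum>n\<le>m. \<bar>gh_diff n (hermite_fun m)\<bar>)"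

lemma gh_diff_bound_nonneg: "gh_diff_bound m \<ge> 0"
  by (simp add: gh_diff_bound_def sum_nonneg)

lemma gh_diff_bound_0: "gh_diff_bound 0 = 1"
  by (simp add: gh_diff_bound_def gh_diff_0)

lemma gh_diff_bound_odd: "odd m \<Longrightarrow> gh_diff_bound m = 0"
  by (simp add: gh_diff_bound_def gh_diff_hermite_odd)

lemma gh_diff_bound_le: "gh_diff_bound m \<le> 8 * (real m + 1)\<^sup>2"
proof -
  have "\<bar>gh_diff n (hermite_fun m)\<bar> \<le> 8 * (real m + 1)" for n
    using gh_quad_hermite_bound[of n m] gh_quad_hermite_bound[of "n - 1" m]
    by (auto simp: gh_diff_def)
  then have "gh_diff_bound m \<le> (\<Sum>n\<le>m. 8 * (real m + 1))"
    unfolding gh_diff_bound_def by (intro sum_mono)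
  then show ?thesis by (simp add: power2_eq_square algebra_simps)
qed

subsection \<open>Sums over multi-indices\<close>

definition index_box :: "nat \<Rightarrow> (nat \<Rightarrow> nat) \<Rightarrow> (nat \<Rightarrow> nat) set" where
  "index_box M k = {\<mu>. (\<forall>j<M. \<mu> j \<le> k j) \<and> (\<forall>j\<ge>M. \<mu> j = 0)}"

text \<open>The product runs over the support only; it is the infinite product of all factors
  whenever \<phi> j 0 = 1.\<close>

definition multi_prod :: "(nat \<Rightarrow> nat \<Rightarrow> real) \<Rightarrow> (nat \<Rightarrow> nat) \<Rightarrow> real" where
  "multi_prod \<phi> \<mu> = (\<Prod>j | \<mu> j \<noteq> 0. \<phi> j (\<mu> j))"

lemma index_box_Suc:
  "index_box (Suc M) k = (\<lambda>(\<mu>, m). \<mu>(M := m)) ` (index_box M k \<times> {..k M})"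
proof (intro equalityI subsetI)
  fix \<mu> assume \<mu>: "\<mu> \<in> index_box (Suc M) k"
  then have "\<mu>(M := 0) \<in> index_box M k" "\<mu> M \<le> k M"
    by (auto simp: index_box_def)
  then show "\<mu> \<in> (\<lambda>(\<mu>, m). \<mu>(M := m)) ` (index_box M k \<times> {..k M})"
    by (intro image_eqI[of _ _ "(\<mu>(M := 0), \<mu> M)"]) auto
qed (auto simp: index_box_def less_Suc_eq)

lemma index_box_0: "index_box 0 k = {\<lambda>_. 0}"
  by (auto simp: index_box_def)

lemma finite_index_box [simp]: "finite (index_box M k)"
  by (induction M) (auto simp: index_box_0 index_box_Suc)

lemma sum_index_box_Suc:
  fixes g :: "(nat \<Rightarrow> nat) \<Rightarrow> 'a::comm_monoid_add"
  shows "(\<Sum>\<mu>\<in>index_box (Suc M) k. g \<mu>) = (\<Sum>\<mu>\<in>index_box M k. \<Sum>m\<le>k M. g (\<mu>(M := m)))"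
proof -
  have "inj_on (\<lambda>(\<mu>, m). \<mu>(M := m)) (index_box M k \<times> {..k M})"
  proof (rule inj_onI, clarsimp)
    fix \<mu> \<mu>' m m' assume *: "\<mu> \<in> index_box M k" "\<mu>' \<in> index_box M k" "\<mu>(M := m) = \<mu>'(M := m')"
    have "\<mu> j = \<mu>' j" for j
    proof (cases "j = M")
      case False
      then show ?thesis using fun_cong[OF *(3), of j] by simp
    qed (use *(1,2) in \<open>simp add: index_box_def\<close>)
    then show "\<mu> = \<mu>' \<and> m = m'" using fun_cong[OF *(3), of M] by auto
  qed
  then show ?thesis unfolding index_box_Suc
    by (subst sum.reindex) (auto simp: sum.cartesian_product intro!: sum.cong)
qed

lemma prod_fun_upd_lessThan:
  fixes \<phi> :: "nat \<Rightarrow> nat \<Rightarrow> 'a::comm_monoid_mult"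
  shows "(\<Prod>j<M. \<phi> j ((\<mu>(M := m)) j)) = (\<Prod>j<M. \<phi> j (\<mu> j))"
  by (intro prod.cong) auto

lemma sum_index_box_prod:
  fixes \<phi> :: "nat \<Rightarrow> nat \<Rightarrow> 'a::comm_semiring_1"
  shows "(\<Sum>\<mu>\<in>index_box M k. \<Prod>j<M. \<phi> j (\<mu> j)) = (\<Prod>j<M. \<Sum>m\<le>k j. \<phi> j m)"
proof (induction M)
  case (Suc M)
  have "(\<Sum>\<mu>\<in>index_box (Suc M) k. \<Prod>j<Suc M. \<phi> j (\<mu> j))
      = (\<Sum>\<mu>\<in>index_box M k. \<Sum>m\<le>k M. (\<Prod>j<M. \<phi> j (\<mu> j)) * \<phi> M m)"
    unfolding sum_index_box_Suc by (simp only: prod.lessThan_Suc prod_fun_upd_lessThan fun_upd_same)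
  also have "\<dots> = (\<Sum>\<mu>\<in>index_box M k. \<Prod>j<M. \<phi> j (\<mu> j)) * (\<Sum>m\<le>k M. \<phi> M m)"
    by (simp only: sum_distrib_left[symmetric] sum_distrib_right[symmetric])
  finally show ?case using Suc by simp
qed (simp add: index_box_0)

lemma support_subset_lessThan:
  fixes M :: nat
  assumes "\<And>j. j \<ge> M \<Longrightarrow> \<mu> j = (0::nat)"
  shows "{j. \<mu> j \<noteq> 0} \<subseteq> {..<M}"
proof
  fix j assume "j \<in> {j. \<mu> j \<noteq> 0}"
  then have "\<not> M \<le> j" using assms[of j] by auto
  then show "j \<in> {..<M}" by simp
qed

lemma multi_indices_bounded:
  assumes "\<mu> \<in> multi_indices"
  obtains M where "\<And>j. j \<ge> M \<Longrightarrow> \<mu> j = 0"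
proof -
  from assms have "finite {j. \<mu> j \<noteq> 0}" by (simp add: multi_indices_def)
  then obtain M where "{j. \<mu> j \<noteq> 0} \<subseteq> {..<M}" using finite_nat_iff_bounded by blast
  then have "\<mu> j = 0" if "j \<ge> M" for j using that by force
  then show ?thesis by (rule that)
qed

lemma index_box_subset_multi_indices: "index_box M k \<subseteq> multi_indices"
proof
  fix \<mu> assume "\<mu> \<in> index_box M k"
  then have "{j. \<mu> j \<noteq> 0} \<subseteq> {..<M}"
    by (intro support_subset_lessThan) (auto simp: index_box_def)
  then show "\<mu> \<in> multi_indices" by (auto simp: multi_indices_def intro: finite_subset)
qed

text \<open>Reduces sums over arbitrary finite sets of multi-indices to sums over boxes, which
  factorise. The lower bound J for M reserves room for the variables that are treated
  separately.\<close>

lemma finite_multi_indices_in_box: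
  assumes "finite F" "F \<subseteq> multi_indices"
  obtains M K where "M \<ge> J" "F \<subseteq> index_box M (\<lambda>_. K)"
proof -
  have "\<exists>M\<ge>J. \<exists>K. F \<subseteq> index_box M (\<lambda>_. K)"
    using assms
  proof (induction F)
    case (insert \<mu> F)
    then obtain M K where MK: "M \<ge> J" "F \<subseteq> index_box M (\<lambda>_. K)" by auto
    obtain M' where M': "\<And>j. j \<ge> M' \<Longrightarrow> \<mu> j = 0"
      using multi_indices_bounded[of \<mu>] insert.prems by auto
    define K' where "K' = (\<Sum>j<M'. \<mu> j)"
    have "\<mu> j \<le> K'" for j
      by (cases "j < M'") (auto simp: K'_def M' intro: member_le_sum)
    then have "\<mu> \<in> index_box (max M M') (\<lambda>_. max K K')"
      by (auto simp: index_box_def M' le_max_iff_disj)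
    moreover have "index_box M (\<lambda>_. K) \<subseteq> index_box (max M M') (\<lambda>_. max K K')"
      by (auto simp: index_box_def le_max_iff_disj) (metis not_le zero_le)
    ultimately show ?case using MK by (intro exI[of _ "max M M'"]) auto
  qed (auto simp: index_box_def)
  then show ?thesis using that by blast
qed

lemma multi_prod_eq:
  assumes "\<And>j. j \<ge> M \<Longrightarrow> \<mu> j = 0" "\<And>j. \<phi> j 0 = 1"
  shows "multi_prod \<phi> \<mu> = (\<Prod>j<M. \<phi> j (\<mu> j))"
  unfolding multi_prod_def
proof (rule prod.mono_neutral_left)
  show "{j. \<mu> j \<noteq> 0} \<subseteq> {..<M}" by (intro support_subset_lessThan assms)
qed (use assms in auto)

lemma multi_prod_nonneg: "(\<And>j m. \<phi> j m \<ge> 0) \<Longrightarrow> multi_prod \<phi> \<mu> \<ge> 0"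
  unfolding multi_prod_def by (intro prod_nonneg) auto

text \<open>Over a box the sum factorises, and 1 + x \<le> exp x bounds the product by the
  exponential of the sum of all \<epsilon> j.\<close>

lemma summable_on_multi_prod:
  assumes nn: "\<And>j m. \<phi> j m \<ge> 0" and one: "\<And>j. \<phi> j 0 = 1"
    and le: "\<And>j K. (\<Sum>m\<le>K. \<phi> j m) \<le> 1 + \<epsilon> j" and \<epsilon>: "\<And>j. \<epsilon> j \<ge> 0" "summable \<epsilon>"
  shows "multi_prod \<phi> summable_on multi_indices"
proof (rule nonneg_bdd_above_summable_on)
  show "bdd_above (sum (multi_prod \<phi>) ` {F. F \<subseteq> multi_indices \<and> finite F})"
  proof (rule bdd_aboveI2)
    fix F assume "F \<in> {F. F \<subseteq> multi_indices \<and> finite F}"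
    then obtain M K where MK: "F \<subseteq> index_box M (\<lambda>_. K)"
      using finite_multi_indices_in_box[of F 0] by auto
    have "sum (multi_prod \<phi>) F \<le> sum (multi_prod \<phi>) (index_box M (\<lambda>_. K))"
      by (intro sum_mono2 MK) (auto intro: multi_prod_nonneg nn)
    also have "\<dots> = (\<Sum>\<mu>\<in>index_box M (\<lambda>_. K). \<Prod>j<M. \<phi> j (\<mu> j))"
      by (intro sum.cong refl multi_prod_eq one) (auto simp: index_box_def)
    also have "\<dots> = (\<Prod>j<M. \<Sum>m\<le>K. \<phi> j m)" by (rule sum_index_box_prod)
    also have "\<dots> \<le> (\<Prod>j<M. exp (\<epsilon> j))"
      by (intro prod_mono conjI sum_nonneg nn order.trans[OF le exp_ge_add_one_self])
    also have "\<dots> = exp (\<Sum>j<M. \<epsilon> j)" by (simp add: exp_sum)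
    also have "\<dots> \<le> exp (suminf \<epsilon>)" using \<epsilon> by (simp add: sum_le_suminf)
    finally show "sum (multi_prod \<phi>) F \<le> exp (suminf \<epsilon>)" .
  qed
qed (auto intro: multi_prod_nonneg nn)

section \<open>Multinomial series in even exponents\<close>

lemma sum_negative_binomial_le:
  fixes y :: real
  assumes y: "0 \<le> y" "y < 1"
  shows "(\<Sum>k\<le>K. real (a + k choose k) * y ^ k) \<le> inverse (1 - y) ^ Suc a"
proof (induction a)
  case 0
  have "(1 - y) * (\<Sum>k\<le>K. y ^ k) = 1 - y ^ Suc K"
    using sum_gp_basic[of y K] by simp
  also have "\<dots> \<le> 1" using y by simp
  finally show ?case using y by (simp add: field_simps)
next
  case (Suc a)
  have "(1 - y) * (\<Sum>k\<le>K. real (Suc a + k choose k) * y ^ k)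
      = (\<Sum>k\<le>K. real (a + k choose k) * y ^ k) - real (Suc a + K choose K) * y ^ Suc K"
  proof (induction K)
    case (Suc K)
    let ?A = "\<Sum>k\<le>K. real (Suc a + k choose k) * y ^ k" and ?Y = "y ^ Suc K"
    let ?d = "real (Suc a + Suc K choose Suc K)"
    have d: "?d = real (a + Suc K choose Suc K) + real (Suc a + K choose K)" by simp
    have "(1 - y) * (\<Sum>k\<le>Suc K. real (Suc a + k choose k) * y ^ k) = (1 - y) * ?A + ?d * ?Y - ?d * (y * ?Y)"
      by (simp only: sum.atMost_Suc) (simp only: distrib_left left_diff_distrib mult_1 mult_ac)
    then show ?case unfolding Suc by (simp only: sum.atMost_Suc d power_Suc[of y "Suc K"]) (simp only: distrib_right)
  qed simp
  moreover have "0 \<le> real (Suc a + K choose K) * y ^ Suc K" using y by simp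
  ultimately have "(1 - y) * (\<Sum>k\<le>K. real (Suc a + k choose k) * y ^ k) \<le> inverse (1 - y) ^ Suc a"
    using Suc by linarith
  then have "inverse (1 - y) * ((1 - y) * (\<Sum>k\<le>K. real (Suc a + k choose k) * y ^ k))
      \<le> inverse (1 - y) * inverse (1 - y) ^ Suc a"
    using y by (intro mult_left_mono) auto
  moreover have "inverse (1 - y) * ((1 - y) * S) = S" for S using y by (simp add: field_simps)
  ultimately show ?case by (simp only: power_Suc)
qed

lemma sum_even_le:
  fixes g :: "nat \<Rightarrow> real"
  assumes "\<And>k. g k \<ge> 0"
  shows "(\<Sum>m\<le>K. if even m then g (m div 2) else 0) \<le> (\<Sum>k\<le>K. g k)"
proof -
  have "(\<Sum>m\<le>K. if even m then g (m div 2) else 0) = (\<Sum>m\<in>{m. m \<le> K \<and> even m}. g (m div 2))"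
    by (intro sum.mono_neutral_cong_right) auto
  also have "\<dots> = sum g ((\<lambda>m. m div 2) ` {m. m \<le> K \<and> even m})"
    by (subst sum.reindex) (auto simp: inj_on_def elim!: evenE)
  also have "\<dots> \<le> (\<Sum>k\<le>K. g k)" using assms by (intro sum_mono2) auto
  finally show ?thesis .
qed

text \<open>The multinomial theorem in the form that |k|! / k! times x^k sums to 1 / (1 - sum of x),
  written with even indices 2k in the variables from J on. The parameter a makes the induction over
  the number of variables work: exponent k in a new variable turns a into a + k, and the sum over k
  is then a negative binomial series in x M / (1 - X), with X the sum of the earlier
  variables.\<close>

lemma multinomial_box_sum:
  fixes x :: "nat \<Rightarrow> real" and u :: "nat \<Rightarrow> nat \<Rightarrow> real"
  assumes x: "\<And>j. x j \<ge> 0" and X: "\<And>M. (\<Sum>j\<in>{J..<M}. x j) \<le> 1 / 2"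
    and u: "\<And>j m. u j m \<ge> 0" "\<And>j. (\<Sum>m\<le>K. u j m) \<le> B j" and M: "M \<ge> J"
  defines "v \<equiv> \<lambda>j m. if even m then x j ^ (m div 2) / fact (m div 2) else 0"
  shows "(\<Sum>\<mu>\<in>index_box M (\<lambda>_. K). (\<Prod>j<J. u j (\<mu> j)) * (\<Prod>j\<in>{J..<M}. v j (\<mu> j))
      * fact (a + (\<Sum>j\<in>{J..<M}. \<mu> j div 2)) / fact a)
    \<le> (\<Prod>j<J. B j) * inverse (1 - (\<Sum>j\<in>{J..<M}. x j)) ^ Suc a"
  using M
proof (induction M arbitrary: a rule: dec_induct)
  case base
  have "(\<Sum>\<mu>\<in>index_box J (\<lambda>_. K). (\<Prod>j<J. u j (\<mu> j))) = (\<Prod>j<J. \<Sum>m\<le>K. u j m)"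
    by (rule sum_index_box_prod)
  also have "\<dots> \<le> (\<Prod>j<J. B j)" by (intro prod_mono conjI sum_nonneg u)
  finally show ?case by simp
next
  case (step M)
  let ?X = "\<Sum>j\<in>{J..<M}. x j" and ?U = "\<lambda>\<mu>. \<Prod>j<J. u j (\<mu> j)" and ?V = "\<lambda>\<mu>. \<Prod>j\<in>{J..<M}. v j (\<mu> j)"
    and ?N = "\<lambda>\<mu>. \<Sum>j\<in>{J..<M}. \<mu> j div 2"
  have ins: "{J..<Suc M} = insert M {J..<M}" using step by auto
  have X1: "?X + x M \<le> 1 / 2" using X[of "Suc M"] by (simp add: ins add.commute)
  have Xlt: "?X < 1" using X[of M] by simp
  let ?g = "\<lambda>k. (\<Sum>\<mu>\<in>index_box M (\<lambda>_. K). ?U \<mu> * ?V \<mu> * fact (a + k + ?N \<mu>) / fact (a + k))"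
  have v: "v j m \<ge> 0" for j m using x by (auto simp: v_def)
  have gnn: "?g k \<ge> 0" for k
    by (intro sum_nonneg divide_nonneg_nonneg mult_nonneg_nonneg prod_nonneg) (auto simp: u v)
  have "(\<Sum>\<mu>\<in>index_box (Suc M) (\<lambda>_. K). (\<Prod>j<J. u j (\<mu> j)) * (\<Prod>j\<in>{J..<Suc M}. v j (\<mu> j))
      * fact (a + (\<Sum>j\<in>{J..<Suc M}. \<mu> j div 2)) / fact a)
    = (\<Sum>\<mu>\<in>index_box M (\<lambda>_. K). \<Sum>m\<le>K. ?U \<mu> * ?V \<mu> * v M m * fact (a + m div 2 + ?N \<mu>) / fact a)"
    unfolding sum_index_box_Suc
  proof (intro sum.cong refl)
    fix \<mu> :: "nat \<Rightarrow> nat" and m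
    have 1: "(\<Prod>j<J. u j ((\<mu>(M := m)) j)) = ?U \<mu>" using step by (intro prod.cong) auto
    have 2: "(\<Prod>j\<in>{J..<Suc M}. v j ((\<mu>(M := m)) j)) = v M m * ?V \<mu>"
      unfolding ins by (subst prod.insert) (auto intro!: prod.cong)
    have 3: "(\<Sum>j\<in>{J..<Suc M}. (\<mu>(M := m)) j div 2) = m div 2 + ?N \<mu>"
      unfolding ins by (subst sum.insert) (auto intro!: sum.cong)
    show "(\<Prod>j<J. u j ((\<mu>(M := m)) j)) * (\<Prod>j\<in>{J..<Suc M}. v j ((\<mu>(M := m)) j))
      * fact (a + (\<Sum>j\<in>{J..<Suc M}. (\<mu>(M := m)) j div 2)) / fact a
      = ?U \<mu> * ?V \<mu> * v M m * fact (a + m div 2 + ?N \<mu>) / fact a"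
      unfolding 1 2 3 by (simp add: add.assoc mult_ac)
  qed
  also have "\<dots> = (\<Sum>m\<le>K. if even m then x M ^ (m div 2) / fact (m div 2) * fact (a + m div 2) / fact a * ?g (m div 2) else 0)"
    by (subst sum.swap) (auto simp: v_def sum_distrib_left intro!: sum.cong)
  also have "\<dots> \<le> (\<Sum>k\<le>K. x M ^ k / fact k * fact (a + k) / fact a * ?g k)"
    by (rule sum_even_le) (intro mult_nonneg_nonneg gnn divide_nonneg_nonneg, auto simp: x)
  also have "\<dots> \<le> (\<Sum>k\<le>K. x M ^ k / fact k * fact (a + k) / fact a * ((\<Prod>j<J. B j) * inverse (1 - ?X) ^ Suc (a + k)))"
    by (intro sum_mono mult_left_mono step.IH divide_nonneg_nonneg mult_nonneg_nonneg) (auto simp: x)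
  also have "\<dots> = (\<Prod>j<J. B j) * inverse (1 - ?X) ^ Suc a * (\<Sum>k\<le>K. real (a + k choose k) * (x M / (1 - ?X)) ^ k)"
    unfolding sum_distrib_left
  proof (intro sum.cong refl)
    fix k
    have b: "real (a + k choose k) = fact (a + k) / (fact k * fact a)"
      using binomial_fact[of k "a + k", where 'a = real] by simp
    show "x M ^ k / fact k * fact (a + k) / fact a * ((\<Prod>j<J. B j) * inverse (1 - ?X) ^ Suc (a + k))
        = (\<Prod>j<J. B j) * inverse (1 - ?X) ^ Suc a * (real (a + k choose k) * (x M / (1 - ?X)) ^ k)"
      unfolding b divide_inverse by (simp add: power_mult_distrib power_add mult_ac)
  qed
  also have "\<dots> \<le> (\<Prod>j<J. B j) * inverse (1 - ?X) ^ Suc a * inverse (1 - x M / (1 - ?X)) ^ Suc a"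
  proof (rule mult_left_mono[OF sum_negative_binomial_le])
    show "0 \<le> x M / (1 - ?X)" "x M / (1 - ?X) < 1" using x[of M] Xlt X1 by (auto simp: field_simps)
    have "B j \<ge> 0" for j using u(2)[of j] sum_nonneg[of "{..K}" "u j"] u(1) by (meson order.trans)
    then show "0 \<le> (\<Prod>j<J. B j) * inverse (1 - ?X) ^ Suc a"
      using Xlt by (intro mult_nonneg_nonneg prod_nonneg zero_le_power) auto
  qed
  also have "\<dots> = (\<Prod>j<J. B j) * (inverse (1 - ?X) * inverse (1 - x M / (1 - ?X))) ^ Suc a"
    by (simp only: power_mult_distrib mult.assoc)
  \<comment> \<open>(1 - X) (1 - x / (1 - X)) = 1 - (X + x), so the new variable just joins the
    sum.\<close>
  also have "inverse (1 - ?X) * inverse (1 - x M / (1 - ?X)) = inverse (1 - (\<Sum>j\<in>{J..<Suc M}. x j))"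
    unfolding ins using Xlt X1 by (simp add: inverse_mult_distrib[symmetric] right_diff_distrib diff_diff_eq add.commute)
  finally show ?case .
qed

lemma Suc_le_two_power: "real m + 1 \<le> 2 ^ m"
proof -
  have "m < 2 ^ m" by (rule less_exp)
  then have "m + 1 \<le> 2 ^ m" by linarith
  then have "real (m + 1) \<le> real (2 ^ m)" by (simp only: of_nat_le_iff)
  then show ?thesis by simp
qed

text \<open>Taking min m R derivatives gains decay of order R in m, as each of the R factors m - i
  is at least (m + 1) / (R + 1). For m < R the right side is at least 1, which makes the bound
  uniform in m.\<close>

lemma fact_ratio_le:
  "fact (m - min m R) / fact m \<le> ((real R + 1) / (real m + 1)) ^ R"
proof (cases "m \<ge> R")
  case True
  have r: "(real m + 1) / (real R + 1) \<le> real (m - i)" if "i < R" for i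
  proof -
    have "real m + 1 \<le> (real m - real R + 1) * (real R + 1)"
    proof -
      have "0 \<le> real R * (real m - real R)" using True by simp
      then show ?thesis by (simp add: algebra_simps)
    qed
    then have "(real m + 1) / (real R + 1) \<le> real m - real R + 1" by (simp add: field_simps)
    also have "\<dots> \<le> real (m - i)" using that True by (simp add: of_nat_diff)
    finally show ?thesis .
  qed
  have "((real m + 1) / (real R + 1)) ^ R = (\<Prod>i<R. (real m + 1) / (real R + 1))" by simp
  also have "\<dots> \<le> (\<Prod>i<R. real (m - i))" by (intro prod_mono conjI r) auto
  also have "\<dots> = fact m / fact (m - R)"
    using True
  proof (induction R)
    case (Suc R)
    have "fact (m - R) = real (m - R) * fact (m - Suc R)"
      using Suc.prems by (subst fact_reduce) (auto simp: Suc_diff_Suc)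
    moreover have "(\<Prod>i<R. real (m - i)) = fact m / fact (m - R)" using Suc by simp
    moreover have "real (m - R) \<noteq> 0" using Suc.prems by simp
    ultimately show ?case by (simp only: prod.lessThan_Suc) simp
  qed simp
  finally have "((real m + 1) / (real R + 1)) ^ R \<le> fact m / fact (m - R)" .
  then show ?thesis using True by (simp add: min_def power_divide field_simps)
next
  case False
  have "1 \<le> fact m * (1::real)" using fact_ge_1[of m, where 'a = real] by simp
  then have "1 / fact m \<le> (1::real)" by (simp add: field_simps)
  also have "1 \<le> ((real R + 1) / (real m + 1)) ^ R"
    using False by (intro one_le_power) (simp add: field_simps)
  finally show ?thesis using False by (simp add: min_def)
qed

lemma fact_add_le: "fact (m + n) \<le> (2::real) ^ (m + n) * fact m * fact n"
proof -
  have "fact (m + n) = real (m + n choose m) * fact m * fact n"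
    using binomial_fact[of m "m + n", where 'a = real] by simp
  also have "real (m + n choose m) \<le> real (2 ^ (m + n))"
    using binomial_le_pow2[of "m + n" m] by (simp only: of_nat_le_iff)
  finally show ?thesis by (simp add: mult_right_mono)
qed

lemma summable_tail_small:
  fixes f :: "nat \<Rightarrow> real"
  assumes "summable f" "\<And>j. f j \<ge> 0" "\<epsilon> > 0"
  obtains J where "J \<ge> J'" "\<And>M. (\<Sum>j\<in>{J..<M}. f j) \<le> \<epsilon>"
proof -
  obtain N where N: "\<And>m n. m \<ge> N \<Longrightarrow> norm (\<Sum>j\<in>{m..<n}. f j) < \<epsilon>"
    using assms(1,3) unfolding summable_Cauchy by meson
  have "(\<Sum>j\<in>{max N J'..<M}. f j) \<le> \<epsilon>" for M
    using N[of "max N J'" M] by (simp add: abs_less_iff)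
  then show ?thesis using that[of "max N J'"] by simp
qed

lemma sum_inverse_square_bound:
  obtains S :: real where "\<And>K. (\<Sum>m\<le>K. 1 / (real m + 1)\<^sup>2) \<le> S"
proof -
  have "summable (\<lambda>m. 1 / real (Suc m) ^ 2)"
    using inverse_power_summable[of 2, where 'a = real] summable_Suc_iff[of "\<lambda>n. inverse (real n ^ 2)"]
    by (simp add: inverse_eq_divide)
  then have "(\<Sum>m\<in>{..K}. 1 / real (Suc m) ^ 2) \<le> (\<Sum>m. 1 / real (Suc m) ^ 2)" for K
    by (intro sum_le_suminf) auto
  then have "(\<Sum>m\<le>K. 1 / (real m + 1)\<^sup>2) \<le> (\<Sum>m. 1 / real (Suc m) ^ 2)" for K
    by (simp only: of_nat_Suc add.commute)
  then show ?thesis by (rule that)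
qed

text \<open>The coefficient bound is used with \<open>\<kappa>\<^sub>j = \<mu>\<^sub>j\<close> for all but finitely many variables, which
  produces a multinomial series with small variables, and with bounded \<open>\<kappa>\<^sub>j\<close> for the others, which
  produces polynomial decay of high order.\<close>

lemma summable_on_coefficients:
  fixes c :: "(nat \<Rightarrow> nat) \<Rightarrow> real"
  assumes c0: "\<And>\<mu>. c \<mu> \<ge> 0" and C: "C \<ge> 0"
    and c: "\<And>M \<mu> \<kappa>. (\<And>j. j \<ge> M \<Longrightarrow> \<mu> j = 0) \<Longrightarrow> (\<And>j. \<kappa> j \<le> \<mu> j) \<Longrightarrow>
      (c \<mu>)\<^sup>2 \<le> C * fact (\<Sum>j<M. \<kappa> j) * (\<Prod>j<M. lam j ^ \<kappa> j * fact (\<mu> j - \<kappa> j) / fact (\<mu> j))"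
    and lam: "\<And>j. lam j \<ge> 0" and w: "summable (\<lambda>j. lam j * (w j)\<^sup>2)"
    and G0: "\<And>j m. G j m \<ge> 0" and G1: "\<And>j. G j 0 = 1"
    and GA: "\<And>j m. G j m \<le> A j * (real m + 1) ^ a" and Gw: "\<And>j m. G j m \<le> w j ^ m"
    and Godd: "\<And>j m. j \<ge> J' \<Longrightarrow> odd m \<Longrightarrow> G j m = 0"
  shows "(\<lambda>\<mu>. c \<mu> * multi_prod G \<mu>) summable_on multi_indices"
proof -
  \<comment> \<open>The factor 4 pays for two uses of (m + n)! \<le> 2^(m + n) m! n!: one separates
    the first J variables from the others, one splits (2N)! into N! N!. After the square root this
    costs 4 per unit of N.\<close>
  define x where "x j = 4 * lam j * (w j)\<^sup>2" for j
  have x0: "x j \<ge> 0" for j using lam by (simp add: x_def)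
  have "summable x" unfolding x_def[abs_def] mult.assoc by (rule summable_mult[OF w])
  then obtain J where J: "J \<ge> J'" "\<And>M. (\<Sum>j\<in>{J..<M}. x j) \<le> 1 / 2"
    using summable_tail_small[of x "1 / 2" J'] x0 by auto
  \<comment> \<open>The coefficient bound concerns squares, so order 2 (a + 2) leaves a + 2 after
    the root: a compensates the growth of G, and 2 makes the sum over the index converge.\<close>
  define R' where "R' = a + 2"
  define R where "R = 2 * R'"
  have A0: "A j \<ge> 0" for j using order.trans[OF G0 GA, of j 0] by simp
  define A' where "A' j = A j * max 1 (lam j) ^ R' * (real R + 1) ^ R'" for j
  have A'0: "A' j \<ge> 0" for j using A0 by (simp add: A'_def)
  define u where "u j m = A' j / (real m + 1)\<^sup>2" for j and m :: nat
  define v where "v j m = (if even m then x j ^ (m div 2) / fact (m div 2) else 0)" for j and m :: nat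
  define N where "N M \<mu> = (\<Sum>j\<in>{J..<M}. \<mu> j div 2)" for M and \<mu> :: "nat \<Rightarrow> nat"
  \<comment> \<open>Collects what the first J variables contribute to the factorial, where the
    entries of \<kappa> sum to at most J R.\<close>
  define D where "D = C * 2 ^ (J * R) * fact (J * R)"
  have D0: "D \<ge> 0" using C by (simp add: D_def)
  have key: "c \<mu> * multi_prod G \<mu> \<le>
      sqrt D * ((\<Prod>j<J. u j (\<mu> j)) * (\<Prod>j\<in>{J..<M}. v j (\<mu> j)) * fact (N M \<mu>))"
    if M: "M \<ge> J" "\<And>j. j \<ge> M \<Longrightarrow> \<mu> j = 0" for \<mu> M
  \<comment> \<open>One odd index among the later variables makes a factor of G vanish. Otherwise
    all indices there can be halved.\<close>
  proof (cases "\<exists>j\<in>{J..<M}. odd (\<mu> j)")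
    case True
    then obtain j where j: "j \<in> {J..<M}" "odd (\<mu> j)" by blast
    have "multi_prod G \<mu> = (\<Prod>j<M. G j (\<mu> j))" by (intro multi_prod_eq M G1)
    also have "\<dots> = 0" using j J(1) Godd[of j "\<mu> j"] by (intro prod_zero bexI[of _ j]) auto
    finally have "c \<mu> * multi_prod G \<mu> = 0" by simp
    moreover have "0 \<le> sqrt D * ((\<Prod>j<J. u j (\<mu> j)) * (\<Prod>j\<in>{J..<M}. v j (\<mu> j)) * fact (N M \<mu>))"
      using D0 x0 A'0 by (intro mult_nonneg_nonneg prod_nonneg) (auto simp: u_def v_def)
    ultimately show ?thesis by linarith
  next
    case False
    then have ev: "even (\<mu> j)" if "j \<in> {J..<M}" for j using that by blast
    define \<kappa> where "\<kappa> j = (if j < J then min (\<mu> j) R else \<mu> j)" for j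
    define T where "T j = lam j ^ \<kappa> j * fact (\<mu> j - \<kappa> j) / fact (\<mu> j)" for j
    have T0: "T j \<ge> 0" for j using lam by (simp add: T_def)
    define n0 n1 where "n0 = (\<Sum>j<J. \<kappa> j)" and "n1 = (\<Sum>j\<in>{J..<M}. \<kappa> j)"
    have splitM: "{..<M} = {..<J} \<union> {J..<M}" using M(1) by auto
    have splitP: "(\<Prod>j<M. f j) = (\<Prod>j<J. f j) * (\<Prod>j\<in>{J..<M}. f j)" for f :: "nat \<Rightarrow> real"
      unfolding splitM by (rule prod.union_disjoint) auto
    have "(\<Sum>j<M. \<kappa> j) = n0 + n1"
      unfolding splitM n0_def n1_def by (rule sum.union_disjoint) auto
    then have cT: "(c \<mu>)\<^sup>2 \<le> C * fact (n0 + n1) * (\<Prod>j<M. T j)"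
      using c[of M \<mu> \<kappa>] M(2) by (simp add: \<kappa>_def T_def)
    have n1: "n1 = 2 * N M \<mu>"
      unfolding n1_def N_def sum_distrib_left
      by (intro sum.cong refl) (use ev in \<open>auto simp: \<kappa>_def\<close>)
    have n0: "n0 \<le> J * R"
      unfolding n0_def using sum_bounded_above[of "{..<J}" \<kappa> R] by (simp add: \<kappa>_def)
    have "fact (n0 + n1) \<le> (2::real) ^ (n0 + n1) * fact n0 * fact n1" by (rule fact_add_le)
    also have "\<dots> \<le> 2 ^ (J * R + n1) * fact (J * R) * fact n1"
      using n0 by (intro mult_mono power_increasing fact_mono) auto
    also have "\<dots> \<le> 2 ^ (J * R + n1) * fact (J * R) * (2 ^ n1 * fact (N M \<mu>) * fact (N M \<mu>))"
      using fact_add_le[of "N M \<mu>" "N M \<mu>"]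
      by (intro mult_left_mono) (simp_all add: n1 mult_2)
    also have "\<dots> = 2 ^ (J * R) * fact (J * R) * ((4 ^ N M \<mu>)\<^sup>2 * (fact (N M \<mu>))\<^sup>2)"
    proof -
      have "(2::real) ^ n1 * 2 ^ n1 = (4 ^ N M \<mu>)\<^sup>2"
        unfolding n1 power_mult power2_eq_square by simp
      then show ?thesis by (simp add: power_add power2_eq_square mult_ac)
    qed
    finally have fle: "(fact (n0 + n1) :: real) \<le> 2 ^ (J * R) * fact (J * R) * ((4 ^ N M \<mu>)\<^sup>2 * (fact (N M \<mu>))\<^sup>2)" .
    have "(c \<mu> * multi_prod G \<mu>)\<^sup>2 = (c \<mu>)\<^sup>2 * (\<Prod>j<M. (G j (\<mu> j))\<^sup>2)"
      using multi_prod_eq[of M \<mu> G] M(2) G1 by (simp add: power_mult_distrib prod_power_distrib)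
    also have "\<dots> \<le> (C * (2 ^ (J * R) * fact (J * R) * ((4 ^ N M \<mu>)\<^sup>2 * (fact (N M \<mu>))\<^sup>2)) * (\<Prod>j<M. T j)) * (\<Prod>j<M. (G j (\<mu> j))\<^sup>2)"
      by (intro mult_right_mono order.trans[OF cT] mult_left_mono fle C prod_nonneg) (auto simp: T0)
    also have "\<dots> = D * (fact (N M \<mu>))\<^sup>2 * ((\<Prod>j<J. T j * (G j (\<mu> j))\<^sup>2) *
        ((4 ^ N M \<mu>)\<^sup>2 * (\<Prod>j\<in>{J..<M}. T j * (G j (\<mu> j))\<^sup>2)))"
      unfolding splitP prod.distrib D_def by (simp only: mult_ac)
    also have "(4 ^ N M \<mu>)\<^sup>2 * (\<Prod>j\<in>{J..<M}. T j * (G j (\<mu> j))\<^sup>2)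
        = (\<Prod>j\<in>{J..<M}. (4 ^ (\<mu> j div 2))\<^sup>2 * (T j * (G j (\<mu> j))\<^sup>2))"
      unfolding N_def power_sum prod.distrib by (simp add: prod_power_distrib)
    also have "D * (fact (N M \<mu>))\<^sup>2 * ((\<Prod>j<J. T j * (G j (\<mu> j))\<^sup>2) *
        (\<Prod>j\<in>{J..<M}. (4 ^ (\<mu> j div 2))\<^sup>2 * (T j * (G j (\<mu> j))\<^sup>2)))
      \<le> D * (fact (N M \<mu>))\<^sup>2 * ((\<Prod>j<J. (u j (\<mu> j))\<^sup>2) * (\<Prod>j\<in>{J..<M}. (v j (\<mu> j))\<^sup>2))"
    proof (intro mult_left_mono mult_mono prod_mono conjI)
      fix j assume "j \<in> {..<J}"
      then have k: "\<kappa> j = min (\<mu> j) R" by (simp add: \<kappa>_def)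
      have "lam j ^ \<kappa> j \<le> max 1 (lam j) ^ \<kappa> j" using lam by (intro power_mono) auto
      also have "\<dots> \<le> max 1 (lam j) ^ R" unfolding k by (intro power_increasing) auto
      finally have l: "lam j ^ \<kappa> j \<le> max 1 (lam j) ^ R" .
      have "T j = lam j ^ \<kappa> j * (fact (\<mu> j - min (\<mu> j) R) / fact (\<mu> j))" by (simp add: T_def k)
      also have "\<dots> \<le> max 1 (lam j) ^ R * ((real R + 1) / (real (\<mu> j) + 1)) ^ R"
        by (intro mult_mono l fact_ratio_le) (auto simp: le_max_iff_disj)
      finally have T: "T j \<le> max 1 (lam j) ^ R * ((real R + 1) / (real (\<mu> j) + 1)) ^ R" .
      have "T j * (G j (\<mu> j))\<^sup>2 \<le> (max 1 (lam j) ^ R * ((real R + 1) / (real (\<mu> j) + 1)) ^ R) * (A j * (real (\<mu> j) + 1) ^ a)\<^sup>2"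
        by (intro mult_mono T power_mono GA G0) (auto simp: le_max_iff_disj T0)
      also have "\<dots> = (max 1 (lam j) ^ R' * ((real R + 1) / (real (\<mu> j) + 1)) ^ R' * (A j * (real (\<mu> j) + 1) ^ a))\<^sup>2"
        unfolding R_def mult.commute[of 2 R'] power_mult by (simp add: power_mult_distrib)
      also have "max 1 (lam j) ^ R' * ((real R + 1) / (real (\<mu> j) + 1)) ^ R' * (A j * (real (\<mu> j) + 1) ^ a) = u j (\<mu> j)"
        unfolding u_def A'_def power_divide unfolding R'_def power_add
        by (simp add: field_simps)
      finally show "T j * (G j (\<mu> j))\<^sup>2 \<le> (u j (\<mu> j))\<^sup>2" .
    next
      fix j assume j: "j \<in> {J..<M}"
      obtain k where k: "\<mu> j = 2 * k" using ev[OF j] by (elim evenE)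
      have \<kappa>j: "\<kappa> j = 2 * k" using j k by (simp add: \<kappa>_def)
      \<comment> \<open>This replaces 1 / (2k)! by the square of 1 / k!, the shape required by the
        multinomial series after taking roots.\<close>
      have "fact k * fact k \<le> (fact (2 * k) :: real)"
      proof -
        have "fact k * fact k * 1 \<le> fact k * fact k * real (2 * k choose k)"
          by (intro mult_left_mono) (auto simp: Suc_le_eq)
        also have "\<dots> = fact (2 * k)" using binomial_fact[of k "2 * k", where 'a = real] by simp
        finally show ?thesis by simp
      qed
      then have Tle: "T j \<le> lam j ^ (2 * k) / (fact k * fact k)"
        unfolding T_def \<kappa>j k using lam by (auto intro!: divide_left_mono)
      have "(4 ^ (\<mu> j div 2))\<^sup>2 * (T j * (G j (\<mu> j))\<^sup>2) \<le> (4 ^ k)\<^sup>2 * (lam j ^ (2 * k) / (fact k * fact k) * (w j ^ (2 * k))\<^sup>2)"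
        using Tle Gw[of j "2 * k"] G0 lam T0
        by (intro mult_mono mult_nonneg_nonneg power_mono) (auto simp: k)
      also have "\<dots> = (v j (\<mu> j))\<^sup>2"
        by (simp add: v_def k x_def power_mult_distrib power_divide power2_eq_square power_add mult_2)
      finally show "(4 ^ (\<mu> j div 2))\<^sup>2 * (T j * (G j (\<mu> j))\<^sup>2) \<le> (v j (\<mu> j))\<^sup>2" .
    qed (auto intro!: mult_nonneg_nonneg prod_nonneg simp: T0 D0)
    also have "\<dots> = (sqrt D * ((\<Prod>j<J. u j (\<mu> j)) * (\<Prod>j\<in>{J..<M}. v j (\<mu> j)) * fact (N M \<mu>)))\<^sup>2"
      using D0 by (simp add: power_mult_distrib prod_power_distrib mult_ac)
    finally show ?thesis
      by (rule power2_le_imp_le)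
        (use D0 x0 A'0 in \<open>auto intro!: mult_nonneg_nonneg prod_nonneg simp: u_def v_def\<close>)
  qed
  obtain S where S: "\<And>K. (\<Sum>m\<le>K. 1 / (real m + 1)\<^sup>2) \<le> S" using sum_inverse_square_bound by blast
  have uB: "(\<Sum>m\<le>K. u j m) \<le> A' j * S" for j K
    using mult_left_mono[OF S[of K] A'0[of j]] by (simp add: u_def sum_distrib_left)
  have u0: "u j m \<ge> 0" for j m using A'0 by (simp add: u_def)
  have B0: "0 \<le> A' j * S" for j using order.trans[OF sum_nonneg uB, of 0 j] u0 by blast
  show ?thesis
  proof (rule nonneg_bdd_above_summable_on)
    show "bdd_above (sum (\<lambda>\<mu>. c \<mu> * multi_prod G \<mu>) ` {F. F \<subseteq> multi_indices \<and> finite F})"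
    proof (rule bdd_aboveI2)
      fix F assume "F \<in> {F. F \<subseteq> multi_indices \<and> finite F}"
      then obtain M K where MK: "M \<ge> J" "F \<subseteq> index_box M (\<lambda>_. K)"
        using finite_multi_indices_in_box[of F J] by auto
      have "(\<Sum>\<mu>\<in>F. c \<mu> * multi_prod G \<mu>) \<le> (\<Sum>\<mu>\<in>index_box M (\<lambda>_. K). c \<mu> * multi_prod G \<mu>)"
        by (intro sum_mono2 MK) (auto intro!: multi_prod_nonneg mult_nonneg_nonneg c0 G0)
      also have "\<dots> \<le> (\<Sum>\<mu>\<in>index_box M (\<lambda>_. K).
          sqrt D * ((\<Prod>j<J. u j (\<mu> j)) * (\<Prod>j\<in>{J..<M}. v j (\<mu> j)) * fact (N M \<mu>)))"
        by (intro sum_mono key MK) (auto simp: index_box_def)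
      also have "\<dots> = sqrt D * (\<Sum>\<mu>\<in>index_box M (\<lambda>_. K).
          (\<Prod>j<J. u j (\<mu> j)) * (\<Prod>j\<in>{J..<M}. v j (\<mu> j)) * fact (0 + (\<Sum>j\<in>{J..<M}. \<mu> j div 2)) / fact 0)"
        by (simp add: sum_distrib_left N_def)
      also have "\<dots> \<le> sqrt D * ((\<Prod>j<J. A' j * S) * inverse (1 - (\<Sum>j\<in>{J..<M}. x j)) ^ Suc 0)"
        unfolding v_def by (intro mult_left_mono multinomial_box_sum x0 J u0 uB MK) (use D0 in auto)
      also have "\<dots> \<le> sqrt D * ((\<Prod>j<J. A' j * S) * 2)"
      proof (intro mult_left_mono prod_nonneg)
        have "inverse (1 - (\<Sum>j\<in>{J..<M}. x j)) \<le> inverse (1 / 2)"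
          using J(2)[of M] by (intro le_imp_inverse_le) auto
        then show "inverse (1 - (\<Sum>j\<in>{J..<M}. x j)) ^ Suc 0 \<le> 2" by simp
      qed (use B0 D0 in auto)
      finally show "(\<Sum>\<mu>\<in>F. c \<mu> * multi_prod G \<mu>) \<le> sqrt D * ((\<Prod>j<J. A' j * S) * 2)" .
    qed
  qed (auto intro!: multi_prod_nonneg mult_nonneg_nonneg c0 G0)
qed

subsection \<open>The product Gaussian measure\<close>

lemma sets_product_gaussian [simp, measurable_cong]:
  "sets product_gaussian = sets (PiM UNIV (\<lambda>_. borel))"
  unfolding product_gaussian_def by (intro sets_PiM_cong) auto

lemma space_product_gaussian [simp]: "space product_gaussian = UNIV"
  by (simp add: product_gaussian_def space_PiM)

lemma prob_space_product_gaussian: "prob_space product_gaussian"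
  unfolding product_gaussian_def by (intro prob_space_PiM prob_space_std_gaussian)

interpretation gauss: prob_space product_gaussian by (rule prob_space_product_gaussian)

interpretation gauss: pair_sigma_finite std_gaussian product_gaussian ..

lemma distr_fun_upd_product_gaussian:
  "distr (std_gaussian \<Otimes>\<^sub>M product_gaussian) product_gaussian (\<lambda>(t, \<xi>). \<xi>(j := t)) = product_gaussian"
  using distr_pair_PiM_eq_PiM[of UNIV "\<lambda>_. std_gaussian" j] prob_space_std_gaussian
  by (simp add: product_gaussian_def)

lemma measurable_fun_upd_pair [measurable]:
  "(\<lambda>(t, \<xi>). \<xi>(j := t)) \<in> std_gaussian \<Otimes>\<^sub>M product_gaussian \<rightarrow>\<^sub>M product_gaussian"
proof -
  have "(\<lambda>(t, \<xi>). \<xi>(j := t)) \<in> (std_gaussian \<Otimes>\<^sub>M product_gaussian) \<rightarrow>\<^sub>M PiM UNIV (\<lambda>_::nat. borel :: real measure)"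
    by (rule measurable_PiM_single') (auto simp: case_prod_beta fun_upd_def)
  then show ?thesis by (simp add: measurable_def)
qed

text \<open>Resampling one coordinate independently leaves the product law unchanged, so Fubini in a
  single coordinate can be expressed by \<open>fun_upd\<close> on whole sequences, the form in which
  X is given.\<close>

lemma product_gaussian_fubini:
  fixes G :: "(nat \<Rightarrow> real) \<Rightarrow> real"
  assumes G: "integrable product_gaussian G"
  shows "AE \<xi> in product_gaussian. integrable std_gaussian (\<lambda>t. G (\<xi>(j := t)))"
    and "(\<integral>\<xi>. G \<xi> \<partial>product_gaussian) = (\<integral>\<xi>. (\<integral>t. G (\<xi>(j := t)) \<partial>std_gaussian) \<partial>product_gaussian)"
proof -
  have i: "integrable (std_gaussian \<Otimes>\<^sub>M product_gaussian) (\<lambda>(t, \<xi>). G (\<xi>(j := t)))"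
    using integrable_distr[OF measurable_fun_upd_pair[of j], of G] G
    unfolding distr_fun_upd_product_gaussian case_prod_beta by blast
  from gauss.AE_integrable_snd[OF i]
  show "AE \<xi> in product_gaussian. integrable std_gaussian (\<lambda>t. G (\<xi>(j := t)))" .
  have "(\<integral>\<xi>. G \<xi> \<partial>product_gaussian) = (\<integral>z. G (case z of (t, \<xi>) \<Rightarrow> \<xi>(j := t)) \<partial>(std_gaussian \<Otimes>\<^sub>M product_gaussian))"
    using integral_distr[OF measurable_fun_upd_pair[of j], of G] G
    unfolding distr_fun_upd_product_gaussian by simp
  also have "\<dots> = (\<integral>(t, \<xi>). G (\<xi>(j := t)) \<partial>(std_gaussian \<Otimes>\<^sub>M product_gaussian))"
    by (intro Bochner_Integration.integral_cong refl) auto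
  also have "\<dots> = (\<integral>\<xi>. (\<integral>t. G (\<xi>(j := t)) \<partial>std_gaussian) \<partial>product_gaussian)"
    using gauss.integral_snd[OF i] by simp
  finally show "(\<integral>\<xi>. G \<xi> \<partial>product_gaussian) = (\<integral>\<xi>. (\<integral>t. G (\<xi>(j := t)) \<partial>std_gaussian) \<partial>product_gaussian)" .
qed

interpretation pgauss: product_prob_space "\<lambda>_::nat. std_gaussian" UNIV
  by unfold_locales

lemma product_gaussian_restrict:
  assumes "finite J"
  shows "distr product_gaussian (PiM J (\<lambda>_. std_gaussian)) (\<lambda>\<xi>. restrict \<xi> J) = PiM J (\<lambda>_. std_gaussian)"
  using pgauss.distr_PiM_restrict_finite[OF assms] by (simp add: product_gaussian_def)

lemma measurable_restrict_gaussian: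
  "(\<lambda>\<xi>. restrict \<xi> J) \<in> product_gaussian \<rightarrow>\<^sub>M PiM J (\<lambda>_. std_gaussian)"
  unfolding product_gaussian_def by (rule measurable_restrict_subset) simp

lemma product_gaussian_prod:
  fixes \<phi> :: "nat \<Rightarrow> real \<Rightarrow> real"
  assumes J: "finite J" and i: "\<And>j. j \<in> J \<Longrightarrow> integrable std_gaussian (\<phi> j)"
  shows "integrable product_gaussian (\<lambda>\<xi>. \<Prod>j\<in>J. \<phi> j (\<xi> j))"
    and "(\<integral>\<xi>. (\<Prod>j\<in>J. \<phi> j (\<xi> j)) \<partial>product_gaussian) = (\<Prod>j\<in>J. \<integral>t. \<phi> j t \<partial>std_gaussian)"
proof -
  let ?f = "\<lambda>x. \<Prod>j\<in>J. \<phi> j (x j)"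
  have int: "integrable (PiM J (\<lambda>_. std_gaussian)) ?f"
    by (rule pgauss.product_integrable_prod[OF J i])
  have r: "?f (restrict \<xi> J) = ?f \<xi>" for \<xi> by (intro prod.cong) auto
  show "integrable product_gaussian ?f"
    using integrable_distr[OF measurable_restrict_gaussian[of J], of ?f] int
    unfolding product_gaussian_restrict[OF J] r by simp
  have "(\<integral>x. ?f x \<partial>PiM J (\<lambda>_. std_gaussian)) = (\<integral>\<xi>. ?f (restrict \<xi> J) \<partial>product_gaussian)"
    using integral_distr[OF measurable_restrict_gaussian[of J], of ?f] int
    unfolding product_gaussian_restrict[OF J] by simp
  then show "(\<integral>\<xi>. ?f \<xi> \<partial>product_gaussian) = (\<Prod>j\<in>J. \<integral>t. \<phi> j t \<partial>std_gaussian)"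
    unfolding r using pgauss.product_integral_prod[OF J i] by simp
qed

section \<open>Products of square integrable functions\<close>

lemma integrable_mult_square_integrable:
  fixes u v :: "'b \<Rightarrow> real"
  assumes [measurable]: "u \<in> borel_measurable M" "v \<in> borel_measurable M"
    and u: "integrable M (\<lambda>x. (u x)\<^sup>2)" and v: "integrable M (\<lambda>x. (v x)\<^sup>2)"
  shows "integrable M (\<lambda>x. u x * v x)"
proof (rule Bochner_Integration.integrable_bound)
  show "integrable M (\<lambda>x. (u x)\<^sup>2 + (v x)\<^sup>2)" using u v by simp
  have "\<bar>a * b\<bar> \<le> a\<^sup>2 + b\<^sup>2" for a b :: real
  proof -
    have "2 * (\<bar>a\<bar> * \<bar>b\<bar>) \<le> a\<^sup>2 + b\<^sup>2"
      using zero_le_power2[of "\<bar>a\<bar> - \<bar>b\<bar>"] unfolding power2_diff by simp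
    moreover have "0 \<le> \<bar>a\<bar> * \<bar>b\<bar>" by simp
    ultimately show ?thesis unfolding abs_mult by linarith
  qed
  then show "AE x in M. norm (u x * v x) \<le> norm ((u x)\<^sup>2 + (v x)\<^sup>2)" by auto
qed measurable

lemma integral_Cauchy_Schwarz:
  fixes u v :: "'b \<Rightarrow> real"
  assumes [measurable]: "u \<in> borel_measurable M" "v \<in> borel_measurable M"
    and u: "integrable M (\<lambda>x. (u x)\<^sup>2)" and v: "integrable M (\<lambda>x. (v x)\<^sup>2)"
  shows "(\<integral>x. u x * v x \<partial>M)\<^sup>2 \<le> (\<integral>x. (u x)\<^sup>2 \<partial>M) * (\<integral>x. (v x)\<^sup>2 \<partial>M)"
proof -
  let ?A = "\<integral>x. (u x)\<^sup>2 \<partial>M" and ?B = "\<integral>x. (v x)\<^sup>2 \<partial>M" and ?D = "\<integral>x. u x * v x \<partial>M"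
  have uv: "integrable M (\<lambda>x. u x * v x)" by (rule integrable_mult_square_integrable) (use u v in auto)
  show ?thesis
  proof (cases "?B = 0")
    case True
    then have "AE x in M. (v x)\<^sup>2 = 0" using v by (subst (asm) integral_nonneg_eq_0_iff_AE) auto
    then have "?D = 0" by (intro integral_eq_zero_AE) auto
    then show ?thesis by (simp add: True)
  next
    case False
    then have B: "?B > 0" by (simp add: less_le)
    let ?t = "?D / ?B"
    have "0 \<le> (\<integral>x. (u x - ?t * v x)\<^sup>2 \<partial>M)" by simp
    also have "\<dots> = (\<integral>x. (u x)\<^sup>2 - 2 * ?t * (u x * v x) + ?t\<^sup>2 * (v x)\<^sup>2 \<partial>M)"
      by (intro Bochner_Integration.integral_cong refl) (simp only: power2_diff power_mult_distrib mult_ac)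
    also have "\<dots> = ?A - 2 * ?t * ?D + ?t\<^sup>2 * ?B" using u v uv by simp
    also have "\<dots> = ?A - ?D\<^sup>2 / ?B" using B by (simp add: power2_eq_square)
    finally show ?thesis using B by (simp add: field_simps)
  qed
qed

subsection \<open>Derivatives along lines\<close>

lemma frechet_derivatives_multilinear:
  assumes "frechet_derivatives f D" "length vs = k" "i < k"
  shows "linear (\<lambda>x. D m (vs[i := x]))"
  using assms unfolding frechet_derivatives_def bounded_multilinear_form_def by blast

lemma frechet_derivatives_line:
  assumes D: "frechet_derivatives f D"
  shows "((\<lambda>t. D (m + t *\<^sub>R h) vs) has_real_derivative D (m + t *\<^sub>R h) (h # vs)) (at t)"
proof (cases "h = 0")
  case True
  have "D m (0 # vs) = 0"
    using linear_0[OF frechet_derivatives_multilinear[OF D, of "0 # vs" "Suc (length vs)" 0 m]] by simp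
  then show ?thesis using True by simp
next
  case False
  let ?m = "m + t *\<^sub>R h" and ?P = "\<Prod>v\<leftarrow>vs. norm v"
  have P: "?P \<ge> 0" by (induction vs) auto
  have scale: "D ?m ((s *\<^sub>R h) # vs) = s * D ?m (h # vs)" for s
    using linear_scale[OF frechet_derivatives_multilinear[OF D, of "0 # vs" "Suc (length vs)" 0 ?m], of s h] by simp
  show ?thesis
    unfolding has_field_derivative_iff tendsto_iff eventually_at
  proof (intro allI impI)
    fix \<epsilon> :: real assume "\<epsilon> > 0"
    \<comment> \<open>The summand 1 keeps the denominator positive when one of the vectors in
      \<open>vs\<close> is 0.\<close>
    define e' where "e' = \<epsilon> / (2 * norm h * (?P + 1))"
    have e': "e' > 0" using \<open>\<epsilon> > 0\<close> False P by (simp add: e'_def)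
    obtain \<delta> where \<delta>: "\<delta> > 0" "\<And>h' ws. norm h' < \<delta> \<Longrightarrow> length ws = length vs \<Longrightarrow>
        \<bar>D (?m + h') ws - D ?m ws - D ?m (h' # ws)\<bar> \<le> e' * norm h' * (\<Prod>v\<leftarrow>ws. norm v)"
      using D e' unfolding frechet_derivatives_def by meson
    show "\<exists>d>0. \<forall>x\<in>UNIV. x \<noteq> t \<and> dist x t < d \<longrightarrow>
        dist ((D (m + x *\<^sub>R h) vs - D ?m vs) / (x - t)) (D ?m (h # vs)) < \<epsilon>"
    proof (intro exI[of _ "\<delta> / norm h"] conjI ballI impI)
      fix x assume x: "x \<noteq> t \<and> dist x t < \<delta> / norm h"
      let ?s = "x - t"
      have "norm (?s *\<^sub>R h) < \<delta>" using x False unfolding norm_scaleR by (simp add: dist_real_def field_simps)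
      from \<delta>(2)[OF this refl]
      have "\<bar>D (?m + ?s *\<^sub>R h) vs - D ?m vs - ?s * D ?m (h # vs)\<bar> \<le> e' * (\<bar>?s\<bar> * norm h) * ?P"
        by (simp add: scale)
      moreover have "?m + ?s *\<^sub>R h = m + x *\<^sub>R h" by (simp add: algebra_simps)
      ultimately have *: "\<bar>D (m + x *\<^sub>R h) vs - D ?m vs - ?s * D ?m (h # vs)\<bar> \<le> \<bar>?s\<bar> * (e' * norm h * ?P)"
        by (simp add: mult_ac)
      have "dist ((D (m + x *\<^sub>R h) vs - D ?m vs) / ?s) (D ?m (h # vs))
          = \<bar>D (m + x *\<^sub>R h) vs - D ?m vs - ?s * D ?m (h # vs)\<bar> / \<bar>?s\<bar>"
        using x by (simp add: dist_real_def abs_divide[symmetric] diff_divide_distrib)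
      also have "\<dots> \<le> e' * norm h * ?P" using * x by (simp add: field_simps)
      also have "\<dots> \<le> e' * norm h * (?P + 1)" using e' by (intro mult_left_mono) auto
      also have "\<dots> = \<epsilon> / 2"
      proof -
        have "?P + 1 \<noteq> 0" using P by linarith
        moreover have "\<epsilon> / (2 * n * p) * n * p = \<epsilon> / 2" if "n \<noteq> 0" "p \<noteq> 0" for n p :: real
          using that by simp
        ultimately show ?thesis unfolding e'_def using False by (metis norm_eq_zero)
      qed
      also have "\<dots> < \<epsilon>" using \<open>\<epsilon> > 0\<close> by simp
      finally show "dist ((D (m + x *\<^sub>R h) vs - D ?m vs) / ?s) (D ?m (h # vs)) < \<epsilon>" .
    qed (use \<delta>(1) False in auto)
  qed
qed

lemma frechet_derivatives_continuous:
  assumes D: "frechet_derivatives f D"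
  shows "continuous_on UNIV (\<lambda>m. D m vs)"
proof -
  have "isCont (\<lambda>m. D m vs) m" for m
  proof -
    let ?P = "\<Prod>v\<leftarrow>vs. norm v"
    have "bounded_multilinear_form (Suc (length vs)) (D m)" using D unfolding frechet_derivatives_def by blast
    then obtain K where K: "\<And>ws. length ws = Suc (length vs) \<Longrightarrow> \<bar>D m ws\<bar> \<le> K * (\<Prod>v\<leftarrow>ws. norm v)"
      unfolding bounded_multilinear_form_def by blast
    obtain \<delta> where \<delta>: "\<delta> > 0" "\<And>h ws. norm h < \<delta> \<Longrightarrow> length ws = length vs \<Longrightarrow>
        \<bar>D (m + h) ws - D m ws - D m (h # ws)\<bar> \<le> 1 * norm h * (\<Prod>v\<leftarrow>ws. norm v)"
      using D unfolding frechet_derivatives_def by (meson zero_less_one)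
    have bd: "norm (D (m + h) vs - D m vs) \<le> norm h * ((\<bar>K\<bar> + 1) * ?P)" if "norm h < \<delta>" for h
    proof -
      have P: "?P \<ge> 0" by (induction vs) auto
      have "\<bar>D m (h # vs)\<bar> \<le> K * (norm h * ?P)" using K[of "h # vs"] by simp
      also have "\<dots> \<le> \<bar>K\<bar> * (norm h * ?P)" using P by (intro mult_right_mono) auto
      finally have "\<bar>D (m + h) vs - D m vs\<bar> \<le> \<bar>K\<bar> * (norm h * ?P) + norm h * ?P"
        using \<delta>(2)[OF that refl] by linarith
      then show ?thesis by (simp add: algebra_simps)
    qed
    have "((\<lambda>h. D (m + h) vs - D m vs) \<longlongrightarrow> 0) (at 0)"
    proof (rule Lim_null_comparison)
      show "\<forall>\<^sub>F h in at 0. norm (D (m + h) vs - D m vs) \<le> norm h * ((\<bar>K\<bar> + 1) * ?P)"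
        unfolding eventually_at using \<delta>(1) bd by (intro exI[of _ \<delta>]) auto
      show "((\<lambda>h. norm h * ((\<bar>K\<bar> + 1) * ?P)) \<longlongrightarrow> 0) (at (0::'a))"
        by (rule tendsto_eq_intros refl | simp)+
    qed
    then have "((\<lambda>h. D (m + h) vs) \<longlongrightarrow> D m vs) (at 0)" by (rule LIM_zero_cancel)
    then show ?thesis by (simp add: isCont_iff)
  qed
  then show ?thesis by (simp add: continuous_at_imp_continuous_on)
qed

subsection \<open>Hermite coefficients\<close>

lemma sqrt_prod: "sqrt (\<Prod>i\<in>A. f i) = (\<Prod>i\<in>A. sqrt (f i))"
  by (induction A rule: infinite_finite_induct) (auto simp: real_sqrt_mult)

text \<open>Collects what the estimate of the Hermite coefficients takes from the posterior; the
  rate of decay of the eigenvalues comes in later.\<close>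

locale gaussian_functional =
  fixes m1 :: "'a::{real_inner, banach, second_countable_topology}"
    and lam1 :: "nat \<Rightarrow> real" and \<psi>1 :: "nat \<Rightarrow> 'a"
    and Q :: "'a \<Rightarrow> real" and DQ :: "'a \<Rightarrow> 'a list \<Rightarrow> real" and C :: real
  assumes basis: "orthonormal_basis \<psi>1"
    and lam_pos: "\<And>j. lam1 j > 0" and lam_summable: "summable lam1"
    and DQ: "frechet_derivatives Q DQ"
    and bound: "\<And>k js. length js = k \<Longrightarrow>
      (\<integral>\<^sup>+ \<xi>. ennreal (\<bar>DQ (kl_expansion m1 lam1 \<psi>1 \<xi>) (map \<psi>1 js)\<bar>\<^sup>2) \<partial>product_gaussian)
        < ennreal (C * fact k)"
begin

abbreviation X :: "(nat \<Rightarrow> real) \<Rightarrow> 'a" where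
  "X \<equiv> kl_expansion m1 lam1 \<psi>1"

definition directional :: "nat list \<Rightarrow> (nat \<Rightarrow> real) \<Rightarrow> real" where
  "directional js \<xi> = DQ (X \<xi>) (map \<psi>1 js)"

text \<open>For these sequences the series of X converges by orthonormality. Elsewhere no value of X
  can be relied on, so pointwise arguments along lines are confined to them.\<close>

definition regular :: "(nat \<Rightarrow> real) \<Rightarrow> bool" where
  "regular \<xi> \<longleftrightarrow> summable (\<lambda>j. lam1 j * (\<xi> j)\<^sup>2)"

lemma directional_Nil: "directional [] \<xi> = Q (X \<xi>)"
  using DQ by (simp add: directional_def frechet_derivatives_def)

lemma C_pos: "C > 0"
proof -
  have "0 < ennreal (C * fact 0)"
    using bound[of "[]" 0] by (metis gr_zeroI list.size(3) not_less_zero)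
  then show ?thesis by simp
qed

lemma measurable_X [measurable]: "X \<in> borel_measurable product_gaussian"
  unfolding kl_expansion_def by measurable

text \<open>Each (\<xi> j)^2 has expectation 1, so the series in question has the finite expectation
  given by the sum of all \<open>lam1 j\<close>.\<close>

lemma AE_regular: "AE \<xi> in product_gaussian. regular \<xi>"
proof -
  have sq: "(\<integral>\<^sup>+ \<xi>. ennreal ((\<xi> j)\<^sup>2) \<partial>product_gaussian) = 1" for j
  proof -
    have i: "integrable std_gaussian (\<lambda>t. t\<^sup>2)" by (rule integrable_power_std_gaussian)
    have "(\<integral>t. t ^ (2 * 1) \<partial>std_gaussian) = 1" unfolding std_gaussian_moment_even by simp
    then have "(\<integral>\<xi>. (\<xi> j)\<^sup>2 \<partial>product_gaussian) = 1" "integrable product_gaussian (\<lambda>\<xi>. (\<xi> j)\<^sup>2)"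
      using product_gaussian_prod[of "{j}" "\<lambda>_ t. t\<^sup>2"] i by auto
    then show ?thesis by (subst nn_integral_eq_integral) auto
  qed
  have "(\<integral>\<^sup>+ \<xi>. (\<Sum>j. ennreal (lam1 j) * ennreal ((\<xi> j)\<^sup>2)) \<partial>product_gaussian)
      = (\<Sum>j. \<integral>\<^sup>+ \<xi>. ennreal (lam1 j) * ennreal ((\<xi> j)\<^sup>2) \<partial>product_gaussian)"
    by (rule nn_integral_suminf) measurable
  also have "\<dots> = (\<Sum>j. ennreal (lam1 j))"
    by (subst nn_integral_cmult) (measurable, simp add: sq)
  also have "\<dots> < \<infinity>"
    using lam_summable lam_pos by (simp add: less_imp_le suminf_ennreal2 less_top[symmetric] ennreal_suminf_neq_top)
  finally have "AE \<xi> in product_gaussian. (\<Sum>j. ennreal (lam1 j) * ennreal ((\<xi> j)\<^sup>2)) \<noteq> \<infinity>"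
    by (intro nn_integral_noteq_infinite) (auto simp: less_top[symmetric])
  then show ?thesis
  proof eventually_elim
    case (elim \<xi>)
    then have "(\<Sum>j. ennreal (lam1 j * (\<xi> j)\<^sup>2)) \<noteq> top"
      using lam_pos by (simp add: ennreal_mult less_imp_le)
    then show ?case unfolding regular_def
      using lam_pos by (intro summable_suminf_not_top) (auto simp: less_imp_le)
  qed
qed

lemma regular_summable:
  assumes "regular \<xi>"
  shows "summable (\<lambda>j. (sqrt (lam1 j) * \<xi> j) *\<^sub>R \<psi>1 j)"
  by (rule summable_orthonormal[OF basis])
    (use assms lam_pos in \<open>simp add: regular_def power_mult_distrib less_imp_le\<close>)

text \<open>A change of one coordinate moves X along a line of direction \<psi>1 j, so Frechet
  derivatives of Q become ordinary derivatives in \<xi> j.\<close>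

lemma X_fun_upd:
  assumes "regular \<xi>"
  shows "X (\<xi>(j := t)) = (X \<xi> - (sqrt (lam1 j) * \<xi> j) *\<^sub>R \<psi>1 j) + t *\<^sub>R (sqrt (lam1 j) *\<^sub>R \<psi>1 j)"
proof -
  let ?a = "\<lambda>\<xi> i. (sqrt (lam1 i) * \<xi> i) *\<^sub>R \<psi>1 i"
  have "(?a \<xi>) sums (\<Sum>i. ?a \<xi> i)" using regular_summable[OF assms] by (rule summable_sums)
  then have "(\<lambda>i. ?a \<xi> i + (if i = j then ?a (\<xi>(j := t)) i - ?a \<xi> i else 0)) sums
      ((\<Sum>i. ?a \<xi> i) + (?a (\<xi>(j := t)) j - ?a \<xi> j))"
    by (intro sums_add sums_single)
  moreover have "(\<lambda>i. ?a \<xi> i + (if i = j then ?a (\<xi>(j := t)) i - ?a \<xi> i else 0)) = ?a (\<xi>(j := t))"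
    by auto
  ultimately have "(\<Sum>i. ?a (\<xi>(j := t)) i) = (\<Sum>i. ?a \<xi> i) + (?a (\<xi>(j := t)) j - ?a \<xi> j)"
    by (simp add: sums_iff)
  then show ?thesis by (simp add: kl_expansion_def algebra_simps)
qed

lemma measurable_directional [measurable]: "directional js \<in> borel_measurable product_gaussian"
  unfolding directional_def
  by (rule measurable_compose[OF measurable_X])
    (rule borel_measurable_continuous_onI[OF frechet_derivatives_continuous[OF DQ]])

lemma integrable_directional_sq: "integrable product_gaussian (\<lambda>\<xi>. (directional js \<xi>)\<^sup>2)"
  and integral_directional_sq: "(\<integral>\<xi>. (directional js \<xi>)\<^sup>2 \<partial>product_gaussian) \<le> C * fact (length js)"
proof -
  have b: "(\<integral>\<^sup>+ \<xi>. ennreal ((directional js \<xi>)\<^sup>2) \<partial>product_gaussian) < ennreal (C * fact (length js))"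
    using bound[of js "length js"] by (simp add: directional_def)
  then show i: "integrable product_gaussian (\<lambda>\<xi>. (directional js \<xi>)\<^sup>2)"
    by (intro integrableI_nonneg) (auto intro: order.strict_trans simp: less_top)
  show "(\<integral>\<xi>. (directional js \<xi>)\<^sup>2 \<partial>product_gaussian) \<le> C * fact (length js)"
    using b C_pos by (subst (asm) nn_integral_eq_integral[OF i]) (auto simp: ennreal_less_iff)
qed

text \<open>The factor sqrt (lam1 j) brought out by each derivative in \<xi> j is the source of the
  powers of the eigenvalues in the coefficient bound.\<close>

lemma directional_has_derivative:
  assumes "regular \<xi>"
  shows "((\<lambda>t. directional js (\<xi>(j := t))) has_real_derivative
      sqrt (lam1 j) * directional (j # js) (\<xi>(j := t))) (at t)"
proof -
  let ?m = "X \<xi> - (sqrt (lam1 j) * \<xi> j) *\<^sub>R \<psi>1 j" and ?h = "sqrt (lam1 j) *\<^sub>R \<psi>1 j"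
  have "DQ (?m + t *\<^sub>R ?h) (?h # map \<psi>1 js) = sqrt (lam1 j) * DQ (?m + t *\<^sub>R ?h) (\<psi>1 j # map \<psi>1 js)"
    using linear_scale[OF frechet_derivatives_multilinear[OF DQ, of "0 # map \<psi>1 js" "Suc (length js)" 0 "?m + t *\<^sub>R ?h"],
        of "sqrt (lam1 j)" "\<psi>1 j"] by simp
  then show ?thesis
    using frechet_derivatives_line[OF DQ, of ?m ?h "map \<psi>1 js" t]
    by (simp only: directional_def X_fun_upd[OF assms] list.map)
qed

lemma integrable_directional_mult:
  assumes [measurable]: "v \<in> borel_measurable product_gaussian" and "integrable product_gaussian (\<lambda>\<xi>. (v \<xi>)\<^sup>2)"
  shows "integrable product_gaussian (\<lambda>\<xi>. directional js \<xi> * v \<xi>)"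
  by (rule integrable_mult_square_integrable) (use integrable_directional_sq assms(2) in auto)

lemma hermite_product_sq:
  "integrable product_gaussian (\<lambda>\<xi>. (\<Prod>i<M. poly (hermite_poly (\<mu> i)) (\<xi> i))\<^sup>2)"
  "(\<integral>\<xi>. (\<Prod>i<M. poly (hermite_poly (\<mu> i)) (\<xi> i))\<^sup>2 \<partial>product_gaussian) = (\<Prod>i<M. fact (\<mu> i))"
proof -
  have i: "integrable std_gaussian (\<lambda>t. (poly (hermite_poly n) t)\<^sup>2)" for n
    using integrable_poly_std_gaussian[of "(hermite_poly n)\<^sup>2"] by simp
  have n: "(\<integral>t. (poly (hermite_poly n) t)\<^sup>2 \<partial>std_gaussian) = fact n" for n
    using hermite_poly_orthogonal[of n n] by (simp add: power2_eq_square)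
  show "integrable product_gaussian (\<lambda>\<xi>. (\<Prod>i<M. poly (hermite_poly (\<mu> i)) (\<xi> i))\<^sup>2)"
    "(\<integral>\<xi>. (\<Prod>i<M. poly (hermite_poly (\<mu> i)) (\<xi> i))\<^sup>2 \<partial>product_gaussian) = (\<Prod>i<M. fact (\<mu> i))"
    using product_gaussian_prod[of "{..<M}" "\<lambda>i t. (poly (hermite_poly (\<mu> i)) t)\<^sup>2"] i
    by (auto simp: prod_power_distrib n)
qed

lemma measurable_hermite_product [measurable]:
  "(\<lambda>\<xi>. \<Prod>i<M. poly (hermite_poly (\<mu> i)) (\<xi> i)) \<in> borel_measurable product_gaussian"
  by measurable

text \<open>Fubini in coordinate j, then Gaussian integration by parts on single lines. Almost every
  line belongs to a regular sequence and carries square integrable restrictions of both derivatives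
  involved, which yields the integrability against all polynomials that the one-dimensional formula
  asks for.\<close>

lemma directional_integration_by_parts:
  assumes j: "j < M" "\<mu> j = Suc n"
  shows "(\<integral>\<xi>. directional js \<xi> * (\<Prod>i<M. poly (hermite_poly (\<mu> i)) (\<xi> i)) \<partial>product_gaussian)
    = sqrt (lam1 j) * (\<integral>\<xi>. directional (j # js) \<xi> * (\<Prod>i<M. poly (hermite_poly ((\<mu>(j := n)) i)) (\<xi> i)) \<partial>product_gaussian)"
proof -
  define P where "P \<xi> = (\<Prod>i\<in>{..<M} - {j}. poly (hermite_poly (\<mu> i)) (\<xi> i))" for \<xi> :: "nat \<Rightarrow> real"
  have P: "P (\<xi>(j := t)) = P \<xi>" for \<xi> t unfolding P_def by (intro prod.cong) auto
  have 1: "(\<Prod>i<M. poly (hermite_poly (\<mu> i)) (\<xi> i)) = poly (hermite_poly (Suc n)) (\<xi> j) * P \<xi>" for \<xi>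
    unfolding P_def using j by (subst prod.remove[of _ j]) auto
  have 2: "(\<Prod>i<M. poly (hermite_poly ((\<mu>(j := n)) i)) (\<xi> i)) = poly (hermite_poly n) (\<xi> j) * P \<xi>" for \<xi>
    unfolding P_def using j by (subst prod.remove[of _ j]) (auto intro!: prod.cong)
  have i1: "integrable product_gaussian (\<lambda>\<xi>. directional js \<xi> * (\<Prod>i<M. poly (hermite_poly (\<mu> i)) (\<xi> i)))" for js \<mu>
    by (rule integrable_directional_mult) (simp_all add: hermite_product_sq)
  have "(\<integral>\<xi>. directional js \<xi> * (\<Prod>i<M. poly (hermite_poly (\<mu> i)) (\<xi> i)) \<partial>product_gaussian)
      = (\<integral>\<xi>. (\<integral>t. directional js (\<xi>(j := t)) * (poly (hermite_poly (Suc n)) t * P \<xi>) \<partial>std_gaussian) \<partial>product_gaussian)"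
    by (subst product_gaussian_fubini(2)[OF i1, of _ _ j]) (simp only: 1 P fun_upd_same)
  also have "\<dots> = (\<integral>\<xi>. (\<integral>t. sqrt (lam1 j) * (directional (j # js) (\<xi>(j := t)) * (poly (hermite_poly n) t * P \<xi>)) \<partial>std_gaussian) \<partial>product_gaussian)"
  proof (rule integral_cong_AE)
    have A: "AE \<xi> in product_gaussian. integrable std_gaussian (\<lambda>t. (directional js (\<xi>(j := t)))\<^sup>2)" for js
      by (rule product_gaussian_fubini(1)[OF integrable_directional_sq])
    show "AE \<xi> in product_gaussian.
        (\<integral>t. directional js (\<xi>(j := t)) * (poly (hermite_poly (Suc n)) t * P \<xi>) \<partial>std_gaussian)
      = (\<integral>t. sqrt (lam1 j) * (directional (j # js) (\<xi>(j := t)) * (poly (hermite_poly n) t * P \<xi>)) \<partial>std_gaussian)"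
      using AE_regular A[of js] A[of "j # js"]
    proof eventually_elim
      case (elim \<xi>)
      let ?g = "\<lambda>t. directional js (\<xi>(j := t))" and ?g' = "\<lambda>t. sqrt (lam1 j) * directional (j # js) (\<xi>(j := t))"
      have cont: "continuous_on UNIV (\<lambda>t. directional ks (\<xi>(j := t)))" for ks
        using directional_has_derivative[OF elim(1)] by (meson DERIV_isCont continuous_at_imp_continuous_on)
      have int: "integrable std_gaussian (\<lambda>t. directional ks (\<xi>(j := t)) * poly q t)"
        if "integrable std_gaussian (\<lambda>t. (directional ks (\<xi>(j := t)))\<^sup>2)" for ks q
        by (rule integrable_mult_square_integrable)
          (use that cont integrable_poly_std_gaussian[of "q\<^sup>2"] in
            \<open>auto intro!: borel_measurable_continuous_onI simp: measurable_cong_sets[OF sets_std_gaussian refl]\<close>)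
      have "(\<integral>t. ?g t * poly ([:0, 1:] * hermite_poly n - pderiv (hermite_poly n)) t \<partial>std_gaussian)
          = (\<integral>t. ?g' t * poly (hermite_poly n) t \<partial>std_gaussian)"
      proof (rule gaussian_integration_by_parts)
        show "(?g has_real_derivative ?g' t) (at t)" for t by (rule directional_has_derivative[OF elim(1)])
        show "continuous_on UNIV ?g'" by (intro continuous_intros cont)
        show "integrable std_gaussian (\<lambda>t. ?g t * poly q t)" for q by (rule int[OF elim(2)])
        show "integrable std_gaussian (\<lambda>t. ?g' t * poly (hermite_poly n) t)"
          using int[OF elim(3)] by (simp add: mult.assoc)
      qed
      then have "(\<integral>t. ?g t * poly (hermite_poly (Suc n)) t \<partial>std_gaussian) * P \<xi>
          = (\<integral>t. ?g' t * poly (hermite_poly n) t \<partial>std_gaussian) * P \<xi>"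
        unfolding hermite_poly_Suc by simp
      then show ?case
        by (simp only: integral_mult_left_zero[symmetric] mult.assoc)
    qed
    have m: "(\<lambda>\<xi>. \<integral>t. G (\<xi>(j := t)) \<partial>std_gaussian) \<in> borel_measurable product_gaussian"
      if [measurable]: "G \<in> borel_measurable product_gaussian" for G :: "(nat \<Rightarrow> real) \<Rightarrow> real"
    proof (rule std.borel_measurable_lebesgue_integral)
      have "(\<lambda>(t, \<xi>). G (\<xi>(j := t))) \<in> borel_measurable (std_gaussian \<Otimes>\<^sub>M product_gaussian)"
        using measurable_compose[OF measurable_fun_upd_pair[of j] that] by (simp add: case_prod_beta)
      then show "(\<lambda>(\<xi>, t). G (\<xi>(j := t))) \<in> borel_measurable (product_gaussian \<Otimes>\<^sub>M std_gaussian)"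
        by (subst measurable_pair_swap_iff) (simp add: case_prod_beta)
    qed
    have mP: "P \<in> borel_measurable product_gaussian" unfolding P_def by measurable
    note [measurable] = mP
    show "(\<lambda>\<xi>. \<integral>t. directional js (\<xi>(j := t)) * (poly (hermite_poly (Suc n)) t * P \<xi>) \<partial>std_gaussian) \<in> borel_measurable product_gaussian"
      using m[of "\<lambda>\<xi>. directional js \<xi> * (poly (hermite_poly (Suc n)) (\<xi> j) * P \<xi>)"] by (simp add: P)
    show "(\<lambda>\<xi>. \<integral>t. sqrt (lam1 j) * (directional (j # js) (\<xi>(j := t)) * (poly (hermite_poly n) t * P \<xi>)) \<partial>std_gaussian) \<in> borel_measurable product_gaussian"
      using m[of "\<lambda>\<xi>. sqrt (lam1 j) * (directional (j # js) \<xi> * (poly (hermite_poly n) (\<xi> j) * P \<xi>))"] by (simp add: P)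
  qed
  also have "\<dots> = sqrt (lam1 j) * (\<integral>\<xi>. (\<integral>t. directional (j # js) (\<xi>(j := t)) * (poly (hermite_poly n) t * P \<xi>) \<partial>std_gaussian) \<partial>product_gaussian)"
    by simp
  also have "\<dots> = sqrt (lam1 j) * (\<integral>\<xi>. directional (j # js) \<xi> * (\<Prod>i<M. poly (hermite_poly ((\<mu>(j := n)) i)) (\<xi> i)) \<partial>product_gaussian)"
    by (subst product_gaussian_fubini(2)[OF i1, of _ _ j]) (simp only: 2 P fun_upd_same)
  finally show ?thesis .
qed

text \<open>Each integration by parts lowers \<mu> j and \<kappa> j by one and adds j to the list of
  directions, at the price of one factor \<open>lam1 j\<close> in the square. When \<kappa> is used
  up, Cauchy-Schwarz pairs the derivative bound with the remaining Hermite product, whose squared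
  norm is the factorial of what is left of \<mu>. This is why the statement is about arbitrary lists
  of directions.\<close>

lemma directional_hermite_bound:
  assumes "\<And>j. \<kappa> j \<le> \<mu> j"
  shows "(\<integral>\<xi>. directional js \<xi> * (\<Prod>i<M. poly (hermite_poly (\<mu> i)) (\<xi> i)) \<partial>product_gaussian)\<^sup>2
    \<le> C * fact (length js + (\<Sum>j<M. \<kappa> j)) * (\<Prod>j<M. lam1 j ^ \<kappa> j * fact (\<mu> j - \<kappa> j))"
  using assms
proof (induction "\<Sum>j<M. \<kappa> j" arbitrary: js \<mu> \<kappa>)
  case 0
  then have k: "\<And>j. j < M \<Longrightarrow> \<kappa> j = 0" by simp
  have "(\<integral>\<xi>. directional js \<xi> * (\<Prod>i<M. poly (hermite_poly (\<mu> i)) (\<xi> i)) \<partial>product_gaussian)\<^sup>2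
      \<le> (\<integral>\<xi>. (directional js \<xi>)\<^sup>2 \<partial>product_gaussian) * (\<Prod>i<M. fact (\<mu> i))"
    using integral_Cauchy_Schwarz[OF measurable_directional measurable_hermite_product[where M = M and \<mu> = \<mu>]
        integrable_directional_sq[of js] hermite_product_sq(1)]
    by (simp add: hermite_product_sq(2))
  also have "\<dots> \<le> C * fact (length js) * (\<Prod>i<M. fact (\<mu> i))"
    by (intro mult_right_mono integral_directional_sq prod_nonneg) auto
  finally show ?case using 0 k by simp
next
  case (Suc n)
  then obtain j where j: "j < M" "\<kappa> j > 0"
    by (metis (no_types, lifting) Suc_neq_Zero lessThan_iff neq0_conv sum.neutral)
  let ?\<kappa> = "\<kappa>(j := \<kappa> j - 1)" and ?\<mu> = "\<mu>(j := \<mu> j - 1)"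
  have mj: "\<mu> j = Suc (\<mu> j - 1)" using j Suc.prems[of j] by simp
  have s: "(\<Sum>i<M. \<kappa> i) = Suc (\<Sum>i<M. ?\<kappa> i)"
  proof -
    have "(\<Sum>i<M. \<kappa> i) = \<kappa> j + (\<Sum>i\<in>{..<M} - {j}. \<kappa> i)" using j by (subst sum.remove[of _ j]) auto
    moreover have "(\<Sum>i<M. ?\<kappa> i) = (\<kappa> j - 1) + (\<Sum>i\<in>{..<M} - {j}. \<kappa> i)"
      using j by (subst sum.remove[of _ j]) auto
    ultimately show ?thesis using j by simp
  qed
  have p: "lam1 j * (\<Prod>i<M. lam1 i ^ ?\<kappa> i * fact (?\<mu> i - ?\<kappa> i)) = (\<Prod>i<M. lam1 i ^ \<kappa> i * fact (\<mu> i - \<kappa> i))"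
  proof -
    have "(\<Prod>i<M. lam1 i ^ ?\<kappa> i * fact (?\<mu> i - ?\<kappa> i))
        = (lam1 j ^ (\<kappa> j - 1) * fact (\<mu> j - \<kappa> j)) * (\<Prod>i\<in>{..<M} - {j}. lam1 i ^ \<kappa> i * fact (\<mu> i - \<kappa> i))"
      using j by (subst prod.remove[of _ j]) auto
    moreover have "(\<Prod>i<M. lam1 i ^ \<kappa> i * fact (\<mu> i - \<kappa> i))
        = (lam1 j ^ \<kappa> j * fact (\<mu> j - \<kappa> j)) * (\<Prod>i\<in>{..<M} - {j}. lam1 i ^ \<kappa> i * fact (\<mu> i - \<kappa> i))"
      using j by (subst prod.remove[of _ j]) auto
    moreover have "lam1 j ^ \<kappa> j = lam1 j * lam1 j ^ (\<kappa> j - 1)" using j by (metis power_eq_if neq0_conv)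
    ultimately show ?thesis by (simp add: mult_ac)
  qed
  have le: "?\<kappa> i \<le> ?\<mu> i" for i using Suc.prems[of i] by auto
  have "n = (\<Sum>i<M. ?\<kappa> i)" using Suc(2) s by simp
  from Suc.hyps(1)[OF this le, of "j # js"]
  have IH: "(\<integral>\<xi>. directional (j # js) \<xi> * (\<Prod>i<M. poly (hermite_poly (?\<mu> i)) (\<xi> i)) \<partial>product_gaussian)\<^sup>2
      \<le> C * fact (length js + (\<Sum>i<M. \<kappa> i)) * (\<Prod>i<M. lam1 i ^ ?\<kappa> i * fact (?\<mu> i - ?\<kappa> i))"
    by (simp only: s list.size add_Suc add_Suc_right add_0_right)
  have "(\<integral>\<xi>. directional js \<xi> * (\<Prod>i<M. poly (hermite_poly (\<mu> i)) (\<xi> i)) \<partial>product_gaussian)\<^sup>2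
      = lam1 j * (\<integral>\<xi>. directional (j # js) \<xi> * (\<Prod>i<M. poly (hermite_poly (?\<mu> i)) (\<xi> i)) \<partial>product_gaussian)\<^sup>2"
    unfolding directional_integration_by_parts[where \<mu> = \<mu> and M = M, OF j(1) mj] power_mult_distrib
    using lam_pos[of j] by (simp add: less_imp_le)
  also have "\<dots> \<le> lam1 j * (C * fact (length js + (\<Sum>i<M. \<kappa> i)) * (\<Prod>i<M. lam1 i ^ ?\<kappa> i * fact (?\<mu> i - ?\<kappa> i)))"
    by (intro mult_left_mono IH less_imp_le[OF lam_pos])
  also have "\<dots> = C * fact (length js + (\<Sum>i<M. \<kappa> i)) * (\<Prod>i<M. lam1 i ^ \<kappa> i * fact (\<mu> i - \<kappa> i))"
    unfolding p[symmetric] by (simp only: mult_ac)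
  finally show ?case .
qed

definition hermite_coeff :: "(nat \<Rightarrow> nat) \<Rightarrow> real" where
  "hermite_coeff \<mu> = (\<integral>\<xi>. Q (X \<xi>) * multi_prod (\<lambda>j m. hermite_fun m (\<xi> j)) \<mu> \<partial>product_gaussian)"

lemma hermite_coeff_bound:
  assumes M: "\<And>j. j \<ge> M \<Longrightarrow> \<mu> j = 0" and \<kappa>: "\<And>j. \<kappa> j \<le> \<mu> j"
  shows "\<bar>hermite_coeff \<mu>\<bar>\<^sup>2 \<le> C * fact (\<Sum>j<M. \<kappa> j) * (\<Prod>j<M. lam1 j ^ \<kappa> j * fact (\<mu> j - \<kappa> j) / fact (\<mu> j))"
proof -
  let ?F = "\<Prod>j<M. fact (\<mu> j) :: real"
  let ?I = "\<integral>\<xi>. directional [] \<xi> * (\<Prod>i<M. poly (hermite_poly (\<mu> i)) (\<xi> i)) \<partial>product_gaussian"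
  have Fp: "?F > 0" by (intro prod_pos) auto
  have "multi_prod (\<lambda>j m. hermite_fun m (\<xi> j)) \<mu> = (\<Prod>j<M. poly (hermite_poly (\<mu> j)) (\<xi> j)) / sqrt ?F" for \<xi> :: "nat \<Rightarrow> real"
    by (subst multi_prod_eq[of M]) (auto simp: M hermite_fun_def prod_dividef sqrt_prod)
  then have "hermite_coeff \<mu> = ?I / sqrt ?F"
    by (simp add: hermite_coeff_def directional_Nil)
  then have "\<bar>hermite_coeff \<mu>\<bar>\<^sup>2 = ?I\<^sup>2 / ?F" using Fp by (simp add: power_divide less_imp_le)
  also have "\<dots> \<le> C * fact (\<Sum>j<M. \<kappa> j) * (\<Prod>j<M. lam1 j ^ \<kappa> j * fact (\<mu> j - \<kappa> j)) / ?F"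
    using directional_hermite_bound[of \<kappa> \<mu> "[]" M, OF \<kappa>] Fp by (intro divide_right_mono) auto
  finally show ?thesis by (simp add: prod_dividef)
qed

end

subsection \<open>Completeness of the Hermite functions on the line\<close>

lemma integrable_exp_square_quarter_poly: "integrable std_gaussian (\<lambda>x. exp (x\<^sup>2 / 4) * poly q x)"
proof -
  have eq: "std_normal_density x * exp (x\<^sup>2 / 4) = sqrt 2 * normal_density 0 (sqrt 2) x" for x
    by (simp add: normal_density_def std_normal_density_def real_sqrt_mult exp_add[symmetric] field_simps)
  have k: "integrable std_gaussian (\<lambda>x. exp (x\<^sup>2 / 4) * x ^ k)" for k
  proof -
    have "integrable lborel (\<lambda>x. sqrt 2 * (normal_density 0 (sqrt 2) x * x ^ k))"
      using integrable_normal_moment[of "sqrt 2" 0 k] by simp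
    then show ?thesis by (subst integrable_std_gaussian_iff) (auto simp: eq mult.assoc[symmetric])
  qed
  have "exp (x\<^sup>2 / 4) * poly q x = (\<Sum>i\<le>degree q. coeff q i * (exp (x\<^sup>2 / 4) * x ^ i))" for x
    by (simp add: poly_altdef sum_distrib_left mult_ac)
  then show ?thesis using k by simp
qed

lemma integrable_bounded_poly_sq:
  assumes [measurable]: "g \<in> borel_measurable borel" and B: "\<And>x. \<bar>g x\<bar> \<le> B"
  shows "integrable std_gaussian (\<lambda>x. ((g x - poly p x) * poly w x)\<^sup>2)"
proof (rule Bochner_Integration.integrable_bound)
  show "integrable std_gaussian (\<lambda>x. poly (smult (2 * B\<^sup>2) (w\<^sup>2) + smult 2 (p\<^sup>2 * w\<^sup>2)) x)"
    by (rule integrable_poly_std_gaussian)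
  have "((g x - poly p x) * poly w x)\<^sup>2 \<le> poly (smult (2 * B\<^sup>2) (w\<^sup>2) + smult 2 (p\<^sup>2 * w\<^sup>2)) x" for x
  proof -
    have "(g x - poly p x)\<^sup>2 \<le> 2 * (g x)\<^sup>2 + 2 * (poly p x)\<^sup>2"
      using zero_le_power2[of "g x + poly p x"] unfolding power2_sum power2_diff by linarith
    also have "(g x)\<^sup>2 \<le> B\<^sup>2" using B[of x] by (simp add: abs_le_square_iff[symmetric])
    finally have "(g x - poly p x)\<^sup>2 * (poly w x)\<^sup>2 \<le> (2 * B\<^sup>2 + 2 * (poly p x)\<^sup>2) * (poly w x)\<^sup>2"
      by (intro mult_right_mono) auto
    moreover have "poly (smult (2 * B\<^sup>2) (w\<^sup>2) + smult 2 (p\<^sup>2 * w\<^sup>2)) x = (2 * B\<^sup>2 + 2 * (poly p x)\<^sup>2) * (poly w x)\<^sup>2"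
      by (simp add: algebra_simps)
    ultimately show ?thesis by (simp only: power_mult_distrib)
  qed
  then show "AE x in std_gaussian. norm (((g x - poly p x) * poly w x)\<^sup>2)
      \<le> norm (poly (smult (2 * B\<^sup>2) (w\<^sup>2) + smult 2 (p\<^sup>2 * w\<^sup>2)) x)"
    by (intro AE_I2) (smt (verit) norm_ge_zero real_norm_def zero_le_power2)
qed measurable

text \<open>The weights \<open>w\<close> make this class of functions closed under products.\<close>

definition weighted_approximable :: "(real \<Rightarrow> real) \<Rightarrow> bool" where
  "weighted_approximable g \<longleftrightarrow> g \<in> borel_measurable borel \<and> (\<exists>B. \<forall>x. \<bar>g x\<bar> \<le> B) \<and>
     (\<forall>w \<epsilon>. \<epsilon> > 0 \<longrightarrow> (\<exists>p. (\<integral>x. ((g x - poly p x) * poly w x)\<^sup>2 \<partial>std_gaussian) < \<epsilon>))"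

lemma weighted_approximable_const: "weighted_approximable (\<lambda>x. c)"
  unfolding weighted_approximable_def
proof (intro conjI allI impI)
  fix w and \<epsilon> :: real assume "\<epsilon> > 0"
  then show "\<exists>p. (\<integral>x. ((c - poly p x) * poly w x)\<^sup>2 \<partial>std_gaussian) < \<epsilon>"
    by (intro exI[of _ "[:c:]"]) simp
qed auto

lemma integral_sq_add_le:
  fixes u v :: "real \<Rightarrow> real"
  assumes uv: "\<And>x. f x = u x + v x"
    and u: "integrable std_gaussian (\<lambda>x. (u x)\<^sup>2)" and v: "integrable std_gaussian (\<lambda>x. (v x)\<^sup>2)"
  shows "(\<integral>x. (f x)\<^sup>2 \<partial>std_gaussian) \<le> 2 * (\<integral>x. (u x)\<^sup>2 \<partial>std_gaussian) + 2 * (\<integral>x. (v x)\<^sup>2 \<partial>std_gaussian)"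
proof -
  have le: "(f x)\<^sup>2 \<le> 2 * (u x)\<^sup>2 + 2 * (v x)\<^sup>2" for x
    using zero_le_power2[of "u x - v x"] unfolding uv power2_sum power2_diff by linarith
  have "(\<integral>x. (f x)\<^sup>2 \<partial>std_gaussian) \<le> (\<integral>x. 2 * (u x)\<^sup>2 + 2 * (v x)\<^sup>2 \<partial>std_gaussian)"
    using u v le by (intro integral_mono') auto
  then show ?thesis using u v by simp
qed

lemma weighted_approximable_add:
  assumes f: "weighted_approximable f" and g: "weighted_approximable g"
  shows "weighted_approximable (\<lambda>x. f x + g x)"
  unfolding weighted_approximable_def
proof (intro conjI allI impI)
  obtain A B where A: "\<And>x. \<bar>f x\<bar> \<le> A" and B: "\<And>x. \<bar>g x\<bar> \<le> B"
    using f g unfolding weighted_approximable_def by blast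
  have m [measurable]: "f \<in> borel_measurable borel" "g \<in> borel_measurable borel"
    using f g by (auto simp: weighted_approximable_def)
  show "(\<lambda>x. f x + g x) \<in> borel_measurable borel" by measurable
  show "\<exists>B. \<forall>x. \<bar>f x + g x\<bar> \<le> B"
    using A B by (intro exI[of _ "A + B"]) (meson abs_triangle_ineq add_mono order.trans)
  fix w and \<epsilon> :: real assume "\<epsilon> > 0"
  then have "\<epsilon> / 4 > 0" by simp
  then obtain p q where p: "(\<integral>x. ((f x - poly p x) * poly w x)\<^sup>2 \<partial>std_gaussian) < \<epsilon> / 4"
    and q: "(\<integral>x. ((g x - poly q x) * poly w x)\<^sup>2 \<partial>std_gaussian) < \<epsilon> / 4"
    using f g unfolding weighted_approximable_def by meson
  have "(\<integral>x. ((f x + g x - poly (p + q) x) * poly w x)\<^sup>2 \<partial>std_gaussian)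
      \<le> 2 * (\<integral>x. ((f x - poly p x) * poly w x)\<^sup>2 \<partial>std_gaussian) + 2 * (\<integral>x. ((g x - poly q x) * poly w x)\<^sup>2 \<partial>std_gaussian)"
    by (rule integral_sq_add_le)
      (use integrable_bounded_poly_sq[OF m(1) A] integrable_bounded_poly_sq[OF m(2) B] in \<open>auto simp: algebra_simps\<close>)
  also have "\<dots> < \<epsilon>" using p q by simp
  finally show "\<exists>p. (\<integral>x. ((f x + g x - poly p x) * poly w x)\<^sup>2 \<partial>std_gaussian) < \<epsilon>" by blast
qed

text \<open>f g - p q = f (g - q) + (f - p) q. First g is approximated with the weight scaled by a
  bound for f; then q is fixed, and f is approximated with the weight q w. The second choice is
  where arbitrary polynomial weights are essential.\<close>

lemma weighted_approximable_mult:
  assumes f: "weighted_approximable f" and g: "weighted_approximable g"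
  shows "weighted_approximable (\<lambda>x. f x * g x)"
  unfolding weighted_approximable_def
proof (intro conjI allI impI)
  obtain A B where A: "\<And>x. \<bar>f x\<bar> \<le> A" and B: "\<And>x. \<bar>g x\<bar> \<le> B"
    using f g unfolding weighted_approximable_def by blast
  have m [measurable]: "f \<in> borel_measurable borel" "g \<in> borel_measurable borel"
    using f g by (auto simp: weighted_approximable_def)
  show "(\<lambda>x. f x * g x) \<in> borel_measurable borel" by measurable
  show "\<exists>B. \<forall>x. \<bar>f x * g x\<bar> \<le> B"
    using A B by (intro exI[of _ "A * B"]) (auto simp: abs_mult intro!: mult_mono order.trans[OF abs_ge_zero A])
  fix w and \<epsilon> :: real assume "\<epsilon> > 0"
  then have e: "\<epsilon> / 4 > 0" by simp
  then obtain q where q: "(\<integral>x. ((g x - poly q x) * poly (smult A w) x)\<^sup>2 \<partial>std_gaussian) < \<epsilon> / 4"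
    using g unfolding weighted_approximable_def by meson
  obtain p where p: "(\<integral>x. ((f x - poly p x) * poly (q * w) x)\<^sup>2 \<partial>std_gaussian) < \<epsilon> / 4"
    using f e unfolding weighted_approximable_def by meson
  have i1: "integrable std_gaussian (\<lambda>x. ((g x - poly q x) * poly (smult A w) x)\<^sup>2)"
    by (rule integrable_bounded_poly_sq[OF m(2) B])
  have le: "(f x * ((g x - poly q x) * poly w x))\<^sup>2 \<le> ((g x - poly q x) * poly (smult A w) x)\<^sup>2" for x
  proof -
    have "(f x)\<^sup>2 \<le> A\<^sup>2" using A[of x] by (simp add: abs_le_square_iff[symmetric])
    then have "(f x)\<^sup>2 * ((g x - poly q x) * poly w x)\<^sup>2 \<le> A\<^sup>2 * ((g x - poly q x) * poly w x)\<^sup>2"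
      by (rule mult_right_mono) simp
    then show ?thesis by (simp add: power_mult_distrib mult_ac)
  qed
  have i2: "integrable std_gaussian (\<lambda>x. (f x * ((g x - poly q x) * poly w x))\<^sup>2)"
    by (rule Bochner_Integration.integrable_bound[OF i1]) (use le in \<open>auto intro!: AE_I2\<close>)
  have i3: "integrable std_gaussian (\<lambda>x. ((f x - poly p x) * poly (q * w) x)\<^sup>2)"
    by (rule integrable_bounded_poly_sq[OF m(1) A])
  have "(\<integral>x. ((f x * g x - poly (p * q) x) * poly w x)\<^sup>2 \<partial>std_gaussian)
      \<le> 2 * (\<integral>x. (f x * ((g x - poly q x) * poly w x))\<^sup>2 \<partial>std_gaussian) + 2 * (\<integral>x. ((f x - poly p x) * poly (q * w) x)\<^sup>2 \<partial>std_gaussian)"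
    by (rule integral_sq_add_le[OF _ i2 i3]) (simp add: algebra_simps)
  also have "(\<integral>x. (f x * ((g x - poly q x) * poly w x))\<^sup>2 \<partial>std_gaussian) \<le> (\<integral>x. ((g x - poly q x) * poly (smult A w) x)\<^sup>2 \<partial>std_gaussian)"
    by (rule integral_mono[OF i2 i1 le])
  finally have "(\<integral>x. ((f x * g x - poly (p * q) x) * poly w x)\<^sup>2 \<partial>std_gaussian) < \<epsilon>" using p q by simp
  then show "\<exists>p. (\<integral>x. ((f x * g x - poly p x) * poly w x)\<^sup>2 \<partial>std_gaussian) < \<epsilon>" by blast
qed

text \<open>Taylor polynomials converge pointwise, and their squared weighted error is dominated by
  a multiple of exp (x^2 / 4) times a polynomial, which is integrable for the Gaussian
  measure.\<close>

lemma weighted_approximable_sin: "weighted_approximable (\<lambda>x. sin (b * x))"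
  unfolding weighted_approximable_def
proof (intro conjI allI impI)
  show "\<exists>B. \<forall>x. \<bar>sin (b * x)\<bar> \<le> B" by (intro exI[of _ 1]) simp
  fix w and \<epsilon> :: real assume "\<epsilon> > 0"
  define T where "T n = (\<Sum>k<n. monom (sin_coeff k * b ^ k) k)" for n
  have T: "poly (T n) x = (\<Sum>k<n. sin_coeff k * (b * x) ^ k)" for n x
    by (simp add: T_def poly_sum poly_monom power_mult_distrib mult_ac)
  have bd: "((sin (b * x) - poly (T n) x) * poly w x)\<^sup>2 \<le> 4 * exp (4 * b\<^sup>2) * (exp (x\<^sup>2 / 4) * poly (w\<^sup>2) x)" for n x
  proof -
    have "\<bar>poly (T n) x\<bar> \<le> (\<Sum>k<n. \<bar>b * x\<bar> ^ k /\<^sub>R fact k)"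
      unfolding T by (rule order.trans[OF sum_abs])
        (auto intro!: sum_mono simp: abs_mult power_abs sin_coeff_def divide_inverse mult_ac)
    also have "\<dots> \<le> exp \<bar>b * x\<bar>"
      unfolding exp_def by (intro sum_le_suminf summable_exp_generic) auto
    finally have "\<bar>sin (b * x) - poly (T n) x\<bar> \<le> 1 + exp \<bar>b * x\<bar>"
      using abs_sin_le_one[of "b * x"] by linarith
    also have "\<dots> \<le> 2 * exp \<bar>b * x\<bar>" by simp
    finally have "(sin (b * x) - poly (T n) x)\<^sup>2 \<le> (2 * exp \<bar>b * x\<bar>)\<^sup>2"
      by (rule power2_le_iff_abs_le[THEN iffD2, rotated]) simp
    also have "\<dots> = 4 * exp (2 * \<bar>b * x\<bar>)" by (simp add: power_mult_distrib exp_double)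
    \<comment> \<open>Completing the square trades the linear exponent for x^2 / 4, the largest
      growth for which integrability has been prepared.\<close>
    also have "2 * \<bar>b * x\<bar> \<le> 4 * b\<^sup>2 + x\<^sup>2 / 4"
    proof -
      have "0 \<le> (2 * \<bar>b\<bar> - \<bar>x\<bar> / 2)\<^sup>2" by simp
      then show ?thesis by (simp add: power2_diff abs_mult power_divide)
    qed
    finally have "(sin (b * x) - poly (T n) x)\<^sup>2 \<le> 4 * exp (4 * b\<^sup>2) * exp (x\<^sup>2 / 4)"
      by (simp add: exp_add)
    then have "(sin (b * x) - poly (T n) x)\<^sup>2 * (poly w x)\<^sup>2 \<le> 4 * exp (4 * b\<^sup>2) * exp (x\<^sup>2 / 4) * (poly w x)\<^sup>2"
      by (rule mult_right_mono) simp
    then show ?thesis by (simp add: power_mult_distrib mult_ac)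
  qed
  have "(\<lambda>n. \<integral>x. ((sin (b * x) - poly (T n) x) * poly w x)\<^sup>2 \<partial>std_gaussian) \<longlonglongrightarrow> (\<integral>x. 0 \<partial>std_gaussian)"
  proof (rule integral_dominated_convergence)
    show "integrable std_gaussian (\<lambda>x. 4 * exp (4 * b\<^sup>2) * (exp (x\<^sup>2 / 4) * poly (w\<^sup>2) x))"
      by (intro Bochner_Integration.integrable_mult_right integrable_exp_square_quarter_poly)
    show "AE x in std_gaussian. (\<lambda>n. ((sin (b * x) - poly (T n) x) * poly w x)\<^sup>2) \<longlonglongrightarrow> 0"
    proof (intro AE_I2)
      fix x
      have "(\<lambda>n. poly (T n) x) \<longlonglongrightarrow> sin (b * x)"
        using sin_converges[of "b * x"] unfolding T sums_def by (simp add: scaleR_conv_of_real)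
      then have "(\<lambda>n. ((sin (b * x) - poly (T n) x) * poly w x)\<^sup>2) \<longlonglongrightarrow> ((sin (b * x) - sin (b * x)) * poly w x)\<^sup>2"
        by (intro tendsto_intros)
      then show "(\<lambda>n. ((sin (b * x) - poly (T n) x) * poly w x)\<^sup>2) \<longlonglongrightarrow> 0" by simp
    qed
    show "AE x in std_gaussian. norm (((sin (b * x) - poly (T n) x) * poly w x)\<^sup>2)
        \<le> 4 * exp (4 * b\<^sup>2) * (exp (x\<^sup>2 / 4) * poly (w\<^sup>2) x)" for n
      using bd by (intro AE_I2) simp
  qed measurable
  then have "\<forall>\<^sub>F n in sequentially. (\<integral>x. ((sin (b * x) - poly (T n) x) * poly w x)\<^sup>2 \<partial>std_gaussian) < \<epsilon>"
    using \<open>\<epsilon> > 0\<close> by (intro order_tendstoD) auto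
  then show "\<exists>p. (\<integral>x. ((sin (b * x) - poly p x) * poly w x)\<^sup>2 \<partial>std_gaussian) < \<epsilon>"
    by (auto simp: eventually_at_top_linorder)
qed measurable

lemma weighted_approximable_polynomial_sin:
  "real_polynomial_function g \<Longrightarrow> weighted_approximable (\<lambda>x. g (sin (b * x)))"
proof (induction rule: real_polynomial_function.induct)
  case (linear f)
  then have "f = (\<lambda>x. f 1 * x)"
    by (intro ext) (metis linear_simps(5) mult.commute mult.right_neutral real_scaleR_def)
  then show ?case
    using weighted_approximable_mult[OF weighted_approximable_const[of "f 1"] weighted_approximable_sin[of b]]
    by metis
qed (auto intro: weighted_approximable_const weighted_approximable_add weighted_approximable_mult)

text \<open>A function supported in \<open>[-R, R]\<close> is approximated by a polynomial in \<open>sin (b x)\<close> with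
  \<open>b = \<pi> / (2 R)\<close>: on \<open>[-R, R]\<close> one can recover \<open>x\<close> by the arcus sine, and outside the approximant
  stays bounded.\<close>

lemma compact_support_approximable:
  fixes \<rho> :: "real \<Rightarrow> real"
  assumes cont: "continuous_on UNIV \<rho>" and bd: "\<And>x. \<bar>\<rho> x\<bar> \<le> 1"
    and supp: "\<And>x. \<bar>x\<bar> \<ge> L \<Longrightarrow> \<rho> x = 0" and \<epsilon>: "\<epsilon> > 0"
  shows "\<exists>p. (\<integral>x. (\<rho> x - poly p x)\<^sup>2 \<partial>std_gaussian) < \<epsilon>"
proof -
  have m [measurable]: "\<rho> \<in> borel_measurable borel" using cont by (rule borel_measurable_continuous_onI)
  define \<eta> where "\<eta> = min 1 (\<epsilon> / 16)"
  have \<eta>: "\<eta> > 0" "\<eta> \<le> 1" "\<eta> \<le> \<epsilon> / 16" using \<epsilon> by (auto simp: \<eta>_def)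
  \<comment> \<open>R \<ge> 144 / \<epsilon> and R \<ge> 1 give 9 / R^2 \<le> \<epsilon> / 16.
    Outside [-R, R] the error is at most 3, and there 3^2 \<le> 9 x^2 / R^2, a function whose
    Gaussian integral is 9 / R^2.\<close>
  define R where "R = max (max L 1) (144 / \<epsilon>)"
  have R: "R \<ge> L" "R \<ge> 1" "R \<ge> 144 / \<epsilon>" by (auto simp: R_def)
  have R9: "9 / R\<^sup>2 \<le> \<epsilon> / 16"
  proof -
    have "144 \<le> \<epsilon> * R" using R(3) \<epsilon> by (simp add: field_simps)
    also have "\<dots> \<le> \<epsilon> * R\<^sup>2" using R(2) \<epsilon> by (intro mult_left_mono) (simp_all add: power2_eq_square)
    finally show ?thesis using R(2) by (simp add: field_simps)
  qed
  define b where "b = pi / (2 * R)"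
  have b: "b > 0" using R by (simp add: b_def)
  have "continuous_on {-1..1} (\<lambda>u. \<rho> (arcsin u / b))"
    by (rule continuous_on_compose2[OF cont]) (use b in \<open>auto intro!: continuous_intros\<close>)
  then obtain g where g: "real_polynomial_function g" "\<And>u. u \<in> {-1..1} \<Longrightarrow> \<bar>\<rho> (arcsin u / b) - g u\<bar> < \<eta>"
    using Stone_Weierstrass_real_polynomial_function[of "{-1..1}" "\<lambda>u. \<rho> (arcsin u / b)" \<eta>] \<eta> by auto
  define G where "G x = g (sin (b * x))" for x
  have wG: "weighted_approximable G"
    unfolding G_def[abs_def] by (rule weighted_approximable_polynomial_sin[OF g(1)])
  then have [measurable]: "G \<in> borel_measurable borel" and "\<exists>B. \<forall>x. \<bar>G x\<bar> \<le> B"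
    by (auto simp: weighted_approximable_def)
  then obtain B where B: "\<And>x. \<bar>G x\<bar> \<le> B" by blast
  have le: "(\<rho> x - G x)\<^sup>2 \<le> \<eta> + 9 / R\<^sup>2 * x\<^sup>2" for x
  proof -
    have u: "sin (b * x) \<in> {-1..1}" by simp
    show ?thesis
    proof (cases "\<bar>x\<bar> \<le> R")
      case True
      have "\<bar>b * x\<bar> \<le> pi / 2" using True R b by (simp add: abs_mult b_def field_simps)
      then have "arcsin (sin (b * x)) = b * x" by (intro arcsin_sin) (auto simp: abs_le_iff)
      then have "\<bar>\<rho> x - G x\<bar> < \<eta>" using g(2)[OF u] b by (simp add: G_def)
      then have "(\<rho> x - G x)\<^sup>2 \<le> \<eta>\<^sup>2" by (simp add: abs_le_square_iff[symmetric])
      also have "\<dots> \<le> \<eta>" using \<eta> by (simp add: power2_eq_square mult_left_le)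
      finally show ?thesis by (simp add: add_increasing2)
    next
      case False
      then have "\<rho> x = 0" using supp[of x] R by simp
      moreover have "\<bar>G x\<bar> \<le> 2" using g(2)[OF u] bd[of "arcsin (sin (b * x)) / b"] \<eta> by (simp add: G_def)
      ultimately have "\<bar>\<rho> x - G x\<bar> \<le> \<bar>3::real\<bar>" by simp
      then have "(\<rho> x - G x)\<^sup>2 \<le> 3\<^sup>2" by (simp only: abs_le_square_iff)
      also have "3\<^sup>2 \<le> 9 / R\<^sup>2 * x\<^sup>2"
      proof -
        have "R\<^sup>2 \<le> x\<^sup>2" using False R by (simp add: abs_le_square_iff[symmetric])
        then show ?thesis using R by (simp add: field_simps)
      qed
      finally show ?thesis using \<eta> by simp
    qed
  qed
  have x2: "integrable std_gaussian (\<lambda>x. x\<^sup>2)" "(\<integral>x. x\<^sup>2 \<partial>std_gaussian) = 1"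
    using integrable_power_std_gaussian[of 2] std_gaussian_moment_even[of 1] by auto
  have i0: "integrable std_gaussian (\<lambda>x. \<eta> + 9 / R\<^sup>2 * x\<^sup>2)" using x2 by simp
  have i1: "integrable std_gaussian (\<lambda>x. (\<rho> x - G x)\<^sup>2)"
    by (rule Bochner_Integration.integrable_bound[OF i0]) (use le in \<open>auto intro!: AE_I2 order.trans[OF _ abs_ge_self]\<close>)
  have "(\<integral>x. (\<rho> x - G x)\<^sup>2 \<partial>std_gaussian) \<le> (\<integral>x. \<eta> + 9 / R\<^sup>2 * x\<^sup>2 \<partial>std_gaussian)"
    by (rule integral_mono[OF i1 i0 le])
  also have "\<dots> = \<eta> + 9 / R\<^sup>2" using x2 std.prob_space by simp
  also have "\<dots> \<le> \<epsilon> / 8" using \<eta> R9 by simp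
  finally have 1: "(\<integral>x. (\<rho> x - G x)\<^sup>2 \<partial>std_gaussian) \<le> \<epsilon> / 8" .
  obtain p where p: "(\<integral>x. ((G x - poly p x) * poly 1 x)\<^sup>2 \<partial>std_gaussian) < \<epsilon> / 8"
    using wG \<epsilon> unfolding weighted_approximable_def by (meson zero_less_divide_iff zero_less_numeral)
  have i2: "integrable std_gaussian (\<lambda>x. (G x - poly p x)\<^sup>2)"
    using integrable_bounded_poly_sq[of G B p 1] B by simp
  have "(\<integral>x. (\<rho> x - poly p x)\<^sup>2 \<partial>std_gaussian) \<le> 2 * (\<integral>x. (\<rho> x - G x)\<^sup>2 \<partial>std_gaussian) + 2 * (\<integral>x. (G x - poly p x)\<^sup>2 \<partial>std_gaussian)"
    by (rule integral_sq_add_le[OF _ i1 i2]) simp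
  also have "\<dots> < \<epsilon>" using 1 p \<epsilon> by simp
  finally show ?thesis by blast
qed

section \<open>Parseval's identity for continuous functions of compact support\<close>

definition hermite_coeff1 :: "(real \<Rightarrow> real) \<Rightarrow> nat \<Rightarrow> real" where
  "hermite_coeff1 \<rho> m = (\<integral>x. \<rho> x * hermite_fun m x \<partial>std_gaussian)"

definition hermite_partial_sum :: "(real \<Rightarrow> real) \<Rightarrow> nat \<Rightarrow> real \<Rightarrow> real" where
  "hermite_partial_sum \<rho> K x = (\<Sum>m\<le>K. hermite_coeff1 \<rho> m * hermite_fun m x)"

lemma hermite_partial_sum_poly:
  "hermite_partial_sum \<rho> K x = poly (\<Sum>m\<le>K. smult (hermite_coeff1 \<rho> m / sqrt (fact m)) (hermite_poly m)) x"
  by (simp add: hermite_partial_sum_def hermite_fun_def poly_sum)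

lemma borel_measurable_hermite_partial_sum [measurable]: "hermite_partial_sum \<rho> K \<in> borel_measurable borel"
  unfolding hermite_partial_sum_poly[abs_def] by measurable

lemma integrable_hermite_partial_sum_poly: "integrable std_gaussian (\<lambda>x. hermite_partial_sum \<rho> K x * poly p x)"
  unfolding hermite_partial_sum_poly poly_mult[symmetric] by (rule integrable_poly_std_gaussian)

context
  fixes \<rho> :: "real \<Rightarrow> real"
  assumes m [measurable]: "\<rho> \<in> borel_measurable borel" and bd: "\<And>x. \<bar>\<rho> x\<bar> \<le> 1"
begin

lemma integrable_bounded_mult_poly: "integrable std_gaussian (\<lambda>x. \<rho> x * poly p x)"
  by (rule Bochner_Integration.integrable_bound[OF integrable_norm[OF integrable_poly_std_gaussian[of p]]])
    (use bd in \<open>auto simp: abs_mult intro!: AE_I2 mult_left_le_one_le\<close>)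

lemma integrable_bounded_sq: "integrable std_gaussian (\<lambda>x. (\<rho> x)\<^sup>2)"
  using integrable_bounded_poly_sq[OF m bd, of 0 1] by simp

lemma integral_mult_hermite_partial_sum:
  "(\<integral>x. \<rho> x * hermite_partial_sum \<rho> K x \<partial>std_gaussian) = (\<Sum>m\<le>K. (hermite_coeff1 \<rho> m)\<^sup>2)"
proof -
  have i: "integrable std_gaussian (\<lambda>x. \<rho> x * hermite_fun m x)" for m
    unfolding hermite_fun_eq_poly by (rule integrable_bounded_mult_poly)
  have "(\<integral>x. \<rho> x * hermite_partial_sum \<rho> K x \<partial>std_gaussian)
      = (\<integral>x. (\<Sum>m\<le>K. hermite_coeff1 \<rho> m * (\<rho> x * hermite_fun m x)) \<partial>std_gaussian)"
    by (simp add: hermite_partial_sum_def sum_distrib_left mult_ac)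
  then show ?thesis using i by (simp add: hermite_coeff1_def power2_eq_square)
qed

lemma integral_hermite_partial_sum_sq:
  "(\<integral>x. (hermite_partial_sum \<rho> K x)\<^sup>2 \<partial>std_gaussian) = (\<Sum>m\<le>K. (hermite_coeff1 \<rho> m)\<^sup>2)"
proof -
  have "(\<integral>x. (hermite_partial_sum \<rho> K x)\<^sup>2 \<partial>std_gaussian)
     = (\<integral>x. (\<Sum>m\<le>K. \<Sum>n\<le>K. (hermite_coeff1 \<rho> m * hermite_coeff1 \<rho> n) * (hermite_fun m x * hermite_fun n x)) \<partial>std_gaussian)"
    by (simp add: hermite_partial_sum_def power2_eq_square sum_product mult_ac)
  also have "\<dots> = (\<Sum>m\<le>K. \<Sum>n\<le>K. (hermite_coeff1 \<rho> m * hermite_coeff1 \<rho> n) * (if m = n then 1 else 0))"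
    by (subst Bochner_Integration.integral_sum, simp add: integrable_hermite_fun_mult)
      (simp add: integrable_hermite_fun_mult hermite_fun_orthonormal)
  also have "\<dots> = (\<Sum>m\<le>K. (hermite_coeff1 \<rho> m)\<^sup>2)"
    by (simp add: if_distrib sum.delta power2_eq_square cong: if_cong)
  finally show ?thesis .
qed

text \<open>Strong induction on the degree: subtracting the leading coefficient times the Hermite
  polynomial of the same degree lowers the degree.\<close>

lemma hermite_partial_sum_orthogonal:
  assumes "degree p \<le> K"
  shows "(\<integral>x. (\<rho> x - hermite_partial_sum \<rho> K x) * poly p x \<partial>std_gaussian) = 0"
  using assms
proof (induction "degree p" arbitrary: p rule: less_induct)
  case (less p)
  have i: "integrable std_gaussian (\<lambda>x. (\<rho> x - hermite_partial_sum \<rho> K x) * poly q x)" for q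
    unfolding left_diff_distrib
    by (intro Bochner_Integration.integrable_diff integrable_bounded_mult_poly integrable_hermite_partial_sum_poly)
  have H: "(\<integral>x. (\<rho> x - hermite_partial_sum \<rho> K x) * poly (hermite_poly n) x \<partial>std_gaussian) = 0" if "n \<le> K" for n
  proof -
    have i1: "integrable std_gaussian (\<lambda>x. \<rho> x * hermite_fun n x)"
      unfolding hermite_fun_eq_poly by (rule integrable_bounded_mult_poly)
    have i2: "integrable std_gaussian (\<lambda>x. hermite_partial_sum \<rho> K x * hermite_fun n x)"
      unfolding hermite_fun_eq_poly by (rule integrable_hermite_partial_sum_poly)
    have "(\<integral>x. (\<rho> x - hermite_partial_sum \<rho> K x) * hermite_fun n x \<partial>std_gaussian)
        = hermite_coeff1 \<rho> n - (\<integral>x. hermite_partial_sum \<rho> K x * hermite_fun n x \<partial>std_gaussian)"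
      unfolding left_diff_distrib hermite_coeff1_def by (rule Bochner_Integration.integral_diff[OF i1 i2])
    also have "(\<integral>x. hermite_partial_sum \<rho> K x * hermite_fun n x \<partial>std_gaussian)
        = (\<integral>x. (\<Sum>m\<le>K. hermite_coeff1 \<rho> m * (hermite_fun m x * hermite_fun n x)) \<partial>std_gaussian)"
      by (simp add: hermite_partial_sum_def sum_distrib_right mult.assoc)
    also have "(\<integral>x. (\<Sum>m\<le>K. hermite_coeff1 \<rho> m * (hermite_fun m x * hermite_fun n x)) \<partial>std_gaussian)
        = (\<Sum>m\<le>K. hermite_coeff1 \<rho> m * (if m = n then 1 else 0))"
      by (simp add: integrable_hermite_fun_mult hermite_fun_orthonormal)
    also have "\<dots> = hermite_coeff1 \<rho> n" using that by (simp add: if_distrib sum.delta cong: if_cong)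
    finally have "(\<integral>x. (\<rho> x - hermite_partial_sum \<rho> K x) * poly (hermite_poly n) x / sqrt (fact n) \<partial>std_gaussian) = 0"
      by (simp add: hermite_fun_def)
    then show ?thesis by (simp only: integral_divide_zero) simp
  qed
  let ?n = "degree p"
  define r where "r = p - smult (lead_coeff p) (hermite_poly ?n)"
  have p: "poly p x = poly r x + lead_coeff p * poly (hermite_poly ?n) x" for x by (simp add: r_def)
  have r: "(\<integral>x. (\<rho> x - hermite_partial_sum \<rho> K x) * poly r x \<partial>std_gaussian) = 0"
  proof (cases "r = 0")
    case False
    have "degree r \<le> ?n" unfolding r_def by (intro degree_diff_le) (auto intro: order.trans[OF degree_smult_le])
    moreover have "coeff r ?n = 0" using lead_coeff_hermite_poly[of ?n] by (simp add: r_def)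
    ultimately have "degree r < ?n" using False by (metis le_neq_implies_less leading_coeff_0_iff)
    then show ?thesis using less by simp
  qed simp
  have "(\<integral>x. (\<rho> x - hermite_partial_sum \<rho> K x) * poly p x \<partial>std_gaussian)
     = (\<integral>x. (\<rho> x - hermite_partial_sum \<rho> K x) * poly r x + lead_coeff p * ((\<rho> x - hermite_partial_sum \<rho> K x) * poly (hermite_poly ?n) x) \<partial>std_gaussian)"
    unfolding p by (simp only: distrib_left mult.left_commute)
  also have "\<dots> = 0" using i r H[OF less.prems] by simp
  finally show ?case .
qed

text \<open>The partial sum is the best approximation of \<rho> among polynomials of degree at most
  K. Its squared error is the defect in Parseval's identity, and it is at most that of any
  approximating polynomial of such a degree.\<close>

lemma hermite_parseval:
  assumes cont: "continuous_on UNIV \<rho>" and supp: "\<And>x. \<bar>x\<bar> \<ge> L \<Longrightarrow> \<rho> x = 0"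
  shows "(\<lambda>K. \<Sum>m\<le>K. (hermite_coeff1 \<rho> m)\<^sup>2) \<longlonglongrightarrow> (\<integral>x. (\<rho> x)\<^sup>2 \<partial>std_gaussian)"
proof (rule LIMSEQ_I)
  fix \<epsilon> :: real assume "\<epsilon> > 0"
  then obtain p where p: "(\<integral>x. (\<rho> x - poly p x)\<^sup>2 \<partial>std_gaussian) < \<epsilon>"
    using compact_support_approximable[OF cont bd supp, of L \<epsilon>] by auto
  have "norm ((\<Sum>m\<le>K. (hermite_coeff1 \<rho> m)\<^sup>2) - (\<integral>x. (\<rho> x)\<^sup>2 \<partial>std_gaussian)) < \<epsilon>" if "K \<ge> degree p" for K
  proof -
    let ?q = "hermite_partial_sum \<rho> K"
    define q where "q = (\<Sum>m\<le>K. smult (hermite_coeff1 \<rho> m / sqrt (fact m)) (hermite_poly m))"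
    have q: "?q = poly q" by (auto simp: q_def hermite_partial_sum_poly)
    have iq1: "integrable std_gaussian (\<lambda>x. (?q x)\<^sup>2)"
      using integrable_poly_std_gaussian[of "q\<^sup>2"] by (simp add: q)
    have iq2: "integrable std_gaussian (\<lambda>x. \<rho> x * ?q x)"
      unfolding q by (rule integrable_bounded_mult_poly)
    have iq3: "integrable std_gaussian (\<lambda>x. (\<rho> x - ?q x) * poly (q - p) x)"
      unfolding left_diff_distrib
      by (intro Bochner_Integration.integrable_diff integrable_bounded_mult_poly integrable_hermite_partial_sum_poly)
    have iq4: "integrable std_gaussian (\<lambda>x. (poly (q - p) x)\<^sup>2)"
      using integrable_poly_std_gaussian[of "(q - p)\<^sup>2"] by (simp only: poly_power)
    have iq5: "integrable std_gaussian (\<lambda>x. (\<rho> x - ?q x)\<^sup>2)"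
      using integrable_bounded_poly_sq[OF m bd, of q 1] by (simp add: q)
    note iq = iq1 iq2 iq3 iq4 iq5
    have dq: "degree (q - p) \<le> K"
      unfolding q_def using that
      by (intro degree_diff_le degree_sum_le) (auto intro: order.trans[OF degree_smult_le])
    have "(\<rho> x - ?q x)\<^sup>2 = (\<rho> x)\<^sup>2 - 2 * (\<rho> x * ?q x) + (?q x)\<^sup>2" for x
      by (simp add: power2_diff)
    then have d: "(\<integral>x. (\<rho> x - ?q x)\<^sup>2 \<partial>std_gaussian) = (\<integral>x. (\<rho> x)\<^sup>2 \<partial>std_gaussian) - (\<Sum>m\<le>K. (hermite_coeff1 \<rho> m)\<^sup>2)"
      using iq integrable_bounded_sq
      by (simp add: integral_mult_hermite_partial_sum integral_hermite_partial_sum_sq)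
    have "(\<rho> x - poly p x)\<^sup>2 = (\<rho> x - ?q x)\<^sup>2 + 2 * ((\<rho> x - ?q x) * poly (q - p) x) + (poly (q - p) x)\<^sup>2" for x
      by (simp add: q power2_eq_square algebra_simps)
    then have "(\<integral>x. (\<rho> x - poly p x)\<^sup>2 \<partial>std_gaussian) = (\<integral>x. (\<rho> x - ?q x)\<^sup>2 \<partial>std_gaussian) + (\<integral>x. (poly (q - p) x)\<^sup>2 \<partial>std_gaussian)"
      using iq hermite_partial_sum_orthogonal[OF dq] by (simp del: poly_diff)
    moreover have "0 \<le> (\<integral>x. (poly (q - p) x)\<^sup>2 \<partial>std_gaussian)" by (rule Bochner_Integration.integral_nonneg) simp
    moreover have "0 \<le> (\<integral>x. (\<rho> x - ?q x)\<^sup>2 \<partial>std_gaussian)" by (rule Bochner_Integration.integral_nonneg) simp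
    ultimately show ?thesis using p d unfolding real_norm_def by linarith
  qed
  then show "\<exists>N. \<forall>K\<ge>N. norm ((\<Sum>m\<le>K. (hermite_coeff1 \<rho> m)\<^sup>2) - (\<integral>x. (\<rho> x)\<^sup>2 \<partial>std_gaussian)) < \<epsilon>" by blast
qed

end

section \<open>Series over multi-indices as integrals for the counting measure\<close>

lemma integrable_count_space_if_summable_on:
  fixes g :: "'b \<Rightarrow> real"
  assumes "g summable_on A" "\<And>x. x \<in> A \<Longrightarrow> g x \<ge> 0"
  shows "integrable (count_space A) g"
proof -
  have "(\<lambda>x. norm (g x)) summable_on A" using assms by (subst summable_on_cong[of _ _ g]) auto
  then have "Infinite_Set_Sum.abs_summable_on g A" by (rule abs_summable_equivalent[THEN iffD1])
  then show ?thesis by (simp add: Infinite_Set_Sum.abs_summable_on_def)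
qed

text \<open>The boxes in M variables exhaust all indices at which g can be nonzero, so this is
  dominated convergence.\<close>

lemma sum_index_box_LIMSEQ:
  fixes g :: "(nat \<Rightarrow> nat) \<Rightarrow> real"
  assumes g: "integrable (count_space multi_indices) g"
    and M: "\<And>\<mu> j. \<mu> \<in> multi_indices \<Longrightarrow> j \<ge> M \<Longrightarrow> \<mu> j \<noteq> 0 \<Longrightarrow> g \<mu> = 0"
  shows "(\<lambda>K. \<Sum>\<mu>\<in>index_box M (\<lambda>_. K). g \<mu>) \<longlonglongrightarrow> (\<integral>\<mu>. g \<mu> \<partial>count_space multi_indices)"
proof -
  let ?s = "\<lambda>K \<mu>. indicator (index_box M (\<lambda>_. K)) \<mu> * g \<mu>"
  have "(\<lambda>K. \<integral>\<mu>. ?s K \<mu> \<partial>count_space multi_indices) \<longlonglongrightarrow> (\<integral>\<mu>. g \<mu> \<partial>count_space multi_indices)"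
  proof (rule integral_dominated_convergence)
    show "integrable (count_space multi_indices) (\<lambda>\<mu>. norm (g \<mu>))" using g by simp
    show "AE \<mu> in count_space multi_indices. (\<lambda>K. ?s K \<mu>) \<longlonglongrightarrow> g \<mu>"
      unfolding AE_count_space
    proof
      fix \<mu> assume \<mu>: "\<mu> \<in> multi_indices"
      show "(\<lambda>K. ?s K \<mu>) \<longlonglongrightarrow> g \<mu>"
      proof (cases "\<exists>j\<ge>M. \<mu> j \<noteq> 0")
        case True
        then have "g \<mu> = 0" using M[OF \<mu>] by blast
        then show ?thesis by simp
      next
        case False
        define K0 where "K0 = (\<Sum>j<M. \<mu> j)"
        have "\<mu> j \<le> K0" if "j < M" for j using that by (auto simp: K0_def intro: member_le_sum)
        then have "\<mu> \<in> index_box M (\<lambda>_. K)" if "K \<ge> K0" for K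
          using that False unfolding index_box_def by (blast intro: order.trans)
        then have "\<forall>\<^sub>F K in sequentially. ?s K \<mu> = g \<mu>"
          unfolding eventually_at_top_linorder by (intro exI[of _ K0]) auto
        then show ?thesis by (rule tendsto_eventually)
      qed
    qed
    show "AE \<mu> in count_space multi_indices. norm (?s K \<mu>) \<le> norm (g \<mu>)" for K
      by (simp add: AE_count_space split: split_indicator)
  qed auto
  moreover have "(\<integral>\<mu>. ?s K \<mu> \<partial>count_space multi_indices) = (\<Sum>\<mu>\<in>index_box M (\<lambda>_. K). g \<mu>)" for K
  proof -
    have "(\<integral>\<mu>. ?s K \<mu> \<partial>count_space multi_indices) = (\<integral>\<mu>. indicator (index_box M (\<lambda>_. K)) \<mu> *\<^sub>R g \<mu> \<partial>count_space multi_indices)"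
      by simp
    also have "\<dots> = (\<integral>\<mu>. g \<mu> \<partial>count_space (index_box M (\<lambda>_. K)))"
      using index_box_subset_multi_indices[of M "\<lambda>_. K"]
      by (subst integral_restrict_space[symmetric]) (auto simp: restrict_count_space Int_absorb1 Int_absorb2)
    also have "\<dots> = (\<Sum>\<mu>\<in>index_box M (\<lambda>_. K). g \<mu>)" by (simp add: lebesgue_integral_count_space_finite)
    finally show ?thesis .
  qed
  ultimately show ?thesis by simp
qed

subsection \<open>Localising bumps\<close>

text \<open>In the first n variables a tent of half width 1 / n at z; in the others a plateau, equal
  to 1 on [-t j, t j] and vanishing beyond 2 t j. The plateaus are chosen later with masses so close
  to 1 that products over arbitrarily many variables keep a positive mass. They are centred at 0,
  where the coordinates of a quadrature point eventually are.\<close>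

definition bump :: "(nat \<Rightarrow> real) \<Rightarrow> (nat \<Rightarrow> real) \<Rightarrow> nat \<Rightarrow> nat \<Rightarrow> real \<Rightarrow> real" where
  "bump z t n j x = (if j < n then max 0 (1 - real n * \<bar>x - z j\<bar>) else max 0 (min 1 (2 - \<bar>x\<bar> / t j)))"

lemma bump_nonneg: "bump z t n j x \<ge> 0" and bump_le_1: "bump z t n j x \<le> 1"
  by (auto simp: bump_def)

lemma continuous_bump: "continuous_on UNIV (bump z t n j)"
  unfolding bump_def[abs_def] by (cases "j < n") (auto simp: divide_inverse intro!: continuous_intros)

lemma borel_measurable_bump [measurable]: "bump z t n j \<in> borel_measurable borel"
  by (rule borel_measurable_continuous_onI[OF continuous_bump])

lemma bump_tent_support: "j < n \<Longrightarrow> bump z t n j x \<noteq> 0 \<Longrightarrow> \<bar>x - z j\<bar> \<le> 1 / real n"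
  by (auto simp: bump_def field_simps max_def split: if_splits)

lemma bump_wide_support: "j \<ge> n \<Longrightarrow> t j > 0 \<Longrightarrow> bump z t n j x \<noteq> 0 \<Longrightarrow> \<bar>x\<bar> \<le> 2 * t j"
  by (auto simp: bump_def field_simps max_def min_def split: if_splits)

lemma bump_bounded_support:
  assumes "\<And>j. t j > 0"
  shows "\<exists>L. \<forall>x. \<bar>x\<bar> \<ge> L \<longrightarrow> bump z t n j x = 0"
proof (cases "j < n")
  case True
  have "bump z t n j x = 0" if "\<bar>x\<bar> \<ge> \<bar>z j\<bar> + 2" for x
  proof (rule ccontr)
    assume "bump z t n j x \<noteq> 0"
    then have "\<bar>x - z j\<bar> \<le> 1 / real n" by (rule bump_tent_support[OF True])
    also have "\<dots> \<le> 1" using True by simp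
    finally show False using that by linarith
  qed
  then show ?thesis by blast
next
  case False
  have "bump z t n j x = 0" if "\<bar>x\<bar> \<ge> 2 * t j + 1" for x
    using bump_wide_support[of n j t z x] assms[of j] that False by force
  then show ?thesis by blast
qed

lemma bump_symmetric: "z j = 0 \<Longrightarrow> bump z t n j (- x) = bump z t n j x"
  by (simp add: bump_def)

lemma integrable_bump_mult_poly: "integrable std_gaussian (\<lambda>x. bump z t n j x * poly p x)"
  by (rule integrable_bounded_mult_poly) (auto simp: bump_nonneg bump_le_1)

lemma integrable_bump: "integrable std_gaussian (bump z t n j)"
  using integrable_bump_mult_poly[of z t n j 1] by simp

lemma integrable_bump_mult_hermite: "integrable std_gaussian (\<lambda>x. bump z t n j x * hermite_fun m x)"
  unfolding hermite_fun_eq_poly by (rule integrable_bump_mult_poly)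

section \<open>Averages of Hermite functions over a bump\<close>

definition bump_mass :: "(nat \<Rightarrow> real) \<Rightarrow> (nat \<Rightarrow> real) \<Rightarrow> nat \<Rightarrow> nat \<Rightarrow> real" where
  "bump_mass z t n j = (\<integral>x. bump z t n j x \<partial>std_gaussian)"

definition bump_average :: "(nat \<Rightarrow> real) \<Rightarrow> (nat \<Rightarrow> real) \<Rightarrow> nat \<Rightarrow> nat \<Rightarrow> nat \<Rightarrow> real" where
  "bump_average z t n j m = hermite_coeff1 (bump z t n j) m / bump_mass z t n j"

lemma bump_mass_le_1: "bump_mass z t n j \<le> 1"
proof -
  have "bump_mass z t n j \<le> (\<integral>x. 1 \<partial>std_gaussian)"
    unfolding bump_mass_def by (intro integral_mono integrable_bump) (auto simp: bump_le_1)
  then show ?thesis using std.prob_space by simp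
qed

lemma bump_mass_pos:
  assumes t: "\<And>j. t j > 0"
  shows "bump_mass z t n j > 0"
proof (rule ccontr)
  assume "\<not> bump_mass z t n j > 0"
  moreover have "bump_mass z t n j \<ge> 0" unfolding bump_mass_def by (simp add: bump_nonneg)
  ultimately have "bump_mass z t n j = 0" by linarith
  then have "AE x in std_gaussian. bump z t n j x = 0"
    unfolding bump_mass_def by (subst (asm) integral_nonneg_eq_0_iff_AE[OF integrable_bump]) (auto simp: bump_nonneg)
  then have ae: "AE x in lborel. bump z t n j x = 0"
    unfolding std_gaussian_def by (subst (asm) AE_density) (auto simp: normal_density_pos)
  define c where "c = (if j < n then z j else 0)"
  define r where "r = (if j < n then 1 / (2 * real n) else t j)"
  have r: "r > 0" using t by (auto simp: r_def)
  have "bump z t n j x \<noteq> 0" if "x \<in> {c - r..c + r}" for x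
  proof (cases "j < n")
    case True
    have "\<bar>x - z j\<bar> \<le> 1 / (2 * real n)" using that True by (auto simp: c_def r_def abs_le_iff)
    then have "real n * \<bar>x - z j\<bar> \<le> 1 / 2" using True by (simp add: field_simps)
    then show ?thesis using True by (simp add: bump_def)
  next
    case False
    have "\<bar>x\<bar> \<le> t j" using that False by (simp add: c_def r_def abs_le_iff)
    then have "\<bar>x\<bar> / t j \<le> 1" using t[of j] by simp
    then show ?thesis using False by (simp add: bump_def)
  qed
  then have "AE x in lborel. x \<notin> {c - r..c + r}" by (intro eventually_mono[OF ae]) auto
  then have "{c - r..c + r} \<in> null_sets lborel" by (subst (asm) AE_iff_null_sets[symmetric]) auto
  then show False using r by (auto simp: null_sets_def)
qed

text \<open>Markov's inequality for the moment of order 2k, in the pointwise form that 1 - (x / t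
  j)^(2k) lies below the bump.\<close>

lemma bump_mass_wide:
  assumes t: "\<And>j. t j > 0" and j: "j \<ge> n"
  shows "bump_mass z t n j \<ge> 1 - fact (2 * k) / (2 ^ k * fact k) / t j ^ (2 * k)"
proof -
  have le: "1 - x ^ (2 * k) / t j ^ (2 * k) \<le> bump z t n j x" for x
  proof (cases "\<bar>x\<bar> \<le> t j")
    case True
    then have "\<bar>x\<bar> / t j \<le> 1" using t[of j] by simp
    then have "bump z t n j x = 1" using j by (simp add: bump_def)
    moreover have "0 \<le> x ^ (2 * k) / t j ^ (2 * k)" using t[of j] by (simp add: zero_le_even_power less_imp_le)
    ultimately show ?thesis by simp
  next
    case False
    then have "1 \<le> (\<bar>x\<bar> / t j) ^ (2 * k)" using t[of j] by (intro one_le_power) simp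
    also have "\<dots> = x ^ (2 * k) / t j ^ (2 * k)" by (simp add: power_divide power_even_abs)
    finally show ?thesis using bump_nonneg[of z t n j x] by linarith
  qed
  have i: "integrable std_gaussian (\<lambda>x. x ^ (2 * k) / t j ^ (2 * k))"
    by (intro Bochner_Integration.integrable_divide_zero integrable_power_std_gaussian)
  have "(\<integral>x. 1 - x ^ (2 * k) / t j ^ (2 * k) \<partial>std_gaussian) \<le> bump_mass z t n j"
    unfolding bump_mass_def by (intro integral_mono integrable_bump Bochner_Integration.integrable_diff i le) auto
  moreover have "(\<integral>x. 1 - x ^ (2 * k) / t j ^ (2 * k) \<partial>std_gaussian) = 1 - fact (2 * k) / (2 ^ k * fact k) / t j ^ (2 * k)"
    using i std.prob_space by (simp add: std_gaussian_moment_even)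
  ultimately show ?thesis by simp
qed

lemma bump_average_0:
  assumes "\<And>j. t j > 0"
  shows "bump_average z t n j 0 = 1"
proof -
  have "0 < bump_mass z t n j" by (rule bump_mass_pos[OF assms])
  then show ?thesis by (simp add: bump_average_def hermite_coeff1_def bump_mass_def)
qed

lemma bump_average_odd:
  assumes "z j = 0" "odd m"
  shows "bump_average z t n j m = 0"
proof -
  have "hermite_coeff1 (bump z t n j) m = (\<integral>x. bump z t n j (- x) * hermite_fun m (- x) \<partial>std_gaussian)"
    unfolding hermite_coeff1_def by (rule std_gaussian_reflect[symmetric]) measurable
  also have "\<dots> = - hermite_coeff1 (bump z t n j) m"
    using assms by (simp add: bump_symmetric hermite_fun_minus hermite_coeff1_def)
  finally show ?thesis by (simp add: bump_average_def)
qed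

text \<open>Hermite functions grow at most like exp (x^2 / 4), so their averages are controlled by
  the mean of this function over the bump. The majorant u covers two cases: for a tent the
  exponential is bounded on the support; for a plateau it is integrable and the mass is not
  small.\<close>

lemma bump_average_bound:
  assumes t: "\<And>j. t j > 0" and le: "\<And>x. bump z t n j x * exp (x\<^sup>2 / 4) \<le> u x"
    and u: "integrable std_gaussian u" "(\<integral>x. u x \<partial>std_gaussian) \<le> E * bump_mass z t n j"
  shows "\<bar>bump_average z t n j m\<bar> \<le> 2 * (real m + 1) * E"
proof -
  have "\<bar>hermite_coeff1 (bump z t n j) m\<bar> \<le> (\<integral>x. \<bar>bump z t n j x * hermite_fun m x\<bar> \<partial>std_gaussian)"
    unfolding hermite_coeff1_def by (rule integral_abs_bound)
  also have "\<dots> \<le> (\<integral>x. 2 * (real m + 1) * u x \<partial>std_gaussian)"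
  proof (rule integral_mono)
    fix x
    have "\<bar>bump z t n j x * hermite_fun m x\<bar> \<le> bump z t n j x * (2 * (real m + 1) * exp (x\<^sup>2 / 4))"
      unfolding abs_mult by (simp only: abs_of_nonneg[OF bump_nonneg]) (intro mult_left_mono hermite_fun_bound bump_nonneg)
    also have "\<dots> = 2 * (real m + 1) * (bump z t n j x * exp (x\<^sup>2 / 4))" by simp
    also have "\<dots> \<le> 2 * (real m + 1) * u x" by (intro mult_left_mono le) auto
    finally show "\<bar>bump z t n j x * hermite_fun m x\<bar> \<le> 2 * (real m + 1) * u x" .
  qed (use u(1) integrable_bump_mult_hermite in auto)
  also have "\<dots> \<le> 2 * (real m + 1) * (E * bump_mass z t n j)"
    using mult_left_mono[OF u(2), of "2 * (real m + 1)"] by simp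
  finally have "\<bar>hermite_coeff1 (bump z t n j) m\<bar> \<le> 2 * (real m + 1) * (E * bump_mass z t n j)" .
  moreover have "0 < bump_mass z t n j" by (rule bump_mass_pos[OF t])
  ultimately show ?thesis by (simp add: bump_average_def abs_divide field_simps)
qed

lemma bump_average_bound_tent:
  assumes t: "\<And>j. t j > 0" and j: "j < n"
  shows "\<bar>bump_average z t n j m\<bar> \<le> 2 * (real m + 1) * exp ((\<bar>z j\<bar> + 1)\<^sup>2 / 4)"
proof (rule bump_average_bound[OF t])
  fix x
  show "bump z t n j x * exp (x\<^sup>2 / 4) \<le> exp ((\<bar>z j\<bar> + 1)\<^sup>2 / 4) * bump z t n j x"
  proof (cases "bump z t n j x = 0")
    case False
    have "\<bar>x - z j\<bar> \<le> 1 / real n" by (rule bump_tent_support[OF j False])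
    also have "\<dots> \<le> 1" using j by simp
    finally have "\<bar>x\<bar> \<le> \<bar>\<bar>z j\<bar> + 1\<bar>" by linarith
    then have "x\<^sup>2 \<le> (\<bar>z j\<bar> + 1)\<^sup>2" by (simp only: abs_le_square_iff)
    then have "exp (x\<^sup>2 / 4) \<le> exp ((\<bar>z j\<bar> + 1)\<^sup>2 / 4)" by simp
    then have "bump z t n j x * exp (x\<^sup>2 / 4) \<le> bump z t n j x * exp ((\<bar>z j\<bar> + 1)\<^sup>2 / 4)"
      by (rule mult_left_mono) (rule bump_nonneg)
    then show ?thesis by (simp only: mult.commute)
  qed simp
qed (auto simp: bump_mass_def intro: integrable_bump)

lemma bump_average_bound_wide:
  assumes t: "\<And>j. t j > 0" and c: "bump_mass z t n j \<ge> 1 / 2"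
  shows "\<bar>bump_average z t n j m\<bar> \<le> 2 * (real m + 1) * 3"
proof (rule bump_average_bound[OF t _ integrable_exp_square_quarter])
  show "bump z t n j x * exp (x\<^sup>2 / 4) \<le> exp (x\<^sup>2 / 4)" for x
    by (rule mult_left_le_one_le) (auto simp: bump_nonneg bump_le_1)
  \<comment> \<open>The constant 3 is twice 3 / 2, since the mass is only known to be at least 1 /
    2.\<close>
  have "sqrt 2 \<le> 3 / 2" by (rule real_le_lsqrt) (auto simp: power2_eq_square)
  then show "(\<integral>x. exp (x\<^sup>2 / 4) \<partial>std_gaussian) \<le> 3 * bump_mass z t n j"
    unfolding integral_exp_square_quarter using c by simp
qed

text \<open>From n > j on the bump is a tent that shrinks to the point z j, and continuity
  applies.\<close>

lemma bump_average_LIMSEQ: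
  assumes t: "\<And>j. t j > 0"
  shows "(\<lambda>n. bump_average z t n j m) \<longlonglongrightarrow> hermite_fun m (z j)"
proof (rule LIMSEQ_I)
  fix \<epsilon> :: real assume \<epsilon>: "\<epsilon> > 0"
  have "isCont (hermite_fun m) (z j)"
    unfolding hermite_fun_eq_poly[abs_def] by (rule poly_isCont)
  then obtain \<delta> where \<delta>: "\<delta> > 0" "\<And>x. \<bar>x - z j\<bar> < \<delta> \<Longrightarrow> \<bar>hermite_fun m x - hermite_fun m (z j)\<bar> < \<epsilon> / 2"
    unfolding continuous_at_eps_delta using \<epsilon> by (metis dist_real_def half_gt_zero)
  obtain N where N: "real N > 1 / \<delta>" using reals_Archimedean2 by blast
  show "\<exists>N. \<forall>n\<ge>N. norm (bump_average z t n j m - hermite_fun m (z j)) < \<epsilon>"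
  proof (intro exI[of _ "max N (Suc j)"] allI impI)
    fix n assume n: "n \<ge> max N (Suc j)"
    then have j: "j < n" by simp
    have n0: "0 < real n" using j by simp
    have "1 / \<delta> < real n" using N n by (meson less_le_trans max.boundedE of_nat_le_iff)
    then have "1 / real n < \<delta>" using \<delta>(1) n0 by (simp add: field_simps)
    then have le: "\<bar>bump z t n j x * (hermite_fun m x - hermite_fun m (z j))\<bar> \<le> bump z t n j x * (\<epsilon> / 2)" for x
      using bump_tent_support[OF j, of z t x] \<delta>(2)[of x] bump_nonneg[of z t n j x]
      by (cases "bump z t n j x = 0") (auto simp: abs_mult)
    have i: "integrable std_gaussian (\<lambda>x. bump z t n j x * (hermite_fun m x - hermite_fun m (z j)))"
      unfolding right_diff_distrib
      by (intro Bochner_Integration.integrable_diff integrable_bump_mult_hermite Bochner_Integration.integrable_mult_left integrable_bump)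
    have "hermite_coeff1 (bump z t n j) m - hermite_fun m (z j) * bump_mass z t n j
        = (\<integral>x. bump z t n j x * (hermite_fun m x - hermite_fun m (z j)) \<partial>std_gaussian)"
      unfolding right_diff_distrib hermite_coeff1_def bump_mass_def
      by (subst Bochner_Integration.integral_diff) (auto intro: integrable_bump_mult_hermite integrable_bump)
    also have "\<bar>\<dots>\<bar> \<le> (\<integral>x. \<bar>bump z t n j x * (hermite_fun m x - hermite_fun m (z j))\<bar> \<partial>std_gaussian)"
      by (rule integral_abs_bound)
    also have "\<dots> \<le> (\<integral>x. bump z t n j x * (\<epsilon> / 2) \<partial>std_gaussian)"
      by (intro integral_mono le integrable_abs i Bochner_Integration.integrable_mult_left integrable_bump)
    also have "\<dots> = bump_mass z t n j * (\<epsilon> / 2)" by (simp add: bump_mass_def)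
    finally have *: "\<bar>hermite_coeff1 (bump z t n j) m - hermite_fun m (z j) * bump_mass z t n j\<bar> \<le> bump_mass z t n j * (\<epsilon> / 2)" .
    let ?c = "bump_mass z t n j"
    have c: "?c > 0" by (rule bump_mass_pos[OF t])
    have "bump_average z t n j m - hermite_fun m (z j) = (hermite_coeff1 (bump z t n j) m - hermite_fun m (z j) * ?c) / ?c"
      using c by (simp add: bump_average_def diff_divide_distrib)
    then have "norm (bump_average z t n j m - hermite_fun m (z j)) = \<bar>hermite_coeff1 (bump z t n j) m - hermite_fun m (z j) * ?c\<bar> / ?c"
      using c by (simp only: real_norm_def abs_divide abs_of_pos)
    then have "norm (bump_average z t n j m - hermite_fun m (z j)) \<le> \<epsilon> / 2"
      using * c by (simp only: pos_divide_le_eq mult.commute)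
    then show "norm (bump_average z t n j m - hermite_fun m (z j)) < \<epsilon>" using \<epsilon> by simp
  qed
qed

text \<open>The radii have to grow slowly enough for the weighted squares to be summable, so that
  the bumps are small in X, and fast enough for the mass lost by all plateaus together to be at most
  1 / 2. A small power of the index serves both purposes, because all Gaussian moments are
  finite.\<close>

lemma wide_radii_exist:
  fixes lam :: "nat \<Rightarrow> real"
  assumes a: "a > 1" and K: "K > 0" and lam: "\<And>j. lam j \<ge> 0" "\<And>j. lam j \<le> K * real (Suc j) powr (- a)"
  obtains t \<epsilon> :: "nat \<Rightarrow> real" where "\<And>j. t j > 0" "summable (\<lambda>j. lam j * (t j)\<^sup>2)"
    "\<And>z n j. j \<ge> n \<Longrightarrow> bump_mass z t n j \<ge> 1 - \<epsilon> j" "\<And>j. \<epsilon> j \<ge> 0" "\<And>M. (\<Sum>j<M. \<epsilon> j) \<le> 1 / 2"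
proof -
  \<comment> \<open>With this exponent - a + 2 \<eta> = - (a + 1) / 2 < - 1.\<close>
  define \<eta> where "\<eta> = (a - 1) / 4"
  have \<eta>: "\<eta> > 0" using a by (simp add: \<eta>_def)
  \<comment> \<open>If k \<eta> \<ge> 1, the moment of order 2k bounds the mass lost in variable j
    by a multiple of (j + 1)^(-2).\<close>
  obtain k :: nat where k0: "real k > 1 / \<eta> + 1" using reals_Archimedean2 by blast
  have "1 / \<eta> > 0" using \<eta> by simp
  then have "real k > 1" "real k > 1 / \<eta>" using k0 by linarith+
  then have k: "real k * \<eta> \<ge> 1" "k \<ge> 1" using \<eta> by (simp_all add: field_simps)
  define m :: real where "m = fact (2 * k) / (2 ^ k * fact k)"
  have m: "m \<ge> 0" by (simp add: m_def)
  obtain S where S: "\<And>M. (\<Sum>j\<le>M. 1 / (real j + 1)\<^sup>2) \<le> S" using sum_inverse_square_bound by blast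
  have S1: "S \<ge> 0" using order.trans[OF sum_nonneg S, of 0] by simp
  \<comment> \<open>The scale of the radii is chosen so that the lost masses sum to at most 1 /
    2.\<close>
  define T where "T = max 1 (2 * m * S)"
  have T: "T \<ge> 1" "T \<ge> 2 * m * S" by (auto simp: T_def)
  define t where "t j = T * real (Suc j) powr \<eta>" for j
  define \<epsilon> where "\<epsilon> j = m / T * (1 / (real j + 1)\<^sup>2)" for j
  have t: "t j > 0" for j using T by (simp add: t_def)
  have "summable (\<lambda>j. lam j * (t j)\<^sup>2)"
  proof (rule summable_comparison_test')
    have "- a + 2 * \<eta> < - 1" using a by (simp add: \<eta>_def field_simps)
    then have "summable (\<lambda>j. real j powr (- a + 2 * \<eta>))" by (simp add: summable_real_powr_iff)
    then have "summable (\<lambda>j. real (Suc j) powr (- a + 2 * \<eta>))" by (subst summable_Suc_iff)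
    then show "summable (\<lambda>j. K * T\<^sup>2 * real (Suc j) powr (- a + 2 * \<eta>))" by (rule summable_mult)
    fix j :: nat
    have t2: "(t j)\<^sup>2 = T\<^sup>2 * real (Suc j) powr (2 * \<eta>)"
      by (simp add: t_def power_mult_distrib power2_eq_square powr_add[symmetric])
    have "lam j * (t j)\<^sup>2 \<le> K * real (Suc j) powr (- a) * (t j)\<^sup>2" by (intro mult_right_mono lam) auto
    also have "\<dots> = K * real (Suc j) powr (- a) * (T\<^sup>2 * real (Suc j) powr (2 * \<eta>))" by (simp only: t2)
    also have "K * real (Suc j) powr (- a) * (T\<^sup>2 * real (Suc j) powr (2 * \<eta>)) = K * T\<^sup>2 * real (Suc j) powr (- a + 2 * \<eta>)"
      by (simp only: powr_add mult_ac)
    finally have "lam j * (t j)\<^sup>2 \<le> K * T\<^sup>2 * real (Suc j) powr (- a + 2 * \<eta>)" .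
    moreover have "norm (lam j * (t j)\<^sup>2) = lam j * (t j)\<^sup>2" using lam(1)[of j] by simp
    ultimately show "norm (lam j * (t j)\<^sup>2) \<le> K * T\<^sup>2 * real (Suc j) powr (- a + 2 * \<eta>)" by simp
  qed
  moreover have "m / t j ^ (2 * k) \<le> \<epsilon> j" for j
  proof -
    have "real (Suc j) ^ 2 = real (Suc j) powr 2" by (simp add: powr_numeral)
    also have "\<dots> \<le> real (Suc j) powr (2 * (real k * \<eta>))"
      using k(1) by (intro powr_mono) auto
    also have "\<dots> = (real (Suc j) powr \<eta>) ^ (2 * k)"
      by (simp add: powr_realpow[symmetric] powr_powr mult_ac)
    finally have 1: "real (Suc j) ^ 2 \<le> (real (Suc j) powr \<eta>) ^ (2 * k)" .
    have 2: "T \<le> T ^ (2 * k)" using T k(2) power_increasing[of 1 "2 * k" T] by simp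
    have "T * (real j + 1)\<^sup>2 \<le> T ^ (2 * k) * (real (Suc j) powr \<eta>) ^ (2 * k)"
      using 1 2 T by (intro mult_mono) (auto simp: add.commute)
    also have "\<dots> = t j ^ (2 * k)" by (simp add: t_def power_mult_distrib)
    finally have le: "T * (real j + 1)\<^sup>2 \<le> t j ^ (2 * k)" .
    have "m / t j ^ (2 * k) \<le> m / (T * (real j + 1)\<^sup>2)"
      using le m T t[of j] by (intro divide_left_mono mult_pos_pos zero_less_power) auto
    then show ?thesis by (simp add: \<epsilon>_def)
  qed
  then have "bump_mass z t n j \<ge> 1 - \<epsilon> j" if "j \<ge> n" for z n j
    by (rule order.trans[OF diff_left_mono bump_mass_wide[OF t that, where k = k, folded m_def]])
  moreover have "\<epsilon> j \<ge> 0" for j using m T by (simp add: \<epsilon>_def)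
  moreover have "(\<Sum>j<M. \<epsilon> j) \<le> 1 / 2" for M
  proof -
    have "(\<Sum>j<M. \<epsilon> j) = m / T * (\<Sum>j<M. 1 / (real j + 1)\<^sup>2)" by (simp add: \<epsilon>_def sum_distrib_left)
    also have "\<dots> \<le> m / T * S"
    proof (intro mult_left_mono)
      have "(\<Sum>j<M. 1 / (real j + 1)\<^sup>2) \<le> (\<Sum>j\<le>M. 1 / (real j + 1)\<^sup>2)" by (intro sum_mono2) auto
      then show "(\<Sum>j<M. 1 / (real j + 1)\<^sup>2) \<le> S" using S[of M] by linarith
    qed (use m T in auto)
    also have "\<dots> \<le> 1 / 2" using T m S1 by (simp add: field_simps)
    finally show ?thesis .
  qed
  ultimately show ?thesis using that[of t \<epsilon>] t by blast
qed

subsection \<open>Pointwise Hermite expansion\<close>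

text \<open>Weierstrass's product inequality: the loss of a product is at most the sum of the losses
  of its factors.\<close>

lemma one_minus_sum_le_prod:
  fixes c :: "nat \<Rightarrow> real"
  assumes "finite A" "\<And>j. j \<in> A \<Longrightarrow> 0 \<le> c j \<and> c j \<le> 1"
  shows "1 - (\<Sum>j\<in>A. 1 - c j) \<le> (\<Prod>j\<in>A. c j)"
  using assms
proof (induction A)
  case (insert a A)
  let ?P = "\<Prod>j\<in>A. c j"
  have P: "?P \<le> 1" "0 \<le> ?P" using insert.prems by (auto intro!: prod_le_1 prod_nonneg)
  have "(1 - c a) * (1 - ?P) \<ge> 0" using P insert.prems by (intro mult_nonneg_nonneg) auto
  then have "c a * ?P \<ge> ?P - (1 - c a)" by (simp add: algebra_simps)
  moreover have "1 - (\<Sum>j\<in>A. 1 - c j) \<le> ?P" using insert by auto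
  ultimately show ?case using insert by simp
qed simp

text \<open>The rate of decay enters twice: in the choice of the radii of the bumps and in the
  convergence of the error series.\<close>

locale gaussian_functional_decay = gaussian_functional +
  fixes a K :: real
  assumes a: "a > 1" and K: "K > 0" and lam_decay: "\<And>j. lam1 j \<le> K * real (Suc j) powr (- a)"
begin

lemma summable_coeff:
  assumes w: "summable (\<lambda>j. lam1 j * (w j)\<^sup>2)"
    and G0: "\<And>j m. G j m \<ge> 0" and G1: "\<And>j. G j 0 = 1"
    and GA: "\<And>j m. G j m \<le> A j * (real m + 1) ^ b" and Gw: "\<And>j m. G j m \<le> w j ^ m"
    and Godd: "\<And>j m. j \<ge> J \<Longrightarrow> odd m \<Longrightarrow> G j m = 0"
  shows "integrable (count_space multi_indices) (\<lambda>\<mu>. \<bar>hermite_coeff \<mu>\<bar> * multi_prod G \<mu>)"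
proof (rule integrable_count_space_if_summable_on)
  show "(\<lambda>\<mu>. \<bar>hermite_coeff \<mu>\<bar> * multi_prod G \<mu>) summable_on multi_indices"
    by (rule summable_on_coefficients[where C = C and lam = lam1 and w = w and A = A and a = b and J' = J])
      (use C_pos lam_pos w G0 G1 GA Gw Godd hermite_coeff_bound in \<open>auto simp: less_imp_le\<close>)
qed (auto intro!: mult_nonneg_nonneg multi_prod_nonneg G0)

lemma integrable_Q_sq: "integrable product_gaussian (\<lambda>\<xi>. (Q (X \<xi>))\<^sup>2)"
  using integrable_directional_sq[of "[]"] by (simp add: directional_Nil)

lemma measurable_Q_X [measurable]: "(\<lambda>\<xi>. Q (X \<xi>)) \<in> borel_measurable product_gaussian"
  using measurable_directional[of "[]"] by (simp add: directional_Nil[abs_def])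

lemma integrable_Q: "integrable product_gaussian (\<lambda>\<xi>. Q (X \<xi>))"
  using integrable_mult_square_integrable[of "\<lambda>\<xi>. Q (X \<xi>)" product_gaussian "\<lambda>_. 1"] integrable_Q_sq by simp

text \<open>The product of the Hermite partial sums is an orthogonal projection of the product of
  the bumps, so their squared distance is a difference of two products of squared norms. It tends to
  0 by Parseval in each variable, and Q enters only through Cauchy-Schwarz.\<close>

lemma bump_pairing:
  assumes t: "\<And>j. t j > 0"
  shows "(\<lambda>K. \<Sum>\<mu>\<in>index_box M (\<lambda>_. K). hermite_coeff \<mu> * (\<Prod>j<M. hermite_coeff1 (bump z t n j) (\<mu> j)))
     \<longlonglongrightarrow> (\<integral>\<xi>. Q (X \<xi>) * (\<Prod>j<M. bump z t n j (\<xi> j)) \<partial>product_gaussian)"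
proof -
  let ?\<rho> = "\<lambda>j. bump z t n j" and ?q = "\<lambda>K j. hermite_partial_sum (bump z t n j) K"
  let ?F = "\<integral>\<xi>. (Q (X \<xi>))\<^sup>2 \<partial>product_gaussian"
  let ?I = "\<integral>\<xi>. Q (X \<xi>) * (\<Prod>j<M. ?\<rho> j (\<xi> j)) \<partial>product_gaussian"
  let ?S = "\<lambda>K. \<Sum>\<mu>\<in>index_box M (\<lambda>_. K). hermite_coeff \<mu> * (\<Prod>j<M. hermite_coeff1 (?\<rho> j) (\<mu> j))"
  let ?d = "\<lambda>K. (\<Prod>j<M. \<integral>x. (?\<rho> j x)\<^sup>2 \<partial>std_gaussian) - (\<Prod>j<M. \<Sum>m\<le>K. (hermite_coeff1 (?\<rho> j) m)\<^sup>2)"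
  have b: "\<bar>bump z t n j x\<bar> \<le> 1" for j x by (simp add: bump_nonneg bump_le_1)
  note mb = borel_measurable_bump
  have iH: "integrable product_gaussian (\<lambda>\<xi>. Q (X \<xi>) * (\<Prod>j<M. hermite_fun (\<mu> j) (\<xi> j)))" for \<mu>
  proof (rule integrable_mult_square_integrable[OF _ _ integrable_Q_sq])
    have "integrable product_gaussian (\<lambda>\<xi>. \<Prod>j<M. (hermite_fun (\<mu> j) (\<xi> j))\<^sup>2)"
      using product_gaussian_prod(1)[of "{..<M}" "\<lambda>j x. (hermite_fun (\<mu> j) x)\<^sup>2"]
        integrable_hermite_fun_mult by (simp add: power2_eq_square)
    then show "integrable product_gaussian (\<lambda>\<xi>. (\<Prod>j<M. hermite_fun (\<mu> j) (\<xi> j))\<^sup>2)"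
      by (simp add: prod_power_distrib)
  qed measurable
  have qS: "(\<integral>\<xi>. Q (X \<xi>) * (\<Prod>j<M. ?q K j (\<xi> j)) \<partial>product_gaussian) = ?S K" for K
  proof -
    have "(\<Prod>j<M. ?q K j (\<xi> j)) = (\<Sum>\<mu>\<in>index_box M (\<lambda>_. K). \<Prod>j<M. hermite_coeff1 (?\<rho> j) (\<mu> j) * hermite_fun (\<mu> j) (\<xi> j))" for \<xi> :: "nat \<Rightarrow> real"
      unfolding hermite_partial_sum_def by (rule sum_index_box_prod[symmetric])
    then have "(\<integral>\<xi>. Q (X \<xi>) * (\<Prod>j<M. ?q K j (\<xi> j)) \<partial>product_gaussian)
        = (\<integral>\<xi>. (\<Sum>\<mu>\<in>index_box M (\<lambda>_. K). (\<Prod>j<M. hermite_coeff1 (?\<rho> j) (\<mu> j)) * (Q (X \<xi>) * (\<Prod>j<M. hermite_fun (\<mu> j) (\<xi> j)))) \<partial>product_gaussian)"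
      by (simp add: sum_distrib_left prod.distrib mult_ac)
    also have "\<dots> = (\<Sum>\<mu>\<in>index_box M (\<lambda>_. K). (\<Prod>j<M. hermite_coeff1 (?\<rho> j) (\<mu> j)) * (\<integral>\<xi>. Q (X \<xi>) * (\<Prod>j<M. hermite_fun (\<mu> j) (\<xi> j)) \<partial>product_gaussian))"
      using iH by simp
    also have "\<dots> = ?S K"
    proof (intro sum.cong refl)
      fix \<mu> assume "\<mu> \<in> index_box M (\<lambda>_. K)"
      then have "multi_prod (\<lambda>j m. hermite_fun m (\<xi> j)) \<mu> = (\<Prod>j<M. hermite_fun (\<mu> j) (\<xi> j))" for \<xi> :: "nat \<Rightarrow> real"
        by (intro multi_prod_eq) (auto simp: index_box_def)
      then show "(\<Prod>j<M. hermite_coeff1 (?\<rho> j) (\<mu> j)) * (\<integral>\<xi>. Q (X \<xi>) * (\<Prod>j<M. hermite_fun (\<mu> j) (\<xi> j)) \<partial>product_gaussian)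
          = hermite_coeff \<mu> * (\<Prod>j<M. hermite_coeff1 (?\<rho> j) (\<mu> j))"
        by (simp add: hermite_coeff_def)
    qed
    finally show ?thesis .
  qed
  have bound: "(?I - ?S K)\<^sup>2 \<le> ?F * ?d K" for K
  proof -
    let ?u = "\<lambda>\<xi>::nat \<Rightarrow> real. \<Prod>j<M. ?\<rho> j (\<xi> j)" and ?v = "\<lambda>\<xi>::nat \<Rightarrow> real. \<Prod>j<M. ?q K j (\<xi> j)"
    have q: "?q K j x = poly (\<Sum>m\<le>K. smult (hermite_coeff1 (?\<rho> j) m / sqrt (fact m)) (hermite_poly m)) x" for j x
      by (rule hermite_partial_sum_poly)
    have i1: "integrable std_gaussian (\<lambda>x. (?\<rho> j x)\<^sup>2)" for j
      by (rule integrable_bounded_sq[OF mb b])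
    have i2: "integrable std_gaussian (\<lambda>x. ?\<rho> j x * ?q K j x)" for j
      unfolding q by (rule integrable_bounded_mult_poly[OF mb b])
    have i3: "integrable std_gaussian (\<lambda>x. (?q K j x)\<^sup>2)" for j
      unfolding q poly_power[symmetric] by (rule integrable_poly_std_gaussian)
    note p1 = product_gaussian_prod[of "{..<M}" "\<lambda>j x. (?\<rho> j x)\<^sup>2", OF finite_lessThan i1]
    note p2 = product_gaussian_prod[of "{..<M}" "\<lambda>j x. ?\<rho> j x * ?q K j x", OF finite_lessThan i2]
    note p3 = product_gaussian_prod[of "{..<M}" "\<lambda>j x. (?q K j x)\<^sup>2", OF finite_lessThan i3]
    have sq: "(?u \<xi> - ?v \<xi>)\<^sup>2 = (\<Prod>j<M. (?\<rho> j (\<xi> j))\<^sup>2) - 2 * (\<Prod>j<M. ?\<rho> j (\<xi> j) * ?q K j (\<xi> j)) + (\<Prod>j<M. (?q K j (\<xi> j))\<^sup>2)" for \<xi>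
      by (simp add: power2_diff prod_power_distrib prod.distrib)
    have int: "integrable product_gaussian (\<lambda>\<xi>. (?u \<xi> - ?v \<xi>)\<^sup>2)"
      unfolding sq using p1(1) p2(1) p3(1) by simp
    have "(\<integral>\<xi>. (?u \<xi> - ?v \<xi>)\<^sup>2 \<partial>product_gaussian) = ?d K"
      unfolding sq using p1 p2 p3
      by (simp add: integral_mult_hermite_partial_sum[OF mb b] integral_hermite_partial_sum_sq[OF mb b])
    moreover have "?I - ?S K = (\<integral>\<xi>. Q (X \<xi>) * (?u \<xi> - ?v \<xi>) \<partial>product_gaussian)"
    proof -
      have "integrable product_gaussian (\<lambda>\<xi>. Q (X \<xi>) * ?u \<xi>)"
        by (rule integrable_mult_square_integrable[OF _ _ integrable_Q_sq]) (use p1(1) in \<open>auto simp: prod_power_distrib\<close>)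
      moreover have "integrable product_gaussian (\<lambda>\<xi>. Q (X \<xi>) * ?v \<xi>)"
        by (rule integrable_mult_square_integrable[OF _ _ integrable_Q_sq]) (use p3(1) in \<open>auto simp: prod_power_distrib\<close>)
      ultimately show ?thesis unfolding qS[symmetric] right_diff_distrib
        by (rule Bochner_Integration.integral_diff[symmetric])
    qed
    moreover have "(\<integral>\<xi>. Q (X \<xi>) * (?u \<xi> - ?v \<xi>) \<partial>product_gaussian)\<^sup>2 \<le> ?F * (\<integral>\<xi>. (?u \<xi> - ?v \<xi>)\<^sup>2 \<partial>product_gaussian)"
      by (rule integral_Cauchy_Schwarz[OF _ _ integrable_Q_sq int]) measurable
    ultimately show ?thesis by simp
  qed
  have "?d \<longlonglongrightarrow> (\<Prod>j<M. \<integral>x. (?\<rho> j x)\<^sup>2 \<partial>std_gaussian) - (\<Prod>j<M. \<integral>x. (?\<rho> j x)\<^sup>2 \<partial>std_gaussian)"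
  proof (intro tendsto_intros)
    fix j
    obtain L where "\<And>x. \<bar>x\<bar> \<ge> L \<Longrightarrow> bump z t n j x = 0" using bump_bounded_support[of t z n j, OF t] by blast
    from hermite_parseval[OF mb b continuous_bump this]
    show "(\<lambda>K. \<Sum>m\<le>K. (hermite_coeff1 (?\<rho> j) m)\<^sup>2) \<longlonglongrightarrow> (\<integral>x. (?\<rho> j x)\<^sup>2 \<partial>std_gaussian)" .
  qed
  then have lim: "(\<lambda>K. ?F * ?d K) \<longlonglongrightarrow> 0" by (intro tendsto_mult_right_zero) simp
  have "(\<lambda>K. (?I - ?S K)\<^sup>2) \<longlonglongrightarrow> 0"
  proof (rule tendsto_sandwich[OF _ _ tendsto_const lim])
    show "\<forall>\<^sub>F K in sequentially. (?I - ?S K)\<^sup>2 \<le> ?F * ?d K" by (intro always_eventually allI bound)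
  qed simp
  from tendsto_real_sqrt[OF this] have "(\<lambda>K. \<bar>?I - ?S K\<bar>) \<longlonglongrightarrow> 0" by simp
  then have "(\<lambda>K. ?I - ?S K) \<longlonglongrightarrow> 0" by (rule tendsto_rabs_zero_cancel)
  then have "(\<lambda>K. ?I - (?I - ?S K)) \<longlonglongrightarrow> ?I - 0" by (intro tendsto_intros)
  then show ?thesis by simp
qed

text \<open>Parseval's identity turns radii in the single coordinates into a bound for the norm in
  X.\<close>

lemma norm_X_diff_le:
  assumes "summable (\<lambda>j. lam1 j * (u j)\<^sup>2)" "\<And>j. \<bar>\<xi> j - z j\<bar> \<le> u j" and z: "regular z"
  shows "(norm (X \<xi> - X z))\<^sup>2 \<le> (\<Sum>j. lam1 j * (u j)\<^sup>2)"
proof -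
  let ?d = "\<lambda>j. sqrt (lam1 j) * (\<xi> j - z j)"
  have dsq: "(?d j)\<^sup>2 = lam1 j * (\<xi> j - z j)\<^sup>2" for j
    using lam_pos[of j] by (simp add: power_mult_distrib less_imp_le)
  have le: "(?d j)\<^sup>2 \<le> lam1 j * (u j)\<^sup>2" for j
  proof -
    have "\<bar>\<xi> j - z j\<bar> \<le> \<bar>u j\<bar>" using assms(2)[of j] by linarith
    then show ?thesis unfolding dsq abs_le_square_iff using lam_pos[of j] by (intro mult_left_mono) auto
  qed
  have sm: "summable (\<lambda>j. (?d j)\<^sup>2)"
    by (rule summable_comparison_test'[OF assms(1)]) (use le in auto)
  have sd: "summable (\<lambda>j. ?d j *\<^sub>R \<psi>1 j)" by (rule summable_orthonormal[OF basis sm])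
  have "(\<lambda>j. (sqrt (lam1 j) * z j) *\<^sub>R \<psi>1 j + ?d j *\<^sub>R \<psi>1 j) sums
      ((\<Sum>j. (sqrt (lam1 j) * z j) *\<^sub>R \<psi>1 j) + (\<Sum>j. ?d j *\<^sub>R \<psi>1 j))"
    by (intro sums_add summable_sums regular_summable[OF z] sd)
  moreover have "(sqrt (lam1 j) * z j) *\<^sub>R \<psi>1 j + ?d j *\<^sub>R \<psi>1 j = (sqrt (lam1 j) * \<xi> j) *\<^sub>R \<psi>1 j" for j
    unfolding scaleR_add_left[symmetric] distrib_left[symmetric] by simp
  ultimately have "X \<xi> - X z = (\<Sum>j. ?d j *\<^sub>R \<psi>1 j)"
    by (simp add: kl_expansion_def sums_iff)
  then have "(X \<xi> - X z) \<bullet> \<psi>1 j = ?d j" for j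
    using inner_orthonormal_series[OF basis sd] by simp
  then have "(\<lambda>j. (?d j)\<^sup>2) sums (norm (X \<xi> - X z))\<^sup>2"
    using Parseval_inner[OF basis, of "X \<xi> - X z" "X \<xi> - X z"] by (simp add: power2_eq_square power2_norm_eq_inner[symmetric])
  then show ?thesis using le assms(1) by (intro sums_le[OF _ _ summable_sums]) auto
qed

lemma regular_finite_support:
  assumes "\<And>j. j \<ge> J \<Longrightarrow> z j = 0"
  shows "regular z"
  unfolding regular_def by (rule summable_finite[of "{..<J}"]) (use assms in auto)

text \<open>Both sides are compared with averages of Q over product bumps around z. Such an average
  is a Hermite series in which the value of each Hermite function at z j is replaced by its mean
  over the bump. As the bumps shrink, the series converges by dominated convergence, while the
  averages tend to Q at X z by continuity.\<close>

theorem hermite_expansion_pointwise: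
  assumes z: "\<And>j. j \<ge> J \<Longrightarrow> z j = 0"
  shows "integrable (count_space multi_indices) (\<lambda>\<mu>. hermite_coeff \<mu> * multi_prod (\<lambda>j m. hermite_fun m (z j)) \<mu>)"
    and "(\<integral>\<mu>. hermite_coeff \<mu> * multi_prod (\<lambda>j m. hermite_fun m (z j)) \<mu> \<partial>count_space multi_indices) = Q (X z)"
proof -
  obtain t \<epsilon> :: "nat \<Rightarrow> real" where t: "\<And>j. t j > 0" "summable (\<lambda>j. lam1 j * (t j)\<^sup>2)"
    and mass: "\<And>z n j. j \<ge> n \<Longrightarrow> bump_mass z t n j \<ge> 1 - \<epsilon> j"
    and \<epsilon>: "\<And>j. \<epsilon> j \<ge> 0" "\<And>M. (\<Sum>j<M. \<epsilon> j) \<le> 1 / 2"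
    using wide_radii_exist[OF a K less_imp_le[OF lam_pos] lam_decay] by blast
  have half: "bump_mass z t n j \<ge> 1 / 2" if "j \<ge> n" for n j
  proof -
    have "\<epsilon> j \<le> (\<Sum>i<Suc j. \<epsilon> i)" using \<epsilon>(1) by (intro member_le_sum) auto
    then have "\<epsilon> j \<le> 1 / 2" using \<epsilon>(2)[of "Suc j"] by linarith
    then show ?thesis using mass[OF that, of z] by linarith
  qed
  let ?Z = "\<lambda>n M. \<Prod>j<M. bump_mass z t n j"
  let ?D = "\<lambda>n M \<xi>. \<Prod>j<M. bump z t n j (\<xi> j)"
  have Zpos: "?Z n M > 0" for n M by (intro prod_pos bump_mass_pos t)
  \<comment> \<open>A lower bound for \<open>?Z n M\<close> that is uniform in M \<ge> n, as the
    plateaus lose at most half of the mass.\<close>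
  define zz where "zz n = (\<Prod>j<n. bump_mass z t n j) / 2" for n
  have zz: "zz n > 0" for n unfolding zz_def using Zpos[of n n] by simp
  have Zge: "?Z n M \<ge> zz n" if "M \<ge> n" for n M
  proof -
    have s: "{..<M} = {..<n} \<union> {n..<M}" using that by auto
    have "(\<Sum>j\<in>{n..<M}. 1 - bump_mass z t n j) \<le> (\<Sum>j\<in>{n..<M}. \<epsilon> j)"
    proof (rule sum_mono)
      fix j assume "j \<in> {n..<M}"
      then have "bump_mass z t n j \<ge> 1 - \<epsilon> j" by (intro mass) auto
      then show "1 - bump_mass z t n j \<le> \<epsilon> j" by linarith
    qed
    also have "\<dots> \<le> (\<Sum>j<M. \<epsilon> j)" using \<epsilon>(1) by (intro sum_mono2) auto
    also have "\<dots> \<le> 1 / 2" by (rule \<epsilon>(2))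
    finally have "1 / 2 \<le> 1 - (\<Sum>j\<in>{n..<M}. 1 - bump_mass z t n j)" by simp
    also have "\<dots> \<le> (\<Prod>j\<in>{n..<M}. bump_mass z t n j)"
      by (rule one_minus_sum_le_prod) (auto intro: less_imp_le[OF bump_mass_pos[OF t(1)]] bump_mass_le_1)
    finally have "(\<Prod>j<n. bump_mass z t n j) * (1 / 2) \<le> (\<Prod>j<n. bump_mass z t n j) * (\<Prod>j\<in>{n..<M}. bump_mass z t n j)"
      using Zpos[of n n] by (intro mult_left_mono) auto
    moreover have "?Z n M = (\<Prod>j<n. bump_mass z t n j) * (\<Prod>j\<in>{n..<M}. bump_mass z t n j)"
      unfolding s by (rule prod.union_disjoint) auto
    ultimately show ?thesis by (simp add: zz_def)
  qed
  define av where "av n M = (\<integral>\<xi>. Q (X \<xi>) * ?D n M \<xi> \<partial>product_gaussian) / ?Z n M" for n M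
  have D01: "0 \<le> ?D n M \<xi>" "?D n M \<xi> \<le> 1" for n M \<xi>
    by (auto intro!: prod_nonneg prod_le_1 bump_nonneg bump_le_1)
  have Dint: "integrable product_gaussian (?D n M)" "(\<integral>\<xi>. ?D n M \<xi> \<partial>product_gaussian) = ?Z n M" for n M
    using product_gaussian_prod[of "{..<M}" "\<lambda>j. bump z t n j"] integrable_bump by (auto simp: bump_mass_def)
  \<comment> \<open>For fixed n the variables beyond M are unconstrained, so closeness to Q at X z
    can be expected only for M large in dependence on n.\<close>
  have near: "\<exists>N. \<forall>n\<ge>N. \<exists>M\<ge>n. \<bar>av n M - Q (X z)\<bar> \<le> 2 * e" if e: "e > 0" for e
  proof -
    have "continuous_on UNIV Q"
      using frechet_derivatives_continuous[OF DQ, of "[]"] DQ by (simp add: frechet_derivatives_def)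
    then have "isCont Q (X z)" by (simp add: continuous_on_eq_continuous_at)
    then obtain \<delta> where \<delta>: "\<delta> > 0" "\<And>x. norm (x - X z) < \<delta> \<Longrightarrow> \<bar>Q x - Q (X z)\<bar> < e"
      unfolding continuous_at_eps_delta using e by (metis dist_norm real_norm_def)
    \<comment> \<open>The radius of the support in each coordinate; a plateau reaches out to 2 t
      j.\<close>
    define v where "v n j = (if j < n then 1 / real n else 2 * t j)" for n j
    have lv: "lam1 j * (v n j)\<^sup>2 \<le> lam1 j * (1 / (real n)\<^sup>2) + (if j < n then 0 else 4 * (lam1 j * (t j)\<^sup>2))" for n j
      using lam_pos[of j] by (simp add: v_def power_divide power_mult_distrib)
    have sm1: "summable (\<lambda>j. lam1 j * (1 / (real n)\<^sup>2))" for n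
      by (rule summable_mult2[OF lam_summable])
    have sm2: "summable (\<lambda>j. if j < n then 0 else 4 * (lam1 j * (t j)\<^sup>2))" for n
      by (rule summable_comparison_test'[OF summable_mult[OF t(2), of 4]]) (use lam_pos in \<open>auto simp: less_imp_le\<close>)
    have smv: "summable (\<lambda>j. lam1 j * (v n j)\<^sup>2)" for n
      by (rule summable_comparison_test'[OF summable_add[OF sm1[of n] sm2[of n]]]) (use lv lam_pos in \<open>auto simp: less_imp_le\<close>)
    \<comment> \<open>The part with 1 / n vanishes as n grows, and the plateaus contribute only the
      tail from n on of a convergent series.\<close>
    have small: "\<exists>N. \<forall>n\<ge>N. (\<Sum>j. lam1 j * (v n j)\<^sup>2) < \<delta>\<^sup>2"
    proof -
      have l1: "(\<lambda>n. suminf lam1 * (1 / (real n)\<^sup>2)) \<longlonglongrightarrow> 0"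
      proof (rule tendsto_mult_right_zero)
        show "(\<lambda>n. 1 / (real n)\<^sup>2) \<longlonglongrightarrow> 0" by real_asymp
      qed
      have l2: "(\<lambda>n. \<Sum>j. 4 * (lam1 (j + n) * (t (j + n))\<^sup>2)) \<longlonglongrightarrow> 0"
        by (rule suminf_exist_split2[OF summable_mult[OF t(2)]])
      have "(\<lambda>n. suminf lam1 * (1 / (real n)\<^sup>2) + (\<Sum>j. 4 * (lam1 (j + n) * (t (j + n))\<^sup>2))) \<longlonglongrightarrow> 0 + 0"
        by (intro tendsto_add l1 l2)
      then have "\<forall>\<^sub>F n in sequentially. suminf lam1 * (1 / (real n)\<^sup>2) + (\<Sum>j. 4 * (lam1 (j + n) * (t (j + n))\<^sup>2)) < \<delta>\<^sup>2"
        using \<delta>(1) by (intro order_tendstoD(2)) auto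
      then obtain N where N: "\<And>n. n \<ge> N \<Longrightarrow> suminf lam1 * (1 / (real n)\<^sup>2) + (\<Sum>j. 4 * (lam1 (j + n) * (t (j + n))\<^sup>2)) < \<delta>\<^sup>2"
        by (auto simp: eventually_at_top_linorder)
      have "(\<Sum>j. lam1 j * (v n j)\<^sup>2) \<le> suminf lam1 * (1 / (real n)\<^sup>2) + (\<Sum>j. 4 * (lam1 (j + n) * (t (j + n))\<^sup>2))" for n
      proof -
        have "(\<Sum>j. lam1 j * (v n j)\<^sup>2) \<le> (\<Sum>j. lam1 j * (1 / (real n)\<^sup>2) + (if j < n then 0 else 4 * (lam1 j * (t j)\<^sup>2)))"
          by (rule suminf_le[OF lv smv summable_add[OF sm1 sm2]])
        also have "\<dots> = (\<Sum>j. lam1 j * (1 / (real n)\<^sup>2)) + (\<Sum>j. if j < n then 0 else 4 * (lam1 j * (t j)\<^sup>2))"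
          by (rule suminf_add[OF sm1 sm2, symmetric])
        also have "(\<Sum>j. lam1 j * (1 / (real n)\<^sup>2)) = suminf lam1 * (1 / (real n)\<^sup>2)"
          by (rule suminf_mult2[OF lam_summable, symmetric])
        also have "(\<Sum>j. if j < n then 0 else 4 * (lam1 j * (t j)\<^sup>2)) = (\<Sum>j. 4 * (lam1 (j + n) * (t (j + n))\<^sup>2))"
          using suminf_split_initial_segment[OF sm2[of n], of n] by simp
        finally show ?thesis .
      qed
      then show ?thesis using N by (meson le_less_trans)
    qed
    then obtain N where N: "\<And>n. n \<ge> N \<Longrightarrow> (\<Sum>j. lam1 j * (v n j)\<^sup>2) < \<delta>\<^sup>2" by blast
    show ?thesis
    proof (rule exI[of _ "max N J"], intro allI impI)
      fix n assume n: "n \<ge> max N J"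
      \<comment> \<open>The sequences on which none of the infinitely many bumps vanishes; for them
        X \<xi> is within \<delta> of X z.\<close>
      define B where "B = {\<xi>. \<forall>j. bump z t n j (\<xi> j) \<noteq> 0}"
      have osc: "\<bar>Q (X \<xi>) - Q (X z)\<bar> \<le> e" if "\<xi> \<in> B" for \<xi>
      proof -
        have "\<bar>\<xi> j - z j\<bar> \<le> v n j" for j
          using that bump_tent_support[of j n z t "\<xi> j"] bump_wide_support[of n j t z "\<xi> j"] t(1) z[of j] n
          by (auto simp: B_def v_def not_less)
        from norm_X_diff_le[OF smv this regular_finite_support[of J z, OF z]]
        have "(norm (X \<xi> - X z))\<^sup>2 < \<delta>\<^sup>2" using N[of n] n by simp
        then have "norm (X \<xi> - X z) < \<delta>" using \<delta>(1) by (auto intro: power_less_imp_less_base)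
        then show ?thesis using \<delta>(2) by (simp add: less_imp_le)
      qed
      have mBs [measurable]: "B \<in> sets product_gaussian"
      proof -
        have "{\<xi> \<in> space product_gaussian. \<forall>j. bump z t n j (\<xi> j) \<noteq> 0} \<in> sets product_gaussian" by measurable
        then show ?thesis by (simp add: B_def)
      qed
      \<comment> \<open>The contribution from outside B. It tends to 0 as M grows, because each
        sequence outside B eventually meets a vanishing factor.\<close>
      let ?h = "\<lambda>M \<xi>. indicator (- B) \<xi> * (\<bar>Q (X \<xi>) - Q (X z)\<bar> * ?D n M \<xi>)"
      have mB: "indicator (- B) \<in> borel_measurable product_gaussian"
        using sets.compl_sets[OF mBs] unfolding space_product_gaussian Compl_eq_Diff_UNIV
        by (rule borel_measurable_indicator)
      note [measurable] = mB
      have iQ: "integrable product_gaussian (\<lambda>\<xi>. \<bar>Q (X \<xi>) - Q (X z)\<bar>)"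
        by (intro integrable_abs Bochner_Integration.integrable_diff integrable_Q) simp
      have ih: "integrable product_gaussian (?h M)" for M
        by (rule Bochner_Integration.integrable_bound[OF iQ])
          (measurable, auto intro!: AE_I2 mult_left_le simp: abs_mult D01 split: split_indicator)
      have "(\<lambda>M. \<integral>\<xi>. ?h M \<xi> \<partial>product_gaussian) \<longlonglongrightarrow> (\<integral>\<xi>. 0 \<partial>product_gaussian)"
      proof (rule integral_dominated_convergence[OF _ _ iQ])
        show "AE \<xi> in product_gaussian. (\<lambda>M. ?h M \<xi>) \<longlonglongrightarrow> 0"
        proof (rule AE_I2)
          fix \<xi> :: "nat \<Rightarrow> real"
          show "(\<lambda>M. ?h M \<xi>) \<longlonglongrightarrow> 0"
          proof (cases "\<xi> \<in> B")
            case False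
            then obtain j where j: "bump z t n j (\<xi> j) = 0" by (auto simp: B_def)
            have "?D n M \<xi> = 0" if "M \<ge> Suc j" for M
              using that j by (intro prod_zero bexI[of _ j]) auto
            then have "\<forall>\<^sub>F M in sequentially. ?h M \<xi> = 0"
              unfolding eventually_at_top_linorder by (intro exI[of _ "Suc j"]) auto
            then show ?thesis by (rule tendsto_eventually)
          qed simp
        qed
        show "AE \<xi> in product_gaussian. norm (?h M \<xi>) \<le> \<bar>Q (X \<xi>) - Q (X z)\<bar>" for M
          by (auto intro!: AE_I2 mult_left_le simp: abs_mult D01 split: split_indicator)
      qed measurable
      then have "\<forall>\<^sub>F M in sequentially. (\<integral>\<xi>. ?h M \<xi> \<partial>product_gaussian) < e * zz n"
        using zz[of n] e by (intro order_tendstoD(2)) auto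
      then obtain M0 where M0: "\<And>M. M \<ge> M0 \<Longrightarrow> (\<integral>\<xi>. ?h M \<xi> \<partial>product_gaussian) < e * zz n"
        by (auto simp: eventually_at_top_linorder)
      define M where "M = max n M0"
      have iD: "integrable product_gaussian (\<lambda>\<xi>. Q (X \<xi>) * ?D n M \<xi>)"
        by (rule Bochner_Integration.integrable_bound[OF integrable_abs[OF integrable_Q]])
          (measurable, auto intro!: AE_I2 mult_left_le simp: abs_mult D01)
      have av: "av n M - Q (X z) = (\<integral>\<xi>. Q (X \<xi>) * ?D n M \<xi> - Q (X z) * ?D n M \<xi> \<partial>product_gaussian) / ?Z n M"
      proof -
        have gen: "p / Z - q = (p - q * Z) / Z" if "Z > 0" for p q Z :: real using that by (simp add: field_simps)
        have "(\<integral>\<xi>. Q (X \<xi>) * ?D n M \<xi> - Q (X z) * ?D n M \<xi> \<partial>product_gaussian)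
            = (\<integral>\<xi>. Q (X \<xi>) * ?D n M \<xi> \<partial>product_gaussian) - Q (X z) * ?Z n M"
          using iD Dint by simp
        then show ?thesis unfolding av_def by (simp only: gen[OF Zpos])
      qed
      have "\<bar>av n M - Q (X z)\<bar> = \<bar>\<integral>\<xi>. Q (X \<xi>) * ?D n M \<xi> - Q (X z) * ?D n M \<xi> \<partial>product_gaussian\<bar> / ?Z n M"
        unfolding av abs_divide abs_of_pos[OF Zpos[of n M]] ..
      also have "\<dots> \<le> (e * ?Z n M + e * zz n) / ?Z n M"
      proof (rule divide_right_mono)
        have "\<bar>\<integral>\<xi>. Q (X \<xi>) * ?D n M \<xi> - Q (X z) * ?D n M \<xi> \<partial>product_gaussian\<bar>
            \<le> (\<integral>\<xi>. \<bar>Q (X \<xi>) * ?D n M \<xi> - Q (X z) * ?D n M \<xi>\<bar> \<partial>product_gaussian)"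
          by (rule integral_abs_bound)
        also have "\<dots> \<le> (\<integral>\<xi>. e * ?D n M \<xi> + ?h M \<xi> \<partial>product_gaussian)"
        proof (rule integral_mono)
          show "integrable product_gaussian (\<lambda>\<xi>. \<bar>Q (X \<xi>) * ?D n M \<xi> - Q (X z) * ?D n M \<xi>\<bar>)"
            using iD Dint by simp
          show "integrable product_gaussian (\<lambda>\<xi>. e * ?D n M \<xi> + ?h M \<xi>)"
            by (intro Bochner_Integration.integrable_add Bochner_Integration.integrable_mult_right Dint ih)
          fix \<xi> :: "nat \<Rightarrow> real"
          have D0: "0 \<le> ?D n M \<xi>" by (rule D01(1))
          have eq: "\<bar>Q (X \<xi>) * ?D n M \<xi> - Q (X z) * ?D n M \<xi>\<bar> = \<bar>Q (X \<xi>) - Q (X z)\<bar> * ?D n M \<xi>"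
            unfolding left_diff_distrib[symmetric] abs_mult by (simp only: abs_of_nonneg[OF D0])
          show "\<bar>Q (X \<xi>) * ?D n M \<xi> - Q (X z) * ?D n M \<xi>\<bar> \<le> e * ?D n M \<xi> + ?h M \<xi>"
          proof (cases "\<xi> \<in> B")
            case True
            then show ?thesis unfolding eq using mult_right_mono[OF osc[OF True] D0] by simp
          next
            case False
            then show ?thesis unfolding eq using mult_nonneg_nonneg[OF less_imp_le[OF e] D0] by simp
          qed
        qed
        also have "\<dots> = e * ?Z n M + (\<integral>\<xi>. ?h M \<xi> \<partial>product_gaussian)"
          using Dint ih by simp
        also have "\<dots> \<le> e * ?Z n M + e * zz n" using M0[of M] by (simp add: M_def)
        finally show "\<bar>\<integral>\<xi>. Q (X \<xi>) * ?D n M \<xi> - Q (X z) * ?D n M \<xi> \<partial>product_gaussian\<bar> \<le> e * ?Z n M + e * zz n" .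
      qed (use Zpos[of n M] in simp)
      also have "\<dots> \<le> (e * ?Z n M + e * ?Z n M) / ?Z n M"
        using Zpos[of n M] Zge[of n M] e
        by (intro divide_right_mono add_left_mono mult_left_mono) (auto simp: M_def)
      also have "\<dots> = 2 * e"
      proof -
        have "(e * Z + e * Z) / Z = 2 * e" if "Z > 0" for Z :: real using that by (simp add: field_simps)
        then show ?thesis using Zpos[of n M] by blast
      qed
      finally show "\<exists>M\<ge>n. \<bar>av n M - Q (X z)\<bar> \<le> 2 * e" by (intro exI[of _ M]) (auto simp: M_def)
    qed
  qed
  \<comment> \<open>One constant for all averages: 3 for the plateaus, the exponentials for tents in
    the first J variables. Later tents are centred at 0 and give exp (1 / 4), which is below
    3.\<close>
  define E where "E = 3 + (\<Sum>j<J. exp ((\<bar>z j\<bar> + 1)\<^sup>2 / 4))"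
  have E3: "E \<ge> 3" by (simp add: E_def sum_nonneg)
  have Ez: "exp ((\<bar>z j\<bar> + 1)\<^sup>2 / 4) \<le> E" for j
  proof (cases "j < J")
    case True
    then have "exp ((\<bar>z j\<bar> + 1)\<^sup>2 / 4) \<le> (\<Sum>j<J. exp ((\<bar>z j\<bar> + 1)\<^sup>2 / 4))" by (intro member_le_sum) auto
    then show ?thesis by (simp add: E_def)
  next
    case False
    then have "exp ((\<bar>z j\<bar> + 1)\<^sup>2 / 4) = exp (1 / 4)" using z[of j] by simp
    also have "\<dots> \<le> exp 1" by simp
    finally show ?thesis using exp_le E3 by linarith
  qed
  \<comment> \<open>From J on all bumps are symmetric, so the averages of odd Hermite functions
    vanish. This is the parity that the summability criterion asks for.\<close>
  define G where "G j m = (if m = 0 then 1 else if j \<ge> J \<and> odd m then 0 else 2 * (real m + 1) * E)" for j m :: nat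
  have intG: "integrable (count_space multi_indices) (\<lambda>\<mu>. \<bar>hermite_coeff \<mu>\<bar> * multi_prod G \<mu>)"
  proof (rule summable_coeff[where w = "\<lambda>_. 4 * E" and A = "\<lambda>_. 2 * E" and b = 1 and J = J])
    show "summable (\<lambda>j. lam1 j * (4 * E)\<^sup>2)" by (rule summable_mult2[OF lam_summable])
    show "G j m \<ge> 0" for j m using E3 by (auto simp: G_def)
    show "G j 0 = 1" for j by (simp add: G_def)
    show "G j m = 0" if "j \<ge> J" "odd m" for j m using that by (auto simp: G_def elim: oddE)
    show "G j m \<le> 2 * E * (real m + 1) ^ 1" for j m
      using E3 by (auto simp: G_def mult_ac)
    show "G j m \<le> (4 * E) ^ m" for j m
    proof (cases "m = 0")
      case False
      then obtain k where k: "m = Suc k" by (cases m) auto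
      have "2 * (real m + 1) * E \<le> 2 ^ m * 2 ^ m * E ^ m"
      proof (rule mult_mono)
        show "2 * (real m + 1) \<le> 2 ^ m * 2 ^ m" using Suc_le_two_power[of m]
          by (intro mult_mono) (auto simp: k)
        show "E \<le> E ^ m" using E3 power_increasing[of 1 m E] k by simp
      qed (use E3 in auto)
      also have "\<dots> = (4 * E) ^ m" unfolding power_mult_distrib[symmetric] by simp
      finally show ?thesis using E3 False by (auto simp: G_def)
    qed (simp add: G_def)
  qed
  have one: "bump_average z t n j 0 = 1" for n j by (rule bump_average_0[OF t(1)])
  have avG: "\<bar>bump_average z t n j m\<bar> \<le> G j m" for n j m
  proof (cases "m = 0")
    case True
    then show ?thesis using one[of n j] by (simp add: G_def)
  next
    case m: False
    show ?thesis
    proof (cases "j \<ge> J \<and> odd m")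
      case True
      then show ?thesis using bump_average_odd[of z j m t n] z[of j] m by (simp add: G_def)
    next
      case False
      then have G: "G j m = 2 * (real m + 1) * E" using m unfolding G_def by presburger
      show ?thesis
      proof (cases "j < n")
        case True
        have "\<bar>bump_average z t n j m\<bar> \<le> 2 * (real m + 1) * exp ((\<bar>z j\<bar> + 1)\<^sup>2 / 4)"
          by (rule bump_average_bound_tent[OF t(1) True])
        also have "\<dots> \<le> 2 * (real m + 1) * E" by (intro mult_left_mono Ez) auto
        finally show ?thesis by (simp only: G)
      next
        case False
        have "\<bar>bump_average z t n j m\<bar> \<le> 2 * (real m + 1) * 3"
          by (rule bump_average_bound_wide[OF t(1) half]) (use False in simp)
        also have "\<dots> \<le> 2 * (real m + 1) * E" by (intro mult_left_mono E3) auto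
        finally show ?thesis by (simp only: G)
      qed
    qed
  qed
  \<comment> \<open>An average over M variables sees only the indices supported in these
    variables.\<close>
  let ?b = "\<lambda>n M \<mu>. if \<forall>j\<ge>M. \<mu> j = 0 then hermite_coeff \<mu> * multi_prod (bump_average z t n) \<mu> else 0"
  have bG: "norm (?b n M \<mu>) \<le> \<bar>hermite_coeff \<mu>\<bar> * multi_prod G \<mu>" for n M \<mu>
  proof -
    have "\<bar>multi_prod (bump_average z t n) \<mu>\<bar> \<le> multi_prod G \<mu>"
      unfolding multi_prod_def abs_prod by (intro prod_mono) (auto intro: avG)
    moreover have "multi_prod G \<mu> \<ge> 0" by (rule multi_prod_nonneg) (use E3 in \<open>auto simp: G_def\<close>)
    ultimately show ?thesis by (auto simp: abs_mult intro: mult_left_mono)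
  qed
  have bint: "integrable (count_space multi_indices) (?b n M)" for n M
  proof (rule Bochner_Integration.integrable_bound[OF intG])
    show "AE \<mu> in count_space multi_indices. norm (?b n M \<mu>) \<le> norm (\<bar>hermite_coeff \<mu>\<bar> * multi_prod G \<mu>)"
      unfolding AE_count_space real_norm_def[of "_ * _"] by (intro ballI order.trans[OF bG abs_ge_self])
  qed simp
  have av_eq: "av n M = (\<integral>\<mu>. ?b n M \<mu> \<partial>count_space multi_indices)" for n M
  proof -
    have A: "(\<lambda>K. \<Sum>\<mu>\<in>index_box M (\<lambda>_. K). ?b n M \<mu>) \<longlonglongrightarrow> (\<integral>\<mu>. ?b n M \<mu> \<partial>count_space multi_indices)"
      by (rule sum_index_box_LIMSEQ[OF bint]) auto
    have B: "(\<Sum>\<mu>\<in>index_box M (\<lambda>_. K). ?b n M \<mu>)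
        = (\<Sum>\<mu>\<in>index_box M (\<lambda>_. K). hermite_coeff \<mu> * (\<Prod>j<M. hermite_coeff1 (bump z t n j) (\<mu> j))) / ?Z n M" for K
      unfolding sum_divide_distrib
    proof (intro sum.cong refl)
      fix \<mu> assume \<mu>: "\<mu> \<in> index_box M (\<lambda>_. K)"
      then have "multi_prod (bump_average z t n) \<mu> = (\<Prod>j<M. bump_average z t n j (\<mu> j))"
        by (intro multi_prod_eq one) (auto simp: index_box_def)
      also have "\<dots> = (\<Prod>j<M. hermite_coeff1 (bump z t n j) (\<mu> j)) / ?Z n M"
        by (simp add: bump_average_def prod_dividef)
      finally show "?b n M \<mu> = hermite_coeff \<mu> * (\<Prod>j<M. hermite_coeff1 (bump z t n j) (\<mu> j)) / ?Z n M"
        using \<mu> by (simp add: index_box_def)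
    qed
    have "(\<lambda>K. (\<Sum>\<mu>\<in>index_box M (\<lambda>_. K). hermite_coeff \<mu> * (\<Prod>j<M. hermite_coeff1 (bump z t n j) (\<mu> j))) / ?Z n M) \<longlonglongrightarrow> av n M"
      unfolding av_def by (intro tendsto_divide bump_pairing t tendsto_const less_imp_neq[OF Zpos, symmetric])
    then show ?thesis by (rule LIMSEQ_unique[OF _ A[unfolded B]])
  qed
  \<comment> \<open>The number of variables has to be fixed for each n independently of the
    tolerance, so some M is taken that nearly minimises the deviation. The summand 1 / (n + 1) keeps
    the threshold strictly above the infimum even when the infimum is 0.\<close>
  define Mn where "Mn n = (SOME M. M \<ge> n \<and> \<bar>av n M - Q (X z)\<bar> \<le> 2 * (INF M\<in>{n..}. \<bar>av n M - Q (X z)\<bar>) + 1 / real (Suc n))" for n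
  have Mn: "Mn n \<ge> n \<and> \<bar>av n (Mn n) - Q (X z)\<bar> \<le> 2 * (INF M\<in>{n..}. \<bar>av n M - Q (X z)\<bar>) + 1 / real (Suc n)" for n
  proof -
    let ?I = "INF M\<in>{n..}. \<bar>av n M - Q (X z)\<bar>"
    have I0: "?I \<ge> 0" by (rule cINF_greatest) auto
    have lt: "?I < 2 * ?I + 1 / real (Suc n)" using I0 by (simp add: add_nonneg_pos)
    have "\<exists>x\<in>(\<lambda>M. \<bar>av n M - Q (X z)\<bar>) ` {n..}. x < 2 * ?I + 1 / real (Suc n)"
      by (rule cInf_lessD[OF _ lt]) simp
    then obtain M where "M \<ge> n" "\<bar>av n M - Q (X z)\<bar> < 2 * ?I + 1 / real (Suc n)"
      by blast
    then have "\<exists>M. M \<ge> n \<and> \<bar>av n M - Q (X z)\<bar> \<le> 2 * ?I + 1 / real (Suc n)" by (intro exI[of _ M]) auto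
    then show ?thesis unfolding Mn_def by (rule someI_ex)
  qed
  have lim1: "(\<lambda>n. av n (Mn n)) \<longlonglongrightarrow> Q (X z)"
  proof (rule LIMSEQ_I)
    fix e :: real assume e: "e > 0"
    then obtain N where N: "\<And>n. n \<ge> N \<Longrightarrow> \<exists>M\<ge>n. \<bar>av n M - Q (X z)\<bar> \<le> 2 * (e / 8)"
      using near[of "e / 8"] by auto
    obtain N' :: nat where N': "real N' > 4 / e" using reals_Archimedean2 by blast
    show "\<exists>N. \<forall>n\<ge>N. norm (av n (Mn n) - Q (X z)) < e"
    proof (intro exI[of _ "max N N'"] allI impI)
      fix n assume n: "n \<ge> max N N'"
      then obtain M where M: "M \<ge> n" "\<bar>av n M - Q (X z)\<bar> \<le> 2 * (e / 8)" using N[of n] by auto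
      have "(INF M\<in>{n..}. \<bar>av n M - Q (X z)\<bar>) \<le> \<bar>av n M - Q (X z)\<bar>"
        using M(1) by (intro cINF_lower bdd_belowI2[of _ 0]) auto
      moreover have "1 / real (Suc n) < e / 4"
      proof -
        have "4 / e < real (Suc n)" using N' n by simp
        then show ?thesis using e by (simp add: field_simps)
      qed
      ultimately show "norm (av n (Mn n) - Q (X z)) < e" using Mn[of n] M(2) e unfolding real_norm_def by linarith
    qed
  qed
  let ?H = "\<lambda>\<mu>. hermite_coeff \<mu> * multi_prod (\<lambda>j m. hermite_fun m (z j)) \<mu>"
  have ptw: "(\<lambda>n. ?b n (Mn n) \<mu>) \<longlonglongrightarrow> ?H \<mu>" if \<mu>: "\<mu> \<in> multi_indices" for \<mu>
  proof -
    obtain M0 where M0: "\<And>j. j \<ge> M0 \<Longrightarrow> \<mu> j = 0" using multi_indices_bounded[OF \<mu>] by blast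
    have "(\<lambda>n. hermite_coeff \<mu> * multi_prod (bump_average z t n) \<mu>) \<longlonglongrightarrow> ?H \<mu>"
      unfolding multi_prod_def by (intro tendsto_mult tendsto_const tendsto_prod bump_average_LIMSEQ t)
    moreover have "\<forall>\<^sub>F n in sequentially. hermite_coeff \<mu> * multi_prod (bump_average z t n) \<mu> = ?b n (Mn n) \<mu>"
      unfolding eventually_at_top_linorder
    proof (intro exI[of _ M0] allI impI)
      fix n assume "n \<ge> M0"
      then have "\<forall>j\<ge>Mn n. \<mu> j = 0" using Mn[of n] M0 by (meson order.trans)
      then show "hermite_coeff \<mu> * multi_prod (bump_average z t n) \<mu> = ?b n (Mn n) \<mu>" by simp
    qed
    ultimately show ?thesis by (rule Lim_transform_eventually)
  qed
  have le: "norm (?H \<mu>) \<le> \<bar>hermite_coeff \<mu>\<bar> * multi_prod G \<mu>" if "\<mu> \<in> multi_indices" for \<mu>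
    by (rule LIMSEQ_le_const2[OF tendsto_norm[OF ptw[OF that]]]) (use bG in blast)
  show int: "integrable (count_space multi_indices) ?H"
  proof (rule Bochner_Integration.integrable_bound[OF intG])
    show "AE \<mu> in count_space multi_indices. norm (?H \<mu>) \<le> norm (\<bar>hermite_coeff \<mu>\<bar> * multi_prod G \<mu>)"
      unfolding AE_count_space by (intro ballI order.trans[OF le]) simp_all
  qed simp
  have "(\<lambda>n. \<integral>\<mu>. ?b n (Mn n) \<mu> \<partial>count_space multi_indices) \<longlonglongrightarrow> (\<integral>\<mu>. ?H \<mu> \<partial>count_space multi_indices)"
  proof (rule integral_dominated_convergence[OF _ _ intG])
    show "AE \<mu> in count_space multi_indices. (\<lambda>n. ?b n (Mn n) \<mu>) \<longlonglongrightarrow> ?H \<mu>"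
      unfolding AE_count_space by (intro ballI ptw)
    show "AE \<mu> in count_space multi_indices. norm (?b n (Mn n) \<mu>) \<le> \<bar>hermite_coeff \<mu>\<bar> * multi_prod G \<mu>" for n
      by (intro AE_I2 bG)
  qed simp_all
  then show "(\<integral>\<mu>. ?H \<mu> \<partial>count_space multi_indices) = Q (X z)"
    using lim1 unfolding av_eq by (rule LIMSEQ_unique)
qed

end

subsection \<open>The sparse quadrature of Hermite products\<close>

lemma gh_diff_scale: "gh_diff n (\<lambda>t. k * \<phi> t) = k * gh_diff n \<phi>"
  by (simp add: gh_diff_def gh_quad_def sum_distrib_left right_diff_distrib mult.left_commute)

text \<open>In the induction the constant c collects the differences of the variables already
  processed.\<close>

lemma fold_gh_diff_var_prod:
  fixes \<phi> :: "nat \<Rightarrow> real \<Rightarrow> real"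
  assumes "distinct js" "set js \<subseteq> A" "finite A"
  shows "fold (\<lambda>j. gh_diff_var (\<nu> j) j) js (\<lambda>\<xi>. c * (\<Prod>j\<in>A. \<phi> j (\<xi> j)))
    = (\<lambda>\<xi>. (c * (\<Prod>j\<in>set js. gh_diff (\<nu> j) (\<phi> j))) * (\<Prod>j\<in>A - set js. \<phi> j (\<xi> j)))"
  using assms
proof (induction js arbitrary: A c)
  case (Cons i js)
  have i: "i \<in> A" "i \<notin> set js" and fin: "finite A" using Cons.prems by auto
  have "gh_diff_var (\<nu> i) i (\<lambda>\<xi>. c * (\<Prod>j\<in>A. \<phi> j (\<xi> j)))
      = (\<lambda>\<xi>. (c * gh_diff (\<nu> i) (\<phi> i)) * (\<Prod>j\<in>A - {i}. \<phi> j (\<xi> j)))"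
  proof
    fix \<xi> :: "nat \<Rightarrow> real"
    have "c * (\<Prod>j\<in>A. \<phi> j ((\<xi>(i := t)) j)) = (c * (\<Prod>j\<in>A - {i}. \<phi> j (\<xi> j))) * \<phi> i t" for t
    proof -
      have "(\<Prod>j\<in>A. \<phi> j ((\<xi>(i := t)) j)) = \<phi> i t * (\<Prod>j\<in>A - {i}. \<phi> j ((\<xi>(i := t)) j))"
        using prod.remove[OF fin i(1), of "\<lambda>j. \<phi> j ((\<xi>(i := t)) j)"] by simp
      also have "(\<Prod>j\<in>A - {i}. \<phi> j ((\<xi>(i := t)) j)) = (\<Prod>j\<in>A - {i}. \<phi> j (\<xi> j))"
        by (intro prod.cong) auto
      finally show ?thesis by simp
    qed
    then show "gh_diff_var (\<nu> i) i (\<lambda>\<xi>. c * (\<Prod>j\<in>A. \<phi> j (\<xi> j))) \<xi>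
        = (c * gh_diff (\<nu> i) (\<phi> i)) * (\<Prod>j\<in>A - {i}. \<phi> j (\<xi> j))"
      unfolding gh_diff_var_def by (simp only: gh_diff_scale) simp
  qed
  moreover have "fold (\<lambda>j. gh_diff_var (\<nu> j) j) js (\<lambda>\<xi>. (c * gh_diff (\<nu> i) (\<phi> i)) * (\<Prod>j\<in>A - {i}. \<phi> j (\<xi> j)))
      = (\<lambda>\<xi>. ((c * gh_diff (\<nu> i) (\<phi> i)) * (\<Prod>j\<in>set js. gh_diff (\<nu> j) (\<phi> j))) * (\<Prod>j\<in>(A - {i}) - set js. \<phi> j (\<xi> j)))"
    using Cons.prems i by (intro Cons.IH) auto
  moreover have "(A - {i}) - set js = A - set (i # js)" by auto
  ultimately show ?case using i by (simp add: mult.assoc)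
qed simp

lemma tensor_diff_prod:
  assumes \<nu>: "\<And>j. j \<ge> M \<Longrightarrow> \<nu> j = 0"
  shows "tensor_diff \<nu> (\<lambda>\<xi>. \<Prod>j<M. \<phi> j (\<xi> j)) = (\<Prod>j<M. gh_diff (\<nu> j) (\<phi> j))"
proof -
  have sub: "{j. \<nu> j \<noteq> 0} \<subseteq> {..<M}" by (intro support_subset_lessThan \<nu>)
  then have fin: "finite {j. \<nu> j \<noteq> 0}" by (rule finite_subset) simp
  have "tensor_diff \<nu> (\<lambda>\<xi>. 1 * (\<Prod>j<M. \<phi> j (\<xi> j)))
      = (\<Prod>j | \<nu> j \<noteq> 0. gh_diff (\<nu> j) (\<phi> j)) * (\<Prod>j\<in>{..<M} - {j. \<nu> j \<noteq> 0}. \<phi> j 0)"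
    unfolding tensor_diff_def
    by (subst fold_gh_diff_var_prod) (use sub fin in auto)
  \<comment> \<open>Outside the support the rule is evaluation at 0, which is the difference of
    level 0.\<close>
  also have "(\<Prod>j\<in>{..<M} - {j. \<nu> j \<noteq> 0}. \<phi> j 0) = (\<Prod>j\<in>{..<M} - {j. \<nu> j \<noteq> 0}. gh_diff (\<nu> j) (\<phi> j))"
    by (intro prod.cong) (auto simp: gh_diff_0)
  also have "(\<Prod>j | \<nu> j \<noteq> 0. gh_diff (\<nu> j) (\<phi> j)) * \<dots> = (\<Prod>j<M. gh_diff (\<nu> j) (\<phi> j))"
    using prod.subset_diff[OF sub, of "\<lambda>j. gh_diff (\<nu> j) (\<phi> j)"] by (simp add: mult.commute)
  finally show ?thesis by simp
qed

abbreviation hermite_product :: "(nat \<Rightarrow> nat) \<Rightarrow> (nat \<Rightarrow> real) \<Rightarrow> real" where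
  "hermite_product \<mu> \<xi> \<equiv> multi_prod (\<lambda>j m. hermite_fun m (\<xi> j)) \<mu>"

lemma tensor_diff_hermite_product:
  assumes "\<And>j. j \<ge> M \<Longrightarrow> \<nu> j = 0" "\<And>j. j \<ge> M \<Longrightarrow> \<mu> j = 0"
  shows "tensor_diff \<nu> (hermite_product \<mu>) = (\<Prod>j<M. gh_diff (\<nu> j) (hermite_fun (\<mu> j)))"
proof -
  have "hermite_product \<mu> = (\<lambda>\<xi>. \<Prod>j<M. hermite_fun (\<mu> j) (\<xi> j))"
    by (intro ext multi_prod_eq assms) auto
  then show ?thesis using tensor_diff_prod[of M \<nu> "\<lambda>j. hermite_fun (\<mu> j)", OF assms(1)] by simp
qed

text \<open>A difference of level above \<mu> j kills the Hermite function, so only \<nu> \<le>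
  \<mu> contributes. If \<mu> belongs to the admissible set, this whole box is present and the
  differences telescope to a product of exact rules. In general the sum of absolute values over the
  box bounds whatever part of it is present.\<close>

lemma sparse_quad_hermite:
  assumes \<Lambda>: "finite \<Lambda>" "\<Lambda> \<subseteq> multi_indices" "admissible \<Lambda>" and \<mu>: "\<mu> \<in> multi_indices"
  shows sparse_quad_hermite_exact: "\<mu> \<in> \<Lambda> \<Longrightarrow> sparse_quad \<Lambda> (hermite_product \<mu>) = (if \<mu> = (\<lambda>_. 0) then 1 else 0)"
    and sparse_quad_hermite_bound: "\<bar>sparse_quad \<Lambda> (hermite_product \<mu>)\<bar> \<le> multi_prod (\<lambda>_. gh_diff_bound) \<mu>"
proof -
  obtain M K where MK: "insert \<mu> \<Lambda> \<subseteq> index_box M (\<lambda>_. K)"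
    using finite_multi_indices_in_box[of "insert \<mu> \<Lambda>" 0] \<Lambda> \<mu> by auto
  then have z: "\<nu> j = 0" if "\<nu> \<in> insert \<mu> \<Lambda>" "j \<ge> M" for \<nu> j using that by (auto simp: index_box_def)
  have td: "tensor_diff \<nu> (hermite_product \<mu>) = (\<Prod>j<M. gh_diff (\<nu> j) (hermite_fun (\<mu> j)))" if "\<nu> \<in> \<Lambda>" for \<nu>
    using that by (intro tensor_diff_hermite_product z) auto
  have vanish: "(\<Prod>j<M. gh_diff (\<nu> j) (hermite_fun (\<mu> j))) = 0" if "\<nu> \<in> \<Lambda>" "\<nu> \<notin> index_box M \<mu>" for \<nu>
  proof -
    have "\<exists>j<M. \<not> \<nu> j \<le> \<mu> j" using that z by (auto simp: index_box_def)
    then obtain j where "j < M" "\<nu> j > \<mu> j" by (auto simp: not_le)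
    then show ?thesis by (intro prod_zero bexI[of _ j]) (auto simp: gh_diff_hermite_eq_0)
  qed
  have sq: "sparse_quad \<Lambda> (hermite_product \<mu>) = (\<Sum>\<nu>\<in>\<Lambda> \<inter> index_box M \<mu>. \<Prod>j<M. gh_diff (\<nu> j) (hermite_fun (\<mu> j)))"
    unfolding sparse_quad_def using \<Lambda>(1) vanish by (intro sum.mono_neutral_cong_right) (auto simp: td)
  show "\<bar>sparse_quad \<Lambda> (hermite_product \<mu>)\<bar> \<le> multi_prod (\<lambda>_. gh_diff_bound) \<mu>"
  proof -
    have "\<bar>sparse_quad \<Lambda> (hermite_product \<mu>)\<bar> \<le> (\<Sum>\<nu>\<in>\<Lambda> \<inter> index_box M \<mu>. \<Prod>j<M. \<bar>gh_diff (\<nu> j) (hermite_fun (\<mu> j))\<bar>)"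
      unfolding sq abs_prod[symmetric] by (rule sum_abs)
    also have "\<dots> \<le> (\<Sum>\<nu>\<in>index_box M \<mu>. \<Prod>j<M. \<bar>gh_diff (\<nu> j) (hermite_fun (\<mu> j))\<bar>)"
      by (intro sum_mono2) (auto intro: prod_nonneg)
    also have "\<dots> = (\<Prod>j<M. gh_diff_bound (\<mu> j))"
      unfolding gh_diff_bound_def by (rule sum_index_box_prod)
    also have "\<dots> = multi_prod (\<lambda>_. gh_diff_bound) \<mu>"
      by (rule multi_prod_eq[symmetric]) (auto simp: z gh_diff_bound_0)
    finally show ?thesis .
  qed
  show "sparse_quad \<Lambda> (hermite_product \<mu>) = (if \<mu> = (\<lambda>_. 0) then 1 else 0)" if "\<mu> \<in> \<Lambda>"
  proof -
    have "\<nu> \<in> \<Lambda>" if \<nu>: "\<nu> \<in> index_box M \<mu>" for \<nu>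
    proof -
      have "\<nu> j \<le> \<mu> j" for j using \<nu> by (cases "j < M") (auto simp: index_box_def)
      moreover have "\<nu> \<in> multi_indices" using \<nu> index_box_subset_multi_indices by blast
      ultimately show ?thesis using \<Lambda>(3) \<open>\<mu> \<in> \<Lambda>\<close> unfolding admissible_def by blast
    qed
    then have "\<Lambda> \<inter> index_box M \<mu> = index_box M \<mu>" by auto
    then have "sparse_quad \<Lambda> (hermite_product \<mu>) = (\<Prod>j<M. \<Sum>n\<le>\<mu> j. gh_diff n (hermite_fun (\<mu> j)))"
      unfolding sq by (simp only:) (rule sum_index_box_prod)
    also have "\<dots> = (\<Prod>j<M. if \<mu> j = 0 then 1 else 0)"
      by (simp add: sum_gh_diff gh_quad_hermite_exact)
    also have "\<dots> = (if \<mu> = (\<lambda>_. 0) then 1 else 0)"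
    proof (cases "\<mu> = (\<lambda>_. 0)")
      case False
      then obtain j where j: "\<mu> j \<noteq> 0" by auto
      then have "j < M" using z[of \<mu> j] by (meson insertI1 not_le)
      then have "(\<Prod>j<M. if \<mu> j = 0 then 1 else (0::real)) = 0" using j by (intro prod_zero bexI[of _ j]) auto
      then show ?thesis using False by simp
    qed simp
    finally show ?thesis .
  qed
qed

text \<open>A tensor difference is a finite combination of evaluations at finitely supported points,
  so it commutes with the series as soon as the expansion holds at such points.\<close>

lemma tensor_diff_integral:
  fixes \<phi> :: "'b \<Rightarrow> (nat \<Rightarrow> real) \<Rightarrow> real"
  assumes P: "\<And>z. finite {j. z j \<noteq> 0} \<Longrightarrow> integrable M (\<lambda>\<mu>. \<phi> \<mu> z) \<and> g z = (\<integral>\<mu>. \<phi> \<mu> z \<partial>M)"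
  shows "integrable M (\<lambda>\<mu>. tensor_diff \<nu> (\<phi> \<mu>))" "tensor_diff \<nu> g = (\<integral>\<mu>. tensor_diff \<nu> (\<phi> \<mu>) \<partial>M)"
proof -
  have quad: "integrable M (\<lambda>\<mu>. gh_quad n (\<lambda>t. \<phi> \<mu> (z(j := t)))) \<and>
      gh_quad n (\<lambda>t. g (z(j := t))) = (\<integral>\<mu>. gh_quad n (\<lambda>t. \<phi> \<mu> (z(j := t))) \<partial>M)"
    if z: "finite {j. z j \<noteq> 0}"
      and P: "\<And>z. finite {j. z j \<noteq> 0} \<Longrightarrow> integrable M (\<lambda>\<mu>. \<phi> \<mu> z) \<and> g z = (\<integral>\<mu>. \<phi> \<mu> z \<partial>M)"
    for n j z g and \<phi> :: "'b \<Rightarrow> (nat \<Rightarrow> real) \<Rightarrow> real"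
  proof -
    have "finite {i. (z(j := t)) i \<noteq> 0}" for t
      by (rule finite_subset[of _ "insert j {j. z j \<noteq> 0}"]) (use z in auto)
    then have "integrable M (\<lambda>\<mu>. \<phi> \<mu> (z(j := t)))" "g (z(j := t)) = (\<integral>\<mu>. \<phi> \<mu> (z(j := t)) \<partial>M)" for t
      using P by blast+
    then show ?thesis unfolding gh_quad_def by simp
  qed
  have "\<forall>z. finite {j. z j \<noteq> 0} \<longrightarrow> integrable M (\<lambda>\<mu>. fold (\<lambda>j. gh_diff_var (\<nu> j) j) js (\<phi> \<mu>) z) \<and>
     fold (\<lambda>j. gh_diff_var (\<nu> j) j) js g z = (\<integral>\<mu>. fold (\<lambda>j. gh_diff_var (\<nu> j) j) js (\<phi> \<mu>) z \<partial>M)" for js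
    using P
  proof (induction js arbitrary: g \<phi>)
    case (Cons i js)
    have "integrable M (\<lambda>\<mu>. gh_diff_var (\<nu> i) i (\<phi> \<mu>) z) \<and>
        gh_diff_var (\<nu> i) i g z = (\<integral>\<mu>. gh_diff_var (\<nu> i) i (\<phi> \<mu>) z \<partial>M)" if "finite {j. z j \<noteq> 0}" for z
      using quad[where z = z and \<phi> = \<phi> and g = g and n = "\<nu> i" and j = i, OF that Cons.prems] quad[where z = z and \<phi> = \<phi> and g = g and n = "\<nu> i - 1" and j = i, OF that Cons.prems]
      by (cases "\<nu> i = 0") (auto simp: gh_diff_var_def gh_diff_def)
    from Cons.IH[where g = "gh_diff_var (\<nu> i) i g" and \<phi> = "\<lambda>\<mu>. gh_diff_var (\<nu> i) i (\<phi> \<mu>)", OF this]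
    show ?case by simp
  qed simp
  from this[of "sorted_list_of_set {j. \<nu> j \<noteq> 0}", THEN spec, of "\<lambda>_. 0"]
  show "integrable M (\<lambda>\<mu>. tensor_diff \<nu> (\<phi> \<mu>))" "tensor_diff \<nu> g = (\<integral>\<mu>. tensor_diff \<nu> (\<phi> \<mu>) \<partial>M)"
    by (simp_all add: tensor_diff_def)
qed

subsection \<open>The weights\<close>

text \<open>The factor of variable j in the weight, which is a product because the bound on the
  entries of the summation index acts on each variable separately.\<close>

definition weight_factor :: "real \<Rightarrow> (nat \<Rightarrow> real) \<Rightarrow> nat \<Rightarrow> nat \<Rightarrow> real" where
  "weight_factor q \<tau> j n = (\<Sum>l\<le>weight_order q. real (n choose l) * ((\<tau> j)\<^sup>2) ^ l)"

lemma weight_factor_0: "weight_factor q \<tau> j 0 = 1"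
proof -
  have "weight_factor q \<tau> j 0 = (\<Sum>l\<le>weight_order q. if l = 0 then 1 else 0)"
    unfolding weight_factor_def by (intro sum.cong) (auto simp: binomial_eq_0)
  then show ?thesis by simp
qed

lemma weight_factor_ge_1: "weight_factor q \<tau> j n \<ge> 1"
proof -
  have "(\<Sum>l\<in>{0}. real (n choose l) * ((\<tau> j)\<^sup>2) ^ l) \<le> weight_factor q \<tau> j n"
    unfolding weight_factor_def by (intro sum_mono2) auto
  then show ?thesis by simp
qed

lemma choose_mono_left: "m \<le> n \<Longrightarrow> (m choose l) \<le> (n choose l)"
proof (induction n rule: dec_induct)
  case (step n)
  have "(n choose l) \<le> (Suc n choose l)" by (cases l) auto
  then show ?case using step by linarith
qed simp

lemma weight_factor_mono: "m \<le> n \<Longrightarrow> weight_factor q \<tau> j m \<le> weight_factor q \<tau> j n"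
  unfolding weight_factor_def
  by (intro sum_mono mult_right_mono) (auto simp: choose_mono_left)

text \<open>Extension to the full binomial sum. It gives growth of the form \<open>w j ^ m\<close>,
  which the multinomial series for the later variables needs.\<close>

lemma weight_factor_le_power: "weight_factor q \<tau> j n \<le> (1 + (\<tau> j)\<^sup>2) ^ n"
proof -
  have "weight_factor q \<tau> j n \<le> (\<Sum>l\<le>max (weight_order q) n. real (n choose l) * ((\<tau> j)\<^sup>2) ^ l)"
    unfolding weight_factor_def by (intro sum_mono2) auto
  also have "\<dots> = (\<Sum>l\<le>n. real (n choose l) * ((\<tau> j)\<^sup>2) ^ l)"
    by (intro sum.mono_neutral_right) (auto simp: binomial_eq_0)
  also have "\<dots> = (1 + (\<tau> j)\<^sup>2) ^ n"
    using binomial_ring[of "(\<tau> j)\<^sup>2" 1 n] by (simp add: add.commute)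
  finally show ?thesis .
qed

text \<open>The truncation at \<open>weight_order q\<close> makes the growth in n polynomial, as the
  estimate in the first variables requires.\<close>

lemma weight_factor_le_poly:
  assumes "\<tau> j \<ge> 1"
  shows "weight_factor q \<tau> j n \<le> real (weight_order q + 1) * ((\<tau> j)\<^sup>2) ^ weight_order q * (real n + 1) ^ weight_order q"
proof -
  let ?r = "weight_order q"
  have "real (n choose l) * ((\<tau> j)\<^sup>2) ^ l \<le> (real n + 1) ^ ?r * ((\<tau> j)\<^sup>2) ^ ?r" if "l \<le> ?r" for l
  proof (intro mult_mono)
    have "real (n choose l) \<le> (real n + 1) ^ l"
    proof -
      have "(n choose l) \<le> n ^ l" by (cases "l \<le> n") (auto simp: binomial_le_pow binomial_eq_0)
      then have "real (n choose l) \<le> real (n ^ l)" by (simp only: of_nat_le_iff)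
      then have "real (n choose l) \<le> real n ^ l" by simp
      also have "\<dots> \<le> (real n + 1) ^ l" by (intro power_mono) auto
      finally show ?thesis .
    qed
    also have "\<dots> \<le> (real n + 1) ^ ?r" using that by (intro power_increasing) auto
    finally show "real (n choose l) \<le> (real n + 1) ^ ?r" .
    show "((\<tau> j)\<^sup>2) ^ l \<le> ((\<tau> j)\<^sup>2) ^ ?r" using that assms by (intro power_increasing) auto
  qed auto
  then have "weight_factor q \<tau> j n \<le> (\<Sum>l\<le>?r. (real n + 1) ^ ?r * ((\<tau> j)\<^sup>2) ^ ?r)"
    unfolding weight_factor_def by (intro sum_mono) auto
  then show ?thesis by (simp add: mult_ac)
qed

text \<open>The single term l = min n R already shows growth of order R in n together with one
  factor (\<tau> j)^2.\<close>

lemma weight_factor_ge: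
  assumes \<tau>: "\<tau> j \<ge> 1" and n: "n \<ge> 1" and R: "R \<ge> 1" "R \<le> weight_order q"
  shows "weight_factor q \<tau> j n \<ge> (\<tau> j)\<^sup>2 * ((real n + 1) / (real R + 1)) ^ R / fact R"
proof -
  let ?l = "min n R"
  have "((real n + 1) / (real R + 1)) ^ R \<le> fact n / fact (n - ?l)"
  proof -
    have "fact (n - ?l) / fact n \<le> ((real R + 1) / (real n + 1)) ^ R" by (rule fact_ratio_le)
    then show ?thesis by (simp add: power_divide field_simps)
  qed
  also have "\<dots> = real (n choose ?l) * fact ?l"
    using binomial_fact[of ?l n, where 'a = real] by simp
  also have "\<dots> \<le> real (n choose ?l) * fact R" by (intro mult_left_mono fact_mono) auto
  finally have 1: "((real n + 1) / (real R + 1)) ^ R / fact R \<le> real (n choose ?l)" by (simp add: field_simps)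
  have 2: "(\<tau> j)\<^sup>2 \<le> ((\<tau> j)\<^sup>2) ^ ?l" using \<tau> n R power_increasing[of 1 ?l "(\<tau> j)\<^sup>2"] by simp
  have "(\<tau> j)\<^sup>2 * ((real n + 1) / (real R + 1)) ^ R / fact R = ((real n + 1) / (real R + 1)) ^ R / fact R * (\<tau> j)\<^sup>2" by simp
  also have "\<dots> \<le> real (n choose ?l) * ((\<tau> j)\<^sup>2) ^ ?l" by (intro mult_mono 1 2) auto
  also have "\<dots> = (\<Sum>l\<in>{?l}. real (n choose l) * ((\<tau> j)\<^sup>2) ^ l)" by simp
  also have "\<dots> \<le> weight_factor q \<tau> j n"
    unfolding weight_factor_def using R by (intro sum_mono2) auto
  finally show ?thesis .
qed

lemma quad_weight_eq:
  assumes \<nu>: "\<nu> \<in> multi_indices"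
  shows "quad_weight q \<tau> \<nu> = multi_prod (weight_factor q \<tau>) \<nu>"
proof -
  let ?r = "weight_order q"
  let ?f = "\<lambda>\<mu>. real (multi_binomial \<nu> \<mu>) * multi_power (\<lambda>j. (\<tau> j)\<^sup>2) \<mu>"
  obtain M where M: "\<And>j. j \<ge> M \<Longrightarrow> \<nu> j = 0" using multi_indices_bounded[OF \<nu>] by blast
  have "quad_weight q \<tau> \<nu> = infsum ?f (index_box M (\<lambda>_. ?r))"
    unfolding quad_weight_def
  proof (rule infsum_cong_neutral)
    fix \<mu> assume \<mu>: "\<mu> \<in> {\<mu> \<in> multi_indices. \<forall>j. \<mu> j \<le> ?r} - index_box M (\<lambda>_. ?r)"
    then obtain j where j: "j \<ge> M" "\<mu> j \<noteq> 0" by (auto simp: index_box_def)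
    have "finite {j. \<mu> j \<noteq> 0}" "finite {j. \<nu> j \<noteq> 0}" using \<mu> \<nu> by (auto simp: multi_indices_def)
    then have "finite {j. \<nu> j \<noteq> 0 \<or> \<mu> j \<noteq> 0}" by (simp add: Collect_disj_eq)
    then have "multi_binomial \<nu> \<mu> = 0"
      unfolding multi_binomial_def using j M[of j] by (intro prod_zero bexI[of _ j]) (auto simp: binomial_eq_0)
    then show "?f \<mu> = 0" by simp
  next
    fix \<mu> assume \<mu>: "\<mu> \<in> index_box M (\<lambda>_. ?r) - {\<mu> \<in> multi_indices. \<forall>j. \<mu> j \<le> ?r}"
    then have "\<mu> \<in> multi_indices" using index_box_subset_multi_indices by blast
    moreover have "\<mu> j \<le> ?r" for j using \<mu> by (cases "j < M") (auto simp: index_box_def)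
    ultimately show "?f \<mu> = 0" using \<mu> by blast
  qed auto
  also have "\<dots> = (\<Sum>\<mu>\<in>index_box M (\<lambda>_. ?r). ?f \<mu>)" by (simp add: infsum_finite)
  also have "\<dots> = (\<Sum>\<mu>\<in>index_box M (\<lambda>_. ?r). \<Prod>j<M. real (\<nu> j choose \<mu> j) * ((\<tau> j)\<^sup>2) ^ \<mu> j)"
  proof (intro sum.cong refl)
    fix \<mu> assume \<mu>: "\<mu> \<in> index_box M (\<lambda>_. ?r)"
    then have \<mu>0: "\<And>j. j \<ge> M \<Longrightarrow> \<mu> j = 0" by (auto simp: index_box_def)
    have "{j. \<nu> j \<noteq> 0 \<or> \<mu> j \<noteq> 0} \<subseteq> {..<M}"
      using support_subset_lessThan[of M \<nu>, OF M] support_subset_lessThan[of M \<mu>, OF \<mu>0] by auto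
    then have "multi_binomial \<nu> \<mu> = (\<Prod>j<M. \<nu> j choose \<mu> j)"
      unfolding multi_binomial_def by (intro prod.mono_neutral_left) auto
    moreover have "multi_power (\<lambda>j. (\<tau> j)\<^sup>2) \<mu> = (\<Prod>j<M. ((\<tau> j)\<^sup>2) ^ \<mu> j)"
      unfolding multi_power_def using support_subset_lessThan[of M \<mu>, OF \<mu>0]
      by (intro prod.mono_neutral_left) auto
    ultimately show "?f \<mu> = (\<Prod>j<M. real (\<nu> j choose \<mu> j) * ((\<tau> j)\<^sup>2) ^ \<mu> j)"
      by (simp add: prod.distrib)
  qed
  also have "\<dots> = (\<Prod>j<M. weight_factor q \<tau> j (\<nu> j))"
    unfolding weight_factor_def by (rule sum_index_box_prod[of "\<lambda>j m. real (\<nu> j choose m) * ((\<tau> j)\<^sup>2) ^ m"])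
  also have "\<dots> = multi_prod (weight_factor q \<tau>) \<nu>"
    by (rule multi_prod_eq[symmetric]) (auto simp: M weight_factor_0)
  finally show ?thesis .
qed

lemma quad_weight_ge_1:
  assumes "\<nu> \<in> multi_indices"
  shows "quad_weight q \<tau> \<nu> \<ge> 1"
  unfolding quad_weight_eq[OF assms] multi_prod_def by (intro prod_ge_1) (auto intro: weight_factor_ge_1)

lemma quad_weight_mono:
  assumes \<nu>: "\<nu> \<in> multi_indices" and \<mu>: "\<mu> \<in> multi_indices" and le: "\<And>j. \<mu> j \<le> \<nu> j"
  shows "quad_weight q \<tau> \<mu> \<le> quad_weight q \<tau> \<nu>"
proof -
  obtain M where M: "\<And>j. j \<ge> M \<Longrightarrow> \<nu> j = 0" using multi_indices_bounded[OF \<nu>] by blast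
  then have M': "\<mu> j = 0" if "j \<ge> M" for j using le[of j] that by simp
  have "(\<Prod>j<M. weight_factor q \<tau> j (\<mu> j)) \<le> (\<Prod>j<M. weight_factor q \<tau> j (\<nu> j))"
    by (intro prod_mono conjI weight_factor_mono le order.trans[OF zero_le_one weight_factor_ge_1])
  then show ?thesis
    unfolding quad_weight_eq[OF \<nu>] quad_weight_eq[OF \<mu>]
    using multi_prod_eq[of M \<mu> "weight_factor q \<tau>"] multi_prod_eq[of M \<nu> "weight_factor q \<tau>"] M M'
    by (simp add: weight_factor_0)
qed

section \<open>Sets of indices with the smallest weights\<close>

lemma infinite_multi_indices: "infinite multi_indices"
proof
  assume "finite multi_indices"
  moreover have "range (\<lambda>j i. if i = j then 1 else 0 :: nat) \<subseteq> multi_indices"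
    by (auto simp: multi_indices_def)
  moreover have "inj (\<lambda>j i. if i = j then 1 else 0 :: nat)"
    by (rule injI) (metis zero_neq_one)
  ultimately show False using finite_subset finite_imageD infinite_UNIV_nat by metis
qed

text \<open>Among the indices with the smallest weights, those with small \<open>|\<nu>|\<close> are taken first; this
  keeps the sets admissible when weights coincide.\<close>

lemma smallest_weights_exist:
  fixes b :: "(nat \<Rightarrow> nat) \<Rightarrow> real"
  assumes fin: "\<And>T. finite {\<nu> \<in> multi_indices. b \<nu> \<le> T}"
    and mono: "\<And>\<nu> \<mu>. \<nu> \<in> multi_indices \<Longrightarrow> \<mu> \<in> multi_indices \<Longrightarrow> (\<And>j. \<mu> j \<le> \<nu> j) \<Longrightarrow> b \<mu> \<le> b \<nu>"
  shows "\<exists>\<Lambda>. \<Lambda> \<subseteq> multi_indices \<and> admissible \<Lambda> \<and> finite \<Lambda> \<and> card \<Lambda> = N \<and>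
    (\<forall>\<nu>\<in>\<Lambda>. \<forall>\<mu>\<in>multi_indices - \<Lambda>. b \<nu> \<le> b \<mu>)"
proof (induction N)
  case 0
  show ?case by (intro exI[of _ "{}"]) (auto simp: admissible_def)
next
  case (Suc N)
  then obtain \<Lambda> where \<Lambda>: "\<Lambda> \<subseteq> multi_indices" "admissible \<Lambda>" "finite \<Lambda>" "card \<Lambda> = N"
    "\<And>\<nu> \<mu>. \<nu> \<in> \<Lambda> \<Longrightarrow> \<mu> \<in> multi_indices - \<Lambda> \<Longrightarrow> b \<nu> \<le> b \<mu>" by blast
  let ?size = "\<lambda>\<nu>::nat \<Rightarrow> nat. \<Sum>j | \<nu> j \<noteq> 0. \<nu> j"
  obtain \<mu>' where \<mu>': "\<mu>' \<in> multi_indices - \<Lambda>"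
    using infinite_multi_indices \<Lambda>(3) by (metis all_not_in_conv finite.emptyI Diff_infinite_finite)
  \<comment> \<open>Comparison with one arbitrary index outside \<Lambda> confines the search to a
    finite set, so the minimum exists.\<close>
  define S where "S = {\<nu> \<in> multi_indices - \<Lambda>. b \<nu> \<le> b \<mu>'}"
  have S: "finite S" "S \<noteq> {}" unfolding S_def using fin[of "b \<mu>'"] \<mu>' by (auto intro: rev_finite_subset)
  define m where "m = Min (b ` S)"
  define S' where "S' = {\<nu> \<in> S. b \<nu> = m}"
  have "m \<in> b ` S" unfolding m_def using S by (intro Min_in) auto
  then have S': "finite S'" "S' \<noteq> {}" unfolding S'_def using S(1) by auto
  define \<mu>0 where "\<mu>0 = arg_min_on ?size S'"
  have \<mu>0: "\<mu>0 \<in> S'" "\<And>\<nu>. \<nu> \<in> S' \<Longrightarrow> ?size \<mu>0 \<le> ?size \<nu>"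
    unfolding \<mu>0_def using arg_min_if_finite(1)[OF S'] arg_min_least[OF S'] by auto
  have min: "b \<mu>0 \<le> b \<nu>" if "\<nu> \<in> multi_indices - \<Lambda>" for \<nu>
  proof (cases "\<nu> \<in> S")
    case True
    then have "m \<le> b \<nu>" unfolding m_def using S(1) by (intro Min_le) auto
    then show ?thesis using \<mu>0(1) by (simp add: S'_def)
  next
    case False
    then have "b \<mu>' \<le> b \<nu>" using that by (simp add: S_def)
    moreover have "b \<mu>0 \<le> b \<mu>'" using \<mu>0(1) by (simp add: S'_def S_def)
    ultimately show ?thesis by linarith
  qed
  have \<mu>0m: "\<mu>0 \<in> multi_indices" "\<mu>0 \<notin> \<Lambda>" using \<mu>0(1) by (auto simp: S'_def S_def)
  \<comment> \<open>A smaller index still missing would have the same minimal weight but a smaller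
    sum of entries, against the choice of \<mu>0.\<close>
  have below: "\<kappa> \<in> insert \<mu>0 \<Lambda>" if \<kappa>: "\<kappa> \<in> multi_indices" "\<And>j. \<kappa> j \<le> \<mu>0 j" for \<kappa>
  proof (rule ccontr)
    assume n: "\<kappa> \<notin> insert \<mu>0 \<Lambda>"
    then have "b \<kappa> = b \<mu>0" using mono[OF \<mu>0m(1) \<kappa>] min[of \<kappa>] \<kappa>(1) by auto
    then have "\<kappa> \<in> S'" using n \<kappa>(1) \<mu>0(1) by (auto simp: S'_def S_def)
    then have le: "?size \<mu>0 \<le> ?size \<kappa>" by (rule \<mu>0(2))
    obtain M where M: "\<And>j. j \<ge> M \<Longrightarrow> \<mu>0 j = 0" using multi_indices_bounded[OF \<mu>0m(1)] by blast
    then have M': "\<And>j. j \<ge> M \<Longrightarrow> \<kappa> j = 0" using \<kappa>(2) by (metis le_zero_eq)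
    have s: "?size \<nu> = (\<Sum>j<M. \<nu> j)" if "\<And>j. j \<ge> M \<Longrightarrow> \<nu> j = 0" for \<nu>
      by (rule sum.mono_neutral_left) (use support_subset_lessThan[of M \<nu>, OF that] in auto)
    obtain i where i: "\<kappa> i \<noteq> \<mu>0 i" using n by auto
    then have "i < M" using M[of i] M'[of i] by (metis not_le)
    then have "(\<Sum>j<M. \<kappa> j) < (\<Sum>j<M. \<mu>0 j)"
      using i \<kappa>(2) by (intro sum_strict_mono_ex1) (auto simp: le_less intro!: bexI[of _ i])
    then show False using le s[of \<kappa>, OF M'] s[of \<mu>0, OF M] by simp
  qed
  show ?case
  proof (intro exI[of _ "insert \<mu>0 \<Lambda>"] conjI)
    show "admissible (insert \<mu>0 \<Lambda>)"
      unfolding admissible_def using below \<Lambda>(2)[unfolded admissible_def] by blast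
    show "\<forall>\<nu>\<in>insert \<mu>0 \<Lambda>. \<forall>\<mu>\<in>multi_indices - insert \<mu>0 \<Lambda>. b \<nu> \<le> b \<mu>"
      using min \<Lambda>(5) by auto
  qed (use \<Lambda> \<mu>0m in auto)
qed

lemma tensor_diff_scale: "tensor_diff \<nu> (\<lambda>\<xi>. c * g \<xi>) = c * tensor_diff \<nu> g"
proof -
  have "fold (\<lambda>j. gh_diff_var (\<nu> j) j) js (\<lambda>\<xi>. c * g \<xi>) = (\<lambda>\<xi>. c * fold (\<lambda>j. gh_diff_var (\<nu> j) j) js g \<xi>)" for js
  proof (induction js arbitrary: g)
    case (Cons i js)
    have "gh_diff_var (\<nu> i) i (\<lambda>\<xi>. c * g \<xi>) = (\<lambda>\<xi>. c * gh_diff_var (\<nu> i) i g \<xi>)"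
      by (simp add: gh_diff_var_def gh_diff_scale)
    then show ?case using Cons[of "gh_diff_var (\<nu> i) i g"] by simp
  qed simp
  then show ?thesis by (simp add: tensor_diff_def)
qed

text \<open>For q = 1/2 the order exceeds 28. Order 8 is what the next estimate uses, since the
  power -1/4 turns it into the summable power -2.\<close>

lemma weight_order_half: "weight_order (1 / 2) \<ge> 8"
proof -
  have "real (weight_order (1 / 2)) > 14 / (1 / 2)"
    unfolding weight_order_def using reals_Archimedean2 by (rule LeastI_ex)
  then show ?thesis by simp
qed

lemma multi_prod_powr:
  assumes "\<And>j m. \<phi> j m \<ge> 0"
  shows "multi_prod (\<lambda>j m. \<phi> j m powr p) \<mu> = multi_prod \<phi> \<mu> powr p"
  unfolding multi_prod_def using assms by (intro prod_powr_distrib[symmetric])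

text \<open>For n \<ge> 1 one factor to the power -1/4 is at most a constant times (\<tau> j)^(-1/2)
  (n + 1)^(-2), so summability of (\<tau> j)^(-1/2) controls the product over all variables.\<close>

lemma quad_weight_powr_summable:
  assumes \<tau>: "\<And>j. \<tau> j \<ge> 1" and s: "summable (\<lambda>j. inverse (\<tau> j) powr (1 / 2))"
  shows "(\<lambda>\<nu>. quad_weight (1 / 2) \<tau> \<nu> powr (- (1 / 4))) summable_on multi_indices"
proof -
  let ?W = "weight_factor (1 / 2) \<tau>"
  obtain S where S: "\<And>K. (\<Sum>m\<le>K. 1 / (real m + 1)\<^sup>2) \<le> S" using sum_inverse_square_bound by blast
  have S0: "S \<ge> 0" using order.trans[OF sum_nonneg S, of 0] by simp
  \<comment> \<open>81 is 9^(8/4), with 9 = 8 + 1 coming from the lower bound of order 8.\<close>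
  define D :: real where "D = 81 * fact 8 powr (1 / 4)"
  have D0: "D \<ge> 0" by (simp add: D_def)
  define \<epsilon> where "\<epsilon> j = D * S * inverse (\<tau> j) powr (1 / 2)" for j
  have W0: "?W j n \<ge> 0" for j n using weight_factor_ge_1[of "1 / 2" \<tau> j n] by linarith
  have le: "?W j n powr (- (1 / 4)) \<le> D * inverse (\<tau> j) powr (1 / 2) * (1 / (real n + 1)\<^sup>2)" if n: "n \<ge> 1" for j n
  proof -
    have tp: "\<tau> j > 0" using \<tau>[of j] by linarith
    let ?x = "(real n + 1) / 9"
    have "(\<tau> j)\<^sup>2 * ((real n + 1) / (real 8 + 1)) ^ 8 / fact 8 \<le> ?W j n"
      by (rule weight_factor_ge[OF \<tau> n _ weight_order_half]) simp
    then have w: "(\<tau> j)\<^sup>2 * ?x ^ 8 / fact 8 \<le> ?W j n" by simp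
    have pos: "0 < (\<tau> j)\<^sup>2 * ?x ^ 8 / fact 8" using tp by simp
    have "?W j n powr (- (1 / 4)) \<le> ((\<tau> j)\<^sup>2 * ?x ^ 8 / fact 8) powr (- (1 / 4))"
      using w pos by (intro powr_mono2') auto
    also have "\<dots> = ((\<tau> j)\<^sup>2) powr (- (1 / 4)) * (?x ^ 8) powr (- (1 / 4)) / fact 8 powr (- (1 / 4))"
      using tp by (simp only: powr_divide powr_mult)
    also have "((\<tau> j)\<^sup>2) powr (- (1 / 4)) = inverse (\<tau> j) powr (1 / 2)"
    proof -
      have "(\<tau> j)\<^sup>2 = \<tau> j powr 2" using tp by simp
      then have "((\<tau> j)\<^sup>2) powr (- (1 / 4)) = \<tau> j powr (- (1 / 2))" by (simp only: powr_powr) simp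
      then show ?thesis using tp by (simp add: powr_minus inverse_powr)
    qed
    also have "(?x ^ 8) powr (- (1 / 4)) = 81 / (real n + 1)\<^sup>2"
    proof -
      have xp: "?x > 0" by simp
      have "?x ^ 8 = ?x powr 8" using xp by simp
      then have "(?x ^ 8) powr (- (1 / 4)) = ?x powr (- 2)" by (simp only: powr_powr) simp
      also have "\<dots> = inverse (?x\<^sup>2)" using xp by (simp add: powr_minus)
      also have "\<dots> = 81 / (real n + 1)\<^sup>2" by (simp add: power_divide)
      finally show ?thesis .
    qed
    also have "fact 8 powr (- (1 / 4)) = inverse ((fact 8 :: real) powr (1 / 4))" by (rule powr_minus)
    finally show ?thesis unfolding D_def by (simp only: divide_inverse inverse_inverse_eq mult_1 mult_ac)
  qed
  have "multi_prod (\<lambda>j n. ?W j n powr (- (1 / 4))) summable_on multi_indices"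
  proof (rule summable_on_multi_prod)
    show "(\<Sum>m\<le>K. ?W j m powr (- (1 / 4))) \<le> 1 + \<epsilon> j" for j K
    proof -
      let ?c = "D * inverse (\<tau> j) powr (1 / 2)"
      have c0: "?c \<ge> 0" using D0 by simp
      have "(\<Sum>m\<le>K. ?W j m powr (- (1 / 4))) \<le> (\<Sum>m\<le>K. (if m = 0 then 1 else 0) + ?c * (1 / (real m + 1)\<^sup>2))"
      proof (rule sum_mono)
        fix m
        show "?W j m powr (- (1 / 4)) \<le> (if m = 0 then 1 else 0) + ?c * (1 / (real m + 1)\<^sup>2)"
          using le[of m j] c0 by (cases "m = 0") (auto simp: weight_factor_0)
      qed
      also have "\<dots> = 1 + ?c * (\<Sum>m\<le>K. 1 / (real m + 1)\<^sup>2)" by (simp add: sum.distrib sum_distrib_left)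
      also have "\<dots> \<le> 1 + ?c * S" by (intro add_left_mono mult_left_mono S c0)
      finally show ?thesis by (simp add: \<epsilon>_def mult_ac)
    qed
    show "summable \<epsilon>" unfolding \<epsilon>_def by (rule summable_mult[OF s])
  qed (auto simp: weight_factor_0 \<epsilon>_def D0 S0)
  then show ?thesis
    by (rule summable_on_cong[THEN iffD1, rotated]) (simp add: quad_weight_eq multi_prod_powr W0)
qed

lemma gh_diff_bound_le_power: "gh_diff_bound m \<le> 32 ^ m"
proof (cases "m = 0")
  case False
  have "gh_diff_bound m \<le> 8 * (real m + 1)\<^sup>2" by (rule gh_diff_bound_le)
  also have "\<dots> \<le> 8 ^ m * (2 ^ m)\<^sup>2"
    using Suc_le_two_power[of m] False power_increasing[of 1 m "8::real"] by (intro mult_mono power_mono) auto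
  also have "\<dots> = (8 * 2 * 2) ^ m" unfolding power2_eq_square power_mult_distrib by simp
  finally show ?thesis by simp
qed (simp add: gh_diff_bound_0)

section \<open>Error of the sparse quadrature\<close>

context gaussian_functional_decay
begin

lemma hermite_coeff_0: "hermite_coeff (\<lambda>_. 0) = (\<integral>\<xi>. Q (X \<xi>) \<partial>product_gaussian)"
  by (simp add: hermite_coeff_def multi_prod_def)

lemma sparse_quad_expansion:
  assumes "finite \<Lambda>"
  shows "integrable (count_space multi_indices) (\<lambda>\<mu>. hermite_coeff \<mu> * sparse_quad \<Lambda> (hermite_product \<mu>))"
    and "sparse_quad \<Lambda> (\<lambda>\<xi>. Q (X \<xi>)) = (\<integral>\<mu>. hermite_coeff \<mu> * sparse_quad \<Lambda> (hermite_product \<mu>) \<partial>count_space multi_indices)"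
proof -
  have P: "integrable (count_space multi_indices) (\<lambda>\<mu>. hermite_coeff \<mu> * hermite_product \<mu> z) \<and>
      Q (X z) = (\<integral>\<mu>. hermite_coeff \<mu> * hermite_product \<mu> z \<partial>count_space multi_indices)"
    if "finite {j. z j \<noteq> 0}" for z
  proof -
    from iffD1[OF finite_nat_iff_bounded that] obtain J where J: "{j. z j \<noteq> 0} \<subseteq> {..<J}" ..
    have z: "z j = 0" if "j \<ge> J" for j
    proof (rule ccontr)
      assume "z j \<noteq> 0"
      then have "j < J" using J by blast
      then show False using that by simp
    qed
    from hermite_expansion_pointwise[of J z, OF z] show ?thesis by simp
  qed
  have td: "integrable (count_space multi_indices) (\<lambda>\<mu>. hermite_coeff \<mu> * tensor_diff \<nu> (hermite_product \<mu>))"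
    "tensor_diff \<nu> (\<lambda>\<xi>. Q (X \<xi>)) = (\<integral>\<mu>. hermite_coeff \<mu> * tensor_diff \<nu> (hermite_product \<mu>) \<partial>count_space multi_indices)" for \<nu>
    using tensor_diff_integral[of "count_space multi_indices" "\<lambda>\<mu> z. hermite_coeff \<mu> * hermite_product \<mu> z" "\<lambda>\<xi>. Q (X \<xi>)" \<nu>, OF P]
    by (simp_all only: tensor_diff_scale)
  show "integrable (count_space multi_indices) (\<lambda>\<mu>. hermite_coeff \<mu> * sparse_quad \<Lambda> (hermite_product \<mu>))"
    unfolding sparse_quad_def sum_distrib_left by (intro Bochner_Integration.integrable_sum td)
  show "sparse_quad \<Lambda> (\<lambda>\<xi>. Q (X \<xi>)) = (\<integral>\<mu>. hermite_coeff \<mu> * sparse_quad \<Lambda> (hermite_product \<mu>) \<partial>count_space multi_indices)"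
    unfolding sparse_quad_def sum_distrib_left td(2) by (rule Bochner_Integration.integral_sum[symmetric]) (rule td)
qed

text \<open>The expectation is the coefficient at 0, and 0 lies in every nonempty admissible set. As
  the rule is exact on the Hermite products with index in \<Lambda>, the error is a series over the
  remaining indices.\<close>

lemma sparse_quad_error_bound:
  assumes \<Lambda>: "finite \<Lambda>" "\<Lambda> \<subseteq> multi_indices" "admissible \<Lambda>" "\<Lambda> \<noteq> {}"
    and g: "integrable (count_space multi_indices) g"
    and le: "\<And>\<mu>. \<mu> \<in> multi_indices - \<Lambda> \<Longrightarrow> \<bar>hermite_coeff \<mu>\<bar> * multi_prod (\<lambda>_. gh_diff_bound) \<mu> \<le> g \<mu>"
    and g0: "\<And>\<mu>. g \<mu> \<ge> 0"
  shows "\<bar>(\<integral>\<xi>. Q (X \<xi>) \<partial>product_gaussian) - sparse_quad \<Lambda> (\<lambda>\<xi>. Q (X \<xi>))\<bar> \<le> (\<integral>\<mu>. g \<mu> \<partial>count_space multi_indices)"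
proof -
  let ?Z = "\<lambda>_::nat. 0 :: nat"
  let ?I = "\<lambda>\<mu>. indicator {?Z} \<mu> * hermite_coeff ?Z"
  let ?S = "\<lambda>\<mu>. hermite_coeff \<mu> * sparse_quad \<Lambda> (hermite_product \<mu>)"
  have Zm: "?Z \<in> multi_indices" by (simp add: multi_indices_def)
  have Z\<Lambda>: "?Z \<in> \<Lambda>"
  proof -
    obtain \<nu> where "\<nu> \<in> \<Lambda>" using \<Lambda>(4) by auto
    from \<Lambda>(3)[unfolded admissible_def, rule_format, OF this Zm] show ?thesis by simp
  qed
  have fin: "emeasure (count_space multi_indices) {?Z} = 1" using Zm by simp
  have I: "integrable (count_space multi_indices) ?I" "(\<integral>\<mu>. ?I \<mu> \<partial>count_space multi_indices) = hermite_coeff ?Z"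
  proof -
    have "integrable (count_space multi_indices) (indicator {?Z} :: _ \<Rightarrow> real)"
      using Zm fin by (intro integrable_real_indicator) auto
    then show "integrable (count_space multi_indices) ?I" by simp
    have "(\<integral>\<mu>. indicator {?Z} \<mu> \<partial>count_space multi_indices) = (1::real)"
      using Zm fin by (simp add: measure_def)
    then show "(\<integral>\<mu>. ?I \<mu> \<partial>count_space multi_indices) = hermite_coeff ?Z" by simp
  qed
  note S = sparse_quad_expansion[OF \<Lambda>(1)]
  have "(\<integral>\<xi>. Q (X \<xi>) \<partial>product_gaussian) - sparse_quad \<Lambda> (\<lambda>\<xi>. Q (X \<xi>)) = (\<integral>\<mu>. ?I \<mu> - ?S \<mu> \<partial>count_space multi_indices)"
    unfolding S(2) hermite_coeff_0[symmetric] using I S(1) by simp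
  also have "\<bar>(\<integral>\<mu>. ?I \<mu> - ?S \<mu> \<partial>count_space multi_indices)\<bar> \<le> (\<integral>\<mu>. \<bar>?I \<mu> - ?S \<mu>\<bar> \<partial>count_space multi_indices)"
    by (rule integral_abs_bound)
  also have "\<dots> \<le> (\<integral>\<mu>. g \<mu> \<partial>count_space multi_indices)"
  proof (rule integral_mono_AE)
    show "integrable (count_space multi_indices) (\<lambda>\<mu>. \<bar>?I \<mu> - ?S \<mu>\<bar>)" using I S by simp
    show "AE \<mu> in count_space multi_indices. \<bar>?I \<mu> - ?S \<mu>\<bar> \<le> g \<mu>"
      unfolding AE_count_space
    proof
      fix \<mu> assume \<mu>: "\<mu> \<in> multi_indices"
      show "\<bar>?I \<mu> - ?S \<mu>\<bar> \<le> g \<mu>"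
      proof (cases "\<mu> \<in> \<Lambda>")
        case True
        have "?I \<mu> - ?S \<mu> = 0"
          using sparse_quad_hermite_exact[OF \<Lambda>(1-3) \<mu> True] by (auto split: split_indicator)
        then show ?thesis using g0[of \<mu>] by simp
      next
        case False
        then have "\<mu> \<noteq> ?Z" using Z\<Lambda> by auto
        then have "\<bar>?I \<mu> - ?S \<mu>\<bar> = \<bar>hermite_coeff \<mu>\<bar> * \<bar>sparse_quad \<Lambda> (hermite_product \<mu>)\<bar>"
          by (simp add: abs_mult)
        also have "\<dots> \<le> \<bar>hermite_coeff \<mu>\<bar> * multi_prod (\<lambda>_. gh_diff_bound) \<mu>"
          by (intro mult_left_mono sparse_quad_hermite_bound[OF \<Lambda>(1-3) \<mu>]) auto
        also have "\<dots> \<le> g \<mu>" using le \<mu> False by simp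
        finally show ?thesis .
      qed
    qed
  qed (rule g)
  finally show ?thesis .
qed

text \<open>A counting argument: N indices of weight at most b force N b^(-1/4) \<le> S. If b is the
  weight of an index outside \<Lambda>, then 1 \<le> (S / N)^s b^(s/4), and inserting this factor
  into the error series leaves a convergent series that does not depend on N.\<close>

theorem sparse_quadrature_rate:
  assumes s: "s \<ge> 0" "2 * s < a - 1"
  shows "\<exists>\<tau> C'. (\<forall>j. 0 < \<tau> j) \<and> summable (\<lambda>j. inverse (\<tau> j) powr (1 / 2)) \<and> 0 \<le> C' \<and>
      (\<forall>N\<ge>1. \<exists>\<Lambda>. \<Lambda> \<subseteq> multi_indices \<and> admissible \<Lambda> \<and> finite \<Lambda> \<and> card \<Lambda> = N \<and>
        (\<forall>\<nu>\<in>\<Lambda>. \<forall>\<mu>\<in>multi_indices - \<Lambda>. quad_weight (1 / 2) \<tau> \<nu> \<le> quad_weight (1 / 2) \<tau> \<mu>) \<and>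
        \<bar>(\<integral>\<xi>. Q (X \<xi>) \<partial>product_gaussian) - sparse_quad \<Lambda> (\<lambda>\<xi>. Q (X \<xi>))\<bar> \<le> C' * (real N + 1) powr (- s))"
proof -
  \<comment> \<open>Any \<beta> > 2 with \<beta> s < a - 1 serves, and 2 s < a - 1 leaves room for
    it. The denominator uses s + 1 so that s = 0 is allowed.\<close>
  define \<beta> where "\<beta> = 2 + (a - 1 - 2 * s) / (2 * (s + 1))"
  have \<beta>2: "\<beta> > 2" using s by (simp add: \<beta>_def)
  have \<beta>s: "\<beta> * s < a - 1"
  proof -
    have "(a - 1 - 2 * s) * (s / (2 * (s + 1))) \<le> (a - 1 - 2 * s) * (1 / 2)"
      using s by (intro mult_left_mono) (auto simp: field_simps)
    then have "\<beta> * s \<le> 2 * s + (a - 1 - 2 * s) * (1 / 2)" by (simp add: \<beta>_def distrib_right)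
    also have "\<dots> = s + (a - 1) / 2" by (simp add: field_simps)
    also have "\<dots> < a - 1" using s(2) by (simp add: field_simps)
    finally show ?thesis .
  qed
  define \<tau> where "\<tau> j = real (Suc j) powr \<beta>" for j
  have \<tau>1: "\<tau> j \<ge> 1" for j unfolding \<tau>_def using \<beta>2 by (intro ge_one_powr_ge_zero) auto
  have \<tau>p: "\<tau> j > 0" for j using \<tau>1[of j] by linarith
  have \<tau>s: "summable (\<lambda>j. inverse (\<tau> j) powr (1 / 2))"
  proof -
    have "summable (\<lambda>j. real j powr (- (\<beta> / 2)))" using \<beta>2 by (simp add: summable_real_powr_iff)
    then have "summable (\<lambda>j. real (Suc j) powr (- (\<beta> / 2)))" by (subst summable_Suc_iff)
    moreover have "inverse (\<tau> j) powr (1 / 2) = real (Suc j) powr (- (\<beta> / 2))" for j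
      unfolding \<tau>_def powr_minus[symmetric] powr_powr by simp
    ultimately show ?thesis by simp
  qed
  define b where "b = quad_weight (1 / 2) \<tau>"
  let ?W = "weight_factor (1 / 2) \<tau>"
  have b1: "b \<nu> \<ge> 1" if "\<nu> \<in> multi_indices" for \<nu> unfolding b_def by (rule quad_weight_ge_1[OF that])
  have bW: "b \<nu> = multi_prod ?W \<nu>" if "\<nu> \<in> multi_indices" for \<nu> unfolding b_def by (rule quad_weight_eq[OF that])
  have W1: "?W j n \<ge> 1" for j n by (rule weight_factor_ge_1)
  have W0: "?W j n \<ge> 0" for j n using W1[of j n] by linarith
  have bs: "(\<lambda>\<nu>. b \<nu> powr (- (1 / 4))) summable_on multi_indices"
    unfolding b_def by (rule quad_weight_powr_summable[OF \<tau>1 \<tau>s])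
  \<comment> \<open>The summand 1 makes S positive, as N / S is formed later.\<close>
  define S where "S = infsum (\<lambda>\<nu>. b \<nu> powr (- (1 / 4))) multi_indices + 1"
  have S: "S > 0" unfolding S_def by (intro add_nonneg_pos infsum_nonneg) auto
  have count: "real (card F) * T powr (- (1 / 4)) \<le> S"
    if F: "finite F" "F \<subseteq> multi_indices" "\<And>\<nu>. \<nu> \<in> F \<Longrightarrow> b \<nu> \<le> T" for F T
  proof -
    have "real (card F) * T powr (- (1 / 4)) = (\<Sum>\<nu>\<in>F. T powr (- (1 / 4)))" by simp
    also have "\<dots> \<le> (\<Sum>\<nu>\<in>F. b \<nu> powr (- (1 / 4)))"
    proof (rule sum_mono)
      fix \<nu> assume "\<nu> \<in> F"
      then have "1 \<le> b \<nu>" "b \<nu> \<le> T" using b1 F by auto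
      then show "T powr (- (1 / 4)) \<le> b \<nu> powr (- (1 / 4))" by (intro powr_mono2') auto
    qed
    also have "\<dots> \<le> infsum (\<lambda>\<nu>. b \<nu> powr (- (1 / 4))) multi_indices"
      by (rule finite_sum_le_infsum[OF bs F(1,2)]) simp
    finally show ?thesis by (simp add: S_def)
  qed
  have fin: "finite {\<nu> \<in> multi_indices. b \<nu> \<le> T}" for T
  proof (rule ccontr)
    assume inf: "infinite {\<nu> \<in> multi_indices. b \<nu> \<le> T}"
    then obtain \<nu> where "\<nu> \<in> {\<nu> \<in> multi_indices. b \<nu> \<le> T}" by (metis all_not_in_conv finite.emptyI)
    then have T: "T \<ge> 1" using b1[of \<nu>] by auto
    obtain n :: nat where n: "real n > S * T powr (1 / 4)" using reals_Archimedean2 by blast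
    obtain F where F: "finite F" "card F = n" "F \<subseteq> {\<nu> \<in> multi_indices. b \<nu> \<le> T}"
      using infinite_arbitrarily_large[OF inf] by blast
    then have "real n * T powr (- (1 / 4)) \<le> S" using count[of F T] by auto
    then have "real n \<le> S * T powr (1 / 4)" using T by (simp add: powr_minus field_simps)
    then show False using n by simp
  qed
  \<comment> \<open>b^\<delta> is the s-th power of b^(1/4), the quantity that the counting argument
    bounds from below by N / S.\<close>
  define \<delta> where "\<delta> = s / 4"
  have \<delta>: "\<delta> \<ge> 0" using s by (simp add: \<delta>_def)
  \<comment> \<open>The polynomial growth bound needs an integer exponent.\<close>
  obtain D :: nat where D: "real D \<ge> \<delta>" using real_arch_simple by blast
  let ?r = "weight_order (1 / 2)"
  define G where "G j m = gh_diff_bound m * ?W j m powr \<delta>" for j m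
  define A where "A j = 8 * (real (?r + 1) * ((\<tau> j)\<^sup>2) ^ ?r) ^ D" for j
  \<comment> \<open>32 comes from the growth of the quadrature factor, the power of 1 + (\<tau> j)^2
    from the weight.\<close>
  define w where "w j = 32 * (1 + (\<tau> j)\<^sup>2) powr \<delta>" for j
  have G0: "G j m \<ge> 0" for j m by (simp add: G_def gh_diff_bound_nonneg)
  have intG: "integrable (count_space multi_indices) (\<lambda>\<mu>. \<bar>hermite_coeff \<mu>\<bar> * multi_prod G \<mu>)"
  proof (rule summable_coeff[where w = w and A = A and b = "2 + ?r * D" and J = 0])
    show "G j m \<ge> 0" for j m by (rule G0)
    show "G j 0 = 1" for j by (simp add: G_def gh_diff_bound_0 weight_factor_0)
    show "G j m = 0" if "odd m" for j m using that by (simp add: G_def gh_diff_bound_odd)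
    show "G j m \<le> A j * (real m + 1) ^ (2 + ?r * D)" for j m
    proof -
      have "?W j m powr \<delta> \<le> ?W j m powr real D" using D W1 by (intro powr_mono) auto
      also have "\<dots> = ?W j m ^ D" using W1[of j m] by (intro powr_realpow) linarith
      also have "\<dots> \<le> (real (?r + 1) * ((\<tau> j)\<^sup>2) ^ ?r * (real m + 1) ^ ?r) ^ D"
        by (intro power_mono weight_factor_le_poly \<tau>1 W0)
      finally have "G j m \<le> 8 * (real m + 1)\<^sup>2 * (real (?r + 1) * ((\<tau> j)\<^sup>2) ^ ?r * (real m + 1) ^ ?r) ^ D"
        unfolding G_def by (intro mult_mono gh_diff_bound_le) auto
      also have "\<dots> = A j * (real m + 1) ^ (2 + ?r * D)"
        unfolding A_def power_mult_distrib[of _ "(real m + 1) ^ ?r"] power_mult[symmetric] power_add by (simp only: mult_ac)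
      finally show ?thesis .
    qed
    show "G j m \<le> w j ^ m" for j m
    proof -
      have "?W j m powr \<delta> \<le> ((1 + (\<tau> j)\<^sup>2) ^ m) powr \<delta>"
        by (intro powr_mono2 \<delta> W0 weight_factor_le_power)
      also have "\<dots> = ((1 + (\<tau> j)\<^sup>2) powr \<delta>) ^ m"
      proof -
        have p: "1 + (\<tau> j)\<^sup>2 > 0" by (simp add: add_pos_nonneg)
        have "((1 + (\<tau> j)\<^sup>2) ^ m) powr \<delta> = (1 + (\<tau> j)\<^sup>2) powr (real m * \<delta>)"
          using p by (simp add: powr_realpow[symmetric] powr_powr)
        also have "\<dots> = ((1 + (\<tau> j)\<^sup>2) powr \<delta>) ^ m"
          using p by (simp add: powr_realpow[symmetric] powr_powr mult.commute)
        finally show ?thesis .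
      qed
      finally have "G j m \<le> 32 ^ m * ((1 + (\<tau> j)\<^sup>2) powr \<delta>) ^ m"
        unfolding G_def by (intro mult_mono gh_diff_bound_le_power) auto
      then show ?thesis by (simp only: w_def power_mult_distrib)
    qed
    show "summable (\<lambda>j. lam1 j * (w j)\<^sup>2)"
    proof (rule summable_comparison_test')
      let ?c = "K * (1024 * 2 powr (2 * \<delta>))"
      \<comment> \<open>Since \<delta> = s / 4, the square of w j grows like \<tau> j to the power 4
        \<delta> = s, that is like (j + 1)^(\<beta> s).\<close>
      have "- a + \<beta> * s < - 1" using \<beta>s by simp
      then have "summable (\<lambda>j. real j powr (- a + \<beta> * s))" by (simp add: summable_real_powr_iff)
      then have "summable (\<lambda>j. real (Suc j) powr (- a + \<beta> * s))" by (subst summable_Suc_iff)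
      then show "summable (\<lambda>j. ?c * real (Suc j) powr (- a + \<beta> * s))" by (rule summable_mult)
      fix j :: nat
      have "1 \<le> (\<tau> j)\<^sup>2" using \<tau>1[of j] by simp
      then have "(1 + (\<tau> j)\<^sup>2) powr \<delta> \<le> (2 * (\<tau> j)\<^sup>2) powr \<delta>" by (intro powr_mono2 \<delta>) auto
      then have "((1 + (\<tau> j)\<^sup>2) powr \<delta>)\<^sup>2 \<le> ((2 * (\<tau> j)\<^sup>2) powr \<delta>)\<^sup>2" by (rule power_mono) simp
      also have "\<dots> = (2 * (\<tau> j)\<^sup>2) powr (2 * \<delta>)" by (simp add: power2_eq_square powr_add[symmetric])
      also have "\<dots> = 2 powr (2 * \<delta>) * ((\<tau> j)\<^sup>2) powr (2 * \<delta>)" by (simp add: powr_mult)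
      also have "((\<tau> j)\<^sup>2) powr (2 * \<delta>) = real (Suc j) powr (\<beta> * s)"
      proof -
        have "(\<tau> j)\<^sup>2 = real (Suc j) powr (2 * \<beta>)" by (simp add: \<tau>_def power2_eq_square powr_add[symmetric])
        then show ?thesis by (simp only: powr_powr) (simp add: \<delta>_def)
      qed
      finally have "(w j)\<^sup>2 \<le> 1024 * (2 powr (2 * \<delta>) * real (Suc j) powr (\<beta> * s))"
        by (simp add: w_def power_mult_distrib)
      then have "lam1 j * (w j)\<^sup>2 \<le> (K * real (Suc j) powr (- a)) * (1024 * (2 powr (2 * \<delta>) * real (Suc j) powr (\<beta> * s)))"
        using lam_pos[of j] lam_decay[of j] by (intro mult_mono) auto
      also have "\<dots> = ?c * real (Suc j) powr (- a + \<beta> * s)" by (simp only: powr_add mult_ac)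
      finally have "lam1 j * (w j)\<^sup>2 \<le> ?c * real (Suc j) powr (- a + \<beta> * s)" .
      moreover have "norm (lam1 j * (w j)\<^sup>2) = lam1 j * (w j)\<^sup>2" using lam_pos[of j] by simp
      ultimately show "norm (lam1 j * (w j)\<^sup>2) \<le> ?c * real (Suc j) powr (- a + \<beta> * s)" by simp
    qed
  qed
  define B where "B = (\<integral>\<mu>. \<bar>hermite_coeff \<mu>\<bar> * multi_prod G \<mu> \<partial>count_space multi_indices)"
  have hG: "\<bar>hermite_coeff \<mu>\<bar> * multi_prod G \<mu> \<ge> 0" for \<mu>
    by (intro mult_nonneg_nonneg multi_prod_nonneg G0) simp
  have B0: "B \<ge> 0" unfolding B_def by (intro Bochner_Integration.integral_nonneg hG)
  define C' where "C' = (2 * S) powr s * B"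
  have C'0: "C' \<ge> 0" using B0 by (simp add: C'_def)
  show ?thesis
  proof (rule exI[of _ \<tau>], rule exI[of _ C'], intro conjI allI impI)
    show "0 < \<tau> j" for j by (rule \<tau>p)
    show "summable (\<lambda>j. inverse (\<tau> j) powr (1 / 2))" by (rule \<tau>s)
    show "0 \<le> C'" by (rule C'0)
    fix N :: nat assume N: "1 \<le> N"
    obtain \<Lambda> where \<Lambda>: "\<Lambda> \<subseteq> multi_indices" "admissible \<Lambda>" "finite \<Lambda>" "card \<Lambda> = N"
      "\<forall>\<nu>\<in>\<Lambda>. \<forall>\<mu>\<in>multi_indices - \<Lambda>. b \<nu> \<le> b \<mu>"
      using smallest_weights_exist[of b N, OF fin] quad_weight_mono unfolding b_def by blast
    have ne: "\<Lambda> \<noteq> {}" using \<Lambda>(4) N by auto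
    let ?g = "\<lambda>\<mu>. (S / real N) powr s * (\<bar>hermite_coeff \<mu>\<bar> * multi_prod G \<mu>)"
    have "\<bar>(\<integral>\<xi>. Q (X \<xi>) \<partial>product_gaussian) - sparse_quad \<Lambda> (\<lambda>\<xi>. Q (X \<xi>))\<bar> \<le> (\<integral>\<mu>. ?g \<mu> \<partial>count_space multi_indices)"
    proof (rule sparse_quad_error_bound[OF \<Lambda>(3,1,2) ne])
      show "integrable (count_space multi_indices) ?g" using intG by simp
      show "?g \<mu> \<ge> 0" for \<mu> by (intro mult_nonneg_nonneg hG) simp
      fix \<mu> assume \<mu>: "\<mu> \<in> multi_indices - \<Lambda>"
      let ?P = "multi_prod (\<lambda>_. gh_diff_bound) \<mu>"
      have P0: "?P \<ge> 0" by (intro multi_prod_nonneg gh_diff_bound_nonneg)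
      have bp: "b \<mu> \<ge> 1" using b1 \<mu> by auto
      have GP: "multi_prod G \<mu> = ?P * b \<mu> powr \<delta>"
      proof -
        have "multi_prod G \<mu> = ?P * multi_prod (\<lambda>j m. ?W j m powr \<delta>) \<mu>"
          by (simp add: multi_prod_def G_def prod.distrib)
        also have "multi_prod (\<lambda>j m. ?W j m powr \<delta>) \<mu> = b \<mu> powr \<delta>"
          using \<mu> by (simp add: bW multi_prod_powr W0)
        finally show ?thesis .
      qed
      have "real N * b \<mu> powr (- (1 / 4)) \<le> S"
        using count[OF \<Lambda>(3,1), of "b \<mu>"] \<Lambda>(4,5) \<mu> by blast
      then have "real N / S \<le> b \<mu> powr (1 / 4)"
        using S bp by (simp add: powr_minus field_simps)
      then have "(real N / S) powr s \<le> (b \<mu> powr (1 / 4)) powr s"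
        using s S by (intro powr_mono2) auto
      also have "\<dots> = b \<mu> powr \<delta>" by (simp add: powr_powr \<delta>_def)
      finally have "(S / real N) powr s * (real N / S) powr s \<le> (S / real N) powr s * b \<mu> powr \<delta>"
        by (rule mult_left_mono) simp
      moreover have "(S / real N) powr s * (real N / S) powr s = 1"
        using S N by (simp add: powr_mult[symmetric])
      ultimately have one: "1 \<le> (S / real N) powr s * b \<mu> powr \<delta>" by simp
      have "\<bar>hermite_coeff \<mu>\<bar> * ?P * 1 \<le> \<bar>hermite_coeff \<mu>\<bar> * ?P * ((S / real N) powr s * b \<mu> powr \<delta>)"
        by (rule mult_left_mono[OF one]) (use P0 in simp)
      then show "\<bar>hermite_coeff \<mu>\<bar> * ?P \<le> ?g \<mu>" unfolding GP by (simp add: mult_ac)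
    qed
    also have "\<dots> = (S / real N) powr s * B" by (simp add: B_def)
    also have "\<dots> \<le> ((2 * S) powr s * (real N + 1) powr (- s)) * B"
    proof (rule mult_right_mono[OF _ B0])
      \<comment> \<open>N + 1 \<le> 2 N, whence the constant (2 S)^s.\<close>
      have "S / real N \<le> 2 * S / (real N + 1)" using N S by (simp add: field_simps)
      then have "(S / real N) powr s \<le> (2 * S / (real N + 1)) powr s" using s S by (intro powr_mono2) auto
      also have "\<dots> = (2 * S) powr s * (real N + 1) powr (- s)"
        by (simp only: powr_divide powr_minus) (simp only: divide_inverse)
      finally show "(S / real N) powr s \<le> (2 * S) powr s * (real N + 1) powr (- s)" .
    qed
    also have "\<dots> = C' * (real N + 1) powr (- s)" by (simp add: C'_def mult_ac)
    finally have "\<bar>(\<integral>\<xi>. Q (X \<xi>) \<partial>product_gaussian) - sparse_quad \<Lambda> (\<lambda>\<xi>. Q (X \<xi>))\<bar> \<le> C' * (real N + 1) powr (- s)" .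
    then show "\<exists>\<Lambda>. \<Lambda> \<subseteq> multi_indices \<and> admissible \<Lambda> \<and> finite \<Lambda> \<and> card \<Lambda> = N \<and>
        (\<forall>\<nu>\<in>\<Lambda>. \<forall>\<mu>\<in>multi_indices - \<Lambda>. quad_weight (1 / 2) \<tau> \<nu> \<le> quad_weight (1 / 2) \<tau> \<mu>) \<and>
        \<bar>(\<integral>\<xi>. Q (X \<xi>) \<partial>product_gaussian) - sparse_quad \<Lambda> (\<lambda>\<xi>. Q (X \<xi>))\<bar> \<le> C' * (real N + 1) powr (- s)"
      using \<Lambda> unfolding b_def by blast
  qed
qed

end

section \<open>From the posterior covariance to the quadrature rate\<close>

theorem theorem4p5:
  fixes d :: nat and \<alpha> :: real
    and domA :: "'a::{real_inner, banach, second_countable_topology} set"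
    and A :: "'a \<Rightarrow> 'a" and lam :: "nat \<Rightarrow> real" and \<psi> :: "nat \<Rightarrow> 'a"
    and prior :: "'a measure" and m0 m1 :: 'a and C0 C1 H :: "'a \<Rightarrow> 'a"
    and \<G> :: "'a \<Rightarrow> 'y::{banach, second_countable_topology}" and y :: 'y
    and noise :: "'y measure" and \<Gamma> :: "('y \<Rightarrow>\<^sub>L real) \<Rightarrow> 'y"
    and lam1 :: "nat \<Rightarrow> real" and \<psi>1 :: "nat \<Rightarrow> 'a"
    and Q :: "'a \<Rightarrow> real" and DQ :: "'a \<Rightarrow> 'a list \<Rightarrow> real" and C :: real
  assumes d: "d \<in> {1, 2, 3}"
    and A: "laplacian_like d domA A lam \<psi>"
    and \<alpha>: "\<alpha> > real d / 2"
    and C0: "C0 = spectral_power lam \<psi> (- \<alpha>)"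
    and prior: "gaussian_hilbert prior m0 C0"
    and noise: "gaussian_banach noise \<Gamma>" "inj \<Gamma>" "\<And>m. y - \<G> m \<in> range \<Gamma>"
    and m1: "is_MAP_point (neg_log_likelihood \<Gamma> \<G> y) (spectral_power lam \<psi> (- \<alpha> / 2)) m0 m1"
    and H: "is_hessian (neg_log_likelihood \<Gamma> \<G> y) m1 H"
    and C1: "is_posterior_covariance C0 H C1"
      "self_adjoint_on UNIV C1" "positive_definite_on UNIV C1"
      "compact_operator C1" "positive_trace_class C1"
    and eigen: "orthonormal_basis \<psi>1" "\<And>j. C1 (\<psi>1 j) = lam1 j *\<^sub>R \<psi>1 j" "decseq lam1"
    and DQ: "frechet_derivatives Q DQ"
    and bound: "\<And>k js. length js = k \<Longrightarrow>
      (\<integral>\<^sup>+ \<xi>. ennreal (\<bar>DQ (kl_expansion m1 lam1 \<psi>1 \<xi>) (map \<psi>1 js)\<bar>\<^sup>2) \<partial>product_gaussian)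
        < ennreal (C * fact k)"
  shows "\<forall>s < \<alpha> / real d - 1.
    \<exists>q \<tau> C'. 0 < q \<and> q < 1 \<and> (\<forall>j. 0 < \<tau> j) \<and> summable (\<lambda>j. inverse (\<tau> j) powr q) \<and>
      (\<forall>N\<ge>1. \<exists>\<Lambda>. \<Lambda> \<subseteq> multi_indices \<and> admissible \<Lambda> \<and> finite \<Lambda> \<and> card \<Lambda> = N \<and>
        (\<forall>\<nu>\<in>\<Lambda>. \<forall>\<mu>\<in>multi_indices - \<Lambda>. quad_weight q \<tau> \<nu> \<le> quad_weight q \<tau> \<mu>) \<and>
        \<bar>(\<integral>\<xi>. Q (kl_expansion m1 lam1 \<psi>1 \<xi>) \<partial>product_gaussian)
           - sparse_quad \<Lambda> (\<lambda>\<xi>. Q (kl_expansion m1 lam1 \<psi>1 \<xi>))\<bar>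
          \<le> C' * (real N + 1) powr (- s))"
proof (intro allI impI)
  fix s :: real assume s: "s < \<alpha> / real d - 1"
  have d0: "d > 0" using d by auto
  then have \<alpha>0: "\<alpha> > 0" using \<alpha> by (auto intro: le_less_trans[of 0 "real d / 2"])
  \<comment> \<open>The decay exponent of the posterior eigenvalues; it exceeds 1, so they are
    summable.\<close>
  define a where "a = 2 * \<alpha> / real d"
  have a1: "a > 1" using \<alpha> d0 by (simp add: a_def field_simps)
  have H': "bounded_linear H" using H by (simp add: is_hessian_def)
  note eig = posterior_eigenvalues_decay[OF d0 A \<alpha>0 C0 H' C1(1-3) eigen]
  have pos: "lam1 j > 0" for j by (rule eig(1))
  obtain K where K: "K > 0" "\<And>j. lam1 j \<le> K * real (Suc j) powr (- a)"
    using eig(2) unfolding a_def by blast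
  have sm: "summable lam1"
  proof (rule summable_comparison_test')
    have "summable (\<lambda>j. real j powr (- a))" using a1 by (simp add: summable_real_powr_iff)
    then have "summable (\<lambda>j. real (Suc j) powr (- a))" by (subst summable_Suc_iff)
    then show "summable (\<lambda>j. K * real (Suc j) powr (- a))" by (rule summable_mult)
    show "norm (lam1 j) \<le> K * real (Suc j) powr (- a)" for j using pos[of j] K(2)[of j] by simp
  qed
  interpret gaussian_functional_decay m1 lam1 \<psi>1 Q DQ C a K
    by unfold_locales (use eigen(1) pos sm DQ bound a1 K in auto)
  \<comment> \<open>A negative s follows from the rate with exponent 0; for \<alpha> \<le> d only
    such s occur.\<close>
  define s' where "s' = max s 0"
  have s': "s' \<ge> 0" "2 * s' < a - 1"
  proof -
    have "2 * s < a - 2" using s by (simp add: a_def)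
    then show "2 * s' < a - 1" using a1 by (simp add: s'_def max_def)
  qed (simp add: s'_def)
  obtain \<tau> C' where \<tau>: "\<forall>j. 0 < \<tau> j" "summable (\<lambda>j. inverse (\<tau> j) powr (1 / 2))" "0 \<le> C'"
    and rate: "\<forall>N\<ge>1. \<exists>\<Lambda>. \<Lambda> \<subseteq> multi_indices \<and> admissible \<Lambda> \<and> finite \<Lambda> \<and> card \<Lambda> = N \<and>
        (\<forall>\<nu>\<in>\<Lambda>. \<forall>\<mu>\<in>multi_indices - \<Lambda>. quad_weight (1 / 2) \<tau> \<nu> \<le> quad_weight (1 / 2) \<tau> \<mu>) \<and>
        \<bar>(\<integral>\<xi>. Q (X \<xi>) \<partial>product_gaussian) - sparse_quad \<Lambda> (\<lambda>\<xi>. Q (X \<xi>))\<bar> \<le> C' * (real N + 1) powr (- s')"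
    using sparse_quadrature_rate[OF s'] by blast
  have mono: "C' * (real N + 1) powr (- s') \<le> C' * (real N + 1) powr (- s)" for N
    using \<tau>(3) by (intro mult_left_mono powr_mono) (auto simp: s'_def)
  have "\<forall>N\<ge>1. \<exists>\<Lambda>. \<Lambda> \<subseteq> multi_indices \<and> admissible \<Lambda> \<and> finite \<Lambda> \<and> card \<Lambda> = N \<and>
        (\<forall>\<nu>\<in>\<Lambda>. \<forall>\<mu>\<in>multi_indices - \<Lambda>. quad_weight (1 / 2) \<tau> \<nu> \<le> quad_weight (1 / 2) \<tau> \<mu>) \<and>
        \<bar>(\<integral>\<xi>. Q (X \<xi>) \<partial>product_gaussian) - sparse_quad \<Lambda> (\<lambda>\<xi>. Q (X \<xi>))\<bar> \<le> C' * (real N + 1) powr (- s)"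
    using rate mono by (meson order.trans)
  then show "\<exists>q \<tau> C'. 0 < q \<and> q < 1 \<and> (\<forall>j. 0 < \<tau> j) \<and> summable (\<lambda>j. inverse (\<tau> j) powr q) \<and>
      (\<forall>N\<ge>1. \<exists>\<Lambda>. \<Lambda> \<subseteq> multi_indices \<and> admissible \<Lambda> \<and> finite \<Lambda> \<and> card \<Lambda> = N \<and>
        (\<forall>\<nu>\<in>\<Lambda>. \<forall>\<mu>\<in>multi_indices - \<Lambda>. quad_weight q \<tau> \<nu> \<le> quad_weight q \<tau> \<mu>) \<and>
        \<bar>(\<integral>\<xi>. Q (kl_expansion m1 lam1 \<psi>1 \<xi>) \<partial>product_gaussian)
           - sparse_quad \<Lambda> (\<lambda>\<xi>. Q (kl_expansion m1 lam1 \<psi>1 \<xi>))\<bar>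
          \<le> C' * (real N + 1) powr (- s))"
    using \<tau> by (intro exI[of _ "1 / 2"] exI[of _ \<tau>] exI[of _ C'] conjI) simp_all
qed

end
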